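(* Let $d \ge 1$, let $D \subset \mathbb{R}^d$ be a domain containing $[-2,2]^d$, and let $\{X_\epsilon\}_{\epsilon \in (0,1]}$ be a collection of centred Gaussian fields on $D$ with covariance $$\mathbb{E}[X_\epsilon(x)X_\epsilon(y)] = -\log(|x-y|+\epsilon) + g_\epsilon(x,y), \qquad x,y \in D,$$ where each $g_\epsilon$ is continuous and $\sup_{x,y\in D}|g_\epsilon(x,y)| \le C_g$ for a constant $C_g>0$ independent of $\epsilon$. For $\beta \in \mathbb{R}$ let $Z_\epsilon(\beta) := \int_{[-1,1]^d} e^{\beta X_\epsilon(x)}\,dx$. Then for every $q>1$ the limit $$\tilde{\eta}_q := \lim_{\epsilon \to 0} \frac{\log \mathbb{E}\left[\frac{Z_\epsilon(q\beta)}{Z_\epsilon(\beta)^q}\right]}{\log \epsilon}$$ exists and is given by $$\tilde{\eta}_q = \begin{cases} -\frac{\beta^2q^2}{2} + \frac{\beta^2 q}{2}, & 0 \le \beta^2 < \frac{2d}{2q-1},\\[2pt] \frac{(2d-\beta^2)^2}{8\beta^2} - d(q-1), & \frac{2d}{2q-1} \le \beta^2 < 2d,\\[2pt] -d(q-1), & \beta^2 \ge 2d.\end{cases}$$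
   Context: $|\cdot|$ denotes the Euclidean norm on $\mathbb{R}^d$. The fields $X_\epsilon$ have continuous covariance and are defined pointwise. *)

theory Defs
  imports "HOL-Probability.Probability"
begin

definition centred_gaussian_rv :: "'w measure \<Rightarrow> ('w \<Rightarrow> real) \<Rightarrow> bool" where
  "centred_gaussian_rv M Y \<longleftrightarrow> Y \<in> borel_measurable M \<and>
     ((\<exists>\<sigma>>0. distributed M lborel Y (\<lambda>t. ennreal (normal_density 0 \<sigma> t)))
      \<or> (AE \<omega> in M. Y \<omega> = 0))"

definition centred_gaussian_field ::
    "'w measure \<Rightarrow> 'd set \<Rightarrow> ('d \<Rightarrow> 'w \<Rightarrow> real) \<Rightarrow> bool" where
  "centred_gaussian_field M D X \<longleftrightarrow>
     (\<forall>S c. finite S \<and> S \<subseteq> D \<longrightarrow> centred_gaussian_rv M (\<lambda>\<omega>. \<Sum>x\<in>S. c x * X x \<omega>))"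

definition Zpart :: "('d::euclidean_space \<Rightarrow> 'w \<Rightarrow> real) \<Rightarrow> real \<Rightarrow> 'w \<Rightarrow> real" where
  "Zpart X \<beta> \<omega> = (LINT x : cbox (- One) One | lborel. exp (\<beta> * X x \<omega>))"

definition eta_tilde :: "nat \<Rightarrow> real \<Rightarrow> real \<Rightarrow> real" where
  "eta_tilde d q \<beta> =
     (if \<beta>\<^sup>2 < 2 * real d / (2 * q - 1) then - (\<beta>\<^sup>2 * q\<^sup>2) / 2 + \<beta>\<^sup>2 * q / 2
      else if \<beta>\<^sup>2 < 2 * real d then (2 * real d - \<beta>\<^sup>2)\<^sup>2 / (8 * \<beta>\<^sup>2) - real d * (q - 1)
      else - real d * (q - 1))"

end

theory Submission
  imports Defs "HOL-Complex_Analysis.Complex_Analysis" "HOL-Real_Asymp.Real_Asymp"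
begin

text \<open>Write \<open>Z b\<close> for the partition function, \<open>d\<close> for the dimension and
  \<open>A q = E (Z (q * b) / Z b powr q)\<close>.  By Hoelder's inequality \<open>ln (A q)\<close> is convex in \<open>q\<close>;
  moreover \<open>A 1 = 1\<close>, and \<open>A q\<close> is at most of order \<open>\<epsilon> powr (- d * q)\<close>.

  If \<open>b\<^sup>2 < 2 * d\<close>, the negative moments of \<open>Z b\<close> have the exponents of the powers of \<open>E (Z b)\<close>:
  Kahane's convexity inequality compares the mass of a union of separated cells with that of
  independent copies, whose sum is unlikely to be small.  Hoelder's inequality turns this into the
  upper bound for \<open>A q\<close>.  The matching lower bound, valid while \<open>q * b\<^sup>2 < d + b\<^sup>2 / 2\<close>, again follows
  from Hoelder's inequality and an upper bound for \<open>E (Z b powr s * Z (q * b))\<close> with small \<open>s > 0\<close>,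
  obtained by splitting \<open>Z b\<close> over dyadic shells around the tilting point.  For larger \<open>q\<close>
  convexity makes \<open>ln (A q)\<close> continue linearly with the maximal slope \<open>d\<close>.

  For \<open>b\<^sup>2 \<ge> 2 * d\<close> the lower bound is Jensen's inequality \<open>ln (A q) \<ge> E (ln (Z (q * b))) - q * E (ln (Z b))\<close>;
  both terms are found from the critical value of \<open>b\<close>, since \<open>E (ln (Z b))\<close> is convex in \<open>b\<close>.\<close>

section \<open>Uniqueness of Laplace transforms and Gaussian families\<close>

text \<open>Second moments of \<open>Z b\<close>, normalised by the mean, stay bounded only for
  \<open>b\<^sup>2 < d\<close>. Moments of order \<open>1 + h\<close> with small
  \<open>h > 0\<close> take their place: tilted at a point, they become a sum over dyadic shells,
  which is geometric for all \<open>b\<^sup>2 < 2 * d\<close>. Negative moments need a lower tail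
  below any given power of \<open>\<epsilon>\<close>. The number of cells is therefore a small power
  of \<open>1 / \<epsilon>\<close>; the common Gaussian variable of the comparison then has variance
  a small multiple of \<open>ln (1 / \<epsilon>)\<close>. Only exponents of
  \<open>\<epsilon>\<close> matter, so factors \<open>\<epsilon> powr (- \<delta>)\<close> may be
  lost, and finite averages of field values can serve as coarse field. In Kahane's comparison the
  exponential of minus a sum is a product of functions of single coordinates; equality in law is
  needed only for such products, which reduces it to uniqueness in dimension one. The quadratic
  exponent \<open>b\<^sup>2 * (q\<^sup>2 - q) / 2\<close> has slope \<open>d\<close> at
  \<open>q = d / b\<^sup>2 + 1 / 2\<close>. This is the breakpoint of the formula and also the value
  of \<open>q\<close> at which the shell sums cease to converge.\<close>

lemma exp_abs_le_add: "exp \<bar>x\<bar> \<le> exp x + exp (- x)" for x :: real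
  by (cases "x \<ge> 0") (auto simp: abs_if)

text \<open>The moment generating function is an everywhere convergent power series in its argument;
  its coefficients are the moments, and they also determine the characteristic function.\<close>

lemma mgf_power_series:
  fixes \<mu> :: "real measure" and z :: "'a :: {real_normed_field, banach, second_countable_topology}"
  assumes "finite_measure \<mu>" and [measurable_cong]: "sets \<mu> = sets borel"
    and int: "\<And>a. integrable \<mu> (\<lambda>x. exp (a * x))"
  shows "(\<lambda>k. z ^ k * of_real ((\<integral>x. x ^ k \<partial>\<mu>) / fact k)) sums (\<integral>x. exp (z * of_real x) \<partial>\<mu>)"
    and "integrable \<mu> (\<lambda>x. x ^ k)"
proof -
  interpret finite_measure \<mu> by fact
  have int_abs: "integrable \<mu> (\<lambda>x. exp (a * \<bar>x\<bar>))" if "a \<ge> 0" for a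
  proof (rule Bochner_Integration.integrable_bound)
    show "integrable \<mu> (\<lambda>x. exp (a * x) + exp ((- a) * x))"
      using int[of a] int[of "- a"] by (intro Bochner_Integration.integrable_add)
    show "AE x in \<mu>. norm (exp (a * \<bar>x\<bar>)) \<le> norm (exp (a * x) + exp ((- a) * x))"
      using exp_abs_le_add[of "a * _"] that by (intro AE_I2) (auto simp: abs_mult add_nonneg_nonneg)
  qed measurable
  have term_le: "\<bar>x\<bar> ^ k / fact k \<le> exp \<bar>x\<bar>" for x :: real and k
    using exp_ge_one_plus_x_over_n_power_n sum_le_suminf[of "\<lambda>k. \<bar>x\<bar> ^ k / fact k" "{k}"]
      summable_exp[of "\<bar>x\<bar>"]
    by (auto simp: exp_def scaleR_conv_of_real divide_simps ac_simps)
  show int_pow: "integrable \<mu> (\<lambda>x. x ^ k)" for k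
  proof (rule Bochner_Integration.integrable_bound)
    show "integrable \<mu> (\<lambda>x. fact k * exp (1 * \<bar>x\<bar>))"
      using int_abs[of 1] by auto
    show "AE x in \<mu>. norm (x ^ k) \<le> norm (fact k * exp (1 * \<bar>x\<bar>))"
      using term_le[of _ k] by (intro AE_I2) (auto simp: power_abs field_simps)
  qed measurable
  define F :: "nat \<Rightarrow> real \<Rightarrow> 'a" where "F k x = of_real (x ^ k / fact k) * z ^ k" for k x
  have F_int: "integrable \<mu> (F k)" for k
    unfolding F_def using int_pow[of k] by (intro integrable_mult_left integrable_of_real) auto
  have F_sums: "(\<lambda>k. F k x) sums exp (z * of_real x)" for x
    using exp_converges[of "z * of_real x"]
    by (simp add: F_def scaleR_conv_of_real power_mult_distrib divide_simps ac_simps)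
  have nF: "norm (F k x) = (norm z * \<bar>x\<bar>) ^ k /\<^sub>R fact k" for k x
    by (simp add: F_def norm_mult norm_power norm_divide power_mult_distrib field_simps power_abs)
  have nF_sums: "(\<lambda>k. norm (F k x)) sums exp (norm z * \<bar>x\<bar>)" for x
    unfolding nF by (rule exp_converges)
  have "(\<lambda>k. integral\<^sup>L \<mu> (F k)) sums (\<integral>x. (\<Sum>k. F k x) \<partial>\<mu>)"
  proof (rule sums_integral[OF F_int])
    show "AE x in \<mu>. summable (\<lambda>k. norm (F k x))"
      using nF_sums by (intro AE_I2) (auto simp: sums_iff)
    show "summable (\<lambda>k. \<integral>x. norm (F k x) \<partial>\<mu>)"
    proof (rule summableI_nonneg_bounded)
      fix n
      have "(\<Sum>k<n. \<integral>x. norm (F k x) \<partial>\<mu>) = (\<integral>x. (\<Sum>k<n. norm (F k x)) \<partial>\<mu>)"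
        using F_int by (subst Bochner_Integration.integral_sum) auto
      also have "\<dots> \<le> (\<integral>x. exp (norm z * \<bar>x\<bar>) \<partial>\<mu>)"
        using F_int int_abs[of "norm z"] nF_sums
        by (intro integral_mono Bochner_Integration.integrable_sum)
           (auto simp: sums_iff intro!: sum_le_suminf[THEN order_trans])
      finally show "(\<Sum>k<n. \<integral>x. norm (F k x) \<partial>\<mu>) \<le> (\<integral>x. exp (norm z * \<bar>x\<bar>) \<partial>\<mu>)" .
    qed auto
  qed
  moreover have "integral\<^sup>L \<mu> (F k) = z ^ k * of_real ((\<integral>x. x ^ k \<partial>\<mu>) / fact k)" for k
    unfolding F_def using int_pow[of k] by (simp add: integral_of_real del: of_real_power)
  moreover have "(\<Sum>k. F k x) = exp (z * of_real x)" for x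
    using F_sums by (auto simp: sums_iff)
  ultimately show "(\<lambda>k. z ^ k * of_real ((\<integral>x. x ^ k \<partial>\<mu>) / fact k)) sums (\<integral>x. exp (z * of_real x) \<partial>\<mu>)"
    by simp
qed

text \<open>The two power series in \<open>a\<close> have equal sums, hence equal coefficients, that
  is, equal moments. The same series at imaginary arguments is the characteristic function, and
  Levy's uniqueness theorem concludes.\<close>

lemma real_distribution_eqI_mgf:
  assumes "real_distribution \<mu>" "real_distribution \<nu>"
    and int: "\<And>a. integrable \<mu> (\<lambda>x. exp (a * x))" "\<And>a. integrable \<nu> (\<lambda>x. exp (a * x))"
    and eq: "\<And>a::real. (\<integral>x. exp (a * x) \<partial>\<mu>) = (\<integral>x. exp (a * x) \<partial>\<nu>)"
  shows "\<mu> = \<nu>"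
proof -
  interpret \<mu>: real_distribution \<mu> by fact
  interpret \<nu>: real_distribution \<nu> by fact
  note ser\<mu> = mgf_power_series(1)[OF \<mu>.finite_measure_axioms \<mu>.events_eq_borel int(1)]
  note ser\<nu> = mgf_power_series(1)[OF \<nu>.finite_measure_axioms \<nu>.events_eq_borel int(2)]
  define c where "c k = (\<integral>x. x ^ k \<partial>\<mu>) / fact k - (\<integral>x. x ^ k \<partial>\<nu>) / fact k" for k
  have "(\<lambda>k. c k * a ^ k) sums 0" for a :: real
    using sums_diff[OF ser\<mu>[of a] ser\<nu>[of a]] eq[of a] by (simp add: c_def algebra_simps)
  hence c: "(\<lambda>k. c k * (a - 0) ^ k) sums 0" for a :: real by simp
  have "c k = 0" for k
  proof (cases "k = 0")
    case True
    then show ?thesis by (simp add: c_def \<mu>.prob_space \<nu>.prob_space del: \<mu>.space_eq_univ \<nu>.space_eq_univ)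
  next
    case False
    show ?thesis
    proof (rule ccontr)
      assume "c k \<noteq> 0"
      \<comment> \<open>A nonzero coefficient would make the difference series nonzero on a
        punctured ball around 0, but it sums to 0 everywhere.\<close>
      from powser_0_nonzero[of 1 0 c "\<lambda>_. 0", OF _ c _ this] False
      obtain s where "0 < s" "\<And>z::real. z \<in> cball 0 s - {0} \<Longrightarrow> (0::real) \<noteq> 0" by auto
      from this(2)[of s] this(1) show False by auto
    qed
  qed
  hence mom: "(\<integral>x. x ^ k \<partial>\<mu>) / fact k = (\<integral>x. x ^ k \<partial>\<nu>) / fact k" for k
    by (simp add: c_def)
  have "char \<mu> t = char \<nu> t" for t
    unfolding char_def
    using sums_unique2[OF ser\<mu>[of "\<i> * of_real t"], of "\<integral>x. exp (\<i> * of_real t * of_real x) \<partial>\<nu>"]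
      ser\<nu>[of "\<i> * of_real t"] mom
    by (simp add: mult.assoc)
  thus ?thesis using Levy_uniqueness assms(1,2) by blast
qed

text \<open>The weighted marginals compared in \<open>gaussian_family_prod_cong\<close> are not
  probability measures. Their common mass is the value at \<open>a = 0\<close>; dividing by it
  reduces to the probability case.\<close>

lemma finite_measure_eqI_mgf:
  fixes \<mu> \<nu> :: "real measure"
  assumes sets: "sets \<mu> = sets borel" "sets \<nu> = sets borel"
    and eq: "\<And>a. (\<integral>\<^sup>+x. ennreal (exp (a * x)) \<partial>\<mu>) = (\<integral>\<^sup>+x. ennreal (exp (a * x)) \<partial>\<nu>)"
    and fin: "\<And>a. (\<integral>\<^sup>+x. ennreal (exp (a * x)) \<partial>\<mu>) < \<infinity>"
  shows "\<mu> = \<nu>"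
proof -
  note [measurable_cong] = sets
  define m where "m = emeasure \<mu> (space \<mu>)"
  have m: "emeasure \<mu> (space \<mu>) = m" "emeasure \<nu> (space \<nu>) = m" "m < \<infinity>"
    using eq[of 0] fin[of 0] by (auto simp: m_def)
  show ?thesis
  proof (cases "m = 0")
    case True
    have "emeasure \<mu> A = 0" "emeasure \<nu> A = 0" for A
      using m True emeasure_space[of \<mu> A] emeasure_space[of \<nu> A] by auto
    then show ?thesis using sets by (intro measure_eqI) auto
  next
    case False
    have 1: "inverse m * m = 1" "m * inverse m = 1"
      using False m(3) by (cases m; auto simp: inverse_ennreal ennreal_mult[symmetric] mult.commute)+
    let ?S = "\<lambda>\<kappa>. scale_measure (inverse m) \<kappa> :: real measure"
    have rd: "real_distribution (?S \<mu>)" "real_distribution (?S \<nu>)"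
      unfolding real_distribution_def real_distribution_axioms_def using 1 m sets
      by (auto intro!: prob_spaceI simp: space_scale_measure)
    have nn: "(\<integral>\<^sup>+x. ennreal (exp (a * x)) \<partial>?S \<kappa>) = inverse m * (\<integral>\<^sup>+x. ennreal (exp (a * x)) \<partial>\<kappa>)"
      if "sets \<kappa> = sets borel" for \<kappa> a
      using that by (subst nn_integral_scale_measure) (auto cong: measurable_cong_sets)
    have fin': "(\<integral>\<^sup>+x. ennreal (exp (a * x)) \<partial>?S \<mu>) < \<infinity>" for a
      using nn[OF sets(1), of a] fin[of a] False by (auto simp: ennreal_mult_less_top less_top[symmetric] ennreal_mult_eq_top_iff)
    have eq': "(\<integral>\<^sup>+x. ennreal (exp (a * x)) \<partial>?S \<mu>) = (\<integral>\<^sup>+x. ennreal (exp (a * x)) \<partial>?S \<nu>)" for a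
      using nn[OF sets(1)] nn[OF sets(2)] eq by simp
    have "?S \<mu> = ?S \<nu>"
    proof (rule real_distribution_eqI_mgf[OF rd])
      show "integrable (?S \<mu>) (\<lambda>x. exp (a * x))" "integrable (?S \<nu>) (\<lambda>x. exp (a * x))" for a
        using fin'[of a] eq'[of a] by (auto intro!: integrableI_nonneg cong: measurable_cong_sets)
      show "(\<integral>x. exp (a * x) \<partial>?S \<mu>) = (\<integral>x. exp (a * x) \<partial>?S \<nu>)" for a
        using eq'[of a] by (subst (1 2) integral_eq_nn_integral) (auto cong: measurable_cong_sets)
    qed
    hence "scale_measure m (?S \<mu>) = scale_measure m (?S \<nu>)" by simp
    thus ?thesis using 1 by (simp add: mult.commute)
  qed
qed

text \<open>A finite family \<open>U\<close> is centred Gaussian with covariance \<open>S\<close>, expressed by its Laplace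
  transform; for \<open>a = 0\<close> this says that \<open>M\<close> has mass 1.\<close>

definition gaussian_family ::
    "'a measure \<Rightarrow> 'i set \<Rightarrow> ('i \<Rightarrow> 'a \<Rightarrow> real) \<Rightarrow> ('i \<Rightarrow> 'i \<Rightarrow> real) \<Rightarrow> bool" where
  "gaussian_family M I U S \<longleftrightarrow> (\<forall>i\<in>I. U i \<in> borel_measurable M) \<and>
     (\<forall>a. (\<integral>\<^sup>+\<omega>. ennreal (exp (\<Sum>i\<in>I. a i * U i \<omega>)) \<partial>M) =
          ennreal (exp ((\<Sum>i\<in>I. \<Sum>j\<in>I. a i * a j * S i j) / 2)))"

lemma gaussian_familyD:
  assumes "gaussian_family M I U S"
  shows "\<And>i. i \<in> I \<Longrightarrow> U i \<in> borel_measurable M"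
    and "(\<integral>\<^sup>+\<omega>. ennreal (exp (\<Sum>i\<in>I. a i * U i \<omega>)) \<partial>M) =
          ennreal (exp ((\<Sum>i\<in>I. \<Sum>j\<in>I. a i * a j * S i j) / 2))"
  using assms by (auto simp: gaussian_family_def)

lemma gaussian_family_prob_space: "gaussian_family M I U S \<Longrightarrow> prob_space M"
  using gaussian_familyD(2)[of M I U S "\<lambda>_. 0"] by (intro prob_spaceI) simp

text \<open>The functions \<open>f i\<close> are inserted one coordinate at a time, the remaining coordinates being
  kept inside an exponential weight; each insertion is one application of the one-dimensional
  uniqueness theorem.\<close>

lemma gaussian_family_prod_cong:
  fixes U :: "'i \<Rightarrow> 'a \<Rightarrow> real" and V :: "'i \<Rightarrow> 'b \<Rightarrow> real"
  assumes fin: "finite I" and U: "gaussian_family M I U S" and V: "gaussian_family M' I V S"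
    and f[measurable]: "\<And>i. f i \<in> borel_measurable borel" and f_le: "\<And>i x. f i x \<le> (1::ennreal)"
  shows "(\<integral>\<^sup>+\<omega>. (\<Prod>i\<in>I. f i (U i \<omega>)) \<partial>M) = (\<integral>\<^sup>+\<omega>. (\<Prod>i\<in>I. f i (V i \<omega>)) \<partial>M')"
proof -
  note Um = gaussian_familyD(1)[OF U] and Vm = gaussian_familyD(1)[OF V]
  have "(\<integral>\<^sup>+\<omega>. (\<Prod>i\<in>J. f i (U i \<omega>)) * ennreal (exp (\<Sum>i\<in>I-J. a i * U i \<omega>)) \<partial>M) =
        (\<integral>\<^sup>+\<omega>. (\<Prod>i\<in>J. f i (V i \<omega>)) * ennreal (exp (\<Sum>i\<in>I-J. a i * V i \<omega>)) \<partial>M')"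
    if "finite J" "J \<subseteq> I" for J a
    using that
  proof (induction J arbitrary: a rule: finite_induct)
    case empty
    then show ?case using gaussian_familyD(2)[OF U] gaussian_familyD(2)[OF V] by simp
  next
    case (insert k J)
    have k: "k \<in> I" "k \<notin> J" and J: "J \<subseteq> I" using insert by auto
    note [measurable] = Um[OF k(1)] Vm[OF k(1)]
    have split: "I - J = insert k (I - insert k J)" "k \<notin> I - insert k J"
      using k by auto
    define w where "w u = (\<Prod>i\<in>J. f i (u i)) * ennreal (exp (\<Sum>i\<in>I-insert k J. a i * u i))"
      for u :: "'i \<Rightarrow> real"
    have wU[measurable]: "(\<lambda>\<omega>. w (\<lambda>i. U i \<omega>)) \<in> borel_measurable M"
    proof -
      have [measurable]: "(\<lambda>\<omega>. \<Sum>i\<in>I-insert k J. a i * U i \<omega>) \<in> borel_measurable M"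
        using Um by (intro borel_measurable_sum borel_measurable_times) auto
      have [measurable]: "(\<lambda>\<omega>. \<Prod>i\<in>J. f i (U i \<omega>)) \<in> borel_measurable M"
        using Um J by (intro borel_measurable_prod_ennreal measurable_compose[OF _ f]) auto
      show ?thesis unfolding w_def by measurable
    qed
    have wV[measurable]: "(\<lambda>\<omega>. w (\<lambda>i. V i \<omega>)) \<in> borel_measurable M'"
    proof -
      have [measurable]: "(\<lambda>\<omega>. \<Sum>i\<in>I-insert k J. a i * V i \<omega>) \<in> borel_measurable M'"
        using Vm by (intro borel_measurable_sum borel_measurable_times) auto
      have [measurable]: "(\<lambda>\<omega>. \<Prod>i\<in>J. f i (V i \<omega>)) \<in> borel_measurable M'"
        using Vm J by (intro borel_measurable_prod_ennreal measurable_compose[OF _ f]) auto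
      show ?thesis unfolding w_def by measurable
    qed
    have expand: "w u * ennreal (exp (b * u k)) =
        (\<Prod>i\<in>J. f i (u i)) * ennreal (exp (\<Sum>i\<in>I-J. (a(k := b)) i * u i))" for u b
    proof -
      have "(\<Sum>i\<in>I-J. (a(k := b)) i * u i) = b * u k + (\<Sum>i\<in>I-insert k J. a i * u i)"
        unfolding split(1) using fin split(2)
        by (subst sum.insert) (auto intro!: sum.cong)
      thus ?thesis by (simp add: w_def exp_add ennreal_mult mult_ac)
    qed
    note expandU = expand[of "\<lambda>i. U i _"] and expandV = expand[of "\<lambda>i. V i _"]
    \<comment> \<open>The law of coordinate \<open>k\<close> under the measure weighted by
      \<open>w\<close>. By \<open>expand\<close>, its generating function at \<open>b\<close> is an
      instance of the induction hypothesis, with coefficient \<open>b\<close> at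
      \<open>k\<close>.\<close>
    define \<mu> where "\<mu> = distr (density M (\<lambda>\<omega>. w (\<lambda>i. U i \<omega>))) borel (U k)"
    define \<nu> where "\<nu> = distr (density M' (\<lambda>\<omega>. w (\<lambda>i. V i \<omega>))) borel (V k)"
    have mgf\<mu>: "(\<integral>\<^sup>+x. ennreal (exp (b * x)) \<partial>\<mu>) = (\<integral>\<^sup>+\<omega>. w (\<lambda>i. U i \<omega>) * ennreal (exp (b * U k \<omega>)) \<partial>M)" for b
      unfolding \<mu>_def by (subst nn_integral_distr) (auto simp: nn_integral_density)
    have mgf\<nu>: "(\<integral>\<^sup>+x. ennreal (exp (b * x)) \<partial>\<nu>) = (\<integral>\<^sup>+\<omega>. w (\<lambda>i. V i \<omega>) * ennreal (exp (b * V k \<omega>)) \<partial>M')" for b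
      unfolding \<nu>_def by (subst nn_integral_distr) (auto simp: nn_integral_density)
    have "\<mu> = \<nu>"
    proof (rule finite_measure_eqI_mgf)
      show "sets \<mu> = sets borel" "sets \<nu> = sets borel" by (auto simp: \<mu>_def \<nu>_def)
      show "(\<integral>\<^sup>+x. ennreal (exp (b * x)) \<partial>\<mu>) = (\<integral>\<^sup>+x. ennreal (exp (b * x)) \<partial>\<nu>)" for b
        unfolding mgf\<mu> mgf\<nu> expandU expandV using insert.IH[OF J] by simp
      show "(\<integral>\<^sup>+x. ennreal (exp (b * x)) \<partial>\<mu>) < \<infinity>" for b
      proof -
        have "(\<integral>\<^sup>+x. ennreal (exp (b * x)) \<partial>\<mu>) \<le>
            (\<integral>\<^sup>+\<omega>. ennreal (exp (\<Sum>i\<in>I. (if i \<in> J then 0 else (a(k := b)) i) * U i \<omega>)) \<partial>M)"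
          unfolding mgf\<mu> expandU
        proof (intro nn_integral_mono)
          fix \<omega>
          have "(\<Sum>i\<in>I. (if i \<in> J then 0 else (a(k := b)) i) * U i \<omega>) = (\<Sum>i\<in>I-J. (a(k := b)) i * U i \<omega>)"
            using fin by (intro sum.mono_neutral_cong_right) auto
          moreover have "(\<Prod>i\<in>J. f i (U i \<omega>)) \<le> 1"
            using f_le by (intro prod_le_1) auto
          ultimately show "(\<Prod>i\<in>J. f i (U i \<omega>)) * ennreal (exp (\<Sum>i\<in>I-J. (a(k := b)) i * U i \<omega>)) \<le>
             ennreal (exp (\<Sum>i\<in>I. (if i \<in> J then 0 else (a(k := b)) i) * U i \<omega>))"
            using mult_right_mono[of "\<Prod>i\<in>J. f i (U i \<omega>)" 1] by simp
        qed
        also have "\<dots> < \<infinity>" unfolding gaussian_familyD(2)[OF U] by simp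
        finally show ?thesis .
      qed
    qed
    hence "(\<integral>\<^sup>+x. f k x \<partial>\<mu>) = (\<integral>\<^sup>+x. f k x \<partial>\<nu>)" by simp
    moreover have "(\<integral>\<^sup>+x. f k x \<partial>\<mu>) = (\<integral>\<^sup>+\<omega>. w (\<lambda>i. U i \<omega>) * f k (U k \<omega>) \<partial>M)"
      unfolding \<mu>_def by (subst nn_integral_distr) (auto simp: nn_integral_density)
    moreover have "(\<integral>\<^sup>+x. f k x \<partial>\<nu>) = (\<integral>\<^sup>+\<omega>. w (\<lambda>i. V i \<omega>) * f k (V k \<omega>) \<partial>M')"
      unfolding \<nu>_def by (subst nn_integral_distr) (auto simp: nn_integral_density)
    ultimately show ?case
      using insert.hyps by (simp add: w_def mult_ac)
  qed
  from this[OF fin subset_refl, of "\<lambda>_. 0"] show ?thesis by simp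
qed

text \<open>On a product space the Laplace transform factorises, so the covariances of independent
  families add with squared weights. This builds the interpolation path, its increments and the
  common variable of \<open>block_kahane\<close>.\<close>

lemma gaussian_family_pair:
  fixes U :: "'i \<Rightarrow> 'a \<Rightarrow> real" and V :: "'i \<Rightarrow> 'b \<Rightarrow> real"
  assumes U: "gaussian_family M I U S" and V: "gaussian_family M' I V S'"
  shows "gaussian_family (M \<Otimes>\<^sub>M M') I (\<lambda>i \<omega>. x * U i (fst \<omega>) + y * V i (snd \<omega>))
           (\<lambda>i j. x\<^sup>2 * S i j + y\<^sup>2 * S' i j)"
  unfolding gaussian_family_def
proof (intro conjI ballI allI)
  note Um = gaussian_familyD(1)[OF U] and Vm = gaussian_familyD(1)[OF V]
  interpret M': prob_space M' using V by (rule gaussian_family_prob_space)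
  show "(\<lambda>\<omega>. x * U i (fst \<omega>) + y * V i (snd \<omega>)) \<in> borel_measurable (M \<Otimes>\<^sub>M M')" if "i \<in> I" for i
    using Um[OF that] Vm[OF that] by measurable
  fix a :: "'i \<Rightarrow> real"
  have Us: "(\<lambda>\<omega>. \<Sum>i\<in>I. (x * a i) * U i \<omega>) \<in> borel_measurable M"
    using Um by (auto intro!: borel_measurable_sum)
  have Vs: "(\<lambda>\<omega>. \<Sum>i\<in>I. (y * a i) * V i \<omega>) \<in> borel_measurable M'"
    using Vm by (auto intro!: borel_measurable_sum)
  note [measurable] = Us Vs
  have "(\<integral>\<^sup>+\<omega>. ennreal (exp (\<Sum>i\<in>I. a i * (x * U i (fst \<omega>) + y * V i (snd \<omega>)))) \<partial>(M \<Otimes>\<^sub>M M')) =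
      (\<integral>\<^sup>+\<omega>. ennreal (exp (\<Sum>i\<in>I. (x * a i) * U i (fst \<omega>))) * ennreal (exp (\<Sum>i\<in>I. (y * a i) * V i (snd \<omega>))) \<partial>(M \<Otimes>\<^sub>M M'))"
    by (intro nn_integral_cong)
       (simp add: ennreal_mult[symmetric] exp_add[symmetric] sum.distrib[symmetric] algebra_simps)
  also have "\<dots> = (\<integral>\<^sup>+\<omega>. \<integral>\<^sup>+\<omega>'. ennreal (exp (\<Sum>i\<in>I. (x * a i) * U i \<omega>)) * ennreal (exp (\<Sum>i\<in>I. (y * a i) * V i \<omega>')) \<partial>M' \<partial>M)"
    by (subst M'.nn_integral_fst[symmetric]) auto
  also have "\<dots> = ennreal (exp ((\<Sum>i\<in>I. \<Sum>j\<in>I. (x * a i) * (x * a j) * S i j) / 2)) *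
      ennreal (exp ((\<Sum>i\<in>I. \<Sum>j\<in>I. (y * a i) * (y * a j) * S' i j) / 2))"
    by (simp add: nn_integral_cmult nn_integral_multc gaussian_familyD(2)[OF U] gaussian_familyD(2)[OF V])
  also have "\<dots> = ennreal (exp ((\<Sum>i\<in>I. \<Sum>j\<in>I. a i * a j * (x\<^sup>2 * S i j + y\<^sup>2 * S' i j)) / 2))"
    by (simp add: ennreal_mult[symmetric] exp_add[symmetric] add_divide_distrib[symmetric]
        sum.distrib[symmetric] algebra_simps power2_eq_square)
  finally show "(\<integral>\<^sup>+\<omega>. ennreal (exp (\<Sum>i\<in>I. a i * (x * U i (fst \<omega>) + y * V i (snd \<omega>)))) \<partial>(M \<Otimes>\<^sub>M M')) = \<dots>" .
qed

lemma gaussian_family_exp: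
  fixes U :: "'i \<Rightarrow> 'a \<Rightarrow> real"
  assumes fin: "finite I" and U: "gaussian_family M I U S"
    and sym: "\<And>i j. i \<in> I \<Longrightarrow> j \<in> I \<Longrightarrow> S i j = S j i" and ij: "i \<in> I" "j \<in> I"
  shows "has_bochner_integral M (\<lambda>\<omega>. exp (x * U i \<omega> + y * U j \<omega>))
           (exp ((x\<^sup>2 * S i i + 2 * x * y * S i j + y\<^sup>2 * S j j) / 2))"
proof (rule has_bochner_integral_nn_integral)
  note [measurable] = gaussian_familyD(1)[OF U ij(1)] gaussian_familyD(1)[OF U ij(2)]
  show "(\<lambda>\<omega>. exp (x * U i \<omega> + y * U j \<omega>)) \<in> borel_measurable M" by measurable
  \<comment> \<open>The two indicators are added rather than nested, so that \<open>i = j\<close>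
    yields the coefficient \<open>x + y\<close>.\<close>
  define a where "a k = (if k = i then x else 0) + (if k = j then y else 0)" for k
  have lin: "(\<Sum>k\<in>I. a k * u k) = x * u i + y * u j" for u :: "'i \<Rightarrow> real"
    unfolding a_def distrib_right sum.distrib using fin ij
    by (simp add: if_distrib[of "\<lambda>t. t * _"] cong: if_cong)
  have "(\<Sum>k\<in>I. \<Sum>l\<in>I. a k * a l * S k l) = (\<Sum>k\<in>I. a k * (\<Sum>l\<in>I. a l * S k l))"
    by (simp add: sum_distrib_left mult_ac)
  also have "\<dots> = x\<^sup>2 * S i i + 2 * x * y * S i j + y\<^sup>2 * S j j"
    unfolding lin using sym[OF ij] by (simp add: power2_eq_square algebra_simps)
  finally show "(\<integral>\<^sup>+\<omega>. ennreal (exp (x * U i \<omega> + y * U j \<omega>)) \<partial>M) =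
      ennreal (exp ((x\<^sup>2 * S i i + 2 * x * y * S i j + y\<^sup>2 * S j j) / 2))"
    using gaussian_familyD(2)[OF U, of a] by (simp add: lin)
qed auto

section \<open>Elementary estimates behind the second-order expansion\<close>

lemma exp_minus_taylor2:
  fixes u v :: real
  assumes "0 \<le> u" "0 \<le> v"
  shows "\<bar>exp (- v) - exp (- u) * (1 - (v - u) + (v - u)\<^sup>2 / 2)\<bar> \<le> \<bar>v - u\<bar> ^ 3 / 6"
proof (cases "u = v")
  case False
  have "\<exists>t. (if v < u then v < t \<and> t < u else u < t \<and> t < v) \<and>
      exp (- v) = (\<Sum>m<3. (- 1) ^ m * exp (- u) / fact m * (v - u) ^ m) + (- 1) ^ 3 * exp (- t) / fact 3 * (v - u) ^ 3"
    by (rule Taylor[where a = "0" and b = "max u v" and diff = "\<lambda>m x. (- 1) ^ m * exp (- x)"])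
       (use assms False in \<open>auto intro!: derivative_eq_intros\<close>)
  then obtain t where t: "if v < u then v < t \<and> t < u else u < t \<and> t < v"
    and eq: "exp (- v) = (\<Sum>m<3. (- 1) ^ m * exp (- u) / fact m * (v - u) ^ m) - exp (- t) / 6 * (v - u) ^ 3"
    by (auto simp: fact_numeral)
  have "exp (- v) - exp (- u) * (1 - (v - u) + (v - u)\<^sup>2 / 2) = - (exp (- t) / 6 * (v - u) ^ 3)"
    unfolding eq by (simp add: numeral_3_eq_3 power2_eq_square algebra_simps)
  hence "\<bar>exp (- v) - exp (- u) * (1 - (v - u) + (v - u)\<^sup>2 / 2)\<bar> = exp (- t) * \<bar>v - u\<bar> ^ 3 / 6"
    by (simp add: abs_mult power_abs)
  also have "exp (- t) \<le> 1" using t assms by (auto split: if_splits)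
  hence "exp (- t) * \<bar>v - u\<bar> ^ 3 / 6 \<le> 1 * \<bar>v - u\<bar> ^ 3 / 6"
    by (intro divide_right_mono mult_right_mono) auto
  finally show ?thesis by simp
qed simp

text \<open>Bounds a third absolute moment by second and fourth moments, which are explicit for
  log-normal variables. The parameter \<open>s\<close> is free so that the two terms can be
  balanced.\<close>

lemma abs_cube_le:
  fixes x s :: real
  assumes "s > 0"
  shows "\<bar>x\<bar> ^ 3 \<le> (s * x\<^sup>2 + x ^ 4 / s) / 2"
proof -
  have "0 \<le> (s - \<bar>x\<bar>)\<^sup>2 * \<bar>x\<bar>\<^sup>2" by simp
  also have "\<dots> = s\<^sup>2 * x\<^sup>2 + x ^ 4 - 2 * s * \<bar>x\<bar> ^ 3"
    by (simp add: power2_eq_square power3_eq_cube power4_eq_xxxx algebra_simps flip: abs_mult)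
  finally show ?thesis using assms by (simp add: field_simps power2_eq_square)
qed

lemma abs_sum_cube_le:
  fixes f :: "'i \<Rightarrow> real"
  assumes "finite I"
  shows "\<bar>\<Sum>i\<in>I. f i\<bar> ^ 3 \<le> real (card I) ^ 3 * (\<Sum>i\<in>I. \<bar>f i\<bar> ^ 3)"
proof (cases "I = {}")
  case False
  hence "Max ((\<lambda>i. \<bar>f i\<bar>) ` I) \<in> (\<lambda>i. \<bar>f i\<bar>) ` I" using assms by (intro Max_in) auto
  then obtain k where "k \<in> I" "Max ((\<lambda>i. \<bar>f i\<bar>) ` I) = \<bar>f k\<bar>" by auto
  hence k: "k \<in> I" "\<And>i. i \<in> I \<Longrightarrow> \<bar>f i\<bar> \<le> \<bar>f k\<bar>"
    using assms by (auto dest: Max_ge[rotated] intro: Max_ge simp flip: \<open>Max _ = _\<close>)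
  have "\<bar>\<Sum>i\<in>I. f i\<bar> \<le> (\<Sum>i\<in>I. \<bar>f i\<bar>)" by (rule sum_abs)
  also have "\<dots> \<le> real (card I) * \<bar>f k\<bar>" using k by (intro sum_bounded_above) auto
  finally have "\<bar>\<Sum>i\<in>I. f i\<bar> ^ 3 \<le> (real (card I) * \<bar>f k\<bar>) ^ 3" by (rule power_mono) auto
  also have "\<dots> = real (card I) ^ 3 * \<bar>f k\<bar> ^ 3" by (simp add: power_mult_distrib)
  also have "\<bar>f k\<bar> ^ 3 \<le> (\<Sum>i\<in>I. \<bar>f i\<bar> ^ 3)" using assms k by (intro member_le_sum) auto
  finally show ?thesis by (simp add: mult_left_mono)
qed auto

section \<open>Kahane's inequality by Lindeberg replacement\<close>

lemma exp_minus_one_le: "exp x - 1 \<le> x * exp x" for x :: real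
  using exp_ge_add_one_self[of "- x"] by (simp add: exp_minus field_simps)

text \<open>What remains, free of \<open>h\<close>, when the second and fourth central moments of a
  mean-one log-normal variable with logarithmic variance \<open>h * s\<close> are estimated for
  \<open>h \<le> 1\<close>.\<close>

definition lindeberg_const :: "real \<Rightarrow> real" where
  "lindeberg_const s = s * exp s + 6 * s\<^sup>2 * exp (6 * s)"

text \<open>With \<open>a = exp (h * s)\<close>, the polynomial
  \<open>a ^ 6 - 4 * a ^ 3 + 6 * a - 3\<close> is the fourth central moment of a mean-one log-normal
  variable. Its double zero at \<open>a = 1\<close> makes it of order \<open>h\<^sup>2\<close>,
  hence of order \<open>h powr (3/2)\<close> after division by \<open>sqrt h\<close>.\<close>

lemma lindeberg_const_bound:
  fixes h s :: real
  assumes h: "0 < h" "h \<le> 1" and s: "0 \<le> s"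
  shows "(exp (h * s) - 1) * (sqrt h / 2) +
     (exp (h * s) ^ 6 - 4 * exp (h * s) ^ 3 + 6 * exp (h * s) - 3) * (1 / (2 * sqrt h)) \<le>
     lindeberg_const s * (h * sqrt h)"
proof -
  define a where "a = exp (h * s)"
  have hs: "h * s \<le> s" "0 \<le> h * s"
    using h s mult_right_mono[of h 1 s] by simp_all
  have a: "1 \<le> a" "a \<le> exp s" using hs by (simp_all add: a_def)
  have a1: "a - 1 \<le> h * (s * exp s)"
  proof -
    have "a - 1 \<le> (h * s) * exp (h * s)" unfolding a_def by (rule exp_minus_one_le)
    also have "\<dots> \<le> (h * s) * exp s" using hs by (intro mult_left_mono) simp_all
    finally show ?thesis by (simp add: mult.assoc)
  qed
  have "a ^ 6 - 4 * a ^ 3 + 6 * a - 3 = (a - 1)\<^sup>2 * (a ^ 4 + 2 * a ^ 3 + 3 * a\<^sup>2 - 3)" by algebra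
  also have "\<dots> \<le> (h * (s * exp s))\<^sup>2 * (6 * exp s ^ 4)"
  proof -
    have "a ^ 3 \<le> a ^ 4" "a\<^sup>2 \<le> a ^ 4" using a(1) by (simp_all add: power_increasing)
    moreover have "a ^ 4 \<le> exp s ^ 4" using a by (intro power_mono) simp_all
    moreover have "1 \<le> a ^ 2" "1 \<le> a ^ 3" "1 \<le> a ^ 4" using a(1) by (simp_all add: one_le_power)
    ultimately have "a ^ 4 + 2 * a ^ 3 + 3 * a\<^sup>2 - 3 \<le> 6 * exp s ^ 4" "0 \<le> a ^ 4 + 2 * a ^ 3 + 3 * a\<^sup>2 - 3" by linarith+
    moreover have "(a - 1)\<^sup>2 \<le> (h * (s * exp s))\<^sup>2" using a a1 by (intro power_mono) simp_all
    ultimately show ?thesis by (intro mult_mono) simp_all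
  qed
  also have "\<dots> = h\<^sup>2 * (6 * s\<^sup>2 * (exp s ^ 2 * exp s ^ 4))" by (simp add: power_mult_distrib)
  also have "exp s ^ 2 * exp s ^ 4 = exp (6 * s)"
    by (simp add: exp_of_nat_mult[symmetric] exp_add[symmetric])
  finally have a2: "a ^ 6 - 4 * a ^ 3 + 6 * a - 3 \<le> h\<^sup>2 * (6 * s\<^sup>2 * exp (6 * s))" .
  have h2: "h\<^sup>2 * (1 / (2 * sqrt h)) = (h * sqrt h) / 2"
    using h by (simp add: power2_eq_square field_simps)
  have "(a - 1) * (sqrt h / 2) \<le> h * (s * exp s) * (sqrt h / 2)"
    using a1 h by (intro mult_right_mono) simp_all
  also have "\<dots> = (s * exp s) * ((h * sqrt h) / 2)" by simp
  finally have b1: "(a - 1) * (sqrt h / 2) \<le> (s * exp s) * ((h * sqrt h) / 2)" .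
  have "(a ^ 6 - 4 * a ^ 3 + 6 * a - 3) * (1 / (2 * sqrt h)) \<le> h\<^sup>2 * (6 * s\<^sup>2 * exp (6 * s)) * (1 / (2 * sqrt h))"
    using a2 h by (intro mult_right_mono) simp_all
  also have "\<dots> = (6 * s\<^sup>2 * exp (6 * s)) * (h\<^sup>2 * (1 / (2 * sqrt h)))" by simp
  finally have b2: "(a ^ 6 - 4 * a ^ 3 + 6 * a - 3) * (1 / (2 * sqrt h)) \<le> (6 * s\<^sup>2 * exp (6 * s)) * ((h * sqrt h) / 2)"
    unfolding h2 .
  have "(a - 1) * (sqrt h / 2) + (a ^ 6 - 4 * a ^ 3 + 6 * a - 3) * (1 / (2 * sqrt h)) \<le>
      lindeberg_const s * ((h * sqrt h) / 2)"
    using add_mono[OF b1 b2] unfolding lindeberg_const_def distrib_right .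
  also have "\<dots> \<le> lindeberg_const s * (h * sqrt h)"
    using h s by (intro mult_left_mono) (simp_all add: lindeberg_const_def)
  finally show ?thesis unfolding a_def .
qed

text \<open>Second-order expansion of the Laplace transform of a sum of log-normal variables of
  variance \<open>O(h)\<close>: only the second-order term sees the covariances.\<close>

lemma lindeberg_step:
  fixes U :: "'i \<Rightarrow> 'a \<Rightarrow> real"
  assumes fin: "finite I" and U: "gaussian_family M I U S"
    and sym: "\<And>i j. i \<in> I \<Longrightarrow> j \<in> I \<Longrightarrow> S i j = S j i"
    and h: "0 < h" "h \<le> 1" and w: "\<And>i. i \<in> I \<Longrightarrow> 0 \<le> w i"
  shows "\<bar>(\<integral>\<omega>. exp (- (\<Sum>i\<in>I. w i * exp (sqrt h * U i \<omega> - h * S i i / 2))) \<partial>M) -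
           exp (- (\<Sum>i\<in>I. w i)) * (1 + (\<Sum>i\<in>I. \<Sum>j\<in>I. w i * w j * (exp (h * S i j) - 1)) / 2)\<bar>
         \<le> real (card I) ^ 3 * (\<Sum>i\<in>I. w i ^ 3 * lindeberg_const (S i i)) * (h * sqrt h)"
proof -
  interpret M: prob_space M using U by (rule gaussian_family_prob_space)
  note Um = gaussian_familyD(1)[OF U]
  have C1: "has_bochner_integral M (\<lambda>_. 1::real) 1"
    by (simp add: has_bochner_integral_iff M.prob_space)
  define e where "e i \<omega> = exp (sqrt h * U i \<omega> - h * S i i / 2)" for i \<omega>
  have e_pos: "e i \<omega> > 0" for i \<omega> by (simp add: e_def)
  have em: "e i \<in> borel_measurable M" if "i \<in> I" for i
    unfolding e_def using Um[OF that] by measurable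
  have E: "has_bochner_integral M (\<lambda>\<omega>. exp (x * (sqrt h * U i \<omega> - h * S i i / 2) + y * (sqrt h * U j \<omega> - h * S j j / 2)))
      (exp (h * (((x\<^sup>2 - x) * S i i + 2 * x * y * S i j + (y\<^sup>2 - y) * S j j) / 2)))"
    if "i \<in> I" "j \<in> I" for i j x y
  proof -
    have "exp (x * (sqrt h * U i \<omega> - h * S i i / 2) + y * (sqrt h * U j \<omega> - h * S j j / 2)) =
        exp ((x * sqrt h) * U i \<omega> + (y * sqrt h) * U j \<omega>) * exp (- h * (x * S i i + y * S j j) / 2)" for \<omega>
      by (simp add: exp_add[symmetric]) (simp add: field_simps)
    moreover have "exp (h * (((x\<^sup>2 - x) * S i i + 2 * x * y * S i j + (y\<^sup>2 - y) * S j j) / 2)) =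
        exp (((x * sqrt h)\<^sup>2 * S i i + 2 * (x * sqrt h) * (y * sqrt h) * S i j + (y * sqrt h)\<^sup>2 * S j j) / 2) *
        exp (- h * (x * S i i + y * S j j) / 2)"
      using h by (simp add: exp_add[symmetric] power_mult_distrib) (simp add: algebra_simps diff_divide_distrib add_divide_distrib)
    ultimately show ?thesis
      using has_bochner_integral_mult_left[OF gaussian_family_exp[OF fin U sym that, of "x * sqrt h" "y * sqrt h"]] by simp
  qed
  have E1: "has_bochner_integral M (e i) 1" if "i \<in> I" for i
    using E[OF that that, of 1 0] by (simp add: e_def[abs_def])
  have E2: "has_bochner_integral M (\<lambda>\<omega>. e i \<omega> * e j \<omega>) (exp (h * S i j))" if "i \<in> I" "j \<in> I" for i j
    using E[OF that, of 1 1] by (simp add: e_def exp_add)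
  have Ek: "has_bochner_integral M (\<lambda>\<omega>. e i \<omega> ^ k) (exp (h * S i i) ^ (k * (k - 1) div 2))" if "i \<in> I" for i k
  proof -
    have "real (k * (k - 1) div 2) = (real k ^ 2 - real k) / 2"
      by (cases k) (auto simp: real_of_nat_div power2_eq_square algebra_simps)
    hence "exp (h * S i i) ^ (k * (k - 1) div 2) = exp (h * ((((real k)\<^sup>2 - real k) * S i i) / 2))"
      unfolding exp_of_nat_mult[symmetric] by simp
    moreover have "e i \<omega> ^ k = exp (real k * (sqrt h * U i \<omega> - h * S i i / 2))" for \<omega>
      by (simp add: e_def exp_of_nat_mult)
    ultimately show ?thesis
      using E[OF that that, of "real k" 0] by (simp del: exp_of_nat_mult)
  qed
  have C2: "has_bochner_integral M (\<lambda>\<omega>. (e i \<omega> - 1) * (e j \<omega> - 1)) (exp (h * S i j) - 1)"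
    if "i \<in> I" "j \<in> I" for i j
  proof -
    have "has_bochner_integral M (\<lambda>\<omega>. e i \<omega> * e j \<omega> - e i \<omega> - e j \<omega> + 1) (exp (h * S i j) - 1 - 1 + 1)"
      using E1[OF that(1)] E1[OF that(2)] E2[OF that] C1
      by (intro has_bochner_integral_add has_bochner_integral_diff) auto
    thus ?thesis by (simp add: algebra_simps)
  qed
  have C4: "has_bochner_integral M (\<lambda>\<omega>. (e i \<omega> - 1) ^ 4)
      (exp (h * S i i) ^ 6 - 4 * exp (h * S i i) ^ 3 + 6 * exp (h * S i i) - 3)" if "i \<in> I" for i
  proof -
    have "has_bochner_integral M (\<lambda>\<omega>. e i \<omega> ^ 4 - 4 * e i \<omega> ^ 3 + 6 * e i \<omega> ^ 2 - 4 * e i \<omega> + 1)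
       (exp (h * S i i) ^ 6 - 4 * exp (h * S i i) ^ 3 + 6 * exp (h * S i i) - 4 * 1 + 1)"
      using Ek[OF that, of 4] Ek[OF that, of 3] Ek[OF that, of 2] E1[OF that] C1
      by (intro has_bochner_integral_add has_bochner_integral_diff has_bochner_integral_mult_right) auto
    moreover have "e i \<omega> ^ 4 - 4 * e i \<omega> ^ 3 + 6 * e i \<omega> ^ 2 - 4 * e i \<omega> + 1 = (e i \<omega> - 1) ^ 4" for \<omega>
      by algebra
    moreover have "x - 4 * 1 + 1 = x - (3 :: real)" for x by simp
    ultimately show ?thesis by (simp only:)
  qed
  \<comment> \<open>The family is known only through its Laplace transform, so nonnegativity of the
    variance is read off from the second moment of \<open>e i - 1\<close>.\<close>
  have S_nonneg: "S i i \<ge> 0" if "i \<in> I" for i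
  proof -
    have "0 \<le> (\<integral>\<omega>. (e i \<omega> - 1) * (e i \<omega> - 1) \<partial>M)" by (intro integral_nonneg_AE) auto
    also have "\<dots> = exp (h * S i i) - 1" using C2[OF that that] by (simp add: has_bochner_integral_iff)
    finally show ?thesis using h by (simp add: zero_le_mult_iff)
  qed
  define u v where "u = (\<Sum>i\<in>I. w i)" and "v \<omega> = (\<Sum>i\<in>I. w i * e i \<omega>)" for \<omega>
  have vu: "v \<omega> - u = (\<Sum>i\<in>I. w i * (e i \<omega> - 1))" for \<omega>
    by (simp add: u_def v_def sum_subtractf[symmetric] algebra_simps)
  have u0: "u \<ge> 0" using w by (auto simp: u_def intro!: sum_nonneg)
  have v0: "v \<omega> \<ge> 0" for \<omega> unfolding v_def by (intro sum_nonneg mult_nonneg_nonneg w less_imp_le[OF e_pos])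
  have vm: "v \<in> borel_measurable M" unfolding v_def using em by (intro borel_measurable_sum) auto
  note [measurable] = vm
  have D1: "has_bochner_integral M (\<lambda>\<omega>. v \<omega> - u) 0"
  proof -
    have "has_bochner_integral M (\<lambda>\<omega>. \<Sum>i\<in>I. w i * (e i \<omega> - 1)) (\<Sum>i\<in>I. w i * (1 - 1))"
      using E1 C1
      by (intro has_bochner_integral_sum has_bochner_integral_mult_right has_bochner_integral_diff) auto
    thus ?thesis by (simp add: vu)
  qed
  define Q where "Q = (\<Sum>i\<in>I. \<Sum>j\<in>I. w i * w j * (exp (h * S i j) - 1))"
  have D2: "has_bochner_integral M (\<lambda>\<omega>. (v \<omega> - u)\<^sup>2) Q"
  proof -
    have "has_bochner_integral M (\<lambda>\<omega>. \<Sum>i\<in>I. \<Sum>j\<in>I. w i * w j * ((e i \<omega> - 1) * (e j \<omega> - 1))) Q"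
      unfolding Q_def using C2 by (intro has_bochner_integral_sum has_bochner_integral_mult_right) auto
    moreover have "(v \<omega> - u)\<^sup>2 = (\<Sum>i\<in>I. \<Sum>j\<in>I. w i * w j * ((e i \<omega> - 1) * (e j \<omega> - 1)))" for \<omega>
      by (simp add: vu power2_eq_square sum_product mult_ac)
    ultimately show ?thesis by simp
  qed
  \<comment> \<open>The bound of \<open>abs_cube_le\<close> with parameter \<open>sqrt h\<close>,
    which balances a second moment of order \<open>h\<close> against a fourth moment of order
    \<open>h\<^sup>2\<close>: both contribute \<open>h powr (3/2)\<close>.\<close>
  define B where "B \<omega> = real (card I) ^ 3 *
      (\<Sum>i\<in>I. w i ^ 3 * (((e i \<omega> - 1) * (e i \<omega> - 1)) * (sqrt h / 2) + (e i \<omega> - 1) ^ 4 * (1 / (2 * sqrt h))))" for \<omega>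
  define b where "b = real (card I) ^ 3 *
      (\<Sum>i\<in>I. w i ^ 3 * ((exp (h * S i i) - 1) * (sqrt h / 2) +
         (exp (h * S i i) ^ 6 - 4 * exp (h * S i i) ^ 3 + 6 * exp (h * S i i) - 3) * (1 / (2 * sqrt h))))"
  have B: "has_bochner_integral M B b"
    unfolding B_def b_def using C2 C4
    by (intro has_bochner_integral_mult_right has_bochner_integral_sum has_bochner_integral_add has_bochner_integral_mult_left) auto
  have "\<bar>v \<omega> - u\<bar> ^ 3 \<le> B \<omega>" for \<omega>
  proof -
    have "\<bar>v \<omega> - u\<bar> ^ 3 \<le> real (card I) ^ 3 * (\<Sum>i\<in>I. \<bar>w i * (e i \<omega> - 1)\<bar> ^ 3)"
      unfolding vu by (rule abs_sum_cube_le[OF fin])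
    also have "\<dots> \<le> B \<omega>" unfolding B_def
    proof (intro mult_left_mono sum_mono)
      fix i assume i: "i \<in> I"
      have "\<bar>e i \<omega> - 1\<bar> ^ 3 \<le> (sqrt h * (e i \<omega> - 1)\<^sup>2 + (e i \<omega> - 1) ^ 4 / sqrt h) / 2"
        using h by (intro abs_cube_le) auto
      also have "\<dots> = ((e i \<omega> - 1) * (e i \<omega> - 1)) * (sqrt h / 2) + (e i \<omega> - 1) ^ 4 * (1 / (2 * sqrt h))"
        by (simp add: power2_eq_square field_simps)
      finally show "\<bar>w i * (e i \<omega> - 1)\<bar> ^ 3 \<le> w i ^ 3 * \<dots>"
        using w[OF i] by (simp add: abs_mult power_mult_distrib mult_left_mono)
    qed auto
    finally show ?thesis .
  qed
  note cube = this
  have pw: "\<bar>exp (- v \<omega>) - exp (- u) * (1 - (v \<omega> - u) + (v \<omega> - u)\<^sup>2 / 2)\<bar> \<le> B \<omega>" for \<omega>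
  proof -
    have "x / 6 \<le> x" if "0 \<le> x" for x :: real using that by simp
    from this[of "\<bar>v \<omega> - u\<bar> ^ 3"] show ?thesis
      using exp_minus_taylor2[OF u0 v0[of \<omega>]] cube[of \<omega>] by linarith
  qed
  have ev: "integrable M (\<lambda>\<omega>. exp (- v \<omega>))"
    using v0 by (intro M.integrable_const_bound[of _ 1]) auto
  have main: "has_bochner_integral M (\<lambda>\<omega>. exp (- u) * (1 - (v \<omega> - u) + (v \<omega> - u)\<^sup>2 / 2)) (exp (- u) * (1 - 0 + Q / 2))"
    using C1 D1 D2
    by (intro has_bochner_integral_mult_right has_bochner_integral_add has_bochner_integral_diff has_bochner_integral_divide_zero)
       auto
  have "\<bar>(\<integral>\<omega>. exp (- v \<omega>) \<partial>M) - exp (- u) * (1 + Q / 2)\<bar> =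
      \<bar>\<integral>\<omega>. exp (- v \<omega>) - exp (- u) * (1 - (v \<omega> - u) + (v \<omega> - u)\<^sup>2 / 2) \<partial>M\<bar>"
    using ev main by (simp add: has_bochner_integral_iff)
  also have "\<dots> \<le> (\<integral>\<omega>. \<bar>exp (- v \<omega>) - exp (- u) * (1 - (v \<omega> - u) + (v \<omega> - u)\<^sup>2 / 2)\<bar> \<partial>M)"
    by (rule integral_abs_bound)
  also have "\<dots> \<le> integral\<^sup>L M B"
    using ev main B pw by (intro integral_mono) (auto simp: has_bochner_integral_iff)
  also have "\<dots> = b" using B by (simp add: has_bochner_integral_iff)
  also have "b \<le> real (card I) ^ 3 * (\<Sum>i\<in>I. w i ^ 3 * (lindeberg_const (S i i) * (h * sqrt h)))"
    unfolding b_def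
  proof (rule mult_left_mono[OF sum_mono])
    fix i assume i: "i \<in> I"
    show "w i ^ 3 * ((exp (h * S i i) - 1) * (sqrt h / 2) + (exp (h * S i i) ^ 6 - 4 * exp (h * S i i) ^ 3 +
        6 * exp (h * S i i) - 3) * (1 / (2 * sqrt h))) \<le> w i ^ 3 * (lindeberg_const (S i i) * (h * sqrt h))"
      using w[OF i] by (intro mult_left_mono lindeberg_const_bound h S_nonneg i) simp
  qed simp
  also have "\<dots> = real (card I) ^ 3 * (\<Sum>i\<in>I. w i ^ 3 * lindeberg_const (S i i)) * (h * sqrt h)"
    by (simp only: sum_distrib_right mult.assoc)
  finally show ?thesis by (simp add: u_def v_def e_def Q_def)
qed

lemma exp_minus_sum_prod:
  "finite I \<Longrightarrow> ennreal (exp (- (\<Sum>i\<in>I. f i))) = (\<Prod>i\<in>I. ennreal (exp (- f i)))"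
  by (simp add: sum_negf[symmetric] exp_sum prod_ennreal)

text \<open>The terms of order zero and one agree because every factor has mean 1, and the
  second-order terms are ordered by \<open>le\<close> since the weights are nonnegative. The error
  is a sum of terms linear in \<open>w i ^ 3\<close>, so that it can later be integrated over random
  weights.\<close>

lemma lindeberg_compare:
  fixes U :: "'i \<Rightarrow> 'a \<Rightarrow> real" and V :: "'i \<Rightarrow> 'b \<Rightarrow> real"
  assumes fin: "finite I" and U: "gaussian_family M I U S" and V: "gaussian_family M' I V S'"
    and sym: "\<And>i j. i \<in> I \<Longrightarrow> j \<in> I \<Longrightarrow> S i j = S j i" "\<And>i j. i \<in> I \<Longrightarrow> j \<in> I \<Longrightarrow> S' i j = S' j i"
    and le: "\<And>i j. i \<in> I \<Longrightarrow> j \<in> I \<Longrightarrow> S i j \<le> S' i j"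
    and h: "0 < h" "h \<le> 1" and w: "\<And>i. i \<in> I \<Longrightarrow> 0 \<le> w i"
  shows "(\<integral>\<^sup>+\<omega>. ennreal (exp (- (\<Sum>i\<in>I. w i * exp (sqrt h * U i \<omega> - h * S i i / 2)))) \<partial>M) \<le>
     (\<integral>\<^sup>+\<omega>. ennreal (exp (- (\<Sum>i\<in>I. w i * exp (sqrt h * V i \<omega> - h * S' i i / 2)))) \<partial>M') +
     (\<Sum>i\<in>I. ennreal (w i ^ 3) * ennreal (real (card I) ^ 3 * \<bar>lindeberg_const (S i i) + lindeberg_const (S' i i)\<bar> * (h * sqrt h)))"
proof -
  interpret M: prob_space M using U by (rule gaussian_family_prob_space)
  interpret M': prob_space M' using V by (rule gaussian_family_prob_space)
  define f where "f \<omega> = exp (- (\<Sum>i\<in>I. w i * exp (sqrt h * U i \<omega> - h * S i i / 2)))" for \<omega>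
  define g where "g \<omega> = exp (- (\<Sum>i\<in>I. w i * exp (sqrt h * V i \<omega> - h * S' i i / 2)))" for \<omega>
  have fm: "f \<in> borel_measurable M"
  proof -
    have [measurable]: "(\<lambda>\<omega>. \<Sum>i\<in>I. w i * exp (sqrt h * U i \<omega> - h * S i i / 2)) \<in> borel_measurable M"
    proof (rule borel_measurable_sum)
      fix i assume "i \<in> I"
      note [measurable] = gaussian_familyD(1)[OF U this]
      show "(\<lambda>\<omega>. w i * exp (sqrt h * U i \<omega> - h * S i i / 2)) \<in> borel_measurable M" by measurable
    qed
    show ?thesis unfolding f_def by measurable
  qed
  have gm: "g \<in> borel_measurable M'"
  proof -
    have [measurable]: "(\<lambda>\<omega>. \<Sum>i\<in>I. w i * exp (sqrt h * V i \<omega> - h * S' i i / 2)) \<in> borel_measurable M'"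
    proof (rule borel_measurable_sum)
      fix i assume "i \<in> I"
      note [measurable] = gaussian_familyD(1)[OF V this]
      show "(\<lambda>\<omega>. w i * exp (sqrt h * V i \<omega> - h * S' i i / 2)) \<in> borel_measurable M'" by measurable
    qed
    show ?thesis unfolding g_def by measurable
  qed
  have fi: "integrable M f" using fm w
    by (intro M.integrable_const_bound[of _ 1]) (auto simp: f_def intro!: sum_nonneg)
  have gi: "integrable M' g" using gm w
    by (intro M'.integrable_const_bound[of _ 1]) (auto simp: g_def intro!: sum_nonneg)
  define QU QV where "QU = (\<Sum>i\<in>I. \<Sum>j\<in>I. w i * w j * (exp (h * S i j) - 1))"
    and "QV = (\<Sum>i\<in>I. \<Sum>j\<in>I. w i * w j * (exp (h * S' i j) - 1))"
  define u where "u = (\<Sum>i\<in>I. w i)"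
  have Q: "QU \<le> QV" unfolding QU_def QV_def
    using w le h by (intro sum_mono mult_left_mono) auto
  define rU rV where "rU = real (card I) ^ 3 * (\<Sum>i\<in>I. w i ^ 3 * lindeberg_const (S i i)) * (h * sqrt h)"
    and "rV = real (card I) ^ 3 * (\<Sum>i\<in>I. w i ^ 3 * lindeberg_const (S' i i)) * (h * sqrt h)"
  have eU: "\<bar>integral\<^sup>L M f - exp (- u) * (1 + QU / 2)\<bar> \<le> rU"
    using lindeberg_step[OF fin U sym(1) h w] unfolding f_def u_def QU_def rU_def by simp
  have eV: "\<bar>integral\<^sup>L M' g - exp (- u) * (1 + QV / 2)\<bar> \<le> rV"
    using lindeberg_step[OF fin V sym(2) h w] unfolding g_def u_def QV_def rV_def by simp
  have eQ: "exp (- u) * (1 + QU / 2) \<le> exp (- u) * (1 + QV / 2)"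
    using Q by (intro mult_left_mono) auto
  have "integral\<^sup>L M f \<le> integral\<^sup>L M' g + (rU + rV)"
    using abs_le_D1[OF eU] abs_le_D2[OF eV] eQ by argo
  also have "rU + rV = (\<Sum>i\<in>I. w i ^ 3 * (real (card I) ^ 3 * (lindeberg_const (S i i) + lindeberg_const (S' i i)) * (h * sqrt h)))"
    unfolding rU_def rV_def distrib_right[symmetric] distrib_left[symmetric] sum.distrib[symmetric]
      sum_distrib_left sum_distrib_right
    by (intro sum.cong refl) (simp add: algebra_simps)
  also have "\<dots> \<le> (\<Sum>i\<in>I. w i ^ 3 * (real (card I) ^ 3 * \<bar>lindeberg_const (S i i) + lindeberg_const (S' i i)\<bar> * (h * sqrt h)))"
    using w h by (intro sum_mono mult_left_mono mult_right_mono) auto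
  finally have main: "integral\<^sup>L M f \<le> integral\<^sup>L M' g +
      (\<Sum>i\<in>I. w i ^ 3 * (real (card I) ^ 3 * \<bar>lindeberg_const (S i i) + lindeberg_const (S' i i)\<bar> * (h * sqrt h)))"
    by simp
  have "(\<integral>\<^sup>+\<omega>. ennreal (f \<omega>) \<partial>M) = ennreal (integral\<^sup>L M f)"
    by (intro nn_integral_eq_integral fi) (auto simp: f_def)
  also have "\<dots> \<le> ennreal (integral\<^sup>L M' g) +
      ennreal (\<Sum>i\<in>I. w i ^ 3 * (real (card I) ^ 3 * \<bar>lindeberg_const (S i i) + lindeberg_const (S' i i)\<bar> * (h * sqrt h)))"
    using main w h by (subst ennreal_plus[symmetric])
      (auto intro!: ennreal_leI sum_nonneg mult_nonneg_nonneg integral_nonneg_AE simp: g_def)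
  also have "ennreal (\<Sum>i\<in>I. w i ^ 3 * (real (card I) ^ 3 * \<bar>lindeberg_const (S i i) + lindeberg_const (S' i i)\<bar> * (h * sqrt h))) =
     (\<Sum>i\<in>I. ennreal (w i ^ 3) * ennreal (real (card I) ^ 3 * \<bar>lindeberg_const (S i i) + lindeberg_const (S' i i)\<bar> * (h * sqrt h)))"
    using w h by (subst sum_ennreal[symmetric])
      (auto intro!: sum.cong mult_nonneg_nonneg simp: ennreal_mult[symmetric])
  also have "ennreal (integral\<^sup>L M' g) = (\<integral>\<^sup>+\<omega>. ennreal (g \<omega>) \<partial>M')"
    by (intro nn_integral_eq_integral[symmetric] gi) (auto simp: g_def)
  finally show ?thesis unfolding f_def g_def .
qed

text \<open>Kahane's convexity inequality for \<open>w \<mapsto> exp (- w)\<close>.  Along the path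
  \<open>sqrt (1 - t) * U + sqrt t * V\<close>, an increment of \<open>t\<close> by \<open>h\<close> replaces an independent component
  \<open>sqrt h * U\<close> by \<open>sqrt h * V\<close>, which by the Lindeberg expansion costs at most \<open>O(h powr (3/2))\<close>.\<close>

theorem kahane_inequality:
  fixes U :: "'i \<Rightarrow> 'a \<Rightarrow> real" and V :: "'i \<Rightarrow> 'b \<Rightarrow> real"
  assumes fin: "finite I" and U: "gaussian_family M I U S" and V: "gaussian_family M' I V S'"
    and sym: "\<And>i j. i \<in> I \<Longrightarrow> j \<in> I \<Longrightarrow> S i j = S j i" "\<And>i j. i \<in> I \<Longrightarrow> j \<in> I \<Longrightarrow> S' i j = S' j i"
    and le: "\<And>i j. i \<in> I \<Longrightarrow> j \<in> I \<Longrightarrow> S i j \<le> S' i j"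
    and p: "\<And>i. i \<in> I \<Longrightarrow> 0 \<le> p i"
  shows "(\<integral>\<^sup>+\<omega>. ennreal (exp (- (\<Sum>i\<in>I. p i * exp (U i \<omega> - S i i / 2)))) \<partial>M) \<le>
         (\<integral>\<^sup>+\<omega>. ennreal (exp (- (\<Sum>i\<in>I. p i * exp (V i \<omega> - S' i i / 2)))) \<partial>M')"
proof -
  interpret M: prob_space M using U by (rule gaussian_family_prob_space)
  interpret M': prob_space M' using V by (rule gaussian_family_prob_space)
  define F where "F S y = ennreal (exp (- (\<Sum>i\<in>I. p i * exp (y i - S i i / 2))))" for S :: "'i \<Rightarrow> 'i \<Rightarrow> real" and y
  have F_prod: "F S y = (\<Prod>i\<in>I. ennreal (exp (- (p i * exp (y i - S i i / 2)))))" for S y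
    unfolding F_def by (rule exp_minus_sum_prod[OF fin])
  \<comment> \<open>Since \<open>F\<close> is a product over coordinates, its expectation depends
    only on the covariance. Each point of the path may thus be realised on whatever product space
    suits the increment.\<close>
  have law: "(\<integral>\<^sup>+\<omega>. F T (\<lambda>i. Y i \<omega>) \<partial>N) = (\<integral>\<^sup>+\<omega>. F T (\<lambda>i. Y' i \<omega>) \<partial>N')"
    if "gaussian_family N I Y T" "gaussian_family N' I Y' T" for N N' Y Y' T
  proof -
    define \<psi> where "\<psi> i x = (if i \<in> I then ennreal (exp (- (p i * exp (x - T i i / 2)))) else 0)" for i x
    have [measurable]: "\<psi> i \<in> borel_measurable borel" for i
      unfolding \<psi>_def by (cases "i \<in> I") auto
    have "\<psi> i x \<le> 1" for i x using p[of i] by (auto simp: \<psi>_def)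
    from gaussian_family_prod_cong[OF fin that, of \<psi>, OF _ this]
    show ?thesis unfolding F_prod by (simp add: \<psi>_def cong: prod.cong)
  qed
  define T where "T t i j = (1 - t) * S i j + t * S' i j" for t i j
  define Y where "Y t i \<omega> = sqrt (1 - t) * U i (fst \<omega>) + sqrt t * V i (snd \<omega>)" for t i and \<omega> :: "'a \<times> 'b"
  define \<psi> where "\<psi> t = (\<integral>\<^sup>+\<omega>. F (T t) (\<lambda>i. Y t i \<omega>) \<partial>(M \<Otimes>\<^sub>M M'))" for t
  have gY: "gaussian_family (M \<Otimes>\<^sub>M M') I (Y t) (T t)" if "0 \<le> t" "t \<le> 1" for t
    using gaussian_family_pair[OF U V, of "sqrt (1 - t)" "sqrt t"] that by (simp add: Y_def[abs_def] T_def[abs_def])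
  have \<psi>0: "\<psi> 0 = (\<integral>\<^sup>+\<omega>. F S (\<lambda>i. U i \<omega>) \<partial>M)"
    using law[OF gY[of 0], of M U] U by (simp add: \<psi>_def T_def[abs_def])
  have \<psi>1: "\<psi> 1 = (\<integral>\<^sup>+\<omega>. F S' (\<lambda>i. V i \<omega>) \<partial>M')"
    using law[OF gY[of 1], of M' V] V by (simp add: \<psi>_def T_def[abs_def])
  define b where "b i = real (card I) ^ 3 * \<bar>lindeberg_const (S i i) + lindeberg_const (S' i i)\<bar>" for i
  \<comment> \<open>Here \<open>exp (3 * (\<bar>S i i\<bar> + \<bar>S' i i\<bar>))\<close> bounds
    the third moment of the exponential weights uniformly along the path.\<close>
  define C where "C = (\<Sum>i\<in>I. p i ^ 3 * exp (3 * (\<bar>S i i\<bar> + \<bar>S' i i\<bar>)) * b i)"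
  have b0: "b i \<ge> 0" for i by (simp add: b_def)
  have C0: "C \<ge> 0" unfolding C_def using p b0 by (intro sum_nonneg mult_nonneg_nonneg) auto
  \<comment> \<open>The variables at \<open>t\<close> and at \<open>t + h\<close> share the part
    \<open>R\<close> in law and differ only in an independent increment, \<open>sqrt h * U\<close>
    or \<open>sqrt h * V\<close>. Conditionally on \<open>R\<close>,
    \<open>lindeberg_compare\<close> applies with weights \<open>w\<close>.\<close>
  have step: "\<psi> t \<le> \<psi> (t + h) + ennreal (C * (h * sqrt h))" if t: "0 \<le> t" and h: "0 < h" and th: "t + h \<le> 1" for t h
  proof -
    define P where "P = M \<Otimes>\<^sub>M M'"
    define R where "R i \<omega> = sqrt (1 - t - h) * U i (fst \<omega>) + sqrt t * V i (snd \<omega>)" for i and \<omega> :: "'a \<times> 'b"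
    define TR where "TR i j = (1 - t - h) * S i j + t * S' i j" for i j
    have gR: "gaussian_family P I R TR"
      using gaussian_family_pair[OF U V, of "sqrt (1 - t - h)" "sqrt t"] t h th
      by (simp add: R_def[abs_def] TR_def[abs_def] P_def)
    interpret P: prob_space P using gR by (rule gaussian_family_prob_space)
    define RU where "RU i \<omega> = R i (fst \<omega>) + sqrt h * U i (snd \<omega>)" for i and \<omega> :: "('a \<times> 'b) \<times> 'a"
    define RV where "RV i \<omega> = R i (fst \<omega>) + sqrt h * V i (snd \<omega>)" for i and \<omega> :: "('a \<times> 'b) \<times> 'b"
    have "(\<lambda>i j. TR i j + h * S i j) = T t" "(\<lambda>i j. TR i j + h * S' i j) = T (t + h)"
      by (auto simp: TR_def T_def fun_eq_iff algebra_simps)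
    hence gRU: "gaussian_family (P \<Otimes>\<^sub>M M) I RU (T t)" and gRV: "gaussian_family (P \<Otimes>\<^sub>M M') I RV (T (t + h))"
      using gaussian_family_pair[OF gR U, of 1 "sqrt h"] gaussian_family_pair[OF gR V, of 1 "sqrt h"] h
      by (simp_all add: RU_def[abs_def] RV_def[abs_def])
    have Fm: "(\<lambda>\<omega>. F Q (\<lambda>i. W i \<omega>)) \<in> borel_measurable N" if "gaussian_family N I W Q'" for N W Q Q'
      unfolding F_prod
    proof (rule borel_measurable_prod_ennreal)
      fix i assume "i \<in> I"
      note [measurable] = gaussian_familyD(1)[OF that this]
      show "(\<lambda>\<omega>. ennreal (exp (- (p i * exp (W i \<omega> - Q i i / 2))))) \<in> borel_measurable N" by measurable
    qed
    define w where "w \<omega> i = p i * exp (R i \<omega> - TR i i / 2)" for \<omega> i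
    have w0: "0 \<le> w \<omega> i" if "i \<in> I" for \<omega> i using p[OF that] by (simp add: w_def)
    have FU: "F (T t) (\<lambda>i. RU i (\<omega>, \<omega>')) = ennreal (exp (- (\<Sum>i\<in>I. w \<omega> i * exp (sqrt h * U i \<omega>' - h * S i i / 2))))" for \<omega> \<omega>'
      unfolding F_def w_def RU_def T_def TR_def
      by (simp add: mult.assoc exp_add[symmetric]) (simp add: algebra_simps diff_divide_distrib add_divide_distrib)
    have FV: "F (T (t + h)) (\<lambda>i. RV i (\<omega>, \<omega>')) = ennreal (exp (- (\<Sum>i\<in>I. w \<omega> i * exp (sqrt h * V i \<omega>' - h * S' i i / 2))))" for \<omega> \<omega>'
      unfolding F_def w_def RV_def T_def TR_def
      by (simp add: mult.assoc exp_add[symmetric]) (simp add: algebra_simps diff_divide_distrib add_divide_distrib)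
    have "\<psi> t = (\<integral>\<^sup>+\<omega>. F (T t) (\<lambda>i. RU i \<omega>) \<partial>(P \<Otimes>\<^sub>M M))"
      unfolding \<psi>_def using t h th by (intro law[OF gY gRU]) auto
    also have "\<dots> = (\<integral>\<^sup>+\<omega>. \<integral>\<^sup>+\<omega>'. F (T t) (\<lambda>i. RU i (\<omega>, \<omega>')) \<partial>M \<partial>P)"
      by (rule M.nn_integral_fst[OF Fm[OF gRU], symmetric])
    also have "\<dots> \<le> (\<integral>\<^sup>+\<omega>. (\<integral>\<^sup>+\<omega>'. F (T (t + h)) (\<lambda>i. RV i (\<omega>, \<omega>')) \<partial>M') +
        (\<Sum>i\<in>I. ennreal (w \<omega> i ^ 3) * ennreal (b i * (h * sqrt h))) \<partial>P)"
      unfolding FU FV b_def using h th t by (intro nn_integral_mono lindeberg_compare[OF fin U V sym le] w0) auto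
    also have "\<dots> = (\<integral>\<^sup>+\<omega>. (\<integral>\<^sup>+\<omega>'. F (T (t + h)) (\<lambda>i. RV i (\<omega>, \<omega>')) \<partial>M') \<partial>P) +
        (\<integral>\<^sup>+\<omega>. (\<Sum>i\<in>I. ennreal (w \<omega> i ^ 3) * ennreal (b i * (h * sqrt h))) \<partial>P)"
    proof (rule nn_integral_add)
      show "(\<lambda>\<omega>. \<integral>\<^sup>+\<omega>'. F (T (t + h)) (\<lambda>i. RV i (\<omega>, \<omega>')) \<partial>M') \<in> borel_measurable P"
        by (rule M'.borel_measurable_nn_integral_fst[OF Fm[OF gRV]])
      show "(\<lambda>\<omega>. \<Sum>i\<in>I. ennreal (w \<omega> i ^ 3) * ennreal (b i * (h * sqrt h))) \<in> borel_measurable P"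
      proof (rule borel_measurable_sum)
        fix i assume "i \<in> I"
        note [measurable] = gaussian_familyD(1)[OF gR this]
        show "(\<lambda>\<omega>. ennreal (w \<omega> i ^ 3) * ennreal (b i * (h * sqrt h))) \<in> borel_measurable P"
          unfolding w_def by measurable
      qed
    qed
    also have "(\<integral>\<^sup>+\<omega>. (\<integral>\<^sup>+\<omega>'. F (T (t + h)) (\<lambda>i. RV i (\<omega>, \<omega>')) \<partial>M') \<partial>P) = \<psi> (t + h)"
      unfolding \<psi>_def using t h th by (subst law[OF gY gRV]) (auto intro!: M'.nn_integral_fst[OF Fm[OF gRV]])
    finally have main: "\<psi> t \<le> \<psi> (t + h) + (\<integral>\<^sup>+\<omega>. (\<Sum>i\<in>I. ennreal (w \<omega> i ^ 3) * ennreal (b i * (h * sqrt h))) \<partial>P)" .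
    have "(\<integral>\<^sup>+\<omega>. (\<Sum>i\<in>I. ennreal (w \<omega> i ^ 3) * ennreal (b i * (h * sqrt h))) \<partial>P) =
        (\<Sum>i\<in>I. (\<integral>\<^sup>+\<omega>. ennreal (w \<omega> i ^ 3) \<partial>P) * ennreal (b i * (h * sqrt h)))"
    proof (subst nn_integral_sum)
      fix i assume "i \<in> I"
      note [measurable] = gaussian_familyD(1)[OF gR this]
      show "(\<lambda>\<omega>. ennreal (w \<omega> i ^ 3) * ennreal (b i * (h * sqrt h))) \<in> borel_measurable P"
        unfolding w_def by measurable
    next
      show "(\<Sum>i\<in>I. \<integral>\<^sup>+\<omega>. ennreal (w \<omega> i ^ 3) * ennreal (b i * (h * sqrt h)) \<partial>P) =
          (\<Sum>i\<in>I. (\<integral>\<^sup>+\<omega>. ennreal (w \<omega> i ^ 3) \<partial>P) * ennreal (b i * (h * sqrt h)))"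
      proof (rule sum.cong[OF refl], rule nn_integral_multc)
        fix i assume "i \<in> I"
        note [measurable] = gaussian_familyD(1)[OF gR this]
        show "(\<lambda>\<omega>. ennreal (w \<omega> i ^ 3)) \<in> borel_measurable P"
          unfolding w_def by measurable
      qed
    qed
    also have "\<dots> \<le> (\<Sum>i\<in>I. ennreal (p i ^ 3 * exp (3 * (\<bar>S i i\<bar> + \<bar>S' i i\<bar>))) * ennreal (b i * (h * sqrt h)))"
    proof (intro sum_mono mult_right_mono)
      fix i assume i: "i \<in> I"
      have symR: "TR i j = TR j i" if "i \<in> I" "j \<in> I" for i j
        using sym that by (simp add: TR_def)
      have hb: "has_bochner_integral P (\<lambda>\<omega>. exp (3 * R i \<omega>)) (exp (9 * TR i i / 2))"
        using gaussian_family_exp[OF fin gR symR i i, of 3 0] by simp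
      have wcube: "w \<omega> i ^ 3 = p i ^ 3 * exp (- 3 * TR i i / 2) * exp (3 * R i \<omega>)" for \<omega>
        unfolding w_def power_mult_distrib exp_of_nat_mult[symmetric]
        by (simp add: mult.assoc exp_add[symmetric] algebra_simps)
      have "(\<integral>\<^sup>+\<omega>. ennreal (w \<omega> i ^ 3) \<partial>P) = ennreal (\<integral>\<omega>. w \<omega> i ^ 3 \<partial>P)"
        using hb w0[OF i] unfolding wcube by (intro nn_integral_eq_integral) (auto simp: has_bochner_integral_iff p[OF i])
      also have "(\<integral>\<omega>. w \<omega> i ^ 3 \<partial>P) = p i ^ 3 * (exp (- 3 * TR i i / 2) * exp (9 * TR i i / 2))"
        unfolding wcube using hb by (simp add: has_bochner_integral_iff)
      also have "exp (- 3 * TR i i / 2) * exp (9 * TR i i / 2) = exp (3 * TR i i)"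
        by (simp add: exp_add[symmetric])
      also have "TR i i \<le> \<bar>S i i\<bar> + \<bar>S' i i\<bar>"
      proof -
        have "c * x \<le> \<bar>x\<bar>" if "0 \<le> c" "c \<le> 1" for c x :: real
          using that mult_left_mono[OF abs_ge_self, of c x] mult_right_mono[of c 1 "\<bar>x\<bar>"] by simp
        from this[of "1 - t - h" "S i i"] this[of t "S' i i"]
        have "(1 - t - h) * S i i \<le> \<bar>S i i\<bar>" "t * S' i i \<le> \<bar>S' i i\<bar>"
          using t h th by simp_all
        thus ?thesis by (simp add: TR_def)
      qed
      finally show "(\<integral>\<^sup>+\<omega>. ennreal (w \<omega> i ^ 3) \<partial>P) \<le> ennreal (p i ^ 3 * exp (3 * (\<bar>S i i\<bar> + \<bar>S' i i\<bar>)))"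
        using p[OF i] by (simp add: ennreal_leI mult_left_mono)
    qed auto
    also have "\<dots> = ennreal (C * (h * sqrt h))"
      unfolding C_def sum_distrib_right using p b0 h
      by (subst sum_ennreal[symmetric]) (auto intro!: sum.cong mult_nonneg_nonneg simp: ennreal_mult[symmetric] mult_ac)
    finally show ?thesis using main by (meson add_left_mono order_trans)
  qed
  \<comment> \<open>\<open>Suc n\<close> steps of length \<open>h = 1 / Suc n\<close>, each costing
    \<open>C * h powr (3/2)\<close>, lose \<open>C * sqrt h\<close> in total, which tends to
    0.\<close>
  have "\<psi> 0 \<le> \<psi> 1 + ennreal (C / sqrt (real (Suc n)))" for n
  proof -
    define N where "N = Suc n"
    define h where "h = 1 / real N"
    have h: "0 < h" "real N * h = 1" by (auto simp: h_def N_def)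
    have "\<psi> 0 \<le> \<psi> (real k * h) + ennreal (real k * (C * (h * sqrt h)))" if "k \<le> N" for k
      using that
    proof (induction k)
      case (Suc k)
      have "real (Suc k) * h \<le> real N * h" using Suc.prems h by (intro mult_right_mono) auto
      hence "\<psi> (real k * h) \<le> \<psi> (real k * h + h) + ennreal (C * (h * sqrt h))"
        using h by (intro step) (auto simp: algebra_simps)
      hence "\<psi> 0 \<le> (\<psi> (real k * h + h) + ennreal (C * (h * sqrt h))) + ennreal (real k * (C * (h * sqrt h)))"
        using Suc by (auto intro: order_trans add_mono)
      also have "\<dots> = \<psi> (real (Suc k) * h) + ennreal (real (Suc k) * (C * (h * sqrt h)))"
        using h C0 by (simp add: add.assoc ennreal_plus[symmetric] algebra_simps del: ennreal_plus)
      finally show ?case .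
    qed simp
    from this[of N] have "\<psi> 0 \<le> \<psi> 1 + ennreal (real N * (C * (h * sqrt h)))" using h by simp
    also have "real N * (C * (h * sqrt h)) = C * sqrt h" using h(2) by (metis mult.assoc mult.commute mult.right_neutral)
    also have "C * sqrt h = C / sqrt (real N)" by (simp add: h_def real_sqrt_divide)
    finally show ?thesis by (simp add: N_def)
  qed
  moreover have "(\<lambda>n. \<psi> 1 + ennreal (C / sqrt (real (Suc n)))) \<longlonglongrightarrow> \<psi> 1 + ennreal 0"
    by (intro tendsto_add tendsto_const tendsto_ennrealI) real_asymp
  ultimately have "\<psi> 0 \<le> \<psi> 1 + ennreal 0"
    by (intro LIMSEQ_le_const) auto
  thus ?thesis unfolding \<psi>0 \<psi>1 by (simp add: F_def)
qed

section \<open>Log-correlated fields and the mass of a set\<close>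

text \<open>Young's inequality for the normalised functions \<open>f / F\<close> and
  \<open>g / G\<close>. The exponents \<open>1 - \<theta>\<close> and \<open>\<theta>\<close> put
  Hoelder's inequality in the form of log-convexity, and integrability of the product is part of the
  result.\<close>

lemma powr_holder_integral:
  fixes f g :: "'a \<Rightarrow> real"
  assumes f: "integrable M f" and g: "integrable M g"
    and f0: "AE x in M. 0 \<le> f x" and g0: "AE x in M. 0 \<le> g x"
    and \<theta>: "0 < \<theta>" "\<theta> < 1"
  shows "integrable M (\<lambda>x. f x powr (1 - \<theta>) * g x powr \<theta>)"
    and "(\<integral>x. f x powr (1 - \<theta>) * g x powr \<theta> \<partial>M) \<le> (\<integral>x. f x \<partial>M) powr (1 - \<theta>) * (\<integral>x. g x \<partial>M) powr \<theta>"
proof -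
  note [measurable] = borel_measurable_integrable[OF f] borel_measurable_integrable[OF g]
  have young: "u powr (1 - \<theta>) * v powr \<theta> \<le> (1 - \<theta>) * u + \<theta> * v" if "0 \<le> u" "0 \<le> v" for u v :: real
  proof (cases "u = 0 \<or> v = 0")
    case False
    thus ?thesis using Youngs_inequality_0[of "1 - \<theta>" \<theta> u v] \<theta> that by simp
  qed (use \<theta> that in auto)
  show int: "integrable M (\<lambda>x. f x powr (1 - \<theta>) * g x powr \<theta>)"
  proof (rule Bochner_Integration.integrable_bound)
    show "integrable M (\<lambda>x. (1 - \<theta>) * f x + \<theta> * g x)" using f g by auto
    show "AE x in M. norm (f x powr (1 - \<theta>) * g x powr \<theta>) \<le> norm ((1 - \<theta>) * f x + \<theta> * g x)"
      using f0 g0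
    proof eventually_elim
      case (elim x)
      have "0 \<le> (1 - \<theta>) * f x + \<theta> * g x" using elim \<theta> by simp
      with young[OF elim] show ?case by simp
    qed
  qed measurable
  define F G where "F = (\<integral>x. f x \<partial>M)" and "G = (\<integral>x. g x \<partial>M)"
  have FG: "F \<ge> 0" "G \<ge> 0" using f0 g0 by (auto simp: F_def G_def intro!: integral_nonneg_AE)
  show "(\<integral>x. f x powr (1 - \<theta>) * g x powr \<theta> \<partial>M) \<le> F powr (1 - \<theta>) * G powr \<theta>"
  proof (cases "F = 0 \<or> G = 0")
    case True
    have "AE x in M. f x = 0 \<or> g x = 0"
      using True
    proof
      assume "F = 0"
      hence "AE x in M. f x = 0" using f f0 by (simp add: F_def integral_nonneg_eq_0_iff_AE)
      thus ?thesis by auto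
    next
      assume "G = 0"
      hence "AE x in M. g x = 0" using g g0 by (simp add: G_def integral_nonneg_eq_0_iff_AE)
      thus ?thesis by auto
    qed
    hence "AE x in M. f x powr (1 - \<theta>) * g x powr \<theta> = 0" by eventually_elim auto
    hence "(\<integral>x. f x powr (1 - \<theta>) * g x powr \<theta> \<partial>M) = (\<integral>x. 0 \<partial>M)" by (intro integral_cong_AE) auto
    thus ?thesis by simp
  next
    case False
    hence pos: "F > 0" "G > 0" using FG by auto
    have "(\<integral>x. f x powr (1 - \<theta>) * g x powr \<theta> \<partial>M) \<le>
        (\<integral>x. F powr (1 - \<theta>) * G powr \<theta> * ((1 - \<theta>) * (f x / F) + \<theta> * (g x / G)) \<partial>M)"
    proof (intro integral_mono_AE int)
      show "integrable M (\<lambda>x. F powr (1 - \<theta>) * G powr \<theta> * ((1 - \<theta>) * (f x / F) + \<theta> * (g x / G)))"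
        using f g by auto
      show "AE x in M. f x powr (1 - \<theta>) * g x powr \<theta> \<le>
          F powr (1 - \<theta>) * G powr \<theta> * ((1 - \<theta>) * (f x / F) + \<theta> * (g x / G))"
        using f0 g0
      proof eventually_elim
        case (elim x)
        have "f x powr (1 - \<theta>) * g x powr \<theta> =
            F powr (1 - \<theta>) * G powr \<theta> * ((f x / F) powr (1 - \<theta>) * (g x / G) powr \<theta>)"
          using elim pos by (simp add: powr_divide)
        also have "\<dots> \<le> F powr (1 - \<theta>) * G powr \<theta> * ((1 - \<theta>) * (f x / F) + \<theta> * (g x / G))"
          using elim pos by (intro mult_left_mono young) auto
        finally show ?case .
      qed
    qed
    also have "\<dots> = F powr (1 - \<theta>) * G powr \<theta> * ((1 - \<theta>) * (F / F) + \<theta> * (G / G))"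
      using f g by (simp add: F_def G_def)
    also have "\<dots> = F powr (1 - \<theta>) * G powr \<theta>" using pos by simp
    finally show ?thesis .
  qed
qed

lemma set_integral_pos:
  fixes f :: "'a \<Rightarrow> real"
  assumes S: "S \<in> sets M" "emeasure M S \<noteq> 0" and f: "set_integrable M S f" "\<And>x. x \<in> S \<Longrightarrow> 0 < f x"
  shows "0 < (LINT x:S|M. f x)"
proof -
  have nn: "AE x in M. 0 \<le> indicator S x *\<^sub>R f x" using f(2) by (auto simp: indicator_def less_imp_le)
  have "(LINT x:S|M. f x) \<noteq> 0"
  proof
    assume "(LINT x:S|M. f x) = 0"
    hence "AE x in M. indicator S x *\<^sub>R f x = 0"
      using f(1) nn integral_nonneg_eq_0_iff_AE unfolding set_integrable_def set_lebesgue_integral_def by blast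
    hence "AE x in M. x \<notin> S" by eventually_elim (use f(2) in \<open>force simp: indicator_def\<close>)
    hence "emeasure M S = 0" using S by (subst (asm) AE_iff_measurable[OF S(1)]) (auto dest: sets.sets_into_space)
    thus False using S by simp
  qed
  moreover have "0 \<le> (LINT x:S|M. f x)"
    unfolding set_lebesgue_integral_def using nn by (rule integral_nonneg_AE)
  ultimately show ?thesis by simp
qed

text \<open>The measurability assumption carries the indicator of \<open>S\<close> because the field
  is jointly measurable only over \<open>D\<close>.\<close>

lemma (in prob_space) fubini_set_integral:
  fixes f :: "'a \<Rightarrow> 'd::euclidean_space \<Rightarrow> real"
  assumes f[measurable]: "(\<lambda>(\<omega>, y). indicator S y * f \<omega> y) \<in> borel_measurable (M \<Otimes>\<^sub>M lborel)"
    and S[measurable]: "S \<in> sets borel" and Sfin: "emeasure lborel S < \<infinity>"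
    and nn: "\<And>\<omega> y. y \<in> S \<Longrightarrow> 0 \<le> f \<omega> y"
    and int: "\<And>y. y \<in> S \<Longrightarrow> integrable M (\<lambda>\<omega>. f \<omega> y)"
    and le: "\<And>y. y \<in> S \<Longrightarrow> (\<integral>\<omega>. f \<omega> y \<partial>M) \<le> c"
  shows "integrable M (\<lambda>\<omega>. LINT y:S|lborel. f \<omega> y)"
    and "AE \<omega> in M. set_integrable lborel S (f \<omega>)"
    and "set_integrable lborel S (\<lambda>y. \<integral>\<omega>. f \<omega> y \<partial>M)"
    and "(\<integral>\<omega>. (LINT y:S|lborel. f \<omega> y) \<partial>M) = (LINT y:S|lborel. \<integral>\<omega>. f \<omega> y \<partial>M)"
    and "(\<integral>\<omega>. (LINT y:S|lborel. f \<omega> y) \<partial>M) \<le> c * measure lborel S"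
proof -
  interpret P: pair_sigma_finite M "lborel :: 'd measure" ..
  interpret Q: pair_sigma_finite "lborel :: 'd measure" M ..
  define G where "G = (\<lambda>(y, \<omega>). indicator S y * f \<omega> y)"
  have Gm[measurable]: "G \<in> borel_measurable (lborel \<Otimes>\<^sub>M M)"
    using measurable_pair_swap[OF f] by (simp add: G_def case_prod_beta')
  have inner: "(\<integral>\<omega>. G (y, \<omega>) \<partial>M) = indicator S y * (\<integral>\<omega>. f \<omega> y \<partial>M)" for y
    by (auto simp: G_def indicator_def)
  have inner_norm: "(\<integral>\<omega>. norm (G (y, \<omega>)) \<partial>M) = indicator S y * (\<integral>\<omega>. f \<omega> y \<partial>M)" for y
    using nn by (auto simp: G_def indicator_def)
  have cS: "integrable lborel (\<lambda>y. \<bar>c\<bar> * indicator S y :: real)"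
    using Sfin by (intro integrable_mult_right integrable_real_indicator) auto
  have m1: "(\<lambda>y. indicator S y * (\<integral>\<omega>. f \<omega> y \<partial>M)) \<in> borel_measurable lborel"
    unfolding inner[symmetric] by measurable
  have i1: "integrable lborel (\<lambda>y. indicator S y * (\<integral>\<omega>. f \<omega> y \<partial>M))"
  proof (rule Bochner_Integration.integrable_bound[OF cS m1])
    show "AE y in lborel. norm (indicator S y * (\<integral>\<omega>. f \<omega> y \<partial>M)) \<le> norm (\<bar>c\<bar> * indicator S y :: real)"
    proof (rule AE_I2)
      fix y :: 'd
      show "norm (indicator S y * (\<integral>\<omega>. f \<omega> y \<partial>M)) \<le> norm (\<bar>c\<bar> * indicator S y :: real)"
      proof (cases "y \<in> S")
        case True
        have "0 \<le> (\<integral>\<omega>. f \<omega> y \<partial>M)" using nn[OF True] by (intro integral_nonneg_AE) auto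
        with le[OF True] True show ?thesis by simp
      qed simp
    qed
  qed
  have "integrable (lborel \<Otimes>\<^sub>M M) G"
  proof (rule Q.Fubini_integrable[OF Gm])
    show "integrable lborel (\<lambda>y. \<integral>\<omega>. norm (G (y, \<omega>)) \<partial>M)"
      unfolding inner_norm by (rule i1)
    show "AE y in lborel. integrable M (\<lambda>\<omega>. G (y, \<omega>))"
      using int by (auto simp: G_def indicator_def)
  qed
  from Q.integrable_product_swap[OF this]
  have intF: "integrable (M \<Otimes>\<^sub>M lborel) (\<lambda>(\<omega>, y). indicator S y * f \<omega> y)"
    by (simp add: G_def)
  show "set_integrable lborel S (\<lambda>y. \<integral>\<omega>. f \<omega> y \<partial>M)"
    using i1 by (simp add: set_integrable_def)
  show "integrable M (\<lambda>\<omega>. LINT y:S|lborel. f \<omega> y)"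
    using P.integrable_fst'[OF intF] by (simp add: set_lebesgue_integral_def)
  show "AE \<omega> in M. set_integrable lborel S (f \<omega>)"
    using P.AE_integrable_fst'[OF intF] by (simp add: set_integrable_def)
  show eq: "(\<integral>\<omega>. (LINT y:S|lborel. f \<omega> y) \<partial>M) = (LINT y:S|lborel. \<integral>\<omega>. f \<omega> y \<partial>M)"
    using P.Fubini_integral[OF intF] by (simp add: set_lebesgue_integral_def)
  have "(LINT y:S|lborel. \<integral>\<omega>. f \<omega> y \<partial>M) \<le> (\<integral>y. c * indicator S y \<partial>lborel)"
    unfolding set_lebesgue_integral_def real_scaleR_def
    using le Sfin by (intro integral_mono i1 integrable_mult_right integrable_real_indicator) (auto simp: indicator_def)
  thus "(\<integral>\<omega>. (LINT y:S|lborel. f \<omega> y) \<partial>M) \<le> c * measure lborel S"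
    using eq by simp
qed

lemma normal_density_tilt:
  assumes "\<sigma> > 0"
  shows "normal_density 0 \<sigma> t * exp t = exp (\<sigma>\<^sup>2 / 2) * normal_density (\<sigma>\<^sup>2) \<sigma> t"
proof -
  have "- (t - 0)\<^sup>2 / (2 * \<sigma>\<^sup>2) + t = \<sigma>\<^sup>2 / 2 + - (t - \<sigma>\<^sup>2)\<^sup>2 / (2 * \<sigma>\<^sup>2)"
    using assms by (simp add: field_simps power2_eq_square)
  hence "exp (- (t - 0)\<^sup>2 / (2 * \<sigma>\<^sup>2)) * exp t = exp (\<sigma>\<^sup>2 / 2) * exp (- (t - \<sigma>\<^sup>2)\<^sup>2 / (2 * \<sigma>\<^sup>2))"
    unfolding exp_add[symmetric] by simp
  thus ?thesis by (simp add: normal_density_def)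
qed

text \<open>Expressing the exponential moment by the second moment instead of a density parameter
  gives degenerate and nondegenerate variables the same formula.\<close>

lemma (in prob_space) centred_gaussian_rv_moments:
  assumes "centred_gaussian_rv M Y"
  shows "Y \<in> borel_measurable M" and "integrable M (\<lambda>\<omega>. (Y \<omega>)\<^sup>2)"
    and "has_bochner_integral M (\<lambda>\<omega>. exp (Y \<omega>)) (exp ((\<integral>\<omega>. (Y \<omega>)\<^sup>2 \<partial>M) / 2))"
proof -
  show [measurable]: "Y \<in> borel_measurable M" using assms by (simp add: centred_gaussian_rv_def)
  have "integrable M (\<lambda>\<omega>. (Y \<omega>)\<^sup>2) \<and>
      has_bochner_integral M (\<lambda>\<omega>. exp (Y \<omega>)) (exp ((\<integral>\<omega>. (Y \<omega>)\<^sup>2 \<partial>M) / 2))"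
  proof (cases "AE \<omega> in M. Y \<omega> = 0")
    case True
    have "has_bochner_integral M (\<lambda>\<omega>. (Y \<omega>)\<^sup>2) 0 \<longleftrightarrow> has_bochner_integral M (\<lambda>\<omega>. 0) (0 :: real)"
      using True by (intro has_bochner_integral_cong_AE) auto
    moreover have "has_bochner_integral M (\<lambda>\<omega>. exp (Y \<omega>)) 1 \<longleftrightarrow> has_bochner_integral M (\<lambda>\<omega>. 1) (1 :: real)"
      using True by (intro has_bochner_integral_cong_AE) auto
    ultimately show ?thesis by (simp add: has_bochner_integral_iff prob_space)
  next
    case False
    then obtain \<sigma> where \<sigma>: "\<sigma> > 0" and D: "distributed M lborel Y (normal_density 0 \<sigma>)"
      using assms by (auto simp: centred_gaussian_rv_def)
    have sq: "integrable M (\<lambda>\<omega>. (Y \<omega>)\<^sup>2)"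
      using distributed_integrable[OF D, of "\<lambda>x. x\<^sup>2"] integrable_normal_moment[OF \<sigma>, of 0 2] by simp
    have var: "(\<integral>\<omega>. (Y \<omega>)\<^sup>2 \<partial>M) = \<sigma>\<^sup>2"
      using normal_distributed_variance[OF \<sigma> D] normal_distributed_expectation[OF \<sigma> D] by simp
    have "integrable lborel (\<lambda>t. normal_density 0 \<sigma> t * exp t)"
      unfolding normal_density_tilt[OF \<sigma>] using \<sigma> by (intro integrable_mult_right integrable_normal_density)
    moreover have "(\<integral>t. normal_density 0 \<sigma> t * exp t \<partial>lborel) = exp (\<sigma>\<^sup>2 / 2)"
      unfolding normal_density_tilt[OF \<sigma>] using integral_normal_density[OF \<sigma>] by simp
    ultimately have "has_bochner_integral M (\<lambda>\<omega>. exp (Y \<omega>)) (exp (\<sigma>\<^sup>2 / 2))"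
      using distributed_integrable[OF D, of exp] distributed_integral[OF D, of exp]
      by (simp add: has_bochner_integral_iff)
    with sq var show ?thesis by simp
  qed
  thus "integrable M (\<lambda>\<omega>. (Y \<omega>)\<^sup>2)"
    and "has_bochner_integral M (\<lambda>\<omega>. exp (Y \<omega>)) (exp ((\<integral>\<omega>. (Y \<omega>)\<^sup>2 \<partial>M) / 2))" by auto
qed

locale log_correlated_fields = prob_space M for M :: "'w measure" +
  fixes D :: "'d::euclidean_space set"
    and X :: "real \<Rightarrow> 'd \<Rightarrow> 'w \<Rightarrow> real"
    and g :: "real \<Rightarrow> 'd \<Rightarrow> 'd \<Rightarrow> real"
    and C :: real
  assumes D_open: "open D"
    and D_box: "cbox (- 2 *\<^sub>R One) (2 *\<^sub>R One) \<subseteq> D"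
    and gauss: "\<And>\<epsilon>. \<epsilon> \<in> {0<..1} \<Longrightarrow> centred_gaussian_field M D (X \<epsilon>)"
    and field_measurable: "\<And>\<epsilon>. \<epsilon> \<in> {0<..1} \<Longrightarrow>
           (\<lambda>p. X \<epsilon> (snd p) (fst p)) \<in> borel_measurable (M \<Otimes>\<^sub>M restrict_space lborel D)"
    and covariance: "\<And>\<epsilon> x y. \<epsilon> \<in> {0<..1} \<Longrightarrow> x \<in> D \<Longrightarrow> y \<in> D \<Longrightarrow>
           (\<integral>\<omega>. X \<epsilon> x \<omega> * X \<epsilon> y \<omega> \<partial>M) = - ln (norm (x - y) + \<epsilon>) + g \<epsilon> x y"
    and g_cont: "\<And>\<epsilon>. \<epsilon> \<in> {0<..1} \<Longrightarrow> continuous_on (D \<times> D) (\<lambda>(x, y). g \<epsilon> x y)"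
    and C_pos: "C > 0"
    and g_bound: "\<And>\<epsilon> x y. \<epsilon> \<in> {0<..1} \<Longrightarrow> x \<in> D \<Longrightarrow> y \<in> D \<Longrightarrow> \<bar>g \<epsilon> x y\<bar> \<le> C"
begin

section \<open>Covariance bounds and linear functionals of the field\<close>

abbreviation B :: "'d set" where "B \<equiv> cbox (- One) One"

lemma mem_B: "x \<in> B \<longleftrightarrow> (\<forall>i\<in>Basis. \<bar>x \<bullet> i\<bar> \<le> 1)"
  by (simp add: mem_box inner_sum_left_Basis abs_le_iff minus_le_iff conj_commute)

lemma mem_DI: "(\<And>i. i \<in> Basis \<Longrightarrow> \<bar>x \<bullet> i\<bar> \<le> 2) \<Longrightarrow> x \<in> D"
  using D_box by (fastforce simp: mem_box inner_sum_left_Basis abs_le_iff)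

lemma B_subset_D: "B \<subseteq> D"
proof
  fix x :: 'd assume x: "x \<in> B"
  show "x \<in> D"
  proof (rule mem_DI)
    fix i :: 'd assume "i \<in> Basis"
    with x mem_B[of x] have "\<bar>x \<bullet> i\<bar> \<le> 1" by blast
    thus "\<bar>x \<bullet> i\<bar> \<le> 2" by simp
  qed
qed

definition K :: "real \<Rightarrow> 'd \<Rightarrow> 'd \<Rightarrow> real" where
  "K \<epsilon> x y = (\<integral>\<omega>. X \<epsilon> x \<omega> * X \<epsilon> y \<omega> \<partial>M)"

lemma K_sym: "K \<epsilon> x y = K \<epsilon> y x" by (simp add: K_def mult.commute)

lemma K_upper:
  assumes "\<epsilon> \<in> {0<..1}" "x \<in> D" "y \<in> D" "0 < r" "r \<le> norm (x - y) + \<epsilon>"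
  shows "K \<epsilon> x y \<le> - ln r + C"
proof -
  have "ln r \<le> ln (norm (x - y) + \<epsilon>)" using assms by (subst ln_le_cancel_iff) auto
  thus ?thesis using covariance[OF assms(1-3)] g_bound[OF assms(1-3)] by (simp add: K_def)
qed

lemma K_lower:
  assumes "\<epsilon> \<in> {0<..1}" "x \<in> D" "y \<in> D" "norm (x - y) + \<epsilon> \<le> r"
  shows "K \<epsilon> x y \<ge> - ln r - C"
proof -
  have "0 < norm (x - y) + \<epsilon>" using assms by (intro add_nonneg_pos) auto
  hence "ln (norm (x - y) + \<epsilon>) \<le> ln r" using assms by (subst ln_le_cancel_iff) auto
  thus ?thesis using covariance[OF assms(1-3)] g_bound[OF assms(1-3)] by (simp add: K_def)
qed

lemma K_diag:
  assumes "\<epsilon> \<in> {0<..1}" "x \<in> D"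
  shows "K \<epsilon> x x \<le> - ln \<epsilon> + C" "K \<epsilon> x x \<ge> - ln \<epsilon> - C"
  using K_upper[of \<epsilon> x x \<epsilon>] K_lower[of \<epsilon> x x \<epsilon>] assms by auto

text \<open>The linear span of the field values. Every element is a centred Gaussian variable by
  hypothesis, so joint exponential moments of several elements reduce to that of one linear
  combination.\<close>

definition lin :: "real \<Rightarrow> ('w \<Rightarrow> real) set" where
  "lin \<epsilon> = {Y. \<exists>S c. finite S \<and> S \<subseteq> D \<and> Y = (\<lambda>\<omega>. \<Sum>x\<in>S. c x * X \<epsilon> x \<omega>)}"

lemma lin_X: "x \<in> D \<Longrightarrow> X \<epsilon> x \<in> lin \<epsilon>"
  unfolding lin_def by (auto intro!: exI[of _ "{x}"] exI[of _ "\<lambda>_. 1"])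

lemma lin_scale: "Y \<in> lin \<epsilon> \<Longrightarrow> (\<lambda>\<omega>. a * Y \<omega>) \<in> lin \<epsilon>"
proof -
  assume "Y \<in> lin \<epsilon>"
  then obtain S c where "finite S" "S \<subseteq> D" "Y = (\<lambda>\<omega>. \<Sum>x\<in>S. c x * X \<epsilon> x \<omega>)" by (auto simp: lin_def)
  thus ?thesis unfolding lin_def
    by (auto intro!: exI[of _ S] exI[of _ "\<lambda>x. a * c x"] simp: sum_distrib_left mult.assoc)
qed

lemma lin_add:
  assumes "Y \<in> lin \<epsilon>" "Z \<in> lin \<epsilon>"
  shows "(\<lambda>\<omega>. Y \<omega> + Z \<omega>) \<in> lin \<epsilon>"
proof -
  obtain S c where S: "finite S" "S \<subseteq> D" "Y = (\<lambda>\<omega>. \<Sum>x\<in>S. c x * X \<epsilon> x \<omega>)"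
    using assms by (auto simp: lin_def)
  obtain S' c' where S': "finite S'" "S' \<subseteq> D" "Z = (\<lambda>\<omega>. \<Sum>x\<in>S'. c' x * X \<epsilon> x \<omega>)"
    using assms by (auto simp: lin_def)
  have "(\<Sum>x\<in>S. c x * X \<epsilon> x \<omega>) = (\<Sum>x\<in>S \<union> S'. (if x \<in> S then c x else 0) * X \<epsilon> x \<omega>)" for \<omega>
    using S S' by (intro sum.mono_neutral_cong_left) auto
  moreover have "(\<Sum>x\<in>S'. c' x * X \<epsilon> x \<omega>) = (\<Sum>x\<in>S \<union> S'. (if x \<in> S' then c' x else 0) * X \<epsilon> x \<omega>)" for \<omega>
    using S S' by (intro sum.mono_neutral_cong_left) auto
  ultimately have eq: "(\<lambda>\<omega>. Y \<omega> + Z \<omega>) =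
     (\<lambda>\<omega>. \<Sum>x\<in>S \<union> S'. ((if x \<in> S then c x else 0) + (if x \<in> S' then c' x else 0)) * X \<epsilon> x \<omega>)"
    by (simp only: S(3) S'(3) distrib_right sum.distrib)
  show ?thesis unfolding lin_def mem_Collect_eq
    by (rule exI[of _ "S \<union> S'"], rule exI, intro conjI, use S S' in simp, use S S' in simp, rule eq)
qed

lemma lin_zero: "(\<lambda>\<omega>. 0) \<in> lin \<epsilon>"
  unfolding lin_def by (auto intro!: exI[of _ "{}"])

lemma lin_sum: "(\<And>i. i \<in> I \<Longrightarrow> Y i \<in> lin \<epsilon>) \<Longrightarrow> (\<lambda>\<omega>. \<Sum>i\<in>I. Y i \<omega>) \<in> lin \<epsilon>"
  by (induction I rule: infinite_finite_induct) (auto intro: lin_zero lin_add)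

lemma lin_gaussian: "\<epsilon> \<in> {0<..1} \<Longrightarrow> Y \<in> lin \<epsilon> \<Longrightarrow> centred_gaussian_rv M Y"
  using gauss[of \<epsilon>] by (auto simp: lin_def centred_gaussian_field_def)

lemma lin_measurable: "\<epsilon> \<in> {0<..1} \<Longrightarrow> Y \<in> lin \<epsilon> \<Longrightarrow> Y \<in> borel_measurable M"
  using centred_gaussian_rv_moments(1) lin_gaussian by blast

definition cv :: "('w \<Rightarrow> real) \<Rightarrow> ('w \<Rightarrow> real) \<Rightarrow> real" where
  "cv Y Z = (\<integral>\<omega>. Y \<omega> * Z \<omega> \<partial>M)"

lemma cv_X: "cv (X \<epsilon> x) (X \<epsilon> y) = K \<epsilon> x y" by (simp add: cv_def K_def)

lemma cv_sym: "cv Y Z = cv Z Y" by (simp add: cv_def mult.commute)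

lemma lin_integrable_mult:
  assumes e: "\<epsilon> \<in> {0<..1}" and Y: "Y \<in> lin \<epsilon>" and Z: "Z \<in> lin \<epsilon>"
  shows "integrable M (\<lambda>\<omega>. Y \<omega> * Z \<omega>)"
proof -
  have "integrable M (\<lambda>\<omega>. ((Y \<omega> + Z \<omega>)\<^sup>2 - (Y \<omega>)\<^sup>2 - (Z \<omega>)\<^sup>2) / 2)"
    using centred_gaussian_rv_moments(2)[OF lin_gaussian[OF e lin_add[OF Y Z]]]
      centred_gaussian_rv_moments(2)[OF lin_gaussian[OF e Y]] centred_gaussian_rv_moments(2)[OF lin_gaussian[OF e Z]]
    by auto
  thus ?thesis by (simp add: power2_eq_square algebra_simps add_divide_distrib)
qed

lemma cv_scale: "cv (\<lambda>\<omega>. a * Y \<omega>) Z = a * cv Y Z"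
  by (simp add: cv_def mult.assoc)

lemma cv_sum:
  assumes "\<epsilon> \<in> {0<..1}" "\<And>i. i \<in> I \<Longrightarrow> Y i \<in> lin \<epsilon>" "Z \<in> lin \<epsilon>"
  shows "cv (\<lambda>\<omega>. \<Sum>i\<in>I. Y i \<omega>) Z = (\<Sum>i\<in>I. cv (Y i) Z)"
  unfolding cv_def sum_distrib_right using lin_integrable_mult[OF assms(1) assms(2) assms(3)]
  by (intro Bochner_Integration.integral_sum) auto

text \<open>The three slots are taken in \<open>tilt_bound\<close> by the value at the tilting
  point, the coarse functional \<open>L\<close>, and the value at the integration point.\<close>

lemma lin_exp:
  assumes e: "\<epsilon> \<in> {0<..1}" and "U \<in> lin \<epsilon>" "V \<in> lin \<epsilon>" "W \<in> lin \<epsilon>"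
  shows "has_bochner_integral M (\<lambda>\<omega>. exp (a * U \<omega> + b * V \<omega> + c * W \<omega>))
     (exp ((a\<^sup>2 * cv U U + b\<^sup>2 * cv V V + c\<^sup>2 * cv W W + 2 * a * b * cv U V + 2 * a * c * cv U W + 2 * b * c * cv V W) / 2))"
proof -
  note int = lin_integrable_mult[OF e]
  have lin: "(\<lambda>\<omega>. a * U \<omega> + b * V \<omega> + c * W \<omega>) \<in> lin \<epsilon>"
    using assms by (intro lin_add lin_scale)
  have hb: "has_bochner_integral M (\<lambda>\<omega>. Y \<omega> * Z \<omega>) (cv Y Z)" if "Y \<in> lin \<epsilon>" "Z \<in> lin \<epsilon>" for Y Z
    using int[OF that] by (simp add: has_bochner_integral_iff cv_def)
  have "has_bochner_integral M (\<lambda>\<omega>. a\<^sup>2 * (U \<omega> * U \<omega>) + b\<^sup>2 * (V \<omega> * V \<omega>) + c\<^sup>2 * (W \<omega> * W \<omega>) +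
        2 * a * b * (U \<omega> * V \<omega>) + 2 * a * c * (U \<omega> * W \<omega>) + 2 * b * c * (V \<omega> * W \<omega>))
     (a\<^sup>2 * cv U U + b\<^sup>2 * cv V V + c\<^sup>2 * cv W W + 2 * a * b * cv U V + 2 * a * c * cv U W + 2 * b * c * cv V W)"
    by (intro has_bochner_integral_add has_bochner_integral_mult_right hb assms)
  moreover have "a\<^sup>2 * (u * u) + b\<^sup>2 * (v * v) + c\<^sup>2 * (w * w) + 2 * a * b * (u * v) + 2 * a * c * (u * w) +
      2 * b * c * (v * w) = (a * u + b * v + c * w)\<^sup>2" for u v w
    by algebra
  ultimately have "(\<integral>\<omega>. (a * U \<omega> + b * V \<omega> + c * W \<omega>)\<^sup>2 \<partial>M) =
     a\<^sup>2 * cv U U + b\<^sup>2 * cv V V + c\<^sup>2 * cv W W + 2 * a * b * cv U V + 2 * a * c * cv U W + 2 * b * c * cv V W"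
    by (simp only: has_bochner_integral_iff)
  thus ?thesis
    using centred_gaussian_rv_moments(3)[OF lin_gaussian[OF e lin]] by (simp only:)
qed

lemma exp_field:
  assumes "\<epsilon> \<in> {0<..1}" "x \<in> D"
  shows "has_bochner_integral M (\<lambda>\<omega>. exp (a * X \<epsilon> x \<omega>)) (exp (a\<^sup>2 * K \<epsilon> x x / 2))"
  using lin_exp[OF assms(1) lin_X[OF assms(2)] lin_zero lin_zero, of a 0 0] by (simp add: cv_X)

lemma exp_field2:
  assumes "\<epsilon> \<in> {0<..1}" "x \<in> D" "y \<in> D"
  shows "has_bochner_integral M (\<lambda>\<omega>. exp (a * X \<epsilon> x \<omega> + b * X \<epsilon> y \<omega>))
     (exp ((a\<^sup>2 * K \<epsilon> x x + b\<^sup>2 * K \<epsilon> y y + 2 * a * b * K \<epsilon> x y) / 2))"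
  using lin_exp[OF assms(1) lin_X[OF assms(2)] lin_X[OF assms(3)] lin_zero, of a b 0] by (simp add: cv_X)

lemma indicator_field_measurable:
  assumes e: "\<epsilon> \<in> {0<..1}" and S: "S \<in> sets borel" and SD: "S \<subseteq> D"
    and F: "(\<lambda>(t, y). F t y) \<in> borel_measurable (borel \<Otimes>\<^sub>M borel)"
    and V: "V \<in> borel_measurable M"
  shows "(\<lambda>(\<omega>, y). indicator S y * (V \<omega> * (F (X \<epsilon> y \<omega>) y :: real))) \<in> borel_measurable (M \<Otimes>\<^sub>M lborel)"
proof (cases "S = {}")
  case False
  then obtain x0 where x0: "x0 \<in> S" by auto
  \<comment> \<open>Joint measurability is available only over \<open>D\<close>; points outside
    \<open>S\<close> are sent to a fixed point of \<open>S\<close>, which the indicator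
    hides.\<close>
  define \<pi> where "\<pi> y = (if y \<in> S then y else x0)" for y
  have "\<pi> \<in> measurable lborel (restrict_space lborel D)"
  proof (rule measurable_restrict_space2)
    show "\<pi> \<in> space lborel \<rightarrow> D" using x0 SD by (auto simp: \<pi>_def)
    note [measurable] = S
    show "\<pi> \<in> lborel \<rightarrow>\<^sub>M lborel" unfolding \<pi>_def by measurable
  qed
  hence pm: "(\<lambda>p. (fst p, \<pi> (snd p))) \<in> measurable (M \<Otimes>\<^sub>M lborel) (M \<Otimes>\<^sub>M restrict_space lborel D)"
    by (intro measurable_Pair measurable_fst measurable_compose[OF measurable_snd])
  have Xm: "(\<lambda>p. X \<epsilon> (\<pi> (snd p)) (fst p)) \<in> borel_measurable (M \<Otimes>\<^sub>M lborel)"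
    using measurable_compose[OF pm field_measurable[OF e]] by (simp only: fst_conv snd_conv)
  have "(\<lambda>p. (X \<epsilon> (\<pi> (snd p)) (fst p), snd p)) \<in> measurable (M \<Otimes>\<^sub>M lborel) (borel \<Otimes>\<^sub>M borel)"
    by (intro measurable_Pair Xm) simp
  from measurable_compose[OF this F]
  have Fm: "(\<lambda>p. F (X \<epsilon> (\<pi> (snd p)) (fst p)) (snd p)) \<in> borel_measurable (M \<Otimes>\<^sub>M lborel)"
    by (simp only: prod.case)
  have "(\<lambda>p. indicator S (snd p) * (V (fst p) * F (X \<epsilon> (\<pi> (snd p)) (fst p)) (snd p))) \<in> borel_measurable (M \<Otimes>\<^sub>M lborel)"
    using S by (intro borel_measurable_times Fm measurable_compose[OF measurable_fst V]
        measurable_compose[OF measurable_snd borel_measurable_indicator]) simp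
  moreover have "indicator S y * (V \<omega> * F (X \<epsilon> (\<pi> y) \<omega>) y) = indicator S y * (V \<omega> * F (X \<epsilon> y \<omega>) y)" for \<omega> y
    by (auto simp: indicator_def \<pi>_def)
  ultimately show ?thesis by (simp add: case_prod_beta')
qed simp

end

lemma powr_add_le:
  fixes u v s :: real
  assumes "0 \<le> u" "0 \<le> v" "0 < s" "s \<le> 1"
  shows "(u + v) powr s \<le> u powr s + v powr s"
proof (cases "u + v = 0")
  case False
  define w where "w = u + v"
  have w: "w > 0" using False assms by (simp add: w_def)
  have *: "t \<le> t powr s" if "0 \<le> t" "t \<le> 1" for t
    using powr_mono'[of s 1 t] that assms by simp
  have "1 = u / w + v / w" using w by (simp add: w_def add_divide_distrib[symmetric])
  also have "\<dots> \<le> (u / w) powr s + (v / w) powr s"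
    using assms w by (intro add_mono *) (auto simp: w_def)
  also have "\<dots> = (u powr s + v powr s) / w powr s"
    using assms w by (simp add: powr_divide add_divide_distrib)
  finally show ?thesis using w by (simp add: w_def field_simps)
qed (use assms in auto)

context log_correlated_fields
begin

section \<open>Integrability, moments and additivity of the mass\<close>

definition mass :: "real \<Rightarrow> real \<Rightarrow> 'd set \<Rightarrow> 'w \<Rightarrow> real" where
  "mass \<epsilon> b S \<omega> = (LINT y:S|lborel. exp (b * X \<epsilon> y \<omega>))"

lemma mass_nonneg: "0 \<le> mass \<epsilon> b S \<omega>"
  unfolding mass_def set_lebesgue_integral_def by (intro integral_nonneg_AE AE_I2) simp

lemma emeasure_subset_B: "S \<in> sets borel \<Longrightarrow> S \<subseteq> B \<Longrightarrow> emeasure lborel S < \<infinity>"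
  using emeasure_mono[of S B lborel] emeasure_lborel_cbox_finite[of "- One :: 'd" One]
  by (auto simp: less_top[symmetric] top_unique)

text \<open>The random weight \<open>V\<close> is the point: when \<open>V\<close> is a power of
  another mass, a mixed moment reduces to expectations tilted at a single point
  \<open>y\<close>.\<close>

lemma mass_fubini:
  assumes e: "\<epsilon> \<in> {0<..1}" and S: "S \<in> sets borel" "S \<subseteq> B"
    and V: "V \<in> borel_measurable M" "\<And>\<omega>. 0 \<le> V \<omega>"
    and int: "\<And>y. y \<in> S \<Longrightarrow> integrable M (\<lambda>\<omega>. V \<omega> * exp (b * X \<epsilon> y \<omega>))"
    and le: "\<And>y. y \<in> S \<Longrightarrow> (\<integral>\<omega>. V \<omega> * exp (b * X \<epsilon> y \<omega>) \<partial>M) \<le> c"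
  shows "integrable M (\<lambda>\<omega>. V \<omega> * mass \<epsilon> b S \<omega>)"
    and "set_integrable lborel S (\<lambda>y. \<integral>\<omega>. V \<omega> * exp (b * X \<epsilon> y \<omega>) \<partial>M)"
    and "(\<integral>\<omega>. V \<omega> * mass \<epsilon> b S \<omega> \<partial>M) = (LINT y:S|lborel. \<integral>\<omega>. V \<omega> * exp (b * X \<epsilon> y \<omega>) \<partial>M)"
    and "(\<integral>\<omega>. V \<omega> * mass \<epsilon> b S \<omega> \<partial>M) \<le> c * measure lborel S"
proof -
  have "(\<lambda>(t, y). exp (b * t)) \<in> borel_measurable (borel \<Otimes>\<^sub>M (borel :: 'd measure))" by measurable
  from indicator_field_measurable[OF e S(1) order_trans[OF S(2) B_subset_D] this V(1)]
  have m: "(\<lambda>(\<omega>, y). indicator S y * (V \<omega> * exp (b * X \<epsilon> y \<omega>))) \<in> borel_measurable (M \<Otimes>\<^sub>M lborel)" .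
  have eq: "V \<omega> * mass \<epsilon> b S \<omega> = (LINT y:S|lborel. V \<omega> * exp (b * X \<epsilon> y \<omega>))" for \<omega>
    by (simp add: mass_def)
  note F = fubini_set_integral[OF m S(1) emeasure_subset_B[OF S] _ int le]
  show "integrable M (\<lambda>\<omega>. V \<omega> * mass \<epsilon> b S \<omega>)" unfolding eq by (rule F(1)) (rule mult_nonneg_nonneg[OF V(2) exp_ge_zero])
  show "set_integrable lborel S (\<lambda>y. \<integral>\<omega>. V \<omega> * exp (b * X \<epsilon> y \<omega>) \<partial>M)" by (rule F(3)) (rule mult_nonneg_nonneg[OF V(2) exp_ge_zero])
  show "(\<integral>\<omega>. V \<omega> * mass \<epsilon> b S \<omega> \<partial>M) = (LINT y:S|lborel. \<integral>\<omega>. V \<omega> * exp (b * X \<epsilon> y \<omega>) \<partial>M)"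
    unfolding eq by (rule F(4)) (rule mult_nonneg_nonneg[OF V(2) exp_ge_zero])
  show "(\<integral>\<omega>. V \<omega> * mass \<epsilon> b S \<omega> \<partial>M) \<le> c * measure lborel S"
    unfolding eq by (rule F(5)) (rule mult_nonneg_nonneg[OF V(2) exp_ge_zero])
qed

lemma exp_field_le:
  assumes "\<epsilon> \<in> {0<..1}" "x \<in> D"
  shows "integrable M (\<lambda>\<omega>. exp (b * X \<epsilon> x \<omega>))"
    and "(\<integral>\<omega>. exp (b * X \<epsilon> x \<omega>) \<partial>M) \<le> exp (b\<^sup>2 * (- ln \<epsilon> + C) / 2)"
    and "exp (b\<^sup>2 * (- ln \<epsilon> - C) / 2) \<le> (\<integral>\<omega>. exp (b * X \<epsilon> x \<omega>) \<partial>M)"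
proof -
  have hb: "has_bochner_integral M (\<lambda>\<omega>. exp (b * X \<epsilon> x \<omega>)) (exp (b\<^sup>2 * K \<epsilon> x x / 2))"
    by (rule exp_field[OF assms])
  show "integrable M (\<lambda>\<omega>. exp (b * X \<epsilon> x \<omega>))" using hb by (simp only: has_bochner_integral_iff)
  have eq: "(\<integral>\<omega>. exp (b * X \<epsilon> x \<omega>) \<partial>M) = exp (b\<^sup>2 * K \<epsilon> x x / 2)"
    using hb by (simp only: has_bochner_integral_iff)
  show "(\<integral>\<omega>. exp (b * X \<epsilon> x \<omega>) \<partial>M) \<le> exp (b\<^sup>2 * (- ln \<epsilon> + C) / 2)"
    unfolding eq exp_le_cancel_iff by (intro divide_right_mono mult_left_mono K_diag[OF assms]) simp_all
  show "exp (b\<^sup>2 * (- ln \<epsilon> - C) / 2) \<le> (\<integral>\<omega>. exp (b * X \<epsilon> x \<omega>) \<partial>M)"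
    unfolding eq exp_le_cancel_iff by (intro divide_right_mono mult_left_mono K_diag[OF assms]) simp_all
qed

lemma mass_AE_integrable:
  assumes e: "\<epsilon> \<in> {0<..1}" and S: "S \<in> sets borel" "S \<subseteq> B"
  shows "AE \<omega> in M. set_integrable lborel S (\<lambda>y. exp (b * X \<epsilon> y \<omega>))"
proof -
  have "(\<lambda>(t, y). exp (b * t)) \<in> borel_measurable (borel \<Otimes>\<^sub>M (borel :: 'd measure))" by measurable
  from indicator_field_measurable[OF e S(1) order_trans[OF S(2) B_subset_D] this borel_measurable_const[of "1::real"]]
  have m: "(\<lambda>(\<omega>, y). indicator S y * exp (b * X \<epsilon> y \<omega>)) \<in> borel_measurable (M \<Otimes>\<^sub>M lborel)"
    by (simp only: mult_1_left)
  show ?thesis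
  proof (rule fubini_set_integral(2)[OF m S(1) emeasure_subset_B[OF S]])
    fix y assume "y \<in> S"
    hence y: "y \<in> D" using S(2) B_subset_D by blast
    show "integrable M (\<lambda>\<omega>. exp (b * X \<epsilon> y \<omega>))" by (rule exp_field_le(1)[OF e y])
    show "(\<integral>\<omega>. exp (b * X \<epsilon> y \<omega>) \<partial>M) \<le> exp (b\<^sup>2 * (- ln \<epsilon> + C) / 2)" by (rule exp_field_le(2)[OF e y])
  qed simp
qed

lemma mass_integral:
  assumes e: "\<epsilon> \<in> {0<..1}" and S: "S \<in> sets borel" "S \<subseteq> B"
  shows "integrable M (mass \<epsilon> b S)"
    and "(\<integral>\<omega>. mass \<epsilon> b S \<omega> \<partial>M) \<le> exp (b\<^sup>2 * (- ln \<epsilon> + C) / 2) * measure lborel S"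
    and "exp (b\<^sup>2 * (- ln \<epsilon> - C) / 2) * measure lborel S \<le> (\<integral>\<omega>. mass \<epsilon> b S \<omega> \<partial>M)"
proof -
  have SD: "y \<in> D" if "y \<in> S" for y using that S(2) B_subset_D by blast
  note F = mass_fubini[OF e S borel_measurable_const[of "1::real"], of b "exp (b\<^sup>2 * (- ln \<epsilon> + C) / 2)"]
  have F': "integrable M (\<lambda>\<omega>. 1 * mass \<epsilon> b S \<omega>)"
    "set_integrable lborel S (\<lambda>y. \<integral>\<omega>. 1 * exp (b * X \<epsilon> y \<omega>) \<partial>M)"
    "(\<integral>\<omega>. 1 * mass \<epsilon> b S \<omega> \<partial>M) = (LINT y:S|lborel. \<integral>\<omega>. 1 * exp (b * X \<epsilon> y \<omega>) \<partial>M)"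
    "(\<integral>\<omega>. 1 * mass \<epsilon> b S \<omega> \<partial>M) \<le> exp (b\<^sup>2 * (- ln \<epsilon> + C) / 2) * measure lborel S"
    by (rule F; use exp_field_le[OF e SD] in simp)+
  show "integrable M (mass \<epsilon> b S)"
    and "(\<integral>\<omega>. mass \<epsilon> b S \<omega> \<partial>M) \<le> exp (b\<^sup>2 * (- ln \<epsilon> + C) / 2) * measure lborel S"
    using F'(1,4) by simp_all
  have "exp (b\<^sup>2 * (- ln \<epsilon> - C) / 2) * measure lborel S = (LINT y:S|lborel. exp (b\<^sup>2 * (- ln \<epsilon> - C) / 2))"
    by (simp add: set_lebesgue_integral_def mult.commute)
  also have "\<dots> \<le> (LINT y:S|lborel. \<integral>\<omega>. 1 * exp (b * X \<epsilon> y \<omega>) \<partial>M)"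
  proof (rule set_integral_mono[OF _ F'(2)])
    show "set_integrable lborel S (\<lambda>y. exp (b\<^sup>2 * (- ln \<epsilon> - C) / 2))"
      unfolding set_integrable_def using emeasure_subset_B[OF S] S by (intro integrable_scaleR_left integrable_real_indicator) auto
  qed (use exp_field_le(3)[OF e SD] in simp)
  finally show "exp (b\<^sup>2 * (- ln \<epsilon> - C) / 2) * measure lborel S \<le> (\<integral>\<omega>. mass \<epsilon> b S \<omega> \<partial>M)"
    using F'(3) by simp
qed

lemma mass_measurable:
  assumes "\<epsilon> \<in> {0<..1}" "S \<in> sets borel" "S \<subseteq> B"
  shows "mass \<epsilon> b S \<in> borel_measurable M"
  using mass_integral(1)[OF assms] by (rule borel_measurable_integrable)

lemma mass_pos_AE:
  assumes e: "\<epsilon> \<in> {0<..1}" and S: "S \<in> sets borel" "S \<subseteq> B" "emeasure lborel S \<noteq> 0"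
  shows "AE \<omega> in M. 0 < mass \<epsilon> b S \<omega>"
  using mass_AE_integrable[OF e S(1,2), of b]
  by eventually_elim (use S in \<open>auto simp: mass_def intro!: set_integral_pos\<close>)

lemma mass_mono_AE:
  assumes e: "\<epsilon> \<in> {0<..1}" and S: "S \<in> sets borel" "S \<subseteq> S'" "S' \<in> sets borel" "S' \<subseteq> B"
  shows "AE \<omega> in M. mass \<epsilon> b S \<omega> \<le> mass \<epsilon> b S' \<omega>"
  using mass_AE_integrable[OF e S(3,4), of b]
proof eventually_elim
  case (elim \<omega>)
  have "set_integrable lborel S (\<lambda>y. exp (b * X \<epsilon> y \<omega>))"
    by (rule set_integrable_subset[OF elim]) (use S in auto)
  thus ?case using elim S(2) unfolding mass_def set_lebesgue_integral_def set_integrable_def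
    by (intro integral_mono) (auto simp: indicator_def)
qed

lemma mass_Un_AE:
  assumes e: "\<epsilon> \<in> {0<..1}" and S: "S \<in> sets borel" "S \<subseteq> B" and S': "S' \<in> sets borel" "S' \<subseteq> B" and disj: "S \<inter> S' = {}"
  shows "AE \<omega> in M. mass \<epsilon> b (S \<union> S') \<omega> = mass \<epsilon> b S \<omega> + mass \<epsilon> b S' \<omega>"
  using mass_AE_integrable[OF e S, of b] mass_AE_integrable[OF e S', of b]
  by eventually_elim (auto simp: mass_def intro!: set_integral_Un disj)

text \<open>Jensen's inequality for the power \<open>s\<close> under the measure tilted by \<open>exp (q * b * X x + s * L)\<close>;
  choosing \<open>L\<close> close to the part of the field common to all points of \<open>S\<close> makes it sharp.\<close>

lemma tilt_bound:
  assumes e: "\<epsilon> \<in> {0<..1}" and x: "x \<in> D" and S: "S \<in> sets borel" "S \<subseteq> B"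
    and L: "L \<in> lin \<epsilon>" and s: "0 < s" "s < 1"
    and c: "\<And>y. y \<in> S \<Longrightarrow> (b\<^sup>2 * q\<^sup>2 * K \<epsilon> x x + s * (1 - s) * cv L L + s * b\<^sup>2 * K \<epsilon> y y + 2 * q * s * b\<^sup>2 * K \<epsilon> x y
        - 2 * s * (1 - s) * (b * cv L (X \<epsilon> y))) / 2 \<le> c"
  shows "integrable M (\<lambda>\<omega>. exp (q * b * X \<epsilon> x \<omega>) * mass \<epsilon> b S \<omega> powr s)"
    and "(\<integral>\<omega>. exp (q * b * X \<epsilon> x \<omega>) * mass \<epsilon> b S \<omega> powr s \<partial>M) \<le> exp c * measure lborel S powr s"
proof -
  have SD: "y \<in> D" if "y \<in> S" for y using that S(2) B_subset_D by blast
  \<comment> \<open>In \<open>f powr (1 - s) * (W * mass) powr s\<close> the functional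
    \<open>L\<close> cancels, since \<open>s * (1 - s) + (s - 1) * s = 0\<close>. Any
    \<open>L\<close> is therefore admissible.\<close>
  define f where "f \<omega> = exp (q * b * X \<epsilon> x \<omega> + s * L \<omega>)" for \<omega>
  define W where "W \<omega> = exp (q * b * X \<epsilon> x \<omega> + (s - 1) * L \<omega>)" for \<omega>
  define v where "v = ((q * b)\<^sup>2 * K \<epsilon> x x + s\<^sup>2 * cv L L + 2 * (q * b) * s * cv (X \<epsilon> x) L) / 2"
  \<comment> \<open>Chosen so that \<open>(1 - s) * v + s * c' = c\<close>.\<close>
  define c' where "c' = (c - (1 - s) * v) / s"
  have f: "has_bochner_integral M f (exp v)"
    using lin_exp[OF e lin_X[OF x] L lin_zero, of "q * b" s 0] unfolding f_def v_def by (simp add: cv_X)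
  have Wm: "W \<in> borel_measurable M"
    unfolding W_def
    by (intro measurable_compose[OF _ borel_measurable_exp] borel_measurable_add borel_measurable_times
        borel_measurable_const lin_measurable[OF e lin_X[OF x]] lin_measurable[OF e L])
  have g: "integrable M (\<lambda>\<omega>. W \<omega> * exp (b * X \<epsilon> y \<omega>))" "(\<integral>\<omega>. W \<omega> * exp (b * X \<epsilon> y \<omega>) \<partial>M) \<le> exp c'"
    if y: "y \<in> S" for y
  proof -
    define u where "u = ((q * b)\<^sup>2 * cv (X \<epsilon> x) (X \<epsilon> x) + (s - 1)\<^sup>2 * cv L L + b\<^sup>2 * cv (X \<epsilon> y) (X \<epsilon> y)
        + 2 * (q * b) * (s - 1) * cv (X \<epsilon> x) L + 2 * (q * b) * b * cv (X \<epsilon> x) (X \<epsilon> y) + 2 * (s - 1) * b * cv L (X \<epsilon> y)) / 2"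
    have hb: "has_bochner_integral M (\<lambda>\<omega>. W \<omega> * exp (b * X \<epsilon> y \<omega>)) (exp u)"
      using lin_exp[OF e lin_X[OF x] L lin_X[OF SD[OF y]], of "q * b" "s - 1" b]
      unfolding W_def u_def exp_add[symmetric] by (simp add: add.assoc)
    have "(1 - s) * v + s * u = (b\<^sup>2 * q\<^sup>2 * K \<epsilon> x x + s * (1 - s) * cv L L + s * b\<^sup>2 * K \<epsilon> y y + 2 * q * s * b\<^sup>2 * K \<epsilon> x y
        - 2 * s * (1 - s) * (b * cv L (X \<epsilon> y))) / 2"
      unfolding u_def v_def cv_X by (simp add: power2_eq_square field_simps)
    hence "s * u \<le> c - (1 - s) * v" using c[OF y] by simp
    hence "u \<le> c'" unfolding c'_def using s by (simp add: pos_le_divide_eq mult.commute)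
    thus "integrable M (\<lambda>\<omega>. W \<omega> * exp (b * X \<epsilon> y \<omega>))" "(\<integral>\<omega>. W \<omega> * exp (b * X \<epsilon> y \<omega>) \<partial>M) \<le> exp c'"
      using hb by (auto simp: has_bochner_integral_iff)
  qed
  have W0: "0 \<le> W \<omega>" for \<omega> by (simp add: W_def)
  note G = mass_fubini[OF e S Wm W0 g]
  have eq: "f \<omega> powr (1 - s) * (W \<omega> * mass \<epsilon> b S \<omega>) powr s = exp (q * b * X \<epsilon> x \<omega>) * mass \<epsilon> b S \<omega> powr s" for \<omega>
  proof -
    have "f \<omega> powr (1 - s) * W \<omega> powr s = exp ((q * b * X \<epsilon> x \<omega> + s * L \<omega>) * (1 - s) + (q * b * X \<epsilon> x \<omega> + (s - 1) * L \<omega>) * s)"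
      by (simp only: f_def W_def exp_powr_real exp_add[symmetric])
    also have "(q * b * X \<epsilon> x \<omega> + s * L \<omega>) * (1 - s) + (q * b * X \<epsilon> x \<omega> + (s - 1) * L \<omega>) * s = q * b * X \<epsilon> x \<omega>" by algebra
    finally have "f \<omega> powr (1 - s) * W \<omega> powr s = exp (q * b * X \<epsilon> x \<omega>)" .
    thus ?thesis unfolding powr_mult mult.assoc[symmetric] by (simp only:)
  qed
  have fi: "integrable M f" "(\<integral>\<omega>. f \<omega> \<partial>M) = exp v" using f by (auto simp: has_bochner_integral_iff)
  have nn: "AE \<omega> in M. 0 \<le> f \<omega>" "AE \<omega> in M. 0 \<le> W \<omega> * mass \<epsilon> b S \<omega>"
    using W0 mass_nonneg by (auto simp: f_def)
  note H = powr_holder_integral[OF fi(1) G(1) nn s, unfolded eq]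
  show "integrable M (\<lambda>\<omega>. exp (q * b * X \<epsilon> x \<omega>) * mass \<epsilon> b S \<omega> powr s)" by (rule H(1))
  have "(\<integral>\<omega>. exp (q * b * X \<epsilon> x \<omega>) * mass \<epsilon> b S \<omega> powr s \<partial>M) \<le> exp v powr (1 - s) * (\<integral>\<omega>. W \<omega> * mass \<epsilon> b S \<omega> \<partial>M) powr s"
    using H(2) by (simp add: fi(2))
  also have "\<dots> \<le> exp v powr (1 - s) * (exp c' * measure lborel S) powr s"
    using G(4) s W0 mass_nonneg by (intro mult_left_mono powr_mono2 integral_nonneg_AE) auto
  also have "\<dots> = exp ((1 - s) * v + s * c') * measure lborel S powr s"
    by (simp only: powr_mult exp_powr_real exp_add mult.commute[of v] mult.commute[of c'] mult.assoc)
  also have "(1 - s) * v + s * c' = c" using s by (simp add: c'_def)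
  finally show "(\<integral>\<omega>. exp (q * b * X \<epsilon> x \<omega>) * mass \<epsilon> b S \<omega> powr s \<partial>M) \<le> exp c * measure lborel S powr s" .
qed

end

section \<open>Tilted moments over dyadic shells\<close>

lemma measure_subset_cball:
  fixes x :: "'d::euclidean_space"
  assumes "S \<in> sets borel" "S \<subseteq> cball x r" "0 < r"
  shows "measure lborel S \<le> (2 * r) ^ DIM('d)"
proof -
  have sub: "S \<subseteq> cbox (x - r *\<^sub>R One) (x + r *\<^sub>R One)"
  proof
    fix y assume "y \<in> S"
    hence y: "norm (x - y) \<le> r" using assms by (auto simp: dist_norm)
    have "\<bar>(x - y) \<bullet> i\<bar> \<le> r" if "i \<in> Basis" for i
      using Basis_le_norm[OF that, of "x - y"] y by linarith
    thus "y \<in> cbox (x - r *\<^sub>R One) (x + r *\<^sub>R One)"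
      unfolding mem_box by (auto simp: inner_diff_left inner_add_left abs_le_iff algebra_simps)
  qed
  have "measure lborel S \<le> measure lborel (cbox (x - r *\<^sub>R One) (x + r *\<^sub>R One))"
    using assms sub by (intro measure_mono_fmeasurable fmeasurable_cbox) auto
  also have "\<dots> = (2 * r) ^ DIM('d)"
    using assms(3) by (subst content_cbox') (auto simp: box_ne_empty inner_diff_left inner_add_left)
  finally show ?thesis .
qed

context log_correlated_fields
begin

text \<open>\<open>L\<close> is \<open>b\<close> times the average of the field over
  \<open>n\<close> equally spaced points on a segment of length at most \<open>r\<close> near
  \<open>x\<close>. It stands for the part of the field common to the ball: distinct points have
  covariance at most about \<open>- ln r\<close>, and the diagonal, which sees
  \<open>- ln \<epsilon>\<close>, has weight only \<open>1 / n\<close>.\<close>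

lemma probe_functional:
  assumes e: "\<epsilon> \<in> {0<..1}" and x: "x \<in> B" and r: "\<epsilon> \<le> r" "r \<le> 1" and n: "n \<ge> 1"
  obtains L where "L \<in> lin \<epsilon>"
    and "cv L L \<le> b\<^sup>2 * (- ln \<epsilon> / real n - ln r + ln (real n) + C)"
    and "\<And>y. y \<in> B \<Longrightarrow> norm (x - y) \<le> r \<Longrightarrow> b * cv L (X \<epsilon> y) \<ge> b\<^sup>2 * (- ln r - ln 3 - C)"
proof -
  have r0: "r > 0" and e0: "\<epsilon> > 0" using e r by auto
  obtain v :: 'd where v: "v \<in> Basis" using nonempty_Basis by blast
  define u where "u i = x + (r * real (Suc i) / real n) *\<^sub>R v" for i
  have u_dist: "norm (u i - x) \<le> r" if "i < n" for i
  proof -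
    have "norm (u i - x) = r * (real (Suc i) / real n)" using r0 v by (simp add: u_def)
    also have "\<dots> \<le> r * 1" using r0 that by (intro mult_left_mono) auto
    finally show ?thesis by simp
  qed
  \<comment> \<open>The probe points may leave \<open>B\<close>, but stay within distance
    \<open>r \<le> 1\<close> of it, hence in the larger box contained in \<open>D\<close>.\<close>
  have uD: "u i \<in> D" if "i < n" for i
  proof (rule mem_DI)
    fix k :: 'd assume k: "k \<in> Basis"
    have "\<bar>(u i - x) \<bullet> k\<bar> \<le> r" using Basis_le_norm[OF k, of "u i - x"] u_dist[OF that] by linarith
    moreover have "\<bar>x \<bullet> k\<bar> \<le> 1" using x k mem_B by blast
    ultimately show "\<bar>u i \<bullet> k\<bar> \<le> 2" using r by (simp add: inner_diff_left)
  qed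
  have u_sep: "norm (u i - u j) \<ge> r / real n" if "i \<noteq> j" for i j
  proof -
    have "u i - u j = (r / real n * (real i - real j)) *\<^sub>R v"
      by (simp add: u_def scaleR_left_diff_distrib[symmetric] diff_divide_distrib[symmetric] algebra_simps)
    hence "norm (u i - u j) = r / real n * \<bar>real i - real j\<bar>" using r0 v by (simp add: abs_mult)
    moreover have "\<bar>real i - real j\<bar> \<ge> 1" using that by linarith
    ultimately show ?thesis using r0 mult_left_mono[of 1 "\<bar>real i - real j\<bar>" "r / real n"] by simp
  qed
  define Y where "Y i = (\<lambda>\<omega>. (b / real n) * X \<epsilon> (u i) \<omega>)" for i
  define L where "L = (\<lambda>\<omega>. \<Sum>i<n. Y i \<omega>)"
  have Y: "Y i \<in> lin \<epsilon>" if "i < n" for i unfolding Y_def by (intro lin_scale lin_X uD that)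
  have L: "L \<in> lin \<epsilon>" unfolding L_def using Y by (intro lin_sum) simp
  have cvY: "cv (Y i) Z = b / real n * cv (X \<epsilon> (u i)) Z" for i Z unfolding Y_def by (rule cv_scale)
  have cvL: "cv L Z = (\<Sum>i<n. b / real n * cv (X \<epsilon> (u i)) Z)" if "Z \<in> lin \<epsilon>" for Z
    unfolding L_def by (subst cv_sum[OF e _ that]) (simp_all add: Y cvY)
  have cvLX: "cv L (X \<epsilon> y) = (\<Sum>i<n. b / real n * K \<epsilon> (u i) y)" if "y \<in> D" for y
    using cvL[OF lin_X[OF that]] by (simp add: cv_X)
  show ?thesis
  proof
    show "L \<in> lin \<epsilon>" by (rule L)
  next
    define m where "m = - ln r + ln (real n) + C"
    have Kle: "K \<epsilon> (u i) (u j) \<le> (if i = j then - ln \<epsilon> else 0) + m" if "i < n" "j < n" for i j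
    proof (cases "i = j")
      case True
      have "ln r \<le> 0" "0 \<le> ln (real n)" using r r0 n by auto
      thus ?thesis using K_diag(1)[OF e uD[OF that(2)]] True by (simp add: m_def)
    next
      case False
      have "r / real n \<le> norm (u i - u j) + \<epsilon>" using u_sep[OF False] e0 by simp
      from K_upper[OF e uD[OF that(1)] uD[OF that(2)] _ this]
      show ?thesis using False r0 n by (simp add: m_def ln_div)
    qed
    have "cv L L = (\<Sum>i<n. b / real n * cv L (X \<epsilon> (u i)))"
      unfolding cvL[OF L] by (simp add: cv_sym)
    also have "\<dots> = (\<Sum>i<n. b / real n * (\<Sum>j<n. b / real n * K \<epsilon> (u j) (u i)))"
      by (intro sum.cong refl) (simp add: cvLX uD)
    also have "\<dots> = (b / real n)\<^sup>2 * (\<Sum>i<n. \<Sum>j<n. K \<epsilon> (u j) (u i))"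
      by (simp add: sum_distrib_left power2_eq_square mult_ac)
    also have "\<dots> \<le> (b / real n)\<^sup>2 * (\<Sum>i<n. \<Sum>j<n. (if j = i then - ln \<epsilon> else 0) + m)"
      by (intro mult_left_mono sum_mono Kle) auto
    also have "(\<Sum>i<n. \<Sum>j<n. (if j = i then - ln \<epsilon> else 0) + m) = real n * (- ln \<epsilon>) + (real n)\<^sup>2 * m"
      by (simp add: sum.distrib power2_eq_square algebra_simps)
    also have "(b / real n)\<^sup>2 * (real n * (- ln \<epsilon>) + (real n)\<^sup>2 * m) = b\<^sup>2 * (- ln \<epsilon> / real n + m)"
      using n by (simp add: power_divide field_simps power2_eq_square)
    finally show "cv L L \<le> b\<^sup>2 * (- ln \<epsilon> / real n - ln r + ln (real n) + C)"
      by (simp add: m_def algebra_simps)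
  next
    fix y assume y: "y \<in> B" "norm (x - y) \<le> r"
    have yD: "y \<in> D" using y B_subset_D by blast
    have Kge: "K \<epsilon> (u i) y \<ge> - ln r - ln 3 - C" if "i < n" for i
    proof -
      have "norm (u i - y) \<le> norm (u i - x) + norm (x - y)" using norm_triangle_ineq[of "u i - x" "x - y"] by simp
      hence "norm (u i - y) + \<epsilon> \<le> 3 * r" using u_dist[OF that] y r by linarith
      from K_lower[OF e uD[OF that] yD this] show ?thesis using r0 by (simp add: ln_mult)
    qed
    have "b * cv L (X \<epsilon> y) = (b\<^sup>2 / real n) * (\<Sum>i<n. K \<epsilon> (u i) y)"
      unfolding cvLX[OF yD] by (simp add: sum_distrib_left power2_eq_square mult_ac)
    moreover have "(\<Sum>i<n. K \<epsilon> (u i) y) \<ge> real n * (- ln r - ln 3 - C)"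
      using sum_mono[of "{..<n}" "\<lambda>_. - ln r - ln 3 - C" "\<lambda>i. K \<epsilon> (u i) y"] Kge by simp
    hence "(b\<^sup>2 / real n) * (real n * (- ln r - ln 3 - C)) \<le> (b\<^sup>2 / real n) * (\<Sum>i<n. K \<epsilon> (u i) y)"
      by (intro mult_left_mono) auto
    ultimately show "b * cv L (X \<epsilon> y) \<ge> b\<^sup>2 * (- ln r - ln 3 - C)" using n by simp
  qed
qed

text \<open>Everything in the exponent of \<open>shell_bound\<close> that depends on neither
  \<open>\<epsilon>\<close> nor \<open>r\<close>.\<close>

definition shell_const :: "real \<Rightarrow> real \<Rightarrow> real \<Rightarrow> nat \<Rightarrow> real" where
  "shell_const b q s n = b\<^sup>2 / 2 * (q\<^sup>2 * C + s * (1 - s) * (ln (real n) + C) + s * C + 2 * q * s * (ln 2 + C) +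
      2 * s * (1 - s) * (ln 3 + C)) + real DIM('d) * s * ln 2"

text \<open>The power of \<open>r\<close> contributed by a shell of radius \<open>r\<close>:
  \<open>s * d\<close> from its volume, \<open>- q * s * b\<^sup>2\<close> from the covariance with
  the tilting point, and \<open>s * (1 - s) * b\<^sup>2 / 2\<close> from subtracting the coarse
  field. It is positive for some \<open>s > 0\<close> exactly when
  \<open>q * b\<^sup>2 < d + b\<^sup>2 / 2\<close>, which for \<open>q = 1\<close> says
  \<open>b\<^sup>2 < 2 * d\<close>.\<close>

definition shell_exponent :: "real \<Rightarrow> real \<Rightarrow> real \<Rightarrow> real" where
  "shell_exponent b q s = s * (real DIM('d) + b\<^sup>2 / 2 - q * b\<^sup>2 - s * b\<^sup>2 / 2)"

text \<open>This is \<open>tilt_bound\<close> with the functional of \<open>probe_functional\<close>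
  as \<open>L\<close>. Since \<open>shell\<close> bounds \<open>norm (x - y) + \<epsilon>\<close>
  from below rather than the distance alone, a full ball of radius at most
  \<open>2 * \<epsilon>\<close> also counts as a shell.\<close>

lemma shell_bound:
  assumes e: "\<epsilon> \<in> {0<..1}" and x: "x \<in> B" and r: "\<epsilon> \<le> r" "r \<le> 1" and n: "n \<ge> 1"
    and S: "S \<in> sets borel" "S \<subseteq> B" "S \<subseteq> cball x r" and shell: "\<And>y. y \<in> S \<Longrightarrow> r / 2 \<le> norm (x - y) + \<epsilon>"
    and q: "0 \<le> q" and s: "0 < s" "s < 1"
  shows "integrable M (\<lambda>\<omega>. exp (q * b * X \<epsilon> x \<omega>) * mass \<epsilon> b S \<omega> powr s)"
    and "(\<integral>\<omega>. exp (q * b * X \<epsilon> x \<omega>) * mass \<epsilon> b S \<omega> powr s \<partial>M) \<le>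
      exp (b\<^sup>2 / 2 * (q\<^sup>2 + s + s * (1 - s) / real n) * (- ln \<epsilon>) + shell_const b q s n) * r powr shell_exponent b q s"
proof -
  have r0: "r > 0" and e0: "\<epsilon> > 0" using e r by auto
  have xD: "x \<in> D" using x B_subset_D by blast
  obtain L where L: "L \<in> lin \<epsilon>"
    and LL: "cv L L \<le> b\<^sup>2 * (- ln \<epsilon> / real n - ln r + ln (real n) + C)"
    and LX: "\<And>y. y \<in> B \<Longrightarrow> norm (x - y) \<le> r \<Longrightarrow> b * cv L (X \<epsilon> y) \<ge> b\<^sup>2 * (- ln r - ln 3 - C)"
    using probe_functional[OF e x r n, of b] by blast
  define c where "c = (b\<^sup>2 * q\<^sup>2 * (- ln \<epsilon> + C) + s * (1 - s) * (b\<^sup>2 * (- ln \<epsilon> / real n - ln r + ln (real n) + C)) +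
      s * b\<^sup>2 * (- ln \<epsilon> + C) + 2 * q * s * b\<^sup>2 * (- ln (r / 2) + C) - 2 * s * (1 - s) * (b\<^sup>2 * (- ln r - ln 3 - C))) / 2"
  have c: "(b\<^sup>2 * q\<^sup>2 * K \<epsilon> x x + s * (1 - s) * cv L L + s * b\<^sup>2 * K \<epsilon> y y + 2 * q * s * b\<^sup>2 * K \<epsilon> x y
        - 2 * s * (1 - s) * (b * cv L (X \<epsilon> y))) / 2 \<le> c" if y: "y \<in> S" for y
  proof -
    have yB: "y \<in> B" using y S by blast
    have yD: "y \<in> D" using yB B_subset_D by blast
    have yr: "norm (x - y) \<le> r" using y S by (auto simp: dist_norm)
    have "K \<epsilon> x y \<le> - ln (r / 2) + C" using K_upper[OF e xD yD _ shell[OF y]] r0 by simp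
    hence "2 * q * s * b\<^sup>2 * K \<epsilon> x y \<le> 2 * q * s * b\<^sup>2 * (- ln (r / 2) + C)"
      using q s by (intro mult_left_mono) auto
    moreover have "b\<^sup>2 * q\<^sup>2 * K \<epsilon> x x \<le> b\<^sup>2 * q\<^sup>2 * (- ln \<epsilon> + C)" "s * b\<^sup>2 * K \<epsilon> y y \<le> s * b\<^sup>2 * (- ln \<epsilon> + C)"
      using K_diag(1)[OF e xD] K_diag(1)[OF e yD] s by (auto intro!: mult_left_mono)
    moreover have "s * (1 - s) * cv L L \<le> s * (1 - s) * (b\<^sup>2 * (- ln \<epsilon> / real n - ln r + ln (real n) + C))"
      using LL s by (intro mult_left_mono) auto
    moreover have "2 * s * (1 - s) * (b\<^sup>2 * (- ln r - ln 3 - C)) \<le> 2 * s * (1 - s) * (b * cv L (X \<epsilon> y))"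
      using LX[OF yB yr] s by (intro mult_left_mono) auto
    ultimately show ?thesis unfolding c_def by (intro divide_right_mono) linarith+
  qed
  note T = tilt_bound[OF e xD S(1,2) L s c]
  show "integrable M (\<lambda>\<omega>. exp (q * b * X \<epsilon> x \<omega>) * mass \<epsilon> b S \<omega> powr s)" by (rule T(1))
  have "(\<integral>\<omega>. exp (q * b * X \<epsilon> x \<omega>) * mass \<epsilon> b S \<omega> powr s \<partial>M) \<le> exp c * measure lborel S powr s" by (rule T(2))
  also have "\<dots> \<le> exp c * ((2 * r) ^ DIM('d)) powr s"
    using measure_subset_cball[OF S(1,3) r0] s by (intro mult_left_mono powr_mono2) auto
  also have "((2 * r) ^ DIM('d)) powr s = exp (s * (real DIM('d) * (ln 2 + ln r)))"
    using r0 by (simp add: powr_def ln_realpow ln_mult distrib_left)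
  also have "exp c * exp (s * (real DIM('d) * (ln 2 + ln r))) = exp (c + s * (real DIM('d) * (ln 2 + ln r)))"
    by (simp only: exp_add)
  also have "c + s * (real DIM('d) * (ln 2 + ln r)) =
      (b\<^sup>2 / 2 * (q\<^sup>2 + s + s * (1 - s) / real n) * (- ln \<epsilon>) + shell_const b q s n) + shell_exponent b q s * ln r"
    unfolding c_def shell_const_def shell_exponent_def using r0 n
    by (simp add: ln_div field_simps power2_eq_square)
  also have "exp \<dots> = exp (b\<^sup>2 / 2 * (q\<^sup>2 + s + s * (1 - s) / real n) * (- ln \<epsilon>) + shell_const b q s n) * r powr shell_exponent b q s"
    using r0 by (simp add: exp_add powr_def)
  finally show "(\<integral>\<omega>. exp (q * b * X \<epsilon> x \<omega>) * mass \<epsilon> b S \<omega> powr s \<partial>M) \<le> \<dots>" .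
qed

end

lemma measure_B: "measure lborel (cbox (- One) One :: 'd::euclidean_space set) = 2 ^ DIM('d)"
  by (subst content_cbox') (auto simp: box_ne_empty)

lemma (in prob_space) expectation_pos:
  fixes f :: "'a \<Rightarrow> real"
  assumes "integrable M f" "AE \<omega> in M. 0 < f \<omega>"
  shows "0 < (\<integral>\<omega>. f \<omega> \<partial>M)"
proof -
  have nn: "AE \<omega> in M. 0 \<le> f \<omega>" using assms(2) by eventually_elim simp
  have "(\<integral>\<omega>. f \<omega> \<partial>M) \<noteq> 0"
  proof
    assume "(\<integral>\<omega>. f \<omega> \<partial>M) = 0"
    hence "AE \<omega> in M. f \<omega> = 0" using integral_nonneg_eq_0_iff_AE[OF assms(1) nn] by simp
    hence "AE \<omega> in M. False" using assms(2) by eventually_elim simp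
    thus False by simp
  qed
  thus ?thesis using integral_nonneg_AE[OF nn] by simp
qed

lemma integrable_sandwich:
  fixes f g :: "'a \<Rightarrow> real"
  assumes "integrable M g" "f \<in> borel_measurable M" "AE x in M. 0 \<le> f x" "AE x in M. f x \<le> g x"
  shows "integrable M f" and "(\<integral>x. f x \<partial>M) \<le> (\<integral>x. g x \<partial>M)"
proof -
  have "AE x in M. norm (f x) \<le> norm (g x)" using assms(3,4) by eventually_elim simp
  thus "integrable M f" by (rule Bochner_Integration.integrable_bound[OF assms(1,2)])
  thus "(\<integral>x. f x \<partial>M) \<le> (\<integral>x. g x \<partial>M)" using assms(1,4) by (rule integral_mono_AE)
qed

lemma set_integral_holder:
  fixes f g :: "'a \<Rightarrow> real"
  assumes "set_integrable M S f" "set_integrable M S g" "\<And>x. 0 \<le> f x" "\<And>x. 0 \<le> g x" "0 < \<theta>" "\<theta> < 1"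
  shows "(LINT x:S|M. f x powr (1 - \<theta>) * g x powr \<theta>) \<le> (LINT x:S|M. f x) powr (1 - \<theta>) * (LINT x:S|M. g x) powr \<theta>"
proof -
  have eq: "(indicator S x *\<^sub>R f x) powr (1 - \<theta>) * (indicator S x *\<^sub>R g x) powr \<theta> = indicator S x *\<^sub>R (f x powr (1 - \<theta>) * g x powr \<theta>)" for x
    by (simp add: indicator_def)
  show ?thesis
    using powr_holder_integral(2)[OF assms(1,2)[unfolded set_integrable_def] _ _ assms(5,6)] assms(3,4)
    unfolding eq set_lebesgue_integral_def by simp
qed

context log_correlated_fields
begin

lemma mass_powr_measurable:
  assumes "\<epsilon> \<in> {0<..1}" "S \<in> sets borel" "S \<subseteq> B"
  shows "(\<lambda>\<omega>. mass \<epsilon> b S \<omega> powr p) \<in> borel_measurable M"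
proof -
  note [measurable] = mass_measurable[OF assms]
  show ?thesis by measurable
qed

lemma exp_X_measurable:
  assumes "\<epsilon> \<in> {0<..1}" "x \<in> D"
  shows "(\<lambda>\<omega>. exp (c * X \<epsilon> x \<omega>)) \<in> borel_measurable M"
proof -
  note [measurable] = lin_measurable[OF assms(1) lin_X[OF assms(2)]]
  show ?thesis by measurable
qed

text \<open>The ball is peeled dyadically, and the power \<open>s < 1\<close> of the mass is
  subadditive over the pieces. A positive shell exponent makes the contributions geometric,
  dominated by the outermost shell.\<close>

lemma annuli_bound:
  assumes e: "\<epsilon> \<in> {0<..1}" and x: "x \<in> B" and n: "n \<ge> 1"
    and q: "0 \<le> q" and s: "0 < s" "s < 1" and a: "0 < shell_exponent b q s"
    and r: "\<epsilon> \<le> r" "r \<le> 1"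
  shows "integrable M (\<lambda>\<omega>. exp (q * b * X \<epsilon> x \<omega>) * mass \<epsilon> b (B \<inter> cball x r) \<omega> powr s) \<and>
    (\<integral>\<omega>. exp (q * b * X \<epsilon> x \<omega>) * mass \<epsilon> b (B \<inter> cball x r) \<omega> powr s \<partial>M) \<le>
      exp (b\<^sup>2 / 2 * (q\<^sup>2 + s + s * (1 - s) / real n) * (- ln \<epsilon>) + shell_const b q s n) /
        (1 - 2 powr (- shell_exponent b q s)) * r powr shell_exponent b q s"
proof -
  define a where "a = shell_exponent b q s"
  define G where "G = exp (b\<^sup>2 / 2 * (q\<^sup>2 + s + s * (1 - s) / real n) * (- ln \<epsilon>) + shell_const b q s n)"
  \<comment> \<open>Chosen so that \<open>G / w * 2 powr (- a) + G = G / w\<close>: the geometric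
    series is already summed in the inductive bound.\<close>
  define w where "w = 1 - 2 powr (- a)"
  have "2 powr (- a) < 2 powr 0" using a by (intro powr_less_mono) (auto simp: a_def)
  hence w: "0 < w" "w \<le> 1" by (auto simp: w_def)
  have G: "G > 0" by (simp add: G_def)
  define I where "I r \<omega> = exp (q * b * X \<epsilon> x \<omega>) * mass \<epsilon> b (B \<inter> cball x r) \<omega> powr s" for r \<omega>
  have e0: "\<epsilon> > 0" using e by simp
  have xD: "x \<in> D" using x B_subset_D by blast
  \<comment> \<open>Induction on the number of halvings that bring \<open>r\<close> down to the
    innermost scale \<open>2 * \<epsilon>\<close>.\<close>
  have "integrable M (I r) \<and> (\<integral>\<omega>. I r \<omega> \<partial>M) \<le> G / w * r powr a" if "\<epsilon> \<le> r" "r \<le> 1" "r \<le> 2 ^ k * (2 * \<epsilon>)" for k r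
    using that
  proof (induction k arbitrary: r)
    case 0
    have shell: "r / 2 \<le> norm (x - y) + \<epsilon>" for y using 0(3) norm_ge_zero[of "x - y"] by (simp del: norm_ge_zero)
    note sb = shell_bound[OF e x 0(1,2) n _ _ _ shell q s, of "B \<inter> cball x r" b]
    have "integrable M (I r)" unfolding I_def by (rule sb(1)) auto
    moreover have "(\<integral>\<omega>. I r \<omega> \<partial>M) \<le> G * r powr a" unfolding I_def G_def a_def by (rule sb(2)) auto
    moreover have "G * r powr a \<le> G / w * r powr a"
      using w G by (intro mult_right_mono) (auto simp: field_simps)
    ultimately show ?case by linarith
  next
    case (Suc k)
    show ?case
    \<comment> \<open>Halving such a radius could leave the range
      \<open>\<epsilon> \<le> r / 2\<close>; instead the induction hypothesis applies to
      \<open>r\<close> itself.\<close>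
    proof (cases "r \<le> 2 * \<epsilon>")
      case True
      have "1 * (2 * \<epsilon>) \<le> 2 ^ k * (2 * \<epsilon>)" using e0 by (intro mult_right_mono) auto
      hence "r \<le> 2 ^ k * (2 * \<epsilon>)" using True by linarith
      with Suc show ?thesis by blast
    next
      case False
      have r0: "r > 0" using Suc e0 by linarith
      have r2: "\<epsilon> \<le> r / 2" "r / 2 \<le> 1" "r / 2 \<le> 2 ^ k * (2 * \<epsilon>)" using Suc False by auto
      define S1 S2 where "S1 = B \<inter> cball x (r / 2)" and "S2 = B \<inter> cball x r - cball x (r / 2)"
      have S: "S1 \<in> sets borel" "S1 \<subseteq> B" "S2 \<in> sets borel" "S2 \<subseteq> B" "S1 \<inter> S2 = {}" "S2 \<subseteq> cball x r"
        by (auto simp: S1_def S2_def)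
      have "cball x (r / 2) \<subseteq> cball x r" using r0 by (intro subset_cball) auto
      hence un: "B \<inter> cball x r = S1 \<union> S2" unfolding S1_def S2_def by blast
      have shell: "r / 2 \<le> norm (x - y) + \<epsilon>" if "y \<in> S2" for y using that e0 by (auto simp: S2_def dist_norm)
      note sb = shell_bound[OF e x Suc.prems(1,2) n S(3,4,6) shell q s, of b]
      define J where "J \<omega> = exp (q * b * X \<epsilon> x \<omega>) * mass \<epsilon> b S2 \<omega> powr s" for \<omega>
      have J: "integrable M J" "(\<integral>\<omega>. J \<omega> \<partial>M) \<le> G * r powr a"
        unfolding J_def[abs_def] G_def a_def by (rule sb(1), assumption) (rule sb(2), assumption)
      have I1: "integrable M (I (r / 2))" "(\<integral>\<omega>. I (r / 2) \<omega> \<partial>M) \<le> G / w * (r / 2) powr a"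
        using Suc.IH[OF r2] by auto
      have le: "AE \<omega> in M. I r \<omega> \<le> I (r / 2) \<omega> + J \<omega>"
        using mass_Un_AE[OF e S(1-5), of b]
      proof eventually_elim
        case (elim \<omega>)
        have "mass \<epsilon> b (S1 \<union> S2) \<omega> powr s \<le> mass \<epsilon> b S1 \<omega> powr s + mass \<epsilon> b S2 \<omega> powr s"
          unfolding elim using s mass_nonneg by (intro powr_add_le) auto
        thus ?case unfolding I_def J_def un S1_def[symmetric] distrib_left[symmetric]
          by (intro mult_left_mono) auto
      qed
      have Im: "I r \<in> borel_measurable M"
        unfolding I_def
        by (intro borel_measurable_times exp_X_measurable[OF e xD] mass_powr_measurable[OF e]) auto
      note sw = integrable_sandwich[OF Bochner_Integration.integrable_add[OF I1(1) J(1)] Im _ le]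
      have I0: "AE \<omega> in M. 0 \<le> I r \<omega>" by (simp add: I_def)
      note Ii = sw(1)[OF I0]
      have "(\<integral>\<omega>. I r \<omega> \<partial>M) \<le> (\<integral>\<omega>. I (r / 2) \<omega> + J \<omega> \<partial>M)" by (rule sw(2)[OF I0])
      also have "\<dots> = (\<integral>\<omega>. I (r / 2) \<omega> \<partial>M) + (\<integral>\<omega>. J \<omega> \<partial>M)"
        by (rule Bochner_Integration.integral_add[OF I1(1) J(1)])
      also have "\<dots> \<le> G / w * (r / 2) powr a + G * r powr a" using I1(2) J(2) by linarith
      also have "(r / 2) powr a = 2 powr (- a) * r powr a"
        using r0 by (simp add: powr_divide powr_minus field_simps)
      also have "G / w * (2 powr (- a) * r powr a) + G * r powr a = G / w * r powr a * (2 powr (- a) + w)"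
        using w by (simp add: field_simps)
      also have "2 powr (- a) + w = 1" by (simp add: w_def)
      finally show ?thesis using Ii by simp
    qed
  qed
  moreover obtain k where "r / (2 * \<epsilon>) < 2 ^ k" using real_arch_pow[of 2 "r / (2 * \<epsilon>)"] by auto
  hence "r \<le> 2 ^ k * (2 * \<epsilon>)" using e0 by (simp add: field_simps)
  ultimately show ?thesis using r unfolding I_def G_def w_def a_def by blast
qed

text \<open>Fubini's theorem turns the factor \<open>mass \<epsilon> (q * b) B\<close> into a tilt
  at a point \<open>x\<close>, around which the shells are centred. The excess
  \<open>s * (1 - s) / n\<close> is the price of averaging over \<open>n\<close> probe points; it
  disappears in the limit of large \<open>n\<close>.\<close>

lemma tilted_moment:
  assumes n: "n \<ge> 1" and q: "0 \<le> q" and s: "0 < s" "s < 1" and a: "0 < shell_exponent b q s"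
  shows "\<exists>A>0. \<forall>\<epsilon>\<in>{0<..1}. integrable M (\<lambda>\<omega>. mass \<epsilon> b B \<omega> powr s * mass \<epsilon> (q * b) B \<omega>) \<and>
    (\<integral>\<omega>. mass \<epsilon> b B \<omega> powr s * mass \<epsilon> (q * b) B \<omega> \<partial>M) \<le>
      A * exp (b\<^sup>2 / 2 * (q\<^sup>2 + s + s * (1 - s) / real n) * (- ln \<epsilon>))"
proof -
  define A1 where "A1 = exp (shell_const b q s n) / (1 - 2 powr (- shell_exponent b q s))"
  define A2 where "A2 = exp (b\<^sup>2 / 2 * (q\<^sup>2 + s + 2 * q * s) * C) * (2 ^ DIM('d)) powr s"
  have "2 powr (- shell_exponent b q s) < 2 powr 0" using a by (intro powr_less_mono) auto
  hence A1: "A1 > 0" by (simp add: A1_def)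
  have A2: "A2 > 0" by (simp add: A2_def)
  have main: "integrable M (\<lambda>\<omega>. mass \<epsilon> b B \<omega> powr s * exp (q * b * X \<epsilon> x \<omega>)) \<and>
      (\<integral>\<omega>. mass \<epsilon> b B \<omega> powr s * exp (q * b * X \<epsilon> x \<omega>) \<partial>M) \<le>
      (A1 + A2) * exp (b\<^sup>2 / 2 * (q\<^sup>2 + s + s * (1 - s) / real n) * (- ln \<epsilon>))"
    if e: "\<epsilon> \<in> {0<..1}" and x: "x \<in> B" for \<epsilon> x
  proof -
    have e0: "0 < \<epsilon>" "\<epsilon> \<le> 1" using e by auto
    have xD: "x \<in> D" using x B_subset_D by blast
    define E where "E = exp (b\<^sup>2 / 2 * (q\<^sup>2 + s + s * (1 - s) / real n) * (- ln \<epsilon>))"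
    \<comment> \<open>Shells cover radii up to 1 only. On the remaining part the covariance with
      \<open>X \<epsilon> x\<close> is at most \<open>C\<close>, so \<open>L = 0\<close> suffices in
      \<open>tilt_bound\<close>.\<close>
    define S1 S2 where "S1 = B \<inter> cball x 1" and "S2 = B - cball x 1"
    have S: "S1 \<in> sets borel" "S1 \<subseteq> B" "S2 \<in> sets borel" "S2 \<subseteq> B" "S1 \<inter> S2 = {}"
      by (auto simp: S1_def S2_def)
    have un: "B = S1 \<union> S2" unfolding S1_def S2_def by blast
    define I1 where "I1 \<omega> = exp (q * b * X \<epsilon> x \<omega>) * mass \<epsilon> b S1 \<omega> powr s" for \<omega>
    define I2 where "I2 \<omega> = exp (q * b * X \<epsilon> x \<omega>) * mass \<epsilon> b S2 \<omega> powr s" for \<omega>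
    have A1E: "exp (b\<^sup>2 / 2 * (q\<^sup>2 + s + s * (1 - s) / real n) * (- ln \<epsilon>) + shell_const b q s n) /
        (1 - 2 powr (- shell_exponent b q s)) * 1 powr shell_exponent b q s = A1 * E"
      unfolding A1_def E_def exp_add by simp
    have I1: "integrable M I1" "(\<integral>\<omega>. I1 \<omega> \<partial>M) \<le> A1 * E"
      using annuli_bound[OF e x n q s a e0(2) order_refl] unfolding I1_def[abs_def] S1_def A1E by blast+
    define c where "c = b\<^sup>2 / 2 * (q\<^sup>2 + s) * (- ln \<epsilon>) + b\<^sup>2 / 2 * (q\<^sup>2 + s + 2 * q * s) * C"
    have c: "(b\<^sup>2 * q\<^sup>2 * K \<epsilon> x x + s * (1 - s) * cv (\<lambda>\<omega>. 0) (\<lambda>\<omega>. 0) + s * b\<^sup>2 * K \<epsilon> y y + 2 * q * s * b\<^sup>2 * K \<epsilon> x y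
        - 2 * s * (1 - s) * (b * cv (\<lambda>\<omega>. 0) (X \<epsilon> y))) / 2 \<le> c" if y: "y \<in> S2" for y
    proof -
      have yD: "y \<in> D" using y S B_subset_D by blast
      have "1 \<le> norm (x - y) + \<epsilon>" using y e0 by (auto simp: S2_def dist_norm)
      from K_upper[OF e xD yD _ this] have "K \<epsilon> x y \<le> C" by simp
      hence "2 * q * s * b\<^sup>2 * K \<epsilon> x y \<le> 2 * q * s * b\<^sup>2 * C" using q s by (intro mult_left_mono) auto
      moreover have "b\<^sup>2 * q\<^sup>2 * K \<epsilon> x x \<le> b\<^sup>2 * q\<^sup>2 * (- ln \<epsilon> + C)" "s * b\<^sup>2 * K \<epsilon> y y \<le> s * b\<^sup>2 * (- ln \<epsilon> + C)"
        using K_diag(1)[OF e xD] K_diag(1)[OF e yD] s by (auto intro!: mult_left_mono)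
      ultimately have "(b\<^sup>2 * q\<^sup>2 * K \<epsilon> x x + s * b\<^sup>2 * K \<epsilon> y y + 2 * q * s * b\<^sup>2 * K \<epsilon> x y) / 2 \<le>
          (b\<^sup>2 * q\<^sup>2 * (- ln \<epsilon> + C) + s * b\<^sup>2 * (- ln \<epsilon> + C) + 2 * q * s * b\<^sup>2 * C) / 2"
        by (intro divide_right_mono) linarith+
      also have "\<dots> = c" by (simp add: c_def field_simps)
      finally show ?thesis by (simp add: cv_def)
    qed
    note T = tilt_bound[OF e xD S(3,4) lin_zero s c]
    have I2: "integrable M I2" unfolding I2_def by (rule T(1))
    have "(\<integral>\<omega>. I2 \<omega> \<partial>M) \<le> exp c * measure lborel S2 powr s" unfolding I2_def by (rule T(2))
    also have "\<dots> \<le> exp c * (2 ^ DIM('d)) powr s"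
      unfolding measure_B[where 'd = 'd, symmetric] using S s
      by (intro mult_left_mono powr_mono2 measure_mono_fmeasurable fmeasurable_cbox) auto
    also have "\<dots> = A2 * exp (b\<^sup>2 / 2 * (q\<^sup>2 + s) * (- ln \<epsilon>))" by (simp only: A2_def c_def exp_add mult_ac)
    also have "\<dots> \<le> A2 * E"
    proof -
      have "b\<^sup>2 / 2 * (q\<^sup>2 + s) * (- ln \<epsilon>) \<le> b\<^sup>2 / 2 * (q\<^sup>2 + s + s * (1 - s) / real n) * (- ln \<epsilon>)"
        using e0 s by (intro mult_right_mono mult_left_mono) (auto simp: ln_le_zero_iff)
      thus ?thesis unfolding E_def using A2 by (intro mult_left_mono) auto
    qed
    finally have I2': "(\<integral>\<omega>. I2 \<omega> \<partial>M) \<le> A2 * E" .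
    define I where "I \<omega> = mass \<epsilon> b B \<omega> powr s * exp (q * b * X \<epsilon> x \<omega>)" for \<omega>
    have le: "AE \<omega> in M. I \<omega> \<le> I1 \<omega> + I2 \<omega>"
      using mass_Un_AE[OF e S(1-5), of b]
    proof eventually_elim
      case (elim \<omega>)
      have "mass \<epsilon> b B \<omega> powr s \<le> mass \<epsilon> b S1 \<omega> powr s + mass \<epsilon> b S2 \<omega> powr s"
        unfolding un elim using s mass_nonneg by (intro powr_add_le) auto
      hence "exp (q * b * X \<epsilon> x \<omega>) * mass \<epsilon> b B \<omega> powr s \<le> exp (q * b * X \<epsilon> x \<omega>) * (mass \<epsilon> b S1 \<omega> powr s + mass \<epsilon> b S2 \<omega> powr s)"
        by (intro mult_left_mono) auto
      thus ?case unfolding I_def I1_def I2_def by (simp only: distrib_left mult.commute)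
    qed
    have Im: "I \<in> borel_measurable M"
      unfolding I_def
      by (intro borel_measurable_times exp_X_measurable[OF e xD] mass_powr_measurable[OF e]) auto
    note sw = integrable_sandwich[OF Bochner_Integration.integrable_add[OF I1(1) I2] Im _ le]
    have I0: "AE \<omega> in M. 0 \<le> I \<omega>" by (simp add: I_def)
    note Ii = sw(1)[OF I0]
    have "(\<integral>\<omega>. I \<omega> \<partial>M) \<le> (\<integral>\<omega>. I1 \<omega> + I2 \<omega> \<partial>M)" by (rule sw(2)[OF I0])
    also have "\<dots> = (\<integral>\<omega>. I1 \<omega> \<partial>M) + (\<integral>\<omega>. I2 \<omega> \<partial>M)"
      by (rule Bochner_Integration.integral_add[OF I1(1) I2])
    also have "\<dots> \<le> (A1 + A2) * E" using I1(2) I2' by (simp add: distrib_right)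
    finally show ?thesis using Ii unfolding I_def E_def by blast
  qed
  show ?thesis
  proof (intro exI[of _ "(A1 + A2) * measure lborel B"] conjI ballI)
    show "0 < (A1 + A2) * measure lborel B" using A1 A2 by (simp add: measure_B)
    fix \<epsilon> :: real assume e: "\<epsilon> \<in> {0<..1}"
    have Bs: "B \<in> sets borel" by simp
    note F = mass_fubini[OF e Bs order_refl mass_powr_measurable[OF e Bs order_refl] powr_ge_zero
        main[OF e, THEN conjunct1] main[OF e, THEN conjunct2]]
    show "integrable M (\<lambda>\<omega>. mass \<epsilon> b B \<omega> powr s * mass \<epsilon> (q * b) B \<omega>)" by (rule F(1))
    have "(\<integral>\<omega>. mass \<epsilon> b B \<omega> powr s * mass \<epsilon> (q * b) B \<omega> \<partial>M) \<le>
        ((A1 + A2) * exp (b\<^sup>2 / 2 * (q\<^sup>2 + s + s * (1 - s) / real n) * (- ln \<epsilon>))) * measure lborel B"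
      by (rule F(4))
    thus "(\<integral>\<omega>. mass \<epsilon> b B \<omega> powr s * mass \<epsilon> (q * b) B \<omega> \<partial>M) \<le>
        (A1 + A2) * measure lborel B * exp (b\<^sup>2 / 2 * (q\<^sup>2 + s + s * (1 - s) / real n) * (- ln \<epsilon>))"
      by (simp only: mult_ac)
  qed
qed

end

section \<open>The moment ratio\<close>

lemma exists_small_cube:
  fixes x :: "'d::euclidean_space"
  assumes x: "x \<in> cbox (- One) One" and e: "0 < \<epsilon>" "\<epsilon> \<le> 1"
  obtains l where "cbox l (l + \<epsilon> *\<^sub>R One) \<subseteq> cbox (- One) One"
    and "measure lborel (cbox l (l + \<epsilon> *\<^sub>R One)) = \<epsilon> ^ DIM('d)"
    and "\<And>y. y \<in> cbox l (l + \<epsilon> *\<^sub>R One) \<Longrightarrow> norm (x - y) \<le> real DIM('d) * \<epsilon>"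
proof
  \<comment> \<open>Each edge runs from \<open>x\<close> towards the centre of the box, so for
    \<open>\<epsilon> \<le> 1\<close> the cube does not leave it.\<close>
  define l where "l = (\<Sum>i\<in>Basis. (if x \<bullet> i \<le> 0 then x \<bullet> i else x \<bullet> i - \<epsilon>) *\<^sub>R i)"
  have li: "l \<bullet> i = (if x \<bullet> i \<le> 0 then x \<bullet> i else x \<bullet> i - \<epsilon>)" if "i \<in> Basis" for i
    using that by (simp add: l_def inner_sum_left_Basis)
  have xi: "- 1 \<le> x \<bullet> i" "x \<bullet> i \<le> 1" if "i \<in> Basis" for i using x that by (auto simp: mem_box)
  show "cbox l (l + \<epsilon> *\<^sub>R One) \<subseteq> cbox (- One) One"
  proof
    fix y assume y: "y \<in> cbox l (l + \<epsilon> *\<^sub>R One)"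
    show "y \<in> cbox (- One) One" unfolding mem_box
    proof
      fix i :: 'd assume i: "i \<in> Basis"
      have "l \<bullet> i \<le> y \<bullet> i" "y \<bullet> i \<le> l \<bullet> i + \<epsilon>" using y i by (auto simp: mem_box inner_add_left)
      thus "- One \<bullet> i \<le> y \<bullet> i \<and> y \<bullet> i \<le> One \<bullet> i"
        using li[OF i] xi[OF i] e i by (auto split: if_splits)
    qed
  qed
  show "measure lborel (cbox l (l + \<epsilon> *\<^sub>R One)) = \<epsilon> ^ DIM('d)"
    using e by (subst content_cbox') (auto simp: box_ne_empty inner_add_left)
  fix y assume y: "y \<in> cbox l (l + \<epsilon> *\<^sub>R One)"
  have "norm (x - y) \<le> (\<Sum>i\<in>Basis. \<bar>(x - y) \<bullet> i\<bar>)" by (rule norm_le_l1)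
  also have "\<dots> \<le> (\<Sum>i\<in>(Basis :: 'd set). \<epsilon>)"
  proof (rule sum_mono)
    fix i :: 'd assume i: "i \<in> Basis"
    have "l \<bullet> i \<le> y \<bullet> i" "y \<bullet> i \<le> l \<bullet> i + \<epsilon>" using y i by (auto simp: mem_box inner_add_left)
    thus "\<bar>(x - y) \<bullet> i\<bar> \<le> \<epsilon>" using li[OF i] e unfolding inner_diff_left by (auto split: if_splits)
  qed
  finally show "norm (x - y) \<le> real DIM('d) * \<epsilon>" by simp
qed

context log_correlated_fields
begin

lemma mass_zero: "S \<in> sets borel \<Longrightarrow> mass \<epsilon> 0 S \<omega> = measure lborel S"
  by (simp add: mass_def set_lebesgue_integral_def)

lemma mass_logconvex_AE:
  assumes e: "\<epsilon> \<in> {0<..1}" and S: "S \<in> sets borel" "S \<subseteq> B" and \<theta>: "0 < \<theta>" "\<theta> < 1"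
  shows "AE \<omega> in M. mass \<epsilon> ((1 - \<theta>) * b + \<theta> * c) S \<omega> \<le> mass \<epsilon> b S \<omega> powr (1 - \<theta>) * mass \<epsilon> c S \<omega> powr \<theta>"
  using mass_AE_integrable[OF e S, of b] mass_AE_integrable[OF e S, of c]
proof eventually_elim
  case (elim \<omega>)
  have eq: "exp (b * X \<epsilon> y \<omega>) powr (1 - \<theta>) * exp (c * X \<epsilon> y \<omega>) powr \<theta> = exp (((1 - \<theta>) * b + \<theta> * c) * X \<epsilon> y \<omega>)" for y
    unfolding exp_powr_real exp_add[symmetric] by (simp add: algebra_simps)
  show ?case
    using set_integral_holder[OF elim exp_ge_zero exp_ge_zero \<theta>] unfolding eq mass_def .
qed

text \<open>Jensen's inequality for a negative power, in the form of log-convexity: 0 lies between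
  the parameters \<open>b\<close> and \<open>- p * b\<close>, with weight
  \<open>\<theta> = 1 / (1 + p)\<close> on the latter, and at parameter 0 the mass is Lebesgue
  measure.\<close>

lemma mass_neg_powr_AE:
  assumes e: "\<epsilon> \<in> {0<..1}" and S: "S \<in> sets borel" "S \<subseteq> B" "0 < measure lborel S" and p: "p > 0"
  shows "AE \<omega> in M. mass \<epsilon> b S \<omega> powr (- p) \<le> measure lborel S powr (- p - 1) * mass \<epsilon> (- p * b) S \<omega>"
proof -
  define \<theta> where "\<theta> = 1 / (1 + p)"
  have \<theta>: "0 < \<theta>" "\<theta> < 1" using p by (auto simp: \<theta>_def)
  have b: "(1 - \<theta>) * b + \<theta> * (- p * b) = 0" using p by (simp add: \<theta>_def field_simps)
  have ne: "emeasure lborel S \<noteq> 0" using S(3) by (auto simp: measure_def)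
  show ?thesis
    using mass_logconvex_AE[OF e S(1,2) \<theta>, of b "- p * b"] mass_pos_AE[OF e S(1,2) ne, of b] mass_pos_AE[OF e S(1,2) ne, of "- p * b"]
  proof eventually_elim
    case (elim \<omega>)
    define u v w where "u = mass \<epsilon> b S \<omega>" and "v = mass \<epsilon> (- p * b) S \<omega>" and "w = measure lborel S"
    have pos: "u > 0" "v > 0" "w > 0" using elim S by (auto simp: u_def v_def w_def)
    have "w \<le> u powr (1 - \<theta>) * v powr \<theta>"
      using elim(1) unfolding b u_def v_def w_def mass_zero[OF S(1)] .
    hence "ln w \<le> ln (u powr (1 - \<theta>) * v powr \<theta>)" using pos by (subst ln_le_cancel_iff) auto
    also have "\<dots> = (1 - \<theta>) * ln u + \<theta> * ln v" using pos by (simp add: ln_mult ln_powr)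
    finally have "(1 + p) * ln w \<le> (1 + p) * ((1 - \<theta>) * ln u + \<theta> * ln v)" using p by (intro mult_left_mono) auto
    also have "\<dots> = ((1 + p) * (1 - \<theta>)) * ln u + ((1 + p) * \<theta>) * ln v" by (simp only: distrib_left mult.assoc)
    also have "(1 + p) * (1 - \<theta>) = p" using p by (simp add: \<theta>_def field_simps)
    also have "(1 + p) * \<theta> = 1" using p by (simp add: \<theta>_def field_simps)
    finally have "- p * ln u \<le> (- p - 1) * ln w + ln v" by (simp add: algebra_simps)
    hence "exp (- p * ln u) \<le> exp ((- p - 1) * ln w + ln v)" by simp
    also have "\<dots> = w powr (- p - 1) * v" using pos by (simp add: exp_add powr_def)
    finally show ?case using pos by (simp add: powr_def u_def v_def w_def)
  qed
qed

text \<open>Log-convexity again, now with \<open>b\<close> between 0 and \<open>a * b\<close>, where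
  the weight on the latter is \<open>1 / a\<close>.\<close>

lemma mass_powr_AE:
  assumes e: "\<epsilon> \<in> {0<..1}" and S: "S \<in> sets borel" "S \<subseteq> B" "0 < measure lborel S" and a: "a > 1"
  shows "AE \<omega> in M. mass \<epsilon> b S \<omega> powr a \<le> measure lborel S powr (a - 1) * mass \<epsilon> (a * b) S \<omega>"
proof -
  define \<theta> where "\<theta> = 1 / a"
  have \<theta>: "0 < \<theta>" "\<theta> < 1" using a by (auto simp: \<theta>_def)
  have b: "(1 - \<theta>) * 0 + \<theta> * (a * b) = b" using a by (simp add: \<theta>_def)
  show ?thesis
    using mass_logconvex_AE[OF e S(1,2) \<theta>, of 0 "a * b"]
  proof eventually_elim
    case (elim \<omega>)
    have "mass \<epsilon> b S \<omega> \<le> measure lborel S powr (1 - \<theta>) * mass \<epsilon> (a * b) S \<omega> powr \<theta>"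
      using elim unfolding b mass_zero[OF S(1)] .
    hence "mass \<epsilon> b S \<omega> powr a \<le> (measure lborel S powr (1 - \<theta>) * mass \<epsilon> (a * b) S \<omega> powr \<theta>) powr a"
      using a mass_nonneg by (intro powr_mono2) auto
    also have "\<dots> = measure lborel S powr ((1 - \<theta>) * a) * mass \<epsilon> (a * b) S \<omega> powr (\<theta> * a)"
      by (simp add: powr_mult powr_powr)
    also have "(1 - \<theta>) * a = a - 1" using a by (simp add: \<theta>_def field_simps)
    also have "\<theta> * a = 1" using a by (simp add: \<theta>_def)
    finally show ?case using mass_nonneg by simp
  qed
qed

lemma B_facts: "B \<in> sets borel" "0 < measure lborel B" "emeasure lborel B \<noteq> 0"
proof -
  show "B \<in> sets borel" by simp
  show "0 < measure lborel B" by (simp add: measure_B)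
  thus "emeasure lborel B \<noteq> 0" by (auto simp: measure_def)
qed

text \<open>At distances of order \<open>\<epsilon>\<close> the logarithms of
  \<open>\<epsilon>\<close> cancel in the variance of the increment, so its exponential moments are
  bounded uniformly in \<open>\<epsilon>\<close>.\<close>

lemma increment_exp:
  assumes e: "\<epsilon> \<in> {0<..1}" and "x \<in> D" "y \<in> D" and xy: "norm (x - y) \<le> real DIM('d) * \<epsilon>"
  shows "integrable M (\<lambda>\<omega>. exp (c * X \<epsilon> x \<omega>) * exp (- c * X \<epsilon> y \<omega>))"
    and "(\<integral>\<omega>. exp (c * X \<epsilon> x \<omega>) * exp (- c * X \<epsilon> y \<omega>) \<partial>M) \<le> exp (c\<^sup>2 * (2 * C + ln (real DIM('d) + 1)))"
proof -
  have e0: "\<epsilon> > 0" using e by simp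
  have hb: "has_bochner_integral M (\<lambda>\<omega>. exp (c * X \<epsilon> x \<omega>) * exp (- c * X \<epsilon> y \<omega>))
     (exp ((c\<^sup>2 * K \<epsilon> x x + (- c)\<^sup>2 * K \<epsilon> y y + 2 * c * (- c) * K \<epsilon> x y) / 2))"
    unfolding exp_add[symmetric] by (rule exp_field2[OF assms(1-3)])
  show "integrable M (\<lambda>\<omega>. exp (c * X \<epsilon> x \<omega>) * exp (- c * X \<epsilon> y \<omega>))" using hb by (simp only: has_bochner_integral_iff)
  have "norm (x - y) + \<epsilon> \<le> (real DIM('d) + 1) * \<epsilon>" using xy by (simp add: algebra_simps)
  from K_lower[OF assms(1-3) this] have "K \<epsilon> x y \<ge> - ln ((real DIM('d) + 1) * \<epsilon>) - C" .
  moreover have "ln ((real DIM('d) + 1) * \<epsilon>) = ln (real DIM('d) + 1) + ln \<epsilon>"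
    using e0 by (subst ln_mult) (auto intro: add_nonneg_pos)
  ultimately have "K \<epsilon> x y \<ge> - (ln (real DIM('d) + 1) + ln \<epsilon>) - C" by (simp only:)
  hence "K \<epsilon> x x + K \<epsilon> y y - 2 * K \<epsilon> x y \<le> 2 * (2 * C + ln (real DIM('d) + 1))"
    using K_diag(1)[OF e assms(2)] K_diag(1)[OF e assms(3)] by argo
  hence "c\<^sup>2 * (K \<epsilon> x x + K \<epsilon> y y - 2 * K \<epsilon> x y) \<le> c\<^sup>2 * (2 * (2 * C + ln (real DIM('d) + 1)))"
    by (intro mult_left_mono) auto
  hence "(c\<^sup>2 * K \<epsilon> x x + (- c)\<^sup>2 * K \<epsilon> y y + 2 * c * (- c) * K \<epsilon> x y) / 2 \<le> c\<^sup>2 * (2 * C + ln (real DIM('d) + 1))"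
    by (simp add: power2_eq_square algebra_simps)
  thus "(\<integral>\<omega>. exp (c * X \<epsilon> x \<omega>) * exp (- c * X \<epsilon> y \<omega>) \<partial>M) \<le> exp (c\<^sup>2 * (2 * C + ln (real DIM('d) + 1)))"
    using hb by (simp only: has_bochner_integral_iff exp_le_cancel_iff)
qed

definition ratio :: "real \<Rightarrow> real \<Rightarrow> real \<Rightarrow> 'w \<Rightarrow> real" where
  "ratio \<epsilon> b q \<omega> = mass \<epsilon> b B \<omega> powr (- q) * mass \<epsilon> (q * b) B \<omega>"

text \<open>Since \<open>Z\<close> dominates the mass of a cube of side \<open>\<epsilon>\<close> around \<open>x\<close>, where the field is almost
  constant, \<open>(exp (b * X x) / Z) powr p\<close> has expectation at most of order \<open>\<epsilon> powr (- d * p)\<close>.\<close>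

lemma ratio_moment:
  assumes p: "p > 0"
  shows "\<exists>A>0. \<forall>\<epsilon>\<in>{0<..1}. integrable M (ratio \<epsilon> b p) \<and>
    (\<integral>\<omega>. ratio \<epsilon> b p \<omega> \<partial>M) \<le> A * exp (real DIM('d) * p * (- ln \<epsilon>))"
proof -
  define A where "A = exp ((p * b)\<^sup>2 * (2 * C + ln (real DIM('d) + 1)))"
  have main: "integrable M (\<lambda>\<omega>. mass \<epsilon> b B \<omega> powr (- p) * exp (p * b * X \<epsilon> x \<omega>)) \<and>
      (\<integral>\<omega>. mass \<epsilon> b B \<omega> powr (- p) * exp (p * b * X \<epsilon> x \<omega>) \<partial>M) \<le> A * exp (real DIM('d) * p * (- ln \<epsilon>))"
    if e: "\<epsilon> \<in> {0<..1}" and x: "x \<in> B" for \<epsilon> x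
  proof -
    have e0: "0 < \<epsilon>" "\<epsilon> \<le> 1" using e by auto
    have xD: "x \<in> D" using x B_subset_D by blast
    obtain l where l: "cbox l (l + \<epsilon> *\<^sub>R One) \<subseteq> B" "measure lborel (cbox l (l + \<epsilon> *\<^sub>R One)) = \<epsilon> ^ DIM('d)"
      "\<And>y. y \<in> cbox l (l + \<epsilon> *\<^sub>R One) \<Longrightarrow> norm (x - y) \<le> real DIM('d) * \<epsilon>"
      using exists_small_cube[OF x e0] by metis
    define N where "N = cbox l (l + \<epsilon> *\<^sub>R One)"
    have N: "N \<in> sets borel" "N \<subseteq> B" "0 < measure lborel N" using l e0 by (auto simp: N_def)
    have Nne: "emeasure lborel N \<noteq> 0" using N(3) by (auto simp: measure_def)
    have ND: "y \<in> D" if "y \<in> N" for y using that N B_subset_D by blast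
    have Ny: "norm (x - y) \<le> real DIM('d) * \<epsilon>" if "y \<in> N" for y using l(3) that by (simp add: N_def)
    \<comment> \<open>Jensen's inequality on the cube \<open>N\<close> replaces the negative power
      of the mass by a mass with parameter \<open>- p * b\<close>; multiplied by the exponential at
      \<open>x\<close>, only increments of the field remain.\<close>
    define J where "J \<omega> = exp (p * b * X \<epsilon> x \<omega>) * mass \<epsilon> (- (p * b)) N \<omega>" for \<omega>
    note F = mass_fubini[OF e N(1,2) exp_X_measurable[OF e xD] exp_ge_zero
        increment_exp(1)[OF e xD ND Ny, of _ "p * b"] increment_exp(2)[OF e xD ND Ny, of _ "p * b"]]
    have J: "integrable M J" unfolding J_def by (rule F(1))
    have "(\<integral>\<omega>. J \<omega> \<partial>M) \<le> A * measure lborel N" unfolding J_def A_def by (rule F(4))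
    define I where "I \<omega> = mass \<epsilon> b B \<omega> powr (- p) * exp (p * b * X \<epsilon> x \<omega>)" for \<omega>
    have le: "AE \<omega> in M. I \<omega> \<le> measure lborel N powr (- p - 1) * J \<omega>"
      using mass_neg_powr_AE[OF e N p, of b] mass_mono_AE[OF e N(1,2) B_facts(1) order_refl, of b] mass_pos_AE[OF e N(1,2) Nne, of b]
    proof eventually_elim
      case (elim \<omega>)
      have "mass \<epsilon> b B \<omega> powr (- p) \<le> mass \<epsilon> b N \<omega> powr (- p)"
        using elim p by (intro powr_mono2') auto
      also have "\<dots> \<le> measure lborel N powr (- p - 1) * mass \<epsilon> (- p * b) N \<omega>" by (rule elim)
      finally have "I \<omega> \<le> (measure lborel N powr (- p - 1) * mass \<epsilon> (- p * b) N \<omega>) * exp (p * b * X \<epsilon> x \<omega>)"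
        unfolding I_def by (intro mult_right_mono) auto
      thus ?case by (simp add: J_def mult_ac)
    qed
    have Im: "I \<in> borel_measurable M"
      unfolding I_def by (intro borel_measurable_times exp_X_measurable[OF e xD] mass_powr_measurable[OF e]) auto
    have I0: "AE \<omega> in M. 0 \<le> I \<omega>" by (simp add: I_def)
    note sw = integrable_sandwich[OF integrable_mult_right[OF J] Im I0 le]
    have "(\<integral>\<omega>. I \<omega> \<partial>M) \<le> measure lborel N powr (- p - 1) * (\<integral>\<omega>. J \<omega> \<partial>M)"
      using sw(2) by simp
    also have "\<dots> \<le> measure lborel N powr (- p - 1) * (A * measure lborel N)"
      using \<open>(\<integral>\<omega>. J \<omega> \<partial>M) \<le> A * measure lborel N\<close> by (intro mult_left_mono) auto
    also have "\<dots> = A * (measure lborel N powr (- p - 1) * measure lborel N powr 1)" using N(3) by simp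
    also have "measure lborel N powr (- p - 1) * measure lborel N powr 1 = measure lborel N powr (- p)"
      unfolding powr_add[symmetric] by simp
    also have "\<dots> = exp (real DIM('d) * p * (- ln \<epsilon>))"
      using l(2) e0 by (simp add: N_def powr_def ln_realpow)
    finally show ?thesis using sw(1) unfolding I_def by blast
  qed
  show ?thesis
  proof (intro exI[of _ "A * measure lborel B"] conjI ballI)
    show "0 < A * measure lborel B" by (simp add: A_def measure_B)
    fix \<epsilon> :: real assume e: "\<epsilon> \<in> {0<..1}"
    note F = mass_fubini[OF e B_facts(1) order_refl mass_powr_measurable[OF e B_facts(1) order_refl] powr_ge_zero
        main[OF e, THEN conjunct1] main[OF e, THEN conjunct2]]
    show "integrable M (ratio \<epsilon> b p)" unfolding ratio_def by (rule F(1))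
    have "(\<integral>\<omega>. ratio \<epsilon> b p \<omega> \<partial>M) \<le> A * exp (real DIM('d) * p * (- ln \<epsilon>)) * measure lborel B"
      unfolding ratio_def by (rule F(4))
    thus "(\<integral>\<omega>. ratio \<epsilon> b p \<omega> \<partial>M) \<le> A * measure lborel B * exp (real DIM('d) * p * (- ln \<epsilon>))"
      by (simp only: mult_ac)
  qed
qed

lemma ratio_integrable: "p > 0 \<Longrightarrow> \<epsilon> \<in> {0<..1} \<Longrightarrow> integrable M (ratio \<epsilon> b p)"
  using ratio_moment[of p b] by blast

lemma ratio_pos_AE: "\<epsilon> \<in> {0<..1} \<Longrightarrow> AE \<omega> in M. 0 < ratio \<epsilon> b p \<omega>"
  using mass_pos_AE[OF _ B_facts(1) order_refl B_facts(3), of \<epsilon> b] mass_pos_AE[OF _ B_facts(1) order_refl B_facts(3), of \<epsilon> "p * b"]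
  by (auto simp: ratio_def)

lemma ratio_expectation_pos:
  assumes "p > 0" "\<epsilon> \<in> {0<..1}"
  shows "0 < (\<integral>\<omega>. ratio \<epsilon> b p \<omega> \<partial>M)"
  by (rule expectation_pos[OF ratio_integrable[OF assms] ratio_pos_AE[OF assms(2)]])

lemma ratio_one:
  assumes "\<epsilon> \<in> {0<..1}"
  shows "(\<integral>\<omega>. ratio \<epsilon> b 1 \<omega> \<partial>M) = 1"
proof -
  have "AE \<omega> in M. ratio \<epsilon> b 1 \<omega> = 1"
    using mass_pos_AE[OF assms B_facts(1) order_refl B_facts(3), of b]
    by eventually_elim (simp add: ratio_def powr_minus)
  hence "(\<integral>\<omega>. ratio \<epsilon> b 1 \<omega> \<partial>M) = (\<integral>\<omega>. 1 \<partial>M)"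
    by (intro integral_cong_AE borel_measurable_integrable ratio_integrable assms) auto
  thus ?thesis by (simp add: prob_space)
qed

text \<open>Hoelder's inequality is used twice: over space for the mass with parameter
  \<open>q1 * b\<close>, and then under the expectation. The powers of the mass with parameter
  \<open>b\<close> interpolate exactly.\<close>

lemma ratio_logconvex:
  assumes e: "\<epsilon> \<in> {0<..1}" and q: "0 < q0" "0 < q2" and \<theta>: "0 < \<theta>" "\<theta> < 1" and q1: "q1 = (1 - \<theta>) * q0 + \<theta> * q2"
  shows "ln (\<integral>\<omega>. ratio \<epsilon> b q1 \<omega> \<partial>M) \<le> (1 - \<theta>) * ln (\<integral>\<omega>. ratio \<epsilon> b q0 \<omega> \<partial>M) + \<theta> * ln (\<integral>\<omega>. ratio \<epsilon> b q2 \<omega> \<partial>M)"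
proof -
  have q1p: "q1 > 0" unfolding q1 using q \<theta> by (intro add_pos_pos mult_pos_pos) auto
  note A = ratio_expectation_pos[OF q(1) e, of b] ratio_expectation_pos[OF q1p e, of b] ratio_expectation_pos[OF q(2) e, of b]
  note i0 = ratio_integrable[OF q(1) e, of b] and i2 = ratio_integrable[OF q(2) e, of b]
  have nn: "AE \<omega> in M. 0 \<le> ratio \<epsilon> b q \<omega>" for q using mass_nonneg by (auto simp: ratio_def)
  note H = powr_holder_integral[OF i0 i2 nn nn \<theta>]
  have le: "AE \<omega> in M. ratio \<epsilon> b q1 \<omega> \<le> ratio \<epsilon> b q0 \<omega> powr (1 - \<theta>) * ratio \<epsilon> b q2 \<omega> powr \<theta>"
    using mass_logconvex_AE[OF e B_facts(1) order_refl \<theta>, of "q0 * b" "q2 * b"] mass_pos_AE[OF e B_facts(1) order_refl B_facts(3), of b]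
  proof eventually_elim
    case (elim \<omega>)
    define z where "z = mass \<epsilon> b B \<omega>"
    have z: "z > 0" using elim by (simp add: z_def)
    have b: "(1 - \<theta>) * (q0 * b) + \<theta> * (q2 * b) = q1 * b" unfolding q1 by algebra
    have "z powr (- q1) = z powr (- q0 * (1 - \<theta>)) * z powr (- q2 * \<theta>)"
      unfolding powr_add[symmetric] q1 by (simp add: algebra_simps)
    moreover have "z powr (- q1) * mass \<epsilon> (q1 * b) B \<omega> \<le>
        z powr (- q1) * (mass \<epsilon> (q0 * b) B \<omega> powr (1 - \<theta>) * mass \<epsilon> (q2 * b) B \<omega> powr \<theta>)"
      using elim(1) unfolding b by (intro mult_left_mono) auto
    ultimately show ?case
      unfolding ratio_def z_def[symmetric] powr_mult powr_powr by (simp only: mult_ac)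
  qed
  have "(\<integral>\<omega>. ratio \<epsilon> b q1 \<omega> \<partial>M) \<le> (\<integral>\<omega>. ratio \<epsilon> b q0 \<omega> \<partial>M) powr (1 - \<theta>) * (\<integral>\<omega>. ratio \<epsilon> b q2 \<omega> \<partial>M) powr \<theta>"
    using integral_mono_AE[OF ratio_integrable[OF q1p e] H(1) le] H(2) by linarith
  hence "ln (\<integral>\<omega>. ratio \<epsilon> b q1 \<omega> \<partial>M) \<le> ln ((\<integral>\<omega>. ratio \<epsilon> b q0 \<omega> \<partial>M) powr (1 - \<theta>) * (\<integral>\<omega>. ratio \<epsilon> b q2 \<omega> \<partial>M) powr \<theta>)"
    using A by (subst ln_le_cancel_iff) auto
  thus ?thesis using A by (simp add: ln_mult ln_powr)
qed

end

section \<open>Comparison with independent blocks\<close>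

definition std_normal_measure :: "real measure" where
  "std_normal_measure = density lborel (\<lambda>t. ennreal (std_normal_density t))"

lemma sets_std_normal_measure[measurable_cong, simp]: "sets std_normal_measure = sets borel"
  by (simp add: std_normal_measure_def)

lemma space_std_normal_measure[simp]: "space std_normal_measure = UNIV"
  by (simp add: std_normal_measure_def)

lemma std_normal_mgf: "(\<integral>\<^sup>+t. ennreal (exp (a * t)) \<partial>std_normal_measure) = ennreal (exp (a\<^sup>2 / 2))"
proof -
  have eq: "std_normal_density t * exp (a * t) = exp (a\<^sup>2 / 2) * normal_density a 1 t" for t
  proof -
    have "exp (- t\<^sup>2 / 2) * exp (a * t) = exp (a\<^sup>2 / 2) * exp (- (t - a)\<^sup>2 / 2)"
      unfolding exp_add[symmetric] by (simp add: field_simps power2_eq_square)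
    thus ?thesis by (simp add: normal_density_def)
  qed
  have "(\<integral>\<^sup>+t. ennreal (exp (a * t)) \<partial>std_normal_measure) = (\<integral>\<^sup>+t. ennreal (exp (a\<^sup>2 / 2)) * ennreal (normal_density a 1 t) \<partial>lborel)"
    unfolding std_normal_measure_def
    by (subst nn_integral_density) (auto simp: ennreal_mult[symmetric] eq simp del: ennreal_mult intro!: nn_integral_cong)
  also have "\<dots> = ennreal (exp (a\<^sup>2 / 2)) * (\<integral>\<^sup>+t. ennreal (normal_density a 1 t) \<partial>lborel)"
    by (rule nn_integral_cmult) simp
  also have "(\<integral>\<^sup>+t. ennreal (normal_density a 1 t) \<partial>lborel) = 1"
    by (subst nn_integral_eq_integral) auto
  finally show ?thesis by simp
qed

text \<open>A single variable repeated at all indices, hence covariance constantly 1; this is the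
  common component in \<open>block_kahane\<close>.\<close>

lemma gaussian_family_std_normal: "gaussian_family std_normal_measure I (\<lambda>i t. t) (\<lambda>i j. 1)"
  unfolding gaussian_family_def
proof (intro conjI ballI allI)
  fix a :: "'a \<Rightarrow> real"
  have "(\<Sum>i\<in>I. \<Sum>j\<in>I. a i * a j * 1) = (\<Sum>i\<in>I. a i)\<^sup>2"
    by (simp add: power2_eq_square sum_product)
  thus "(\<integral>\<^sup>+t. ennreal (exp (\<Sum>i\<in>I. a i * t)) \<partial>std_normal_measure) =
      ennreal (exp ((\<Sum>i\<in>I. \<Sum>j\<in>I. a i * a j * 1) / 2))"
    using std_normal_mgf[of "\<Sum>i\<in>I. a i"] by (simp add: sum_distrib_right)
qed (simp add: measurable_ident_sets)

lemma prob_space_std_normal: "prob_space std_normal_measure"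
  using gaussian_family_prob_space[OF gaussian_family_std_normal[of "{}"]] .

text \<open>Indices are pairs of a block and a point. The product measure factorises the Laplace
  transform over blocks, so only covariances within a block survive.\<close>

lemma gaussian_family_PiM:
  fixes Z :: "'j \<Rightarrow> 'i set" and U :: "'j \<Rightarrow> 'i \<Rightarrow> 'a \<Rightarrow> real"
  assumes M: "prob_space M" and J: "finite J" and Z: "\<And>j. j \<in> J \<Longrightarrow> finite (Z j)"
    and U: "\<And>j. j \<in> J \<Longrightarrow> gaussian_family M (Z j) (U j) (S j)"
  shows "gaussian_family (PiM J (\<lambda>_. M)) (Sigma J Z) (\<lambda>i \<omega>. U (fst i) (snd i) (\<omega> (fst i)))
     (\<lambda>i k. if fst i = fst k then S (fst i) (snd i) (snd k) else 0)"
  unfolding gaussian_family_def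
proof (intro conjI ballI allI)
  interpret M: prob_space M by fact
  interpret P: product_sigma_finite "\<lambda>_::'j. M" ..
  fix i assume i: "i \<in> Sigma J Z"
  hence "fst i \<in> J" "snd i \<in> Z (fst i)" by auto
  from measurable_compose[OF measurable_component_singleton[OF this(1)] gaussian_familyD(1)[OF U[OF this(1)] this(2)]]
  show "(\<lambda>\<omega>. U (fst i) (snd i) (\<omega> (fst i))) \<in> borel_measurable (PiM J (\<lambda>_. M))" .
next
  interpret M: prob_space M by fact
  interpret P: product_sigma_finite "\<lambda>_::'j. M" ..
  fix a :: "'j \<times> 'i \<Rightarrow> real"
  have m: "(\<lambda>\<omega>. ennreal (exp (\<Sum>z\<in>Z j. a (j, z) * U j z \<omega>))) \<in> borel_measurable M" if "j \<in> J" for j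
    using gaussian_familyD(1)[OF U[OF that]]
    by (intro measurable_compose[OF _ measurable_ennreal] measurable_compose[OF _ borel_measurable_exp]
        borel_measurable_sum borel_measurable_times) auto
  have "(\<Sum>i\<in>Sigma J Z. a i * U (fst i) (snd i) (\<omega> (fst i))) = (\<Sum>j\<in>J. \<Sum>z\<in>Z j. a (j, z) * U j z (\<omega> j))" for \<omega>
    using J Z by (subst sum.Sigma) (auto simp: case_prod_beta')
  hence "(\<integral>\<^sup>+\<omega>. ennreal (exp (\<Sum>i\<in>Sigma J Z. a i * U (fst i) (snd i) (\<omega> (fst i)))) \<partial>PiM J (\<lambda>_. M)) =
      (\<integral>\<^sup>+\<omega>. (\<Prod>j\<in>J. ennreal (exp (\<Sum>z\<in>Z j. a (j, z) * U j z (\<omega> j)))) \<partial>PiM J (\<lambda>_. M))"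
    by (simp add: exp_sum[OF J] prod_ennreal)
  also have "\<dots> = (\<Prod>j\<in>J. \<integral>\<^sup>+\<omega>. ennreal (exp (\<Sum>z\<in>Z j. a (j, z) * U j z \<omega>)) \<partial>M)"
    by (rule P.product_nn_integral_prod[OF J m])
  also have "\<dots> = (\<Prod>j\<in>J. ennreal (exp ((\<Sum>z\<in>Z j. \<Sum>y\<in>Z j. a (j, z) * a (j, y) * S j z y) / 2)))"
    using gaussian_familyD(2)[OF U] by (intro prod.cong refl) auto
  also have "\<dots> = ennreal (exp ((\<Sum>j\<in>J. \<Sum>z\<in>Z j. \<Sum>y\<in>Z j. a (j, z) * a (j, y) * S j z y) / 2))"
    by (simp add: prod_ennreal exp_sum[OF J] sum_divide_distrib)
  also have "(\<Sum>j\<in>J. \<Sum>z\<in>Z j. \<Sum>y\<in>Z j. a (j, z) * a (j, y) * S j z y) =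
      (\<Sum>i\<in>Sigma J Z. \<Sum>k\<in>Sigma J Z. a i * a k * (if fst i = fst k then S (fst i) (snd i) (snd k) else 0))"
  proof -
    have inner: "(\<Sum>k\<in>Sigma J Z. a (j, z) * a k * (if j = fst k then S j z (snd k) else 0)) =
        (\<Sum>y\<in>Z j. a (j, z) * a (j, y) * S j z y)" if "j \<in> J" for j z
    proof -
      have "(\<Sum>k\<in>Sigma J Z. a (j, z) * a k * (if j = fst k then S j z (snd k) else 0)) =
          (\<Sum>k\<in>J. \<Sum>y\<in>Z k. a (j, z) * a (k, y) * (if j = k then S j z y else 0))"
        using J Z by (subst sum.Sigma) (auto simp: case_prod_beta' intro!: sum.cong)
      also have "\<dots> = (\<Sum>k\<in>J. if k = j then (\<Sum>y\<in>Z k. a (j, z) * a (k, y) * S j z y) else 0)"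
        by (intro sum.cong refl) auto
      also have "\<dots> = (\<Sum>y\<in>Z j. a (j, z) * a (j, y) * S j z y)" using J that by simp
      finally show ?thesis .
    qed
    have "(\<Sum>i\<in>Sigma J Z. \<Sum>k\<in>Sigma J Z. a i * a k * (if fst i = fst k then S (fst i) (snd i) (snd k) else 0)) =
        (\<Sum>j\<in>J. \<Sum>z\<in>Z j. \<Sum>k\<in>Sigma J Z. a (j, z) * a k * (if j = fst k then S j z (snd k) else 0))"
      using J Z by (subst sum.Sigma[of J Z]) (auto simp: case_prod_beta' intro!: sum.cong)
    also have "\<dots> = (\<Sum>j\<in>J. \<Sum>z\<in>Z j. \<Sum>y\<in>Z j. a (j, z) * a (j, y) * S j z y)"
      by (intro sum.cong refl inner)
    finally show ?thesis by simp
  qed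
  finally show "(\<integral>\<^sup>+\<omega>. ennreal (exp (\<Sum>i\<in>Sigma J Z. a i * U (fst i) (snd i) (\<omega> (fst i)))) \<partial>PiM J (\<lambda>_. M)) =
      ennreal (exp ((\<Sum>i\<in>Sigma J Z. \<Sum>k\<in>Sigma J Z. a i * a k * (if fst i = fst k then S (fst i) (snd i) (snd k) else 0)) / 2))" .
qed

context log_correlated_fields
begin

text \<open>The index map \<open>u\<close> need not be injective, so the same point may carry
  several labels, as happens with pairs of a block and a point.\<close>

lemma field_gaussian_family:
  fixes u :: "'i \<Rightarrow> 'd"
  assumes e: "\<epsilon> \<in> {0<..1}" and u: "\<And>i. i \<in> I \<Longrightarrow> u i \<in> D"
  shows "gaussian_family M I (\<lambda>i \<omega>. b * X \<epsilon> (u i) \<omega>) (\<lambda>i j. b\<^sup>2 * K \<epsilon> (u i) (u j))"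
  unfolding gaussian_family_def
proof (intro conjI ballI allI)
  show "(\<lambda>\<omega>. b * X \<epsilon> (u i) \<omega>) \<in> borel_measurable M" if "i \<in> I" for i
    by (intro borel_measurable_times borel_measurable_const lin_measurable[OF e lin_X] u that)
  fix a :: "'i \<Rightarrow> real"
  define Y where "Y i = (\<lambda>\<omega>. (a i * b) * X \<epsilon> (u i) \<omega>)" for i
  have Y: "Y i \<in> lin \<epsilon>" if "i \<in> I" for i unfolding Y_def by (intro lin_scale lin_X u that)
  define L where "L = (\<lambda>\<omega>. \<Sum>i\<in>I. Y i \<omega>)"
  have L: "L \<in> lin \<epsilon>" unfolding L_def by (intro lin_sum Y)
  have cvY: "cv (Y i) Z = a i * b * cv (X \<epsilon> (u i)) Z" for i Z unfolding Y_def by (rule cv_scale)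
  have cvL: "cv L Z = (\<Sum>i\<in>I. a i * b * cv (X \<epsilon> (u i)) Z)" if "Z \<in> lin \<epsilon>" for Z
    unfolding L_def by (subst cv_sum[OF e _ that]) (simp_all add: Y cvY)
  have "cv L L = (\<Sum>i\<in>I. a i * b * cv L (X \<epsilon> (u i)))" unfolding cvL[OF L] by (simp add: cv_sym)
  also have "\<dots> = (\<Sum>i\<in>I. a i * b * (\<Sum>j\<in>I. a j * b * K \<epsilon> (u j) (u i)))"
    by (intro sum.cong refl) (simp add: cvL[OF lin_X[OF u]] cv_X)
  also have "\<dots> = (\<Sum>i\<in>I. \<Sum>j\<in>I. a i * a j * (b\<^sup>2 * K \<epsilon> (u i) (u j)))"
    by (simp add: sum_distrib_left power2_eq_square K_sym mult_ac)
  finally have cvLL: "cv L L = (\<Sum>i\<in>I. \<Sum>j\<in>I. a i * a j * (b\<^sup>2 * K \<epsilon> (u i) (u j)))" .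
  have "has_bochner_integral M (\<lambda>\<omega>. exp (L \<omega>)) (exp (cv L L / 2))"
    using lin_exp[OF e L lin_zero lin_zero, of 1 0 0] by simp
  hence "(\<integral>\<^sup>+\<omega>. ennreal (exp (L \<omega>)) \<partial>M) = ennreal (exp (cv L L / 2))"
    by (subst nn_integral_eq_integral) (auto simp: has_bochner_integral_iff)
  moreover have "L \<omega> = (\<Sum>i\<in>I. a i * (b * X \<epsilon> (u i) \<omega>))" for \<omega> by (simp add: L_def Y_def mult.assoc)
  ultimately show "(\<integral>\<^sup>+\<omega>. ennreal (exp (\<Sum>i\<in>I. a i * (b * X \<epsilon> (u i) \<omega>))) \<partial>M) =
      ennreal (exp ((\<Sum>i\<in>I. \<Sum>j\<in>I. a i * a j * (b\<^sup>2 * K \<epsilon> (u i) (u j))) / 2))"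
    by (simp only: cvLL)
qed

text \<open>The dominating field consists of independent copies of \<open>X\<close> on the blocks, plus one common
  Gaussian variable of variance \<open>c\<close>.\<close>

lemma block_kahane:
  fixes Z :: "'j \<Rightarrow> 'd set"
  assumes e: "\<epsilon> \<in> {0<..1}" and J: "finite J" and Z: "\<And>j. j \<in> J \<Longrightarrow> finite (Z j)"
    and ZD: "\<And>j. j \<in> J \<Longrightarrow> Z j \<subseteq> D" and c: "0 \<le> c"
    and cross: "\<And>j k x y. j \<in> J \<Longrightarrow> k \<in> J \<Longrightarrow> j \<noteq> k \<Longrightarrow> x \<in> Z j \<Longrightarrow> y \<in> Z k \<Longrightarrow> K \<epsilon> x y \<le> c"
    and p: "\<And>j z. 0 \<le> p j z"
  shows "(\<integral>\<^sup>+\<omega>. ennreal (exp (- (\<Sum>j\<in>J. \<Sum>z\<in>Z j. p j z * exp (b * X \<epsilon> z \<omega> - b\<^sup>2 * K \<epsilon> z z / 2)))) \<partial>M) \<le>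
    (\<integral>\<^sup>+t. (\<Prod>j\<in>J. \<integral>\<^sup>+\<omega>. ennreal (exp (- (exp (b * sqrt c * t - b\<^sup>2 * c / 2) *
       (\<Sum>z\<in>Z j. p j z * exp (b * X \<epsilon> z \<omega> - b\<^sup>2 * K \<epsilon> z z / 2))))) \<partial>M) \<partial>std_normal_measure)"
proof -
  interpret P: product_sigma_finite "\<lambda>_::'j. M" ..
  interpret PJ: prob_space "PiM J (\<lambda>_. M)" by (intro prob_space_PiM) unfold_locales
  define I where "I = Sigma J Z"
  have I: "finite I" unfolding I_def using J Z by auto
  define S where "S i k = b\<^sup>2 * K \<epsilon> (snd i) (snd k)" for i k :: "'j \<times> 'd"
  define S' where "S' i k = 1\<^sup>2 * 1 * b\<^sup>2 * c + (if fst i = fst k then b\<^sup>2 * K \<epsilon> (snd i) (snd k) else 0)" for i k :: "'j \<times> 'd"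
  have U: "gaussian_family M I (\<lambda>i \<omega>. b * X \<epsilon> (snd i) \<omega>) S"
    unfolding S_def
  proof (rule field_gaussian_family[OF e])
    fix i assume "i \<in> I"
    hence "fst i \<in> J" "snd i \<in> Z (fst i)" by (auto simp: I_def)
    thus "snd i \<in> D" using ZD by blast
  qed
  have V1: "gaussian_family (PiM J (\<lambda>_. M)) I (\<lambda>i \<omega>. b * X \<epsilon> (snd i) (\<omega> (fst i)))
      (\<lambda>i k. if fst i = fst k then b\<^sup>2 * K \<epsilon> (snd i) (snd k) else 0)"
    unfolding I_def
  proof (rule gaussian_family_PiM[OF prob_space_axioms J Z, where U = "\<lambda>j z \<omega>. b * X \<epsilon> z \<omega>" and S = "\<lambda>j x y. b\<^sup>2 * K \<epsilon> x y"])
    fix j assume "j \<in> J"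
    hence "z \<in> D" if "z \<in> Z j" for z using ZD that by blast
    thus "gaussian_family M (Z j) (\<lambda>z \<omega>. b * X \<epsilon> z \<omega>) (\<lambda>x y. b\<^sup>2 * K \<epsilon> x y)"
      by (rule field_gaussian_family[OF e, of _ "\<lambda>z. z"])
  qed
  have V: "gaussian_family (std_normal_measure \<Otimes>\<^sub>M PiM J (\<lambda>_. M)) I
      (\<lambda>i \<omega>. (b * sqrt c) * fst \<omega> + 1 * (b * X \<epsilon> (snd i) (snd \<omega> (fst i)))) S'"
    using gaussian_family_pair[OF gaussian_family_std_normal V1, of "b * sqrt c" 1] c
    by (simp add: S'_def[abs_def] power_mult_distrib)
  have bc: "0 \<le> b\<^sup>2 * c" using c by simp
  \<comment> \<open>Within a block the common variable only adds the nonnegative amount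
    \<open>b\<^sup>2 * c\<close>; across blocks its variance is what \<open>cross\<close>
    requires.\<close>
  have le: "S i k \<le> S' i k" if "i \<in> I" "k \<in> I" for i k
  proof (cases "fst i = fst k")
    case True thus ?thesis using bc by (simp add: S_def S'_def)
  next
    case False
    have "K \<epsilon> (snd i) (snd k) \<le> c" using that False by (intro cross[of "fst i" "fst k"]) (auto simp: I_def)
    thus ?thesis using False by (simp add: S_def S'_def mult_left_mono)
  qed
  have sym: "S i k = S k i" "S' i k = S' k i" for i k by (auto simp: S_def S'_def K_sym)
  have sig: "(\<Sum>i\<in>I. f (fst i) (snd i)) = (\<Sum>j\<in>J. \<Sum>z\<in>Z j. f j z)" for f :: "'j \<Rightarrow> 'd \<Rightarrow> real"
    unfolding I_def using J Z by (subst sum.Sigma) (auto simp: case_prod_beta')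
  define G where "G t j \<omega> = ennreal (exp (- (exp (b * sqrt c * t - b\<^sup>2 * c / 2) *
       (\<Sum>z\<in>Z j. p j z * exp (b * X \<epsilon> z \<omega> - b\<^sup>2 * K \<epsilon> z z / 2)))))" for t j \<omega>
  have Gm: "(\<lambda>\<omega>. G t j \<omega>) \<in> borel_measurable M" if j: "j \<in> J" for t j
  proof -
    have [measurable]: "(\<lambda>\<omega>. \<Sum>z\<in>Z j. p j z * exp (b * X \<epsilon> z \<omega> - b\<^sup>2 * K \<epsilon> z z / 2)) \<in> borel_measurable M"
    proof (rule borel_measurable_sum)
      fix z assume "z \<in> Z j"
      hence "z \<in> D" using ZD[OF j] by blast
      note [measurable] = lin_measurable[OF e lin_X[OF this]]
      show "(\<lambda>\<omega>. p j z * exp (b * X \<epsilon> z \<omega> - b\<^sup>2 * K \<epsilon> z z / 2)) \<in> borel_measurable M" by measurable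
    qed
    show ?thesis unfolding G_def by measurable
  qed
  have Gprod: "ennreal (exp (- (\<Sum>i\<in>I. p (fst i) (snd i) * exp ((b * sqrt c) * t + 1 * (b * X \<epsilon> (snd i) (\<omega> (fst i))) - S' i i / 2)))) =
      (\<Prod>j\<in>J. G t j (\<omega> j))" for t \<omega>
  proof -
    have "(\<Sum>i\<in>I. p (fst i) (snd i) * exp ((b * sqrt c) * t + 1 * (b * X \<epsilon> (snd i) (\<omega> (fst i))) - S' i i / 2)) =
       (\<Sum>j\<in>J. \<Sum>z\<in>Z j. p j z * exp ((b * sqrt c) * t + 1 * (b * X \<epsilon> z (\<omega> j)) - (b\<^sup>2 * c + b\<^sup>2 * K \<epsilon> z z) / 2))"
      unfolding S'_def by (subst sig[symmetric]) simp
    also have "\<dots> = (\<Sum>j\<in>J. exp (b * sqrt c * t - b\<^sup>2 * c / 2) * (\<Sum>z\<in>Z j. p j z * exp (b * X \<epsilon> z (\<omega> j) - b\<^sup>2 * K \<epsilon> z z / 2)))"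
    proof (intro sum.cong refl)
      fix j
      have "exp ((b * sqrt c) * t + 1 * (b * X \<epsilon> z (\<omega> j)) - (b\<^sup>2 * c + b\<^sup>2 * K \<epsilon> z z) / 2) =
        exp (b * sqrt c * t - b\<^sup>2 * c / 2) * exp (b * X \<epsilon> z (\<omega> j) - b\<^sup>2 * K \<epsilon> z z / 2)" for z
        unfolding exp_add[symmetric] by (simp add: field_simps)
      thus "(\<Sum>z\<in>Z j. p j z * exp ((b * sqrt c) * t + 1 * (b * X \<epsilon> z (\<omega> j)) - (b\<^sup>2 * c + b\<^sup>2 * K \<epsilon> z z) / 2)) =
         exp (b * sqrt c * t - b\<^sup>2 * c / 2) * (\<Sum>z\<in>Z j. p j z * exp (b * X \<epsilon> z (\<omega> j) - b\<^sup>2 * K \<epsilon> z z / 2))"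
        by (simp only: sum_distrib_left mult_ac)
    qed
    finally show ?thesis unfolding G_def by (simp only: exp_minus_sum_prod[OF J])
  qed
  have Vm: "(\<lambda>\<omega>. ennreal (exp (- (\<Sum>i\<in>I. p (fst i) (snd i) * exp ((b * sqrt c) * fst \<omega> + 1 * (b * X \<epsilon> (snd i) (snd \<omega> (fst i))) - S' i i / 2)))))
      \<in> borel_measurable (std_normal_measure \<Otimes>\<^sub>M PiM J (\<lambda>_. M))"
  proof -
    have [measurable]: "(\<lambda>\<omega>. \<Sum>i\<in>I. p (fst i) (snd i) * exp ((b * sqrt c) * fst \<omega> + 1 * (b * X \<epsilon> (snd i) (snd \<omega> (fst i))) - S' i i / 2))
       \<in> borel_measurable (std_normal_measure \<Otimes>\<^sub>M PiM J (\<lambda>_. M))"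
    proof (rule borel_measurable_sum)
      fix i assume "i \<in> I"
      note [measurable] = gaussian_familyD(1)[OF V this]
      show "(\<lambda>\<omega>. p (fst i) (snd i) * exp ((b * sqrt c) * fst \<omega> + 1 * (b * X \<epsilon> (snd i) (snd \<omega> (fst i))) - S' i i / 2))
        \<in> borel_measurable (std_normal_measure \<Otimes>\<^sub>M PiM J (\<lambda>_. M))" by measurable
    qed
    show ?thesis by measurable
  qed
  have "(\<integral>\<^sup>+\<omega>. ennreal (exp (- (\<Sum>j\<in>J. \<Sum>z\<in>Z j. p j z * exp (b * X \<epsilon> z \<omega> - b\<^sup>2 * K \<epsilon> z z / 2)))) \<partial>M) =
      (\<integral>\<^sup>+\<omega>. ennreal (exp (- (\<Sum>i\<in>I. p (fst i) (snd i) * exp (b * X \<epsilon> (snd i) \<omega> - S i i / 2)))) \<partial>M)"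
    unfolding S_def by (subst sig[symmetric]) (rule refl)
  also have "\<dots> \<le> (\<integral>\<^sup>+\<omega>. ennreal (exp (- (\<Sum>i\<in>I. p (fst i) (snd i) * exp ((b * sqrt c) * fst \<omega> + 1 * (b * X \<epsilon> (snd i) (snd \<omega> (fst i))) - S' i i / 2))))
      \<partial>(std_normal_measure \<Otimes>\<^sub>M PiM J (\<lambda>_. M)))"
    by (rule kahane_inequality[OF I U V sym le p])
  also have "\<dots> = (\<integral>\<^sup>+t. \<integral>\<^sup>+\<omega>. (\<Prod>j\<in>J. G t j (\<omega> j)) \<partial>PiM J (\<lambda>_. M) \<partial>std_normal_measure)"
    by (subst PJ.nn_integral_fst[OF Vm, symmetric]) (simp only: fst_conv snd_conv Gprod)
  also have "\<dots> = (\<integral>\<^sup>+t. (\<Prod>j\<in>J. \<integral>\<^sup>+\<omega>. G t j \<omega> \<partial>M) \<partial>std_normal_measure)"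
    by (intro nn_integral_cong P.product_nn_integral_prod[OF J Gm])
  finally show ?thesis unfolding G_def .
qed

end

section \<open>Discretisation of the normalised mass\<close>

lemma abs_exp_minus_diff_le:
  fixes x y :: real
  assumes "0 \<le> x" "0 \<le> y"
  shows "\<bar>exp (- x) - exp (- y)\<bar> \<le> \<bar>x - y\<bar>"
proof -
  have *: "exp (- u) - exp (- v) \<le> v - u" if "0 \<le> u" "u \<le> v" for u v :: real
  proof -
    have "exp (- u) - exp (- v) = exp (- u) * (1 - exp (- (v - u)))" by (simp add: algebra_simps exp_add[symmetric])
    also have "\<dots> \<le> 1 * (v - u)"
    proof (rule mult_mono)
      show "1 - exp (- (v - u)) \<le> v - u" using exp_ge_add_one_self[of "- (v - u)"] by linarith
    qed (use that in auto)
    finally show ?thesis by simp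
  qed
  show ?thesis
  proof (cases "x \<le> y")
    case True
    hence "exp (- y) \<le> exp (- x)" by simp
    thus ?thesis using *[OF assms(1) True] True by simp
  next
    case False
    hence "exp (- x) \<le> exp (- y)" by simp
    thus ?thesis using *[of y x] assms False by simp
  qed
qed

text \<open>Simple functions converging to the identity, clamped to the box. Clamping is continuous
  and fixes the box, so convergence there survives; the finite ranges supply the points of the
  discretisation.\<close>

lemma simple_approx_cbox:
  fixes a a' :: "'d::euclidean_space"
  assumes ne: "cbox a a' \<noteq> {}"
  obtains s :: "nat \<Rightarrow> 'd \<Rightarrow> 'd" where "\<And>n. finite (range (s n))" "\<And>n. range (s n) \<subseteq> cbox a a'"
    "\<And>n. s n \<in> borel_measurable borel" "\<And>n. simple_function lborel (s n)" "\<And>y. y \<in> cbox a a' \<Longrightarrow> (\<lambda>n. s n y) \<longlonglongrightarrow> y"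
proof -
  have "(\<lambda>y. y) \<in> borel_measurable (lborel :: 'd measure)" by simp
  from borel_measurable_implies_sequence_metric[OF this, of 0] obtain F :: "nat \<Rightarrow> 'd \<Rightarrow> 'd"
    where F: "\<And>n. simple_function lborel (F n)" "\<And>y. (\<lambda>n. F n y) \<longlonglongrightarrow> y"
    by auto
  have ab: "\<And>i. i \<in> Basis \<Longrightarrow> a \<bullet> i \<le> a' \<bullet> i" using ne by (simp add: box_ne_empty)
  define s where "s n y = clamp a a' (F n y)" for n y
  show ?thesis
  proof
    fix n
    show "simple_function lborel (s n)" unfolding s_def[abs_def] using simple_function_compose1[OF F(1)] .
    from this show "finite (range (s n))" by (auto simp: simple_function_def)
    show "range (s n) \<subseteq> cbox a a'" using clamp_in_interval[OF ab] by (auto simp: s_def)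
    show "s n \<in> borel_measurable borel"
      using borel_measurable_simple_function[OF \<open>simple_function lborel (s n)\<close>] by simp
  next
    fix y assume y: "y \<in> cbox a a'"
    have "continuous_on UNIV (clamp a a')"
      using clamp_continuous_on[of a a' "\<lambda>x. x"] by simp
    hence "isCont (clamp a a') y" by (simp add: continuous_on_eq_continuous_at)
    from isCont_tendsto_compose[OF this F(2)] show "(\<lambda>n. s n y) \<longlonglongrightarrow> y"
      using clamp_cancel_cbox[OF y] by (simp add: s_def)
  qed
qed

context log_correlated_fields
begin

text \<open>The Wick exponential. Its mean is 1, the normalisation in which
  \<open>kahane_inequality\<close> compares fields.\<close>

definition wick :: "real \<Rightarrow> real \<Rightarrow> 'd \<Rightarrow> 'w \<Rightarrow> real" where
  "wick \<epsilon> b y \<omega> = exp (b * X \<epsilon> y \<omega> - b\<^sup>2 * K \<epsilon> y y / 2)"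

definition nmass :: "real \<Rightarrow> real \<Rightarrow> 'd set \<Rightarrow> 'w \<Rightarrow> real" where
  "nmass \<epsilon> b S \<omega> = (LINT y:S|lborel. wick \<epsilon> b y \<omega>)"

lemma wick_pos: "0 < wick \<epsilon> b y \<omega>" by (simp add: wick_def)

lemma nmass_nonneg: "0 \<le> nmass \<epsilon> b S \<omega>"
  unfolding nmass_def set_lebesgue_integral_def using wick_pos by (intro integral_nonneg_AE AE_I2) (simp add: less_imp_le)

lemma wick_eq: "wick \<epsilon> b y \<omega> = exp (b * X \<epsilon> y \<omega>) * exp (- (b\<^sup>2 * K \<epsilon> y y / 2))"
  unfolding wick_def exp_add[symmetric] by simp

lemma wick_expect:
  assumes "\<epsilon> \<in> {0<..1}" "y \<in> D"
  shows "has_bochner_integral M (wick \<epsilon> b y) 1"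
  using has_bochner_integral_mult_left[OF exp_field[OF assms, of b], of "exp (- (b\<^sup>2 * K \<epsilon> y y / 2))"]
  unfolding wick_eq exp_add[symmetric] by simp

lemma wick_expect2:
  assumes "\<epsilon> \<in> {0<..1}" "y \<in> D" "z \<in> D"
  shows "has_bochner_integral M (\<lambda>\<omega>. wick \<epsilon> b y \<omega> * wick \<epsilon> b z \<omega>) (exp (b\<^sup>2 * K \<epsilon> y z))"
proof -
  have "has_bochner_integral M (\<lambda>\<omega>. exp (b * X \<epsilon> y \<omega> + b * X \<epsilon> z \<omega>) * exp (- (b\<^sup>2 * K \<epsilon> y y / 2 + b\<^sup>2 * K \<epsilon> z z / 2)))
      (exp ((b\<^sup>2 * K \<epsilon> y y + b\<^sup>2 * K \<epsilon> z z + 2 * b * b * K \<epsilon> y z) / 2) * exp (- (b\<^sup>2 * K \<epsilon> y y / 2 + b\<^sup>2 * K \<epsilon> z z / 2)))"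
    by (rule has_bochner_integral_mult_left[OF exp_field2[OF assms]])
  moreover have "(b\<^sup>2 * K \<epsilon> y y + b\<^sup>2 * K \<epsilon> z z + 2 * b * b * K \<epsilon> y z) / 2 + - (b\<^sup>2 * K \<epsilon> y y / 2 + b\<^sup>2 * K \<epsilon> z z / 2) = b\<^sup>2 * K \<epsilon> y z"
    by (simp add: power2_eq_square field_simps)
  moreover have "exp (b * X \<epsilon> y \<omega> + b * X \<epsilon> z \<omega>) * exp (- (b\<^sup>2 * K \<epsilon> y y / 2 + b\<^sup>2 * K \<epsilon> z z / 2)) = wick \<epsilon> b y \<omega> * wick \<epsilon> b z \<omega>" for \<omega>
    unfolding wick_def exp_add[symmetric] by (simp add: algebra_simps)
  ultimately show ?thesis unfolding exp_add[symmetric] by simp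
qed

lemma composed_field_measurable:
  assumes e: "\<epsilon> \<in> {0<..1}" and \<pi>: "\<pi> \<in> borel_measurable borel" "\<And>y. \<pi> y \<in> D"
  shows "(\<lambda>p. X \<epsilon> (\<pi> (snd p)) (fst p)) \<in> borel_measurable (M \<Otimes>\<^sub>M lborel)"
proof -
  have "\<pi> \<in> measurable lborel (restrict_space lborel D)"
    by (rule measurable_restrict_space2) (use \<pi> in auto)
  hence pm: "(\<lambda>p. (fst p, \<pi> (snd p))) \<in> measurable (M \<Otimes>\<^sub>M lborel) (M \<Otimes>\<^sub>M restrict_space lborel D)"
    by (intro measurable_Pair measurable_fst measurable_compose[OF measurable_snd])
  show ?thesis using measurable_compose[OF pm field_measurable[OF e]] by (simp only: fst_conv snd_conv)
qed

lemma composed_wick_measurable: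
  assumes e: "\<epsilon> \<in> {0<..1}" and \<pi>: "\<pi> \<in> borel_measurable borel" "\<And>y. \<pi> y \<in> D"
  shows "(\<lambda>p. wick \<epsilon> b (\<pi> (snd p)) (fst p)) \<in> borel_measurable (M \<Otimes>\<^sub>M lborel)"
proof -
  note Xm = composed_field_measurable[OF e \<pi>]
  \<comment> \<open>The variance inside \<open>wick\<close> must be measurable in the point; it is,
    as the expectation of a jointly measurable square.\<close>
  have XX: "(\<lambda>p. X \<epsilon> (\<pi> (snd p)) (fst p) * X \<epsilon> (\<pi> (snd p)) (fst p)) \<in> borel_measurable (M \<Otimes>\<^sub>M lborel)"
    by (intro borel_measurable_times Xm)
  from measurable_pair_swap[OF this]
  have "(\<lambda>(y, \<omega>). X \<epsilon> (\<pi> y) \<omega> * X \<epsilon> (\<pi> y) \<omega>) \<in> borel_measurable (lborel \<Otimes>\<^sub>M M)"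
    by (simp add: case_prod_beta')
  hence "(\<lambda>y. \<integral>\<omega>. X \<epsilon> (\<pi> y) \<omega> * X \<epsilon> (\<pi> y) \<omega> \<partial>M) \<in> borel_measurable lborel"
    by (rule borel_measurable_lebesgue_integral)
  hence Km: "(\<lambda>y. K \<epsilon> (\<pi> y) (\<pi> y)) \<in> borel_measurable lborel" by (simp add: K_def)
  have "(\<lambda>p. K \<epsilon> (\<pi> (snd p)) (\<pi> (snd p))) \<in> borel_measurable (M \<Otimes>\<^sub>M lborel)"
    by (rule measurable_compose[OF measurable_snd Km])
  thus ?thesis unfolding wick_def
    by (intro measurable_compose[OF _ borel_measurable_exp] borel_measurable_diff borel_measurable_times
        borel_measurable_divide borel_measurable_const Xm)
qed

lemma wick_indicator_measurable:
  assumes e: "\<epsilon> \<in> {0<..1}" and S: "S \<in> sets borel" "S \<subseteq> D"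
  shows "(\<lambda>(\<omega>, y). indicator S y * wick \<epsilon> b y \<omega>) \<in> borel_measurable (M \<Otimes>\<^sub>M lborel)"
proof (cases "S = {}")
  case False
  then obtain x0 where x0: "x0 \<in> S" by auto
  define \<pi> where "\<pi> y = (if y \<in> S then y else x0)" for y
  have \<pi>: "\<pi> \<in> borel_measurable borel" "\<And>y. \<pi> y \<in> D"
    using x0 S unfolding \<pi>_def by auto
  have "(\<lambda>p. indicator S (snd p) * wick \<epsilon> b (\<pi> (snd p)) (fst p)) \<in> borel_measurable (M \<Otimes>\<^sub>M lborel)"
    using S(1) by (intro borel_measurable_times composed_wick_measurable[OF e \<pi>]
        measurable_compose[OF measurable_snd borel_measurable_indicator]) simp
  moreover have "indicator S y * wick \<epsilon> b (\<pi> y) \<omega> = indicator S y * wick \<epsilon> b y \<omega>" for \<omega> y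
    by (auto simp: indicator_def \<pi>_def)
  ultimately show ?thesis by (simp add: case_prod_beta')
qed simp

lemma nmass_expect:
  assumes e: "\<epsilon> \<in> {0<..1}" and S: "S \<in> sets borel" "S \<subseteq> B"
  shows "integrable M (nmass \<epsilon> b S)" and "(\<integral>\<omega>. nmass \<epsilon> b S \<omega> \<partial>M) = measure lborel S"
    and "AE \<omega> in M. set_integrable lborel S (\<lambda>y. wick \<epsilon> b y \<omega>)"
proof -
  have SD: "S \<subseteq> D" using S(2) B_subset_D by (rule order_trans)
  have h: "integrable M (wick \<epsilon> b y)" "(\<integral>\<omega>. wick \<epsilon> b y \<omega> \<partial>M) = 1" if "y \<in> S" for y
    using wick_expect[OF e, of y b] that SD by (auto simp: has_bochner_integral_iff)
  note F = fubini_set_integral[OF wick_indicator_measurable[OF e S(1) SD, of b] S(1) emeasure_subset_B[OF S]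
      less_imp_le[OF wick_pos] h(1) eq_refl[OF h(2)]]
  show "integrable M (nmass \<epsilon> b S)" unfolding nmass_def[abs_def] by (rule F(1))
  show "AE \<omega> in M. set_integrable lborel S (\<lambda>y. wick \<epsilon> b y \<omega>)" by (rule F(2))
  have "(\<integral>\<omega>. nmass \<epsilon> b S \<omega> \<partial>M) = (LINT y:S|lborel. \<integral>\<omega>. wick \<epsilon> b y \<omega> \<partial>M)"
    unfolding nmass_def by (rule F(4))
  also have "\<dots> = (LINT y:S|lborel. 1)"
    by (rule set_lebesgue_integral_cong) (use S h in auto)
  also have "\<dots> = measure lborel S" by (simp add: set_lebesgue_integral_def)
  finally show "(\<integral>\<omega>. nmass \<epsilon> b S \<omega> \<partial>M) = measure lborel S" .
qed

text \<open>For fixed \<open>\<epsilon>\<close> the argument of the logarithm stays away from 0, so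
  the covariance inherits continuity from \<open>g\<close>.\<close>

lemma K_tendsto:
  assumes e: "\<epsilon> \<in> {0<..1}" and s: "\<And>n. s n \<in> D" "\<And>n. t n \<in> D" and y: "y \<in> D" and lim: "s \<longlonglongrightarrow> y" "t \<longlonglongrightarrow> y"
  shows "(\<lambda>n. K \<epsilon> (s n) (t n)) \<longlonglongrightarrow> K \<epsilon> y y"
proof -
  have "(\<lambda>n. case (s n, t n) of (x, y) \<Rightarrow> g \<epsilon> x y) \<longlonglongrightarrow> (case (y, y) of (x, y) \<Rightarrow> g \<epsilon> x y)"
    by (rule continuous_on_tendsto_compose[OF g_cont[OF e]]) (use s y lim in \<open>auto intro!: tendsto_Pair\<close>)
  hence "(\<lambda>n. g \<epsilon> (s n) (t n)) \<longlonglongrightarrow> g \<epsilon> y y" by simp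
  moreover have "(\<lambda>n. - ln (norm (s n - t n) + \<epsilon>)) \<longlonglongrightarrow> - ln (norm (y - y) + \<epsilon>)"
    using e by (intro tendsto_intros lim) auto
  ultimately have "(\<lambda>n. - ln (norm (s n - t n) + \<epsilon>) + g \<epsilon> (s n) (t n)) \<longlonglongrightarrow> - ln (norm (y - y) + \<epsilon>) + g \<epsilon> y y"
    by (intro tendsto_add)
  thus ?thesis unfolding K_def covariance[OF e s(1) s(2)] covariance[OF e y y] .
qed

text \<open>The \<open>L\<^sup>1\<close> distance is at most the \<open>L\<^sup>2\<close> distance,
  which \<open>wick_expect2\<close> makes explicit. In \<open>nmass_discretize\<close> the latter
  gives pointwise convergence and the constant 2 gives domination.\<close>

lemma wick_L1_le:
  assumes e: "\<epsilon> \<in> {0<..1}" and y: "y \<in> D" and z: "z \<in> D"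
  shows "integrable M (\<lambda>\<omega>. \<bar>wick \<epsilon> b z \<omega> - wick \<epsilon> b y \<omega>\<bar>)"
    and "(\<integral>\<omega>. \<bar>wick \<epsilon> b z \<omega> - wick \<epsilon> b y \<omega>\<bar> \<partial>M) \<le> 2"
    and "(\<integral>\<omega>. \<bar>wick \<epsilon> b z \<omega> - wick \<epsilon> b y \<omega>\<bar> \<partial>M) \<le>
      sqrt (exp (b\<^sup>2 * K \<epsilon> z z) + exp (b\<^sup>2 * K \<epsilon> y y) - 2 * exp (b\<^sup>2 * K \<epsilon> z y))"
proof -
  have hz: "integrable M (wick \<epsilon> b z)" "(\<integral>\<omega>. wick \<epsilon> b z \<omega> \<partial>M) = 1" using wick_expect[OF e z, of b] by (auto simp: has_bochner_integral_iff)
  have hy: "integrable M (wick \<epsilon> b y)" "(\<integral>\<omega>. wick \<epsilon> b y \<omega> \<partial>M) = 1" using wick_expect[OF e y, of b] by (auto simp: has_bochner_integral_iff)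
  define G where "G \<omega> = \<bar>wick \<epsilon> b z \<omega> - wick \<epsilon> b y \<omega>\<bar>" for \<omega>
  show G: "integrable M (\<lambda>\<omega>. \<bar>wick \<epsilon> b z \<omega> - wick \<epsilon> b y \<omega>\<bar>)"
    by (intro integrable_abs Bochner_Integration.integrable_diff hz hy)
  have "(\<integral>\<omega>. \<bar>wick \<epsilon> b z \<omega> - wick \<epsilon> b y \<omega>\<bar> \<partial>M) \<le> (\<integral>\<omega>. wick \<epsilon> b z \<omega> + wick \<epsilon> b y \<omega> \<partial>M)"
  proof (rule integral_mono[OF G Bochner_Integration.integrable_add[OF hz(1) hy(1)]])
    fix \<omega> show "\<bar>wick \<epsilon> b z \<omega> - wick \<epsilon> b y \<omega>\<bar> \<le> wick \<epsilon> b z \<omega> + wick \<epsilon> b y \<omega>"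
      using wick_pos[of \<epsilon> b z \<omega>] wick_pos[of \<epsilon> b y \<omega>] by linarith
  qed
  also have "\<dots> = 2" using hz hy by simp
  finally show "(\<integral>\<omega>. \<bar>wick \<epsilon> b z \<omega> - wick \<epsilon> b y \<omega>\<bar> \<partial>M) \<le> 2" .
  have "has_bochner_integral M (\<lambda>\<omega>. wick \<epsilon> b z \<omega> * wick \<epsilon> b z \<omega> + wick \<epsilon> b y \<omega> * wick \<epsilon> b y \<omega> - 2 * (wick \<epsilon> b z \<omega> * wick \<epsilon> b y \<omega>))
     (exp (b\<^sup>2 * K \<epsilon> z z) + exp (b\<^sup>2 * K \<epsilon> y y) - 2 * exp (b\<^sup>2 * K \<epsilon> z y))"
    by (intro has_bochner_integral_add has_bochner_integral_diff has_bochner_integral_mult_right wick_expect2 e y z)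
  moreover have "wick \<epsilon> b z \<omega> * wick \<epsilon> b z \<omega> + wick \<epsilon> b y \<omega> * wick \<epsilon> b y \<omega> - 2 * (wick \<epsilon> b z \<omega> * wick \<epsilon> b y \<omega>) = (G \<omega>)\<^sup>2" for \<omega>
    unfolding G_def power2_abs by (simp add: power2_eq_square algebra_simps)
  ultimately have G2: "integrable M (\<lambda>\<omega>. (G \<omega>)\<^sup>2)"
    "(\<integral>\<omega>. (G \<omega>)\<^sup>2 \<partial>M) = exp (b\<^sup>2 * K \<epsilon> z z) + exp (b\<^sup>2 * K \<epsilon> y y) - 2 * exp (b\<^sup>2 * K \<epsilon> z y)"
    by (simp_all add: has_bochner_integral_iff)
  have G1: "integrable M G" unfolding G_def by (rule G)
  have "(\<integral>\<omega>. G \<omega> \<partial>M)\<^sup>2 \<le> (\<integral>\<omega>. (G \<omega>)\<^sup>2 \<partial>M)"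
    using variance_eq[OF G1 G2(1)] variance_positive[of G] by linarith
  hence "(\<integral>\<omega>. G \<omega> \<partial>M) \<le> sqrt (\<integral>\<omega>. (G \<omega>)\<^sup>2 \<partial>M)" by (rule real_le_rsqrt)
  hence "(\<integral>\<omega>. G \<omega> \<partial>M) \<le> sqrt (exp (b\<^sup>2 * K \<epsilon> z z) + exp (b\<^sup>2 * K \<epsilon> y y) - 2 * exp (b\<^sup>2 * K \<epsilon> z y))"
    by (simp only: G2(2))
  thus "(\<integral>\<omega>. \<bar>wick \<epsilon> b z \<omega> - wick \<epsilon> b y \<omega>\<bar> \<partial>M) \<le>
      sqrt (exp (b\<^sup>2 * K \<epsilon> z z) + exp (b\<^sup>2 * K \<epsilon> y y) - 2 * exp (b\<^sup>2 * K \<epsilon> z y))"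
    by (simp only: G_def)
qed

lemma nmass_simple:
  assumes Q: "Q \<in> sets borel" "Q \<subseteq> B" and s: "finite (range s)" "s \<in> borel_measurable borel"
  shows "(LINT y:Q|lborel. wick \<epsilon> b (s y) \<omega>) = (\<Sum>z\<in>range s. measure lborel (Q \<inter> s -` {z}) * wick \<epsilon> b z \<omega>)"
proof -
  have sz: "Q \<inter> s -` {z} \<in> sets borel" "emeasure lborel (Q \<inter> s -` {z}) < \<infinity>" for z
  proof -
    have "s -` {z} \<in> sets borel" using measurable_sets[OF s(2), of "{z}"] by simp
    thus "Q \<inter> s -` {z} \<in> sets borel" using Q by auto
    thus "emeasure lborel (Q \<inter> s -` {z}) < \<infinity>" using Q by (intro emeasure_subset_B) auto
  qed
  have "indicator Q y *\<^sub>R wick \<epsilon> b (s y) \<omega> = (\<Sum>z\<in>range s. indicator (Q \<inter> s -` {z}) y * wick \<epsilon> b z \<omega>)" for y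
  proof -
    have "(\<Sum>z\<in>range s. indicator (Q \<inter> s -` {z}) y * wick \<epsilon> b z \<omega>) = (\<Sum>z\<in>range s. if z = s y then indicator Q y * wick \<epsilon> b z \<omega> else 0)"
      by (intro sum.cong refl) (auto simp: indicator_def)
    also have "\<dots> = indicator Q y * wick \<epsilon> b (s y) \<omega>" using s(1) by (subst sum.delta) auto
    finally show ?thesis by simp
  qed
  hence "(LINT y:Q|lborel. wick \<epsilon> b (s y) \<omega>) = (\<integral>y. (\<Sum>z\<in>range s. indicator (Q \<inter> s -` {z}) y * wick \<epsilon> b z \<omega>) \<partial>lborel)"
    by (simp only: set_lebesgue_integral_def)
  also have "\<dots> = (\<Sum>z\<in>range s. \<integral>y. indicator (Q \<inter> s -` {z}) y * wick \<epsilon> b z \<omega> \<partial>lborel)"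
    by (intro Bochner_Integration.integral_sum integrable_mult_left integrable_real_indicator) (use sz in auto)
  also have "\<dots> = (\<Sum>z\<in>range s. measure lborel (Q \<inter> s -` {z}) * wick \<epsilon> b z \<omega>)"
    by (intro sum.cong refl) simp
  finally show ?thesis .
qed


text \<open>Replacing \<open>y\<close> by a simple approximation turns the spatial integral into a
  finite sum, weighted by the volumes of the level sets. The mean error is at most the spatial
  integral of the \<open>L\<^sup>1\<close> distances, which vanishes by dominated
  convergence.\<close>

lemma nmass_discretize:
  assumes e: "\<epsilon> \<in> {0<..1}" and Q: "cbox a a' \<subseteq> B" "cbox a a' \<noteq> {}"
  obtains Z :: "nat \<Rightarrow> 'd set" and p :: "nat \<Rightarrow> 'd \<Rightarrow> real"
  where "\<And>n. finite (Z n)" "\<And>n. Z n \<subseteq> cbox a a'" "\<And>n z. 0 \<le> p n z"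
    and "\<And>n. integrable M (\<lambda>\<omega>. \<bar>(\<Sum>z\<in>Z n. p n z * wick \<epsilon> b z \<omega>) - nmass \<epsilon> b (cbox a a') \<omega>\<bar>)"
    and "(\<lambda>n. \<integral>\<omega>. \<bar>(\<Sum>z\<in>Z n. p n z * wick \<epsilon> b z \<omega>) - nmass \<epsilon> b (cbox a a') \<omega>\<bar> \<partial>M) \<longlonglongrightarrow> 0"
proof -
  define Q where "Q = cbox a a'"
  have QB: "Q \<in> sets borel" "Q \<subseteq> B" using Q by (auto simp: Q_def)
  have QD: "y \<in> D" if "y \<in> Q" for y using that QB B_subset_D by blast
  obtain s :: "nat \<Rightarrow> 'd \<Rightarrow> 'd" where s: "\<And>n. finite (range (s n))" "\<And>n. range (s n) \<subseteq> Q"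
    "\<And>n. s n \<in> borel_measurable borel" and s_simple: "\<And>n. simple_function lborel (s n)"
    and s_lim: "\<And>y. y \<in> Q \<Longrightarrow> (\<lambda>n. s n y) \<longlonglongrightarrow> y"
  proof (rule simple_approx_cbox[OF Q(2), folded Q_def])
    fix s :: "nat \<Rightarrow> 'd \<Rightarrow> 'd"
    assume *: "\<And>n. finite (range (s n))" "\<And>n. range (s n) \<subseteq> Q" "\<And>n. s n \<in> borel_measurable borel"
      "\<And>n. simple_function lborel (s n)" "\<And>y. y \<in> Q \<Longrightarrow> (\<lambda>n. s n y) \<longlonglongrightarrow> y"
    show thesis by (rule that[OF *])
  qed
  have sD: "s n y \<in> D" for n y using s(2)[of n] QD by blast
  define p where "p n z = measure lborel (Q \<inter> s n -` {z})" for n z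
  define W where "W n \<omega> = (\<Sum>z\<in>range (s n). p n z * wick \<epsilon> b z \<omega>)" for n \<omega>
  have W_eq: "W n \<omega> = (LINT y:Q|lborel. wick \<epsilon> b (s n y) \<omega>)" for n \<omega>
    unfolding W_def p_def nmass_simple[OF QB s(1,3)] ..
  define G where "G n \<omega> y = \<bar>wick \<epsilon> b (s n y) \<omega> - wick \<epsilon> b y \<omega>\<bar>" for n \<omega> y
  have Gm: "(\<lambda>(\<omega>, y). indicator Q y * G n \<omega> y) \<in> borel_measurable (M \<Otimes>\<^sub>M lborel)" for n
  proof -
    have eq: "(\<lambda>(\<omega>, y). indicator Q y * G n \<omega> y) =
        (\<lambda>p. \<bar>indicator Q (snd p) * wick \<epsilon> b (s n (snd p)) (fst p) - indicator Q (snd p) * wick \<epsilon> b (snd p) (fst p)\<bar>)"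
      by (auto simp: G_def indicator_def)
    have m1: "(\<lambda>p. indicator Q (snd p) * wick \<epsilon> b (s n (snd p)) (fst p)) \<in> borel_measurable (M \<Otimes>\<^sub>M lborel)"
      using QB(1) by (intro borel_measurable_times composed_wick_measurable[OF e s(3) sD]
          measurable_compose[OF measurable_snd borel_measurable_indicator]) simp
    have QD': "Q \<subseteq> D" using QD by blast
    have m2: "(\<lambda>p. indicator Q (snd p) * wick \<epsilon> b (snd p) (fst p)) \<in> borel_measurable (M \<Otimes>\<^sub>M lborel)"
      using wick_indicator_measurable[OF e QB(1) QD', of b] by (simp add: case_prod_beta')
    show ?thesis unfolding eq by (intro borel_measurable_abs borel_measurable_diff m1 m2)
  qed
  note L1 = wick_L1_le[OF e QD sD, of _ b]
  have G_nn: "0 \<le> G n \<omega> y" for n \<omega> y by (simp add: G_def)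
  have Gi: "integrable M (\<lambda>\<omega>. G n \<omega> y)" if "y \<in> Q" for n y unfolding G_def by (rule L1(1)[OF that])
  have Gle: "(\<integral>\<omega>. G n \<omega> y \<partial>M) \<le> 2" if "y \<in> Q" for n y unfolding G_def by (rule L1(2)[OF that])
  note em = emeasure_subset_B[OF QB]
  have F': "integrable M (\<lambda>\<omega>. LINT y:Q|lborel. G n \<omega> y)"
    "AE \<omega> in M. set_integrable lborel Q (G n \<omega>)"
    "(\<integral>\<omega>. (LINT y:Q|lborel. G n \<omega> y) \<partial>M) = (LINT y:Q|lborel. \<integral>\<omega>. G n \<omega> y \<partial>M)"
    "set_integrable lborel Q (\<lambda>y. \<integral>\<omega>. G n \<omega> y \<partial>M)" for n
    using fubini_set_integral[where f = "G n" and c = 2, OF Gm QB(1) em G_nn Gi Gle] by blast+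
  have wi: "AE \<omega> in M. set_integrable lborel Q (\<lambda>y. wick \<epsilon> b y \<omega>)" by (rule nmass_expect(3)[OF e QB])
  have si: "set_integrable lborel Q (\<lambda>y. wick \<epsilon> b (s n y) \<omega>)" for n \<omega>
  proof -
    have m: "(\<lambda>y. wick \<epsilon> b (s n y) \<omega>) \<in> borel_measurable lborel"
      by (rule borel_measurable_simple_function[OF simple_function_compose1[OF s_simple]])
    obtain c where c: "\<And>y. \<bar>wick \<epsilon> b (s n y) \<omega>\<bar> \<le> c"
    proof -
      have "finite ((\<lambda>z. \<bar>wick \<epsilon> b z \<omega>\<bar>) ` range (s n))" using s(1) by simp
      hence "\<bar>wick \<epsilon> b (s n y) \<omega>\<bar> \<le> Max ((\<lambda>z. \<bar>wick \<epsilon> b z \<omega>\<bar>) ` range (s n))" for y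
        by (rule Max_ge) simp
      thus thesis by (rule that)
    qed
    show ?thesis unfolding set_integrable_def
    proof (rule Bochner_Integration.integrable_bound)
      show "integrable lborel (\<lambda>y. indicator Q y * c)"
        using emeasure_subset_B[OF QB] QB by (intro integrable_mult_left integrable_real_indicator) auto
      show "(\<lambda>y. indicator Q y *\<^sub>R wick \<epsilon> b (s n y) \<omega>) \<in> borel_measurable lborel"
        using m QB(1) by (intro borel_measurable_scaleR) simp_all
      show "AE y in lborel. norm (indicator Q y *\<^sub>R wick \<epsilon> b (s n y) \<omega>) \<le> norm (indicator Q y * c)"
      proof (rule AE_I2)
        fix y
        have "\<bar>wick \<epsilon> b (s n y) \<omega>\<bar> \<le> \<bar>c\<bar>" using c[of y] by linarith
        thus "norm (indicator Q y *\<^sub>R wick \<epsilon> b (s n y) \<omega>) \<le> norm (indicator Q y * c)"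
          by (simp add: indicator_def)
      qed
    qed
  qed
  have le: "AE \<omega> in M. \<bar>W n \<omega> - nmass \<epsilon> b Q \<omega>\<bar> \<le> (LINT y:Q|lborel. G n \<omega> y)" for n
    using wi F'(2)[of n]
  proof eventually_elim
    case (elim \<omega>)
    have "W n \<omega> - nmass \<epsilon> b Q \<omega> = (LINT y:Q|lborel. wick \<epsilon> b (s n y) \<omega> - wick \<epsilon> b y \<omega>)"
      unfolding W_eq nmass_def by (rule set_integral_diff(2)[symmetric, OF si elim(1)])
    also have "\<bar>\<dots>\<bar> \<le> (LINT y:Q|lborel. G n \<omega> y)"
      unfolding set_lebesgue_integral_def
      by (rule order_trans[OF integral_abs_bound]) (simp add: G_def abs_mult)
    finally show ?case .
  qed
  have Wm: "(\<lambda>\<omega>. \<bar>W n \<omega> - nmass \<epsilon> b Q \<omega>\<bar>) \<in> borel_measurable M" for n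
  proof -
    have "W n \<in> borel_measurable M" unfolding W_def
    proof (intro borel_measurable_sum borel_measurable_times borel_measurable_const)
      fix z assume "z \<in> range (s n)"
      thus "wick \<epsilon> b z \<in> borel_measurable M"
        using wick_expect[OF e, of z b] sD by (auto simp: has_bochner_integral_iff intro: borel_measurable_integrable)
    qed
    thus ?thesis
      by (intro borel_measurable_abs borel_measurable_diff borel_measurable_integrable[OF nmass_expect(1)[OF e QB]])
  qed
  have nn: "AE \<omega> in M. 0 \<le> \<bar>W n \<omega> - nmass \<epsilon> b Q \<omega>\<bar>" for n by simp
  note sw = integrable_sandwich[OF F'(1) Wm nn le]
  have lim: "(\<lambda>n. LINT y:Q|lborel. \<integral>\<omega>. G n \<omega> y \<partial>M) \<longlonglongrightarrow> (\<integral>y. 0 \<partial>(lborel :: 'd measure))"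
    unfolding set_lebesgue_integral_def
  proof (rule integral_dominated_convergence[where w = "\<lambda>y. indicator Q y * 2"])
    show "integrable lborel (\<lambda>y. indicator Q y * 2 :: real)"
      using emeasure_subset_B[OF QB] QB by (intro integrable_mult_left integrable_real_indicator) auto
    show "(\<lambda>y. indicator Q y *\<^sub>R (\<integral>\<omega>. G n \<omega> y \<partial>M)) \<in> borel_measurable lborel" for n
      using F'(4)[of n] unfolding set_integrable_def by (rule borel_measurable_integrable)
    have G0: "0 \<le> (\<integral>\<omega>. G n \<omega> y \<partial>M)" for n y by (intro integral_nonneg_AE AE_I2) (simp add: G_def)
    show "AE y in lborel. norm (indicator Q y *\<^sub>R (\<integral>\<omega>. G n \<omega> y \<partial>M)) \<le> indicator Q y * 2" for n
      using Gle G0 by (intro AE_I2) (simp add: indicator_def)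
    show "AE y in lborel. (\<lambda>n. indicator Q y *\<^sub>R (\<integral>\<omega>. G n \<omega> y \<partial>M)) \<longlonglongrightarrow> 0"
    proof (rule AE_I2)
      fix y :: 'd
      show "(\<lambda>n. indicator Q y *\<^sub>R (\<integral>\<omega>. G n \<omega> y \<partial>M)) \<longlonglongrightarrow> 0"
      proof (cases "y \<in> Q")
        case True
        define \<rho> where "\<rho> n = sqrt (exp (b\<^sup>2 * K \<epsilon> (s n y) (s n y)) + exp (b\<^sup>2 * K \<epsilon> y y) - 2 * exp (b\<^sup>2 * K \<epsilon> (s n y) y))" for n
        have "\<rho> \<longlonglongrightarrow> sqrt (exp (b\<^sup>2 * K \<epsilon> y y) + exp (b\<^sup>2 * K \<epsilon> y y) - 2 * exp (b\<^sup>2 * K \<epsilon> y y))"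
          unfolding \<rho>_def
          by (intro tendsto_intros K_tendsto[OF e sD sD] K_tendsto[OF e sD QD[OF True]] QD[OF True] s_lim[OF True])
        hence \<rho>: "\<rho> \<longlonglongrightarrow> 0" by simp
        have "(\<lambda>n. \<integral>\<omega>. G n \<omega> y \<partial>M) \<longlonglongrightarrow> 0"
        proof (rule tendsto_sandwich[OF _ _ tendsto_const \<rho>])
          show "\<forall>\<^sub>F n in sequentially. 0 \<le> (\<integral>\<omega>. G n \<omega> y \<partial>M)" using G0 by simp
          show "\<forall>\<^sub>F n in sequentially. (\<integral>\<omega>. G n \<omega> y \<partial>M) \<le> \<rho> n"
            using L1(3)[OF True] unfolding G_def \<rho>_def by simp
        qed
        thus ?thesis using True by simp
      qed simp
    qed
  qed simp
  have "(\<lambda>n. \<integral>\<omega>. \<bar>W n \<omega> - nmass \<epsilon> b Q \<omega>\<bar> \<partial>M) \<longlonglongrightarrow> 0"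
  proof (rule tendsto_sandwich[OF _ _ tendsto_const])
    show "(\<lambda>n. LINT y:Q|lborel. \<integral>\<omega>. G n \<omega> y \<partial>M) \<longlonglongrightarrow> 0" using lim by simp
    show "\<forall>\<^sub>F n in sequentially. (\<integral>\<omega>. \<bar>W n \<omega> - nmass \<epsilon> b Q \<omega>\<bar> \<partial>M) \<le> (LINT y:Q|lborel. \<integral>\<omega>. G n \<omega> y \<partial>M)"
      using sw(2) F'(3) by simp
    show "\<forall>\<^sub>F n in sequentially. 0 \<le> (\<integral>\<omega>. \<bar>W n \<omega> - nmass \<epsilon> b Q \<omega>\<bar> \<partial>M)" by simp
  qed
  thus thesis
    using that[of "\<lambda>n. range (s n)" p] s(1,2) sw(1) unfolding W_def Q_def[symmetric] by (simp add: p_def)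
qed

end

lemma (in prob_space) laplace_diff_le:
  fixes V W :: "'a \<Rightarrow> real"
  assumes [measurable]: "V \<in> borel_measurable M" "W \<in> borel_measurable M"
    and nn: "\<And>\<omega>. 0 \<le> V \<omega>" "\<And>\<omega>. 0 \<le> W \<omega>" and int: "integrable M (\<lambda>\<omega>. \<bar>V \<omega> - W \<omega>\<bar>)" and \<kappa>: "0 \<le> \<kappa>"
  shows "\<bar>(\<integral>\<omega>. exp (- (\<kappa> * V \<omega>)) \<partial>M) - (\<integral>\<omega>. exp (- (\<kappa> * W \<omega>)) \<partial>M)\<bar> \<le> \<kappa> * (\<integral>\<omega>. \<bar>V \<omega> - W \<omega>\<bar> \<partial>M)"
proof -
  have V: "integrable M (\<lambda>\<omega>. exp (- (\<kappa> * V \<omega>)))" and W: "integrable M (\<lambda>\<omega>. exp (- (\<kappa> * W \<omega>)))"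
    using nn \<kappa> by (intro integrable_const_bound[of _ 1]; simp)+
  have "\<bar>(\<integral>\<omega>. exp (- (\<kappa> * V \<omega>)) \<partial>M) - (\<integral>\<omega>. exp (- (\<kappa> * W \<omega>)) \<partial>M)\<bar> =
      \<bar>\<integral>\<omega>. exp (- (\<kappa> * V \<omega>)) - exp (- (\<kappa> * W \<omega>)) \<partial>M\<bar>"
    using V W by simp
  also have "\<dots> \<le> (\<integral>\<omega>. \<bar>exp (- (\<kappa> * V \<omega>)) - exp (- (\<kappa> * W \<omega>))\<bar> \<partial>M)" by (rule integral_abs_bound)
  also have "\<dots> \<le> (\<integral>\<omega>. \<kappa> * \<bar>V \<omega> - W \<omega>\<bar> \<partial>M)"
  proof (rule integral_mono)
    show "integrable M (\<lambda>\<omega>. \<bar>exp (- (\<kappa> * V \<omega>)) - exp (- (\<kappa> * W \<omega>))\<bar>)" using V W by (intro integrable_abs Bochner_Integration.integrable_diff)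
    show "integrable M (\<lambda>\<omega>. \<kappa> * \<bar>V \<omega> - W \<omega>\<bar>)" using int by (rule integrable_mult_right)
    fix \<omega>
    have "\<bar>exp (- (\<kappa> * V \<omega>)) - exp (- (\<kappa> * W \<omega>))\<bar> \<le> \<bar>\<kappa> * V \<omega> - \<kappa> * W \<omega>\<bar>"
      using nn \<kappa> by (intro abs_exp_minus_diff_le mult_nonneg_nonneg) auto
    also have "\<dots> = \<kappa> * \<bar>V \<omega> - W \<omega>\<bar>" using \<kappa> by (simp add: right_diff_distrib[symmetric] abs_mult)
    finally show "\<bar>exp (- (\<kappa> * V \<omega>)) - exp (- (\<kappa> * W \<omega>))\<bar> \<le> \<kappa> * \<bar>V \<omega> - W \<omega>\<bar>" .
  qed
  also have "\<dots> = \<kappa> * (\<integral>\<omega>. \<bar>V \<omega> - W \<omega>\<bar> \<partial>M)" by simp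
  finally show ?thesis .
qed

lemma (in prob_space) nn_integral_bounded:
  fixes f :: "'a \<Rightarrow> real"
  assumes "f \<in> borel_measurable M" "\<And>\<omega>. 0 \<le> f \<omega>" "\<And>\<omega>. f \<omega> \<le> 1"
  shows "(\<integral>\<^sup>+\<omega>. ennreal (f \<omega>) \<partial>M) = ennreal (\<integral>\<omega>. f \<omega> \<partial>M)" "integrable M f"
    "0 \<le> (\<integral>\<omega>. f \<omega> \<partial>M)" "(\<integral>\<omega>. f \<omega> \<partial>M) \<le> 1"
proof -
  show i: "integrable M f" using assms by (intro integrable_const_bound[of _ 1]) auto
  show "(\<integral>\<^sup>+\<omega>. ennreal (f \<omega>) \<partial>M) = ennreal (\<integral>\<omega>. f \<omega> \<partial>M)"
    by (rule nn_integral_eq_integral[OF i]) (use assms in simp)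
  show "0 \<le> (\<integral>\<omega>. f \<omega> \<partial>M)" using assms(2) by (intro integral_nonneg_AE) simp
  have "(\<integral>\<omega>. f \<omega> \<partial>M) \<le> (\<integral>\<omega>. 1 \<partial>M)" by (rule integral_mono[OF i]) (use assms in auto)
  thus "(\<integral>\<omega>. f \<omega> \<partial>M) \<le> 1" by (simp add: prob_space)
qed

context log_correlated_fields
begin

text \<open>Kahane's inequality for the Laplace transform of the total mass of finitely many boxes;
  the passage from finite sums uses that the field is continuous in \<open>L\<^sup>2\<close>.\<close>

lemma continuum_kahane:
  fixes a a' :: "'j \<Rightarrow> 'd"
  assumes e: "\<epsilon> \<in> {0<..1}" and J: "finite J"
    and Q: "\<And>j. j \<in> J \<Longrightarrow> cbox (a j) (a' j) \<subseteq> B" "\<And>j. j \<in> J \<Longrightarrow> cbox (a j) (a' j) \<noteq> {}" and c: "0 \<le> c"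
    and cross: "\<And>j k x y. j \<in> J \<Longrightarrow> k \<in> J \<Longrightarrow> j \<noteq> k \<Longrightarrow> x \<in> cbox (a j) (a' j) \<Longrightarrow> y \<in> cbox (a k) (a' k) \<Longrightarrow> K \<epsilon> x y \<le> c"
    and lam: "0 \<le> lam"
  shows "(\<integral>\<omega>. exp (- (lam * (\<Sum>j\<in>J. nmass \<epsilon> b (cbox (a j) (a' j)) \<omega>))) \<partial>M) \<le>
    (\<integral>t. (\<Prod>j\<in>J. \<integral>\<omega>. exp (- (lam * exp (b * sqrt c * t - b\<^sup>2 * c / 2) * nmass \<epsilon> b (cbox (a j) (a' j)) \<omega>)) \<partial>M) \<partial>std_normal_measure)"
proof -
  interpret Nm: prob_space std_normal_measure by (rule prob_space_std_normal)
  define W where "W j = nmass \<epsilon> b (cbox (a j) (a' j))" for j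
  define P where "P j Z p \<longleftrightarrow> (\<forall>n. finite (Z n) \<and> Z n \<subseteq> cbox (a j) (a' j) \<and> (\<forall>z. 0 \<le> p n z) \<and>
      integrable M (\<lambda>\<omega>. \<bar>(\<Sum>z\<in>Z n. p n z * wick \<epsilon> b z \<omega>) - W j \<omega>\<bar>)) \<and>
      (\<lambda>n. \<integral>\<omega>. \<bar>(\<Sum>z\<in>Z n. p n z * wick \<epsilon> b z \<omega>) - W j \<omega>\<bar> \<partial>M) \<longlonglongrightarrow> 0"
    for j and Z :: "nat \<Rightarrow> 'd set" and p :: "nat \<Rightarrow> 'd \<Rightarrow> real"
  have ex: "\<exists>Zp. P j (fst Zp) (snd Zp)" if j: "j \<in> J" for j
  proof (rule nmass_discretize[OF e Q(1)[OF j] Q(2)[OF j], of b])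
    fix Z :: "nat \<Rightarrow> 'd set" and p :: "nat \<Rightarrow> 'd \<Rightarrow> real"
    assume *: "\<And>n. finite (Z n)" "\<And>n. Z n \<subseteq> cbox (a j) (a' j)" "\<And>n z. 0 \<le> p n z"
      "\<And>n. integrable M (\<lambda>\<omega>. \<bar>(\<Sum>z\<in>Z n. p n z * wick \<epsilon> b z \<omega>) - nmass \<epsilon> b (cbox (a j) (a' j)) \<omega>\<bar>)"
      "(\<lambda>n. \<integral>\<omega>. \<bar>(\<Sum>z\<in>Z n. p n z * wick \<epsilon> b z \<omega>) - nmass \<epsilon> b (cbox (a j) (a' j)) \<omega>\<bar> \<partial>M) \<longlonglongrightarrow> 0"
    have "P j (fst (Z, p)) (snd (Z, p))" unfolding P_def W_def fst_conv snd_conv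
      by (intro conjI allI *)
    thus ?thesis by (rule exI)
  qed
  define Zp where "Zp j = (SOME Zp. P j (fst Zp) (snd Zp))" for j
  \<comment> \<open>The weights are set to 0 outside \<open>J\<close>, because
    \<open>block_kahane\<close> asks for nonnegativity at every index.\<close>
  define Z p where "Z j n = fst (Zp j) n" and "p j n z = (if j \<in> J then snd (Zp j) n z else 0)" for j n z
  have PZ: "P j (Z j) (p j)" if j: "j \<in> J" for j
  proof -
    have "P j (fst (Zp j)) (snd (Zp j))" unfolding Zp_def using someI_ex[OF ex[OF j]] .
    moreover have "Z j = fst (Zp j)" "p j = snd (Zp j)" using j by (auto simp: Z_def p_def fun_eq_iff)
    ultimately show ?thesis by simp
  qed
  define V where "V j n \<omega> = (\<Sum>z\<in>Z j n. p j n z * wick \<epsilon> b z \<omega>)" for j n \<omega>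
  have Zfin: "finite (Z j n)" and ZQ: "Z j n \<subseteq> cbox (a j) (a' j)" and p0: "0 \<le> p j n z"
    and Vint: "integrable M (\<lambda>\<omega>. \<bar>V j n \<omega> - W j \<omega>\<bar>)" if "j \<in> J" for j n z
    using PZ[OF that] unfolding P_def V_def by blast+
  have Vlim: "(\<lambda>n. \<integral>\<omega>. \<bar>V j n \<omega> - W j \<omega>\<bar> \<partial>M) \<longlonglongrightarrow> 0" if "j \<in> J" for j
    using PZ[OF that] unfolding P_def V_def by blast
  have ZD: "Z j n \<subseteq> D" if "j \<in> J" for j n using ZQ[OF that] Q(1)[OF that] B_subset_D by (meson order_trans)
  have Vm: "V j n \<in> borel_measurable M" if j: "j \<in> J" for j n
    unfolding V_def
  proof (intro borel_measurable_sum borel_measurable_times borel_measurable_const)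
    fix z assume "z \<in> Z j n"
    hence "z \<in> D" using ZD[OF j] by blast
    from wick_expect[OF e this, of b] have "integrable M (wick \<epsilon> b z)" by (simp only: has_bochner_integral_iff)
    thus "wick \<epsilon> b z \<in> borel_measurable M" by (rule borel_measurable_integrable)
  qed
  have Wm: "W j \<in> borel_measurable M" if "j \<in> J" for j
    unfolding W_def by (rule borel_measurable_integrable[OF nmass_expect(1)[OF e _ Q(1)[OF that]]]) simp
  have V0: "0 \<le> V j n \<omega>" for j n \<omega>
  proof -
    have "0 \<le> p j n z" for z using p0[of j n z] by (cases "j \<in> J") (auto simp: p_def)
    thus ?thesis unfolding V_def by (intro sum_nonneg mult_nonneg_nonneg less_imp_le[OF wick_pos])
  qed
  have W0: "0 \<le> W j \<omega>" for j \<omega> unfolding W_def by (rule nmass_nonneg)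
  define \<kappa> where "\<kappa> t = lam * exp (b * sqrt c * t - b\<^sup>2 * c / 2)" for t
  have \<kappa>0: "0 \<le> \<kappa> t" for t using lam by (simp add: \<kappa>_def)
  define \<phi> where "\<phi> Y t = (\<integral>\<omega>. exp (- (\<kappa> t * Y \<omega>)) \<partial>M)" for Y t
  have \<phi>01: "0 \<le> \<phi> Y t" "\<phi> Y t \<le> 1" "(\<integral>\<^sup>+\<omega>. ennreal (exp (- (\<kappa> t * Y \<omega>))) \<partial>M) = ennreal (\<phi> Y t)"
    if "Y \<in> borel_measurable M" "\<And>\<omega>. 0 \<le> Y \<omega>" for Y t
  proof -
    note [measurable] = that(1)
    have "(\<lambda>\<omega>. exp (- (\<kappa> t * Y \<omega>))) \<in> borel_measurable M" by measurable
    from nn_integral_bounded[OF this] show "0 \<le> \<phi> Y t" "\<phi> Y t \<le> 1" "(\<integral>\<^sup>+\<omega>. ennreal (exp (- (\<kappa> t * Y \<omega>))) \<partial>M) = ennreal (\<phi> Y t)"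
      using that(2) \<kappa>0 by (simp_all add: \<phi>_def)
  qed
  have \<phi>m: "\<phi> Y \<in> borel_measurable std_normal_measure" if "Y \<in> borel_measurable M" for Y
  proof -
    note [measurable] = that
    have "(\<lambda>(t, \<omega>). exp (- (\<kappa> t * Y \<omega>))) \<in> borel_measurable (std_normal_measure \<Otimes>\<^sub>M M)"
      unfolding \<kappa>_def by measurable
    thus ?thesis unfolding \<phi>_def by (rule borel_measurable_lebesgue_integral)
  qed
  define A where "A n = (\<integral>\<omega>. exp (- (lam * (\<Sum>j\<in>J. V j n \<omega>))) \<partial>M)" for n
  define R where "R n = (\<integral>t. (\<Prod>j\<in>J. \<phi> (V j n) t) \<partial>std_normal_measure)" for n
  have sumVm: "(\<lambda>\<omega>. \<Sum>j\<in>J. V j n \<omega>) \<in> borel_measurable M" for n by (intro borel_measurable_sum Vm)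
  have sumWm: "(\<lambda>\<omega>. \<Sum>j\<in>J. W j \<omega>) \<in> borel_measurable M" by (intro borel_measurable_sum Wm)
  have AR: "A n \<le> R n" for n
  proof -
    have eq: "(\<Sum>z\<in>Z j n. lam * p j n z * exp (b * X \<epsilon> z \<omega> - b\<^sup>2 * K \<epsilon> z z / 2)) = lam * V j n \<omega>" for j \<omega>
      by (simp add: V_def wick_def sum_distrib_left mult.assoc)
    have eq3: "lam * (\<Sum>j\<in>J. V j n \<omega>) = (\<Sum>j\<in>J. lam * V j n \<omega>)" for \<omega> by (rule sum_distrib_left)
    have eq2: "exp (b * sqrt c * t - b\<^sup>2 * c / 2) * (lam * V j n \<omega>) = \<kappa> t * V j n \<omega>" for t j \<omega>
      by (simp add: \<kappa>_def)
    have pn: "0 \<le> lam * p j n z" for j z using lam p0[of j] by (cases "j \<in> J") (auto simp: p_def)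
    have cr: "K \<epsilon> x y \<le> c" if "j \<in> J" "k \<in> J" "j \<noteq> k" "x \<in> Z j n" "y \<in> Z k n" for j k x y
      using that ZQ by (intro cross[OF that(1-3)]) blast+
    have "(\<integral>\<^sup>+\<omega>. ennreal (exp (- (lam * (\<Sum>j\<in>J. V j n \<omega>)))) \<partial>M) \<le>
        (\<integral>\<^sup>+t. (\<Prod>j\<in>J. \<integral>\<^sup>+\<omega>. ennreal (exp (- (\<kappa> t * V j n \<omega>))) \<partial>M) \<partial>std_normal_measure)"
      unfolding eq3 eq2[symmetric] eq[symmetric]
      by (rule block_kahane[where b = b and Z = "\<lambda>j. Z j n" and p = "\<lambda>j z. lam * p j n z", OF e J])
         (assumption | rule Zfin ZD c pn cr)+
    also have "\<dots> = (\<integral>\<^sup>+t. ennreal (\<Prod>j\<in>J. \<phi> (V j n) t) \<partial>std_normal_measure)"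
      by (intro nn_integral_cong) (simp add: \<phi>01(3)[OF Vm V0] \<phi>01(1)[OF Vm V0] prod_ennreal cong: prod.cong)
    also have "\<dots> = ennreal (R n)" unfolding R_def
      by (intro Nm.nn_integral_bounded borel_measurable_prod \<phi>m Vm prod_nonneg prod_le_1) (auto intro: \<phi>01[OF Vm V0])
    also have "(\<integral>\<^sup>+\<omega>. ennreal (exp (- (lam * (\<Sum>j\<in>J. V j n \<omega>)))) \<partial>M) = ennreal (A n)"
    proof -
      note [measurable] = sumVm[of n]
      have "(\<lambda>\<omega>. exp (- (lam * (\<Sum>j\<in>J. V j n \<omega>)))) \<in> borel_measurable M" by measurable
      from nn_integral_bounded(1)[OF this] show ?thesis using lam V0 by (simp add: A_def sum_nonneg)
    qed
    finally have "ennreal (A n) \<le> ennreal (R n)" .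
    moreover have "0 \<le> R n" unfolding R_def
      by (intro integral_nonneg_AE AE_I2 prod_nonneg) (auto intro: \<phi>01[OF Vm V0])
    ultimately show ?thesis by (simp add: ennreal_le_iff)
  qed
  have A_lim: "A \<longlonglongrightarrow> (\<integral>\<omega>. exp (- (lam * (\<Sum>j\<in>J. W j \<omega>))) \<partial>M)"
  proof (rule LIM_zero_cancel, rule tendsto_rabs_zero_cancel, rule tendsto_sandwich[OF _ _ tendsto_const])
    show "\<forall>\<^sub>F n in sequentially. \<bar>A n - (\<integral>\<omega>. exp (- (lam * (\<Sum>j\<in>J. W j \<omega>))) \<partial>M)\<bar> \<le>
        lam * (\<Sum>j\<in>J. \<integral>\<omega>. \<bar>V j n \<omega> - W j \<omega>\<bar> \<partial>M)"
    proof (rule always_eventually, rule allI)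
      fix n
      have si: "integrable M (\<lambda>\<omega>. \<Sum>j\<in>J. \<bar>V j n \<omega> - W j \<omega>\<bar>)" using Vint by (intro Bochner_Integration.integrable_sum)
      have m: "(\<lambda>\<omega>. \<bar>(\<Sum>j\<in>J. V j n \<omega>) - (\<Sum>j\<in>J. W j \<omega>)\<bar>) \<in> borel_measurable M"
        by (intro borel_measurable_abs borel_measurable_diff sumVm sumWm)
      have le: "AE \<omega> in M. \<bar>(\<Sum>j\<in>J. V j n \<omega>) - (\<Sum>j\<in>J. W j \<omega>)\<bar> \<le> (\<Sum>j\<in>J. \<bar>V j n \<omega> - W j \<omega>\<bar>)"
        unfolding sum_subtractf[symmetric] by (intro AE_I2 sum_abs)
      have nn: "AE \<omega> in M. 0 \<le> \<bar>(\<Sum>j\<in>J. V j n \<omega>) - (\<Sum>j\<in>J. W j \<omega>)\<bar>" by simp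
      note sw = integrable_sandwich[OF si m nn le]
      have "\<bar>A n - (\<integral>\<omega>. exp (- (lam * (\<Sum>j\<in>J. W j \<omega>))) \<partial>M)\<bar> \<le> lam * (\<integral>\<omega>. \<bar>(\<Sum>j\<in>J. V j n \<omega>) - (\<Sum>j\<in>J. W j \<omega>)\<bar> \<partial>M)"
        unfolding A_def by (rule laplace_diff_le[OF sumVm sumWm _ _ sw(1) lam]) (auto intro: sum_nonneg V0 W0)
      also have "\<dots> \<le> lam * (\<integral>\<omega>. (\<Sum>j\<in>J. \<bar>V j n \<omega> - W j \<omega>\<bar>) \<partial>M)" by (rule mult_left_mono[OF sw(2) lam])
      also have "(\<integral>\<omega>. (\<Sum>j\<in>J. \<bar>V j n \<omega> - W j \<omega>\<bar>) \<partial>M) = (\<Sum>j\<in>J. \<integral>\<omega>. \<bar>V j n \<omega> - W j \<omega>\<bar> \<partial>M)"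
        using Vint by (intro Bochner_Integration.integral_sum)
      finally show "\<bar>A n - (\<integral>\<omega>. exp (- (lam * (\<Sum>j\<in>J. W j \<omega>))) \<partial>M)\<bar> \<le> lam * (\<Sum>j\<in>J. \<integral>\<omega>. \<bar>V j n \<omega> - W j \<omega>\<bar> \<partial>M)" .
    qed
    have "(\<lambda>n. lam * (\<Sum>j\<in>J. \<integral>\<omega>. \<bar>V j n \<omega> - W j \<omega>\<bar> \<partial>M)) \<longlonglongrightarrow> lam * (\<Sum>j\<in>J. 0)"
      by (intro tendsto_mult tendsto_sum tendsto_const Vlim)
    thus "(\<lambda>n. lam * (\<Sum>j\<in>J. \<integral>\<omega>. \<bar>V j n \<omega> - W j \<omega>\<bar> \<partial>M)) \<longlonglongrightarrow> 0" by simp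
  qed simp
  have \<phi>_lim: "(\<lambda>n. \<phi> (V j n) t) \<longlonglongrightarrow> \<phi> (W j) t" if j: "j \<in> J" for j t
  proof (rule LIM_zero_cancel, rule tendsto_rabs_zero_cancel, rule tendsto_sandwich[OF _ _ tendsto_const])
    show "\<forall>\<^sub>F n in sequentially. \<bar>\<phi> (V j n) t - \<phi> (W j) t\<bar> \<le> \<kappa> t * (\<integral>\<omega>. \<bar>V j n \<omega> - W j \<omega>\<bar> \<partial>M)"
      unfolding \<phi>_def by (intro always_eventually allI laplace_diff_le Vm Wm j V0 W0 Vint \<kappa>0)
    have "(\<lambda>n. \<kappa> t * (\<integral>\<omega>. \<bar>V j n \<omega> - W j \<omega>\<bar> \<partial>M)) \<longlonglongrightarrow> \<kappa> t * 0" by (intro tendsto_mult tendsto_const Vlim j)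
    thus "(\<lambda>n. \<kappa> t * (\<integral>\<omega>. \<bar>V j n \<omega> - W j \<omega>\<bar> \<partial>M)) \<longlonglongrightarrow> 0" by simp
  qed simp
  have R_lim: "R \<longlonglongrightarrow> (\<integral>t. (\<Prod>j\<in>J. \<phi> (W j) t) \<partial>std_normal_measure)"
    unfolding R_def
  proof (rule integral_dominated_convergence[where w = "\<lambda>_. 1"])
    show "(\<lambda>t. \<Prod>j\<in>J. \<phi> (W j) t) \<in> borel_measurable std_normal_measure" by (intro borel_measurable_prod \<phi>m Wm)
    show "(\<lambda>t. \<Prod>j\<in>J. \<phi> (V j n) t) \<in> borel_measurable std_normal_measure" for n by (intro borel_measurable_prod \<phi>m Vm)
    show "AE t in std_normal_measure. (\<lambda>n. \<Prod>j\<in>J. \<phi> (V j n) t) \<longlonglongrightarrow> (\<Prod>j\<in>J. \<phi> (W j) t)"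
      by (intro AE_I2 tendsto_prod \<phi>_lim)
    show "AE t in std_normal_measure. norm (\<Prod>j\<in>J. \<phi> (V j n) t) \<le> 1" for n
    proof (rule AE_I2)
      fix t
      have "0 \<le> (\<Prod>j\<in>J. \<phi> (V j n) t)" by (intro prod_nonneg) (auto intro: \<phi>01[OF Vm V0])
      moreover have "(\<Prod>j\<in>J. \<phi> (V j n) t) \<le> 1" by (intro prod_le_1) (auto intro: \<phi>01[OF Vm V0])
      ultimately show "norm (\<Prod>j\<in>J. \<phi> (V j n) t) \<le> 1" by simp
    qed
  qed simp
  have "(\<integral>\<omega>. exp (- (lam * (\<Sum>j\<in>J. W j \<omega>))) \<partial>M) \<le> (\<integral>t. (\<Prod>j\<in>J. \<phi> (W j) t) \<partial>std_normal_measure)"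
    by (rule LIMSEQ_le[OF A_lim R_lim]) (use AR in auto)
  thus ?thesis unfolding W_def \<phi>_def \<kappa>_def .
qed

end

section \<open>Negative moments\<close>

text \<open>Cells of side \<open>1 / k\<close> sit on a grid of spacing \<open>2 / k\<close>, so
  distinct cells are separated by at least their side length, while the \<open>k ^ d\<close> cells
  have total volume 1 for every \<open>k\<close>.\<close>

definition cell_corner :: "nat \<Rightarrow> ('d \<Rightarrow> nat) \<Rightarrow> 'd::euclidean_space" where
  "cell_corner k j = (\<Sum>i\<in>Basis. (- 1 + 2 * real (j i) / real k) *\<^sub>R i)"

definition cell_end :: "nat \<Rightarrow> ('d \<Rightarrow> nat) \<Rightarrow> 'd::euclidean_space" where
  "cell_end k j = cell_corner k j + (1 / real k) *\<^sub>R One"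

lemma cell_inner:
  assumes "i \<in> Basis"
  shows "cell_corner k j \<bullet> i = - 1 + 2 * real (j i) / real k" "cell_end k j \<bullet> i = - 1 + 2 * real (j i) / real k + 1 / real k"
  using assms by (simp_all add: cell_corner_def cell_end_def inner_add_left inner_sum_left_Basis)

lemma mem_cell:
  "x \<in> cbox (cell_corner k j) (cell_end k j) \<longleftrightarrow>
    (\<forall>i\<in>Basis. - 1 + 2 * real (j i) / real k \<le> x \<bullet> i \<and> x \<bullet> i \<le> - 1 + 2 * real (j i) / real k + 1 / real k)"
  unfolding mem_box by (simp add: cell_inner)

lemma cell_subset:
  assumes "j \<in> Pi\<^sub>E Basis (\<lambda>_. {..<k})" "k \<ge> 1"
  shows "cbox (cell_corner k j) (cell_end k j) \<subseteq> (cbox (- One) One :: 'd::euclidean_space set)"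
proof
  fix x :: 'd assume x: "x \<in> cbox (cell_corner k j) (cell_end k j)"
  show "x \<in> cbox (- One) One" unfolding mem_box
  proof
    fix i :: 'd assume i: "i \<in> Basis"
    have "j i < k" using assms(1) i by (auto simp: PiE_iff)
    hence "2 * (real (j i) + 1) / real k \<le> 2" using assms(2) by (simp add: field_simps)
    hence "2 * real (j i) / real k + 1 / real k \<le> 2" using assms(2) by (simp add: field_simps)
    moreover have "0 \<le> 2 * real (j i) / real k" by simp
    moreover have "- 1 + 2 * real (j i) / real k \<le> x \<bullet> i" "x \<bullet> i \<le> - 1 + 2 * real (j i) / real k + 1 / real k"
      using x i unfolding mem_cell by blast+
    ultimately have "- 1 \<le> x \<bullet> i" "x \<bullet> i \<le> 1" by linarith+
    thus "- One \<bullet> i \<le> x \<bullet> i \<and> x \<bullet> i \<le> One \<bullet> i"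
      using i by (simp add: inner_sum_left_Basis)
  qed
qed

lemma cell_measure:
  assumes "k \<ge> 1"
  shows "measure lborel (cbox (cell_corner k j) (cell_end k j) :: 'd::euclidean_space set) = (1 / real k) ^ DIM('d)"
    and "cbox (cell_corner k j) (cell_end k j) \<noteq> ({} :: 'd set)"
proof -
  show ne: "cbox (cell_corner k j) (cell_end k j) \<noteq> ({} :: 'd set)"
    unfolding box_ne_empty by (simp add: cell_inner)
  show "measure lborel (cbox (cell_corner k j) (cell_end k j) :: 'd set) = (1 / real k) ^ DIM('d)"
    by (subst content_cbox'[OF ne]) (simp add: cell_inner cong: prod.cong)
qed

lemma cell_diameter:
  fixes x y :: "'d::euclidean_space"
  assumes "x \<in> cbox (cell_corner k j) (cell_end k j)" "y \<in> cbox (cell_corner k j) (cell_end k j)"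
  shows "norm (x - y) \<le> real DIM('d) / real k"
proof -
  have "norm (x - y) \<le> (\<Sum>i\<in>Basis. \<bar>(x - y) \<bullet> i\<bar>)" by (rule norm_le_l1)
  also have "\<dots> \<le> (\<Sum>i\<in>(Basis :: 'd set). 1 / real k)"
  proof (rule sum_mono)
    fix i :: 'd assume i: "i \<in> Basis"
    show "\<bar>(x - y) \<bullet> i\<bar> \<le> 1 / real k"
      using assms i unfolding mem_cell inner_diff_left by (smt (verit))
  qed
  finally show ?thesis by simp
qed

lemma cell_separation:
  fixes x y :: "'d::euclidean_space"
  assumes j: "j \<in> Pi\<^sub>E Basis (\<lambda>_. {..<k})" "l \<in> Pi\<^sub>E Basis (\<lambda>_. {..<k})" "j \<noteq> l"
    and x: "x \<in> cbox (cell_corner k j) (cell_end k j)" and y: "y \<in> cbox (cell_corner k l) (cell_end k l)"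
  shows "1 / real k \<le> norm (x - y)"
proof -
  have sep: "1 / real k \<le> u - v"
    if "m < n" "- 1 + 2 * real n / real k \<le> u" "v \<le> - 1 + 2 * real m / real k + 1 / real k" for m n :: nat and u v :: real
  proof -
    have "2 * (real m + 1) / real k \<le> 2 * real n / real k" using that(1) by (intro divide_right_mono) auto
    thus ?thesis using that(2,3) by (simp add: add_divide_distrib)
  qed
  obtain i where i: "i \<in> Basis" "j i \<noteq> l i"
    using j by (metis PiE_ext)
  have xi: "- 1 + 2 * real (j i) / real k \<le> x \<bullet> i" "x \<bullet> i \<le> - 1 + 2 * real (j i) / real k + 1 / real k"
    and yi: "- 1 + 2 * real (l i) / real k \<le> y \<bullet> i" "y \<bullet> i \<le> - 1 + 2 * real (l i) / real k + 1 / real k"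
    using x y i(1) unfolding mem_cell by blast+
  have "1 / real k \<le> \<bar>(x - y) \<bullet> i\<bar>"
  proof (cases "j i < l i")
    case True
    from sep[OF this yi(1) xi(2)] show ?thesis by (simp add: inner_diff_left)
  next
    case False
    hence "l i < j i" using i(2) by simp
    from sep[OF this xi(1) yi(2)] show ?thesis by (simp add: inner_diff_left)
  qed
  also have "\<dots> \<le> norm (x - y)" by (rule Basis_le_norm[OF i(1)])
  finally show ?thesis .
qed

text \<open>The remainder of order \<open>1 + h\<close> lets a Laplace transform be bounded by a
  moment of that order, in place of a second moment, which is too large near the critical
  value.\<close>

lemma exp_minus_le_powr:
  fixes u h :: real
  assumes "0 \<le> u" "0 < h" "h \<le> 1"
  shows "exp (- u) \<le> 1 - u + u powr (1 + h)"
proof (cases "u \<le> 1")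
  case True
  have "exp (- u) \<le> 1 - u + u\<^sup>2"
  proof -
    have "(1 + u) * (1 - u + u\<^sup>2) = 1 + u ^ 3" by algebra
    hence "1 \<le> (1 + u) * (1 - u + u\<^sup>2)" using assms by simp
    also have "\<dots> \<le> exp u * (1 - u + u\<^sup>2)"
      using True by (intro mult_right_mono exp_ge_add_one_self) simp
    finally show ?thesis by (simp add: exp_minus field_simps)
  qed
  also have "u\<^sup>2 = u powr 2" using assms by simp
  also have "u powr 2 \<le> u powr (1 + h)" using True assms by (intro powr_mono') auto
  finally show ?thesis by simp
next
  case False
  have "u powr 1 \<le> u powr (1 + h)" using False assms by (intro powr_mono) auto
  hence "u \<le> u powr (1 + h)" using False by simp
  moreover have "exp (- u) \<le> 1" using assms by simp
  ultimately show ?thesis by linarith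
qed

context log_correlated_fields
begin

section \<open>Moments and Laplace transforms of single cells\<close>

lemma nmass_le_mass_AE:
  assumes e: "\<epsilon> \<in> {0<..1}" and S: "S \<in> sets borel" "S \<subseteq> B"
  shows "AE \<omega> in M. nmass \<epsilon> b S \<omega> \<le> exp (- (b\<^sup>2 * (- ln \<epsilon> - C) / 2)) * mass \<epsilon> b S \<omega>"
  using mass_AE_integrable[OF e S, of b] nmass_expect(3)[OF e S, of b]
proof eventually_elim
  case (elim \<omega>)
  have "nmass \<epsilon> b S \<omega> \<le> (LINT y:S|lborel. exp (- (b\<^sup>2 * (- ln \<epsilon> - C) / 2)) * exp (b * X \<epsilon> y \<omega>))"
    unfolding nmass_def
  proof (rule set_integral_mono[OF elim(2) set_integrable_mult_right[OF elim(1)]])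
    fix y assume "y \<in> S"
    hence y: "y \<in> D" using S(2) B_subset_D by blast
    have "b\<^sup>2 * (- ln \<epsilon> - C) \<le> b\<^sup>2 * K \<epsilon> y y" by (intro mult_left_mono K_diag[OF e y]) simp
    thus "wick \<epsilon> b y \<omega> \<le> exp (- (b\<^sup>2 * (- ln \<epsilon> - C) / 2)) * exp (b * X \<epsilon> y \<omega>)"
      unfolding wick_def exp_add[symmetric] by simp
  qed
  also have "\<dots> = exp (- (b\<^sup>2 * (- ln \<epsilon> - C) / 2)) * mass \<epsilon> b S \<omega>" by (simp add: mass_def)
  finally show ?case .
qed

lemma sum_mass_le_AE:
  assumes e: "\<epsilon> \<in> {0<..1}" and J: "finite J" and Q: "\<And>j. j \<in> J \<Longrightarrow> Q j \<in> sets borel" "\<And>j. j \<in> J \<Longrightarrow> Q j \<subseteq> B"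
    and disj: "\<And>j k. j \<in> J \<Longrightarrow> k \<in> J \<Longrightarrow> j \<noteq> k \<Longrightarrow> Q j \<inter> Q k = {}"
  shows "AE \<omega> in M. (\<Sum>j\<in>J. mass \<epsilon> b (Q j) \<omega>) \<le> mass \<epsilon> b B \<omega>"
  using mass_AE_integrable[OF e B_facts(1) order_refl, of b]
proof eventually_elim
  case (elim \<omega>)
  have i: "set_integrable lborel (Q j) (\<lambda>y. exp (b * X \<epsilon> y \<omega>))" if "j \<in> J" for j
    by (rule set_integrable_subset[OF elim]) (use Q that in auto)
  have "(\<Sum>j\<in>J. mass \<epsilon> b (Q j) \<omega>) = (\<integral>y. (\<Sum>j\<in>J. indicator (Q j) y *\<^sub>R exp (b * X \<epsilon> y \<omega>)) \<partial>lborel)"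
    unfolding mass_def set_lebesgue_integral_def using i unfolding set_integrable_def
    by (subst Bochner_Integration.integral_sum) auto
  also have "\<dots> \<le> mass \<epsilon> b B \<omega>" unfolding mass_def set_lebesgue_integral_def
  proof (rule integral_mono)
    show "integrable lborel (\<lambda>y. \<Sum>j\<in>J. indicator (Q j) y *\<^sub>R exp (b * X \<epsilon> y \<omega>))"
      using i unfolding set_integrable_def by (intro Bochner_Integration.integrable_sum)
    show "integrable lborel (\<lambda>y. indicator B y *\<^sub>R exp (b * X \<epsilon> y \<omega>))" using elim unfolding set_integrable_def .
    fix y :: 'd
    show "(\<Sum>j\<in>J. indicator (Q j) y *\<^sub>R exp (b * X \<epsilon> y \<omega>)) \<le> indicator B y *\<^sub>R exp (b * X \<epsilon> y \<omega>)"
    proof (cases "\<exists>j\<in>J. y \<in> Q j")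
      case True
      then obtain l where l: "l \<in> J" "y \<in> Q l" by blast
      have "(\<Sum>j\<in>J. indicator (Q j) y *\<^sub>R exp (b * X \<epsilon> y \<omega>)) = (\<Sum>j\<in>J. if j = l then exp (b * X \<epsilon> y \<omega>) else 0)"
      proof (rule sum.cong[OF refl])
        fix j assume "j \<in> J"
        thus "indicator (Q j) y *\<^sub>R exp (b * X \<epsilon> y \<omega>) = (if j = l then exp (b * X \<epsilon> y \<omega>) else 0)"
          using disj[of j l] l by (auto simp: indicator_def)
      qed
      also have "\<dots> = exp (b * X \<epsilon> y \<omega>)" using J l by simp
      finally show ?thesis using l Q(2)[OF l(1)] by (auto simp: indicator_def)
    next
      case False
      hence "(\<Sum>j\<in>J. indicator (Q j) y *\<^sub>R exp (b * X \<epsilon> y \<omega>)) = 0" by (intro sum.neutral) (auto simp: indicator_def)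
      thus ?thesis by (simp add: indicator_def)
    qed
  qed
  finally show ?case .
qed

text \<open>The constant of \<open>annuli_bound\<close> for \<open>q = 1\<close> and
  \<open>s = h\<close>, enlarged by the factor for passing from \<open>mass\<close> to
  \<open>nmass\<close>.\<close>

definition moment_const :: "real \<Rightarrow> real \<Rightarrow> nat \<Rightarrow> real" where
  "moment_const b h n = exp (b\<^sup>2 * (1 + h) * C / 2 + shell_const b 1 h n) / (1 - 2 powr (- shell_exponent b 1 h))"

text \<open>Up to normalisation, \<open>mass powr (1 + h)\<close> is the integral over
  \<open>x\<close> of \<open>mass powr h\<close> tilted at \<open>x\<close>, and \<open>Q\<close>
  lies in the ball of radius \<open>R\<close> around each of its points, so
  \<open>annuli_bound\<close> with \<open>q = 1\<close> applies. The positive power of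
  \<open>R\<close> is the gain from small cells.\<close>

lemma nmass_moment:
  assumes e: "\<epsilon> \<in> {0<..1}" and n: "n \<ge> 1" and h: "0 < h" "h < 1" and a: "0 < shell_exponent b 1 h"
    and Q: "Q \<in> sets borel" "Q \<subseteq> B" and R: "\<epsilon> \<le> R" "R \<le> 1" and diam: "\<And>x y. x \<in> Q \<Longrightarrow> y \<in> Q \<Longrightarrow> norm (x - y) \<le> R"
  shows "integrable M (\<lambda>\<omega>. nmass \<epsilon> b Q \<omega> powr (1 + h))"
    and "(\<integral>\<omega>. nmass \<epsilon> b Q \<omega> powr (1 + h) \<partial>M) \<le>
      moment_const b h n * exp (b\<^sup>2 / 2 * (h * (1 - h) / real n) * (- ln \<epsilon>)) * R powr shell_exponent b 1 h * measure lborel Q"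
proof -
  define E where "E = exp (b\<^sup>2 / 2 * (1\<^sup>2 + h + h * (1 - h) / real n) * (- ln \<epsilon>) + shell_const b 1 h n) /
        (1 - 2 powr (- shell_exponent b 1 h)) * R powr shell_exponent b 1 h"
  have main: "integrable M (\<lambda>\<omega>. mass \<epsilon> b Q \<omega> powr h * exp (b * X \<epsilon> x \<omega>)) \<and>
      (\<integral>\<omega>. mass \<epsilon> b Q \<omega> powr h * exp (b * X \<epsilon> x \<omega>) \<partial>M) \<le> E" if x: "x \<in> Q" for x
  proof -
    have xB: "x \<in> B" using x Q by blast
    have xD: "x \<in> D" using xB B_subset_D by blast
    define I where "I \<omega> = exp (1 * b * X \<epsilon> x \<omega>) * mass \<epsilon> b (B \<inter> cball x R) \<omega> powr h" for \<omega>
    have I: "integrable M I" "(\<integral>\<omega>. I \<omega> \<partial>M) \<le> E"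
      using annuli_bound[OF e xB n _ h a R] unfolding I_def E_def by simp_all
    have sub: "Q \<subseteq> B \<inter> cball x R" using Q diam[OF x] by (auto simp: dist_norm)
    have bs: "B \<inter> cball x R \<in> sets borel" "B \<inter> cball x R \<subseteq> B" by auto
    have le: "AE \<omega> in M. mass \<epsilon> b Q \<omega> powr h * exp (b * X \<epsilon> x \<omega>) \<le> I \<omega>"
      using mass_mono_AE[OF e Q(1) sub bs, of b]
    proof eventually_elim
      case (elim \<omega>)
      have "mass \<epsilon> b Q \<omega> powr h \<le> mass \<epsilon> b (B \<inter> cball x R) \<omega> powr h"
        using elim h mass_nonneg by (intro powr_mono2) auto
      hence "mass \<epsilon> b Q \<omega> powr h * exp (b * X \<epsilon> x \<omega>) \<le> mass \<epsilon> b (B \<inter> cball x R) \<omega> powr h * exp (b * X \<epsilon> x \<omega>)"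
        by (intro mult_right_mono) auto
      thus ?case by (simp add: I_def mult.commute)
    qed
    have m: "(\<lambda>\<omega>. mass \<epsilon> b Q \<omega> powr h * exp (b * X \<epsilon> x \<omega>)) \<in> borel_measurable M"
      by (intro borel_measurable_times exp_X_measurable[OF e xD] mass_powr_measurable[OF e Q])
    have nn: "AE \<omega> in M. 0 \<le> mass \<epsilon> b Q \<omega> powr h * exp (b * X \<epsilon> x \<omega>)" by simp
    note sw = integrable_sandwich[OF I(1) m nn le]
    show ?thesis using sw I(2) by linarith
  qed
  note F = mass_fubini[OF e Q mass_powr_measurable[OF e Q] powr_ge_zero main[THEN conjunct1] main[THEN conjunct2]]
  define z where "z = exp (- (b\<^sup>2 * (- ln \<epsilon> - C) / 2))"
  have z: "z > 0" by (simp add: z_def)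
  have le: "AE \<omega> in M. nmass \<epsilon> b Q \<omega> powr (1 + h) \<le> z powr (1 + h) * (mass \<epsilon> b Q \<omega> powr h * mass \<epsilon> b Q \<omega>)"
    using nmass_le_mass_AE[OF e Q, of b]
  proof eventually_elim
    case (elim \<omega>)
    have "nmass \<epsilon> b Q \<omega> powr (1 + h) \<le> (z * mass \<epsilon> b Q \<omega>) powr (1 + h)"
      using elim h nmass_nonneg unfolding z_def by (intro powr_mono2) auto
    also have "\<dots> = z powr (1 + h) * (mass \<epsilon> b Q \<omega> powr h * mass \<epsilon> b Q \<omega>)"
      using mass_nonneg[of \<epsilon> b Q \<omega>] by (simp add: powr_mult powr_add abs_mult mult_ac)
    finally show ?case .
  qed
  have m: "(\<lambda>\<omega>. nmass \<epsilon> b Q \<omega> powr (1 + h)) \<in> borel_measurable M"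
  proof -
    note [measurable] = borel_measurable_integrable[OF nmass_expect(1)[OF e Q, of b]]
    show ?thesis by measurable
  qed
  have nn: "AE \<omega> in M. 0 \<le> nmass \<epsilon> b Q \<omega> powr (1 + h)" by simp
  note sw = integrable_sandwich[OF integrable_mult_right[OF F(1)] m nn le]
  show "integrable M (\<lambda>\<omega>. nmass \<epsilon> b Q \<omega> powr (1 + h))" by (rule sw(1))
  have "(\<integral>\<omega>. nmass \<epsilon> b Q \<omega> powr (1 + h) \<partial>M) \<le> z powr (1 + h) * (\<integral>\<omega>. mass \<epsilon> b Q \<omega> powr h * mass \<epsilon> b Q \<omega> \<partial>M)"
    using sw(2) by simp
  also have "\<dots> \<le> z powr (1 + h) * (E * measure lborel Q)" by (rule mult_left_mono[OF F(4) powr_ge_zero])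
  also have "\<dots> = moment_const b h n * exp (b\<^sup>2 / 2 * (h * (1 - h) / real n) * (- ln \<epsilon>)) * R powr shell_exponent b 1 h * measure lborel Q"
  proof -
    have "z powr (1 + h) * exp (b\<^sup>2 / 2 * (1\<^sup>2 + h + h * (1 - h) / real n) * (- ln \<epsilon>) + shell_const b 1 h n) =
        exp (b\<^sup>2 * (1 + h) * C / 2 + shell_const b 1 h n) * exp (b\<^sup>2 / 2 * (h * (1 - h) / real n) * (- ln \<epsilon>))"
      unfolding z_def exp_powr_real exp_add[symmetric] by (simp add: algebra_simps add_divide_distrib diff_divide_distrib)
    thus ?thesis unfolding E_def moment_const_def by (simp only: times_divide_eq_right times_divide_eq_left mult.assoc[symmetric])
  qed
  finally show "(\<integral>\<omega>. nmass \<epsilon> b Q \<omega> powr (1 + h) \<partial>M) \<le> \<dots>" .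
qed

text \<open>In the expansion of order \<open>1 + h\<close>, the moment condition makes the remainder
  at most half of the linear term. Admitting any \<open>\<mu>' \<ge> \<mu>\<close> accommodates a
  multiplier that varies with the common variable.\<close>

lemma nmass_laplace_le:
  assumes e: "\<epsilon> \<in> {0<..1}" and Q: "Q \<in> sets borel" "Q \<subseteq> B" and h: "0 < h" "h \<le> 1" and \<mu>: "0 \<le> \<mu>" "\<mu> \<le> \<mu>'"
    and mom: "integrable M (\<lambda>\<omega>. nmass \<epsilon> b Q \<omega> powr (1 + h))"
      "\<mu> powr h * (\<integral>\<omega>. nmass \<epsilon> b Q \<omega> powr (1 + h) \<partial>M) \<le> measure lborel Q / 2"
  shows "(\<integral>\<omega>. exp (- (\<mu>' * nmass \<epsilon> b Q \<omega>)) \<partial>M) \<le> exp (- (\<mu> * measure lborel Q / 2))"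
proof -
  note i1 = nmass_expect(1,2)[OF e Q, of b]
  note [measurable] = borel_measurable_integrable[OF i1(1)]
  have le: "exp (- (\<mu>' * nmass \<epsilon> b Q \<omega>)) \<le> 1 - \<mu> * nmass \<epsilon> b Q \<omega> + \<mu> powr (1 + h) * nmass \<epsilon> b Q \<omega> powr (1 + h)" for \<omega>
  proof -
    have "exp (- (\<mu>' * nmass \<epsilon> b Q \<omega>)) \<le> exp (- (\<mu> * nmass \<epsilon> b Q \<omega>))"
      using \<mu> nmass_nonneg by (simp add: mult_right_mono)
    also have "\<dots> \<le> 1 - \<mu> * nmass \<epsilon> b Q \<omega> + (\<mu> * nmass \<epsilon> b Q \<omega>) powr (1 + h)"
      using \<mu> nmass_nonneg h by (intro exp_minus_le_powr mult_nonneg_nonneg) auto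
    finally show ?thesis by (simp add: powr_mult)
  qed
  have hb: "has_bochner_integral M (\<lambda>\<omega>. 1 - \<mu> * nmass \<epsilon> b Q \<omega> + \<mu> powr (1 + h) * nmass \<epsilon> b Q \<omega> powr (1 + h))
     (1 - \<mu> * measure lborel Q + \<mu> powr (1 + h) * (\<integral>\<omega>. nmass \<epsilon> b Q \<omega> powr (1 + h) \<partial>M))"
  proof (intro has_bochner_integral_add has_bochner_integral_diff has_bochner_integral_mult_right)
    show "has_bochner_integral M (\<lambda>\<omega>. 1::real) 1" by (simp add: has_bochner_integral_iff prob_space)
    show "has_bochner_integral M (nmass \<epsilon> b Q) (measure lborel Q)" using i1 by (simp add: has_bochner_integral_iff)
    show "has_bochner_integral M (\<lambda>\<omega>. nmass \<epsilon> b Q \<omega> powr (1 + h)) (\<integral>\<omega>. nmass \<epsilon> b Q \<omega> powr (1 + h) \<partial>M)"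
      using mom(1) by (simp add: has_bochner_integral_iff)
  qed
  have nb: "integrable M (\<lambda>\<omega>. exp (- (\<mu>' * nmass \<epsilon> b Q \<omega>)))"
  proof (rule integrable_const_bound[of _ 1])
    show "AE \<omega> in M. norm (exp (- (\<mu>' * nmass \<epsilon> b Q \<omega>))) \<le> 1"
      using \<mu> nmass_nonneg by (intro AE_I2) simp
  qed measurable
  have "(\<integral>\<omega>. exp (- (\<mu>' * nmass \<epsilon> b Q \<omega>)) \<partial>M) \<le>
      (\<integral>\<omega>. 1 - \<mu> * nmass \<epsilon> b Q \<omega> + \<mu> powr (1 + h) * nmass \<epsilon> b Q \<omega> powr (1 + h) \<partial>M)"
    by (rule integral_mono[OF nb _ le]) (use hb in \<open>simp only: has_bochner_integral_iff\<close>)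
  also have "\<dots> = 1 - \<mu> * measure lborel Q + \<mu> powr (1 + h) * (\<integral>\<omega>. nmass \<epsilon> b Q \<omega> powr (1 + h) \<partial>M)"
    using hb by (simp only: has_bochner_integral_iff)
  also have "\<mu> powr (1 + h) * (\<integral>\<omega>. nmass \<epsilon> b Q \<omega> powr (1 + h) \<partial>M) =
      \<mu> * (\<mu> powr h * (\<integral>\<omega>. nmass \<epsilon> b Q \<omega> powr (1 + h) \<partial>M))"
    using \<mu> by (simp add: powr_add)
  also have "\<dots> \<le> \<mu> * (measure lborel Q / 2)" by (intro mult_left_mono mom \<mu>)
  also have "1 - \<mu> * measure lborel Q + \<mu> * (measure lborel Q / 2) = 1 + - (\<mu> * measure lborel Q / 2)" by simp
  also have "\<dots> \<le> exp (- (\<mu> * measure lborel Q / 2))" by (rule exp_ge_add_one_self)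
  finally show ?thesis by simp
qed

end

section \<open>Lower tail and negative moments of the total mass\<close>

lemma std_normal_exp: "has_bochner_integral std_normal_measure (\<lambda>t. exp (a * t)) (exp (a\<^sup>2 / 2))"
  by (rule has_bochner_integral_nn_integral) (simp_all add: std_normal_mgf)

context log_correlated_fields
begin

text \<open>After comparison with independent cells, the product of the cell bounds is
  \<open>exp (- (\<mu> / 2))\<close>. The common variable spoils this only when its exponential
  factor drops below \<open>exp (- \<tau>)\<close>; a Chernoff bound with parameter \<open>l\<close>
  gives the second term.\<close>

lemma laplace_bound:
  assumes e: "\<epsilon> \<in> {0<..1}" and n: "n \<ge> 1" and h: "0 < h" "h < 1" and a: "0 < shell_exponent b 1 h"
    and k: "k \<ge> 1" and R: "\<epsilon> \<le> real DIM('d) / real k" "real DIM('d) / real k \<le> 1" and \<mu>: "0 \<le> \<mu>" and l: "0 \<le> l"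
    and small: "\<mu> powr h * (moment_const b h n * exp (b\<^sup>2 / 2 * (h * (1 - h) / real n) * (- ln \<epsilon>)) *
        (real DIM('d) / real k) powr shell_exponent b 1 h) \<le> 1 / 2"
  shows "(\<integral>\<omega>. exp (- (\<mu> * exp \<tau> * (exp (- (b\<^sup>2 * (- ln \<epsilon> - C) / 2)) * mass \<epsilon> b B \<omega>))) \<partial>M) \<le>
    exp (- (\<mu> / 2)) + exp ((l\<^sup>2 + l) * (b\<^sup>2 * (ln (real k) + C)) / 2 - l * \<tau>)"
proof -
  interpret Nm: prob_space std_normal_measure by (rule prob_space_std_normal)
  define J where "J = Pi\<^sub>E (Basis :: 'd set) (\<lambda>_. {..<k})"
  have J: "finite J" unfolding J_def by (intro finite_PiE) auto
  have cardJ: "card J = k ^ DIM('d)" by (simp add: J_def card_PiE)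
  define Q :: "('d \<Rightarrow> nat) \<Rightarrow> 'd set" where "Q j = cbox (cell_corner k j) (cell_end k j)" for j
  have QB: "Q j \<subseteq> B" if "j \<in> J" for j unfolding Q_def using cell_subset[of j k] that k by (simp add: J_def)
  have Qs: "Q j \<in> sets borel" for j by (simp add: Q_def)
  have Qm: "measure lborel (Q j) = (1 / real k) ^ DIM('d)" and Qne: "Q j \<noteq> {}" for j
    unfolding Q_def using cell_measure[OF k] by blast+
  have sep: "1 / real k \<le> norm (x - y)" if "j \<in> J" "i \<in> J" "j \<noteq> i" "x \<in> Q j" "y \<in> Q i" for i j x y
    using cell_separation[of j k i x y] that by (simp add: J_def Q_def)
  have disj: "Q j \<inter> Q i = {}" if "j \<in> J" "i \<in> J" "j \<noteq> i" for i j
  proof (rule ccontr)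
    assume "Q j \<inter> Q i \<noteq> {}"
    then obtain x where "x \<in> Q j" "x \<in> Q i" by blast
    from sep[OF that this] show False using k by simp
  qed
  \<comment> \<open>Points of different cells are at distance at least \<open>1 / k\<close>, so
    \<open>c\<close> bounds their covariance.\<close>
  define c where "c = ln (real k) + C"
  have c0: "0 \<le> c" using k C_pos by (simp add: c_def)
  have cross: "K \<epsilon> x y \<le> c" if "j \<in> J" "i \<in> J" "j \<noteq> i" "x \<in> Q j" "y \<in> Q i" for i j x y
  proof -
    have D: "x \<in> D" "y \<in> D" using QB[OF that(1)] QB[OF that(2)] that(4,5) B_subset_D by blast+
    have "1 / real k \<le> norm (x - y) + \<epsilon>" using sep[OF that] e by simp
    from K_upper[OF e D _ this] show ?thesis using k by (simp add: c_def ln_div)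
  qed
  define z where "z = exp (- (b\<^sup>2 * (- ln \<epsilon> - C) / 2))"
  have z: "z > 0" by (simp add: z_def)
  define lam where "lam = \<mu> * exp \<tau>"
  have lam: "0 \<le> lam" using \<mu> by (simp add: lam_def)
  have AEn: "AE \<omega> in M. \<forall>j\<in>J. nmass \<epsilon> b (Q j) \<omega> \<le> z * mass \<epsilon> b (Q j) \<omega>"
    using J nmass_le_mass_AE[where b = b, OF e Qs QB] unfolding z_def by (intro AE_finite_allI)
  have AEs: "AE \<omega> in M. (\<Sum>j\<in>J. mass \<epsilon> b (Q j) \<omega>) \<le> mass \<epsilon> b B \<omega>"
    by (rule sum_mass_le_AE[OF e J]) (use Qs QB disj in blast)+
  have le: "AE \<omega> in M. exp (- (lam * (z * mass \<epsilon> b B \<omega>))) \<le> exp (- (lam * (\<Sum>j\<in>J. nmass \<epsilon> b (Q j) \<omega>)))"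
    using AEn AEs
  proof eventually_elim
    case (elim \<omega>)
    have "(\<Sum>j\<in>J. nmass \<epsilon> b (Q j) \<omega>) \<le> (\<Sum>j\<in>J. z * mass \<epsilon> b (Q j) \<omega>)" using elim(1) by (intro sum_mono) blast
    also have "\<dots> = z * (\<Sum>j\<in>J. mass \<epsilon> b (Q j) \<omega>)" by (simp add: sum_distrib_left)
    also have "\<dots> \<le> z * mass \<epsilon> b B \<omega>" using elim(2) z by (intro mult_left_mono) auto
    finally show ?case using lam by (simp add: mult_left_mono)
  qed
  note [measurable] = mass_measurable[OF e B_facts(1) order_refl, of b]
  have sm: "(\<lambda>\<omega>. \<Sum>j\<in>J. nmass \<epsilon> b (Q j) \<omega>) \<in> borel_measurable M"
    by (intro borel_measurable_sum borel_measurable_integrable[OF nmass_expect(1)[OF e Qs QB]])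
  note [measurable] = sm
  have i1: "integrable M (\<lambda>\<omega>. exp (- (lam * (z * mass \<epsilon> b B \<omega>))))"
    by (rule nn_integral_bounded(2)) (use lam z mass_nonneg in \<open>simp_all add: less_imp_le\<close>)
  have i2: "integrable M (\<lambda>\<omega>. exp (- (lam * (\<Sum>j\<in>J. nmass \<epsilon> b (Q j) \<omega>))))"
    by (rule nn_integral_bounded(2)) (use lam nmass_nonneg in \<open>simp_all add: sum_nonneg\<close>)
  define \<phi> where "\<phi> j t = (\<integral>\<omega>. exp (- (lam * exp (b * sqrt c * t - b\<^sup>2 * c / 2) * nmass \<epsilon> b (Q j) \<omega>)) \<partial>M)" for j t
  have \<phi>01: "0 \<le> \<phi> j t \<and> \<phi> j t \<le> 1" if j: "j \<in> J" for j t
  proof -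
    note [measurable] = borel_measurable_integrable[OF nmass_expect(1)[OF e Qs QB[OF j], of b]]
    have m: "(\<lambda>\<omega>. exp (- (lam * exp (b * sqrt c * t - b\<^sup>2 * c / 2) * nmass \<epsilon> b (Q j) \<omega>))) \<in> borel_measurable M" by measurable
    have "exp (- (lam * exp (b * sqrt c * t - b\<^sup>2 * c / 2) * nmass \<epsilon> b (Q j) \<omega>)) \<le> 1" for \<omega>
      using lam nmass_nonneg by simp
    from nn_integral_bounded(3,4)[OF m exp_ge_zero this] show ?thesis unfolding \<phi>_def by blast
  qed
  have prod01: "0 \<le> (\<Prod>j\<in>J. \<phi> j t)" "(\<Prod>j\<in>J. \<phi> j t) \<le> 1" for t
    using \<phi>01 by (auto intro!: prod_nonneg prod_le_1)
  have mom: "integrable M (\<lambda>\<omega>. nmass \<epsilon> b (Q j) \<omega> powr (1 + h))"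
    "\<mu> powr h * (\<integral>\<omega>. nmass \<epsilon> b (Q j) \<omega> powr (1 + h) \<partial>M) \<le> measure lborel (Q j) / 2" if j: "j \<in> J" for j
  proof -
    have diam: "norm (x - y) \<le> real DIM('d) / real k" if "x \<in> Q j" "y \<in> Q j" for x y
      using cell_diameter that by (simp add: Q_def)
    note N = nmass_moment[OF e n h a Qs QB[OF j] R diam]
    show "integrable M (\<lambda>\<omega>. nmass \<epsilon> b (Q j) \<omega> powr (1 + h))" by (rule N(1))
    have "\<mu> powr h * (\<integral>\<omega>. nmass \<epsilon> b (Q j) \<omega> powr (1 + h) \<partial>M) \<le> \<mu> powr h * (moment_const b h n *
        exp (b\<^sup>2 / 2 * (h * (1 - h) / real n) * (- ln \<epsilon>)) * (real DIM('d) / real k) powr shell_exponent b 1 h * measure lborel (Q j))"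
      by (rule mult_left_mono[OF N(2)]) auto
    also have "\<dots> = \<mu> powr h * (moment_const b h n *
        exp (b\<^sup>2 / 2 * (h * (1 - h) / real n) * (- ln \<epsilon>)) * (real DIM('d) / real k) powr shell_exponent b 1 h) * measure lborel (Q j)"
      by (simp only: mult.assoc)
    also have "\<dots> \<le> 1 / 2 * measure lborel (Q j)" by (rule mult_right_mono[OF small]) simp
    finally show "\<mu> powr h * (\<integral>\<omega>. nmass \<epsilon> b (Q j) \<omega> powr (1 + h) \<partial>M) \<le> measure lborel (Q j) / 2" by simp
  qed
  \<comment> \<open>If the common factor times \<open>exp \<tau>\<close> is at least 1, the
    effective multiplier is at least \<open>\<mu>\<close> and every cell contributes. Otherwise the
    product is only known to be at most 1, and the second summand exceeds 1.\<close>
  have prod_le: "(\<Prod>j\<in>J. \<phi> j t) \<le> exp (- (\<mu> / 2)) + exp (l * b\<^sup>2 * c / 2 - l * \<tau>) * exp ((- l * b * sqrt c) * t)" for t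
  proof (cases "b * sqrt c * t - b\<^sup>2 * c / 2 + \<tau> \<ge> 0")
    case True
    have "\<mu> * 1 \<le> \<mu> * exp (\<tau> + (b * sqrt c * t - b\<^sup>2 * c / 2))" using True \<mu> by (intro mult_left_mono) simp_all
    hence mu: "\<mu> \<le> lam * exp (b * sqrt c * t - b\<^sup>2 * c / 2)" unfolding lam_def exp_add by (simp add: mult.assoc)
    have "(\<Prod>j\<in>J. \<phi> j t) \<le> (\<Prod>j\<in>J. exp (- (\<mu> * (1 / real k) ^ DIM('d) / 2)))"
    proof (rule prod_mono, rule conjI)
      fix j assume j: "j \<in> J"
      show "0 \<le> \<phi> j t" using \<phi>01[OF j] by blast
      show "\<phi> j t \<le> exp (- (\<mu> * (1 / real k) ^ DIM('d) / 2))"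
        using nmass_laplace_le[OF e Qs QB[OF j] h(1) less_imp_le[OF h(2)] \<mu> mu mom[OF j]] unfolding \<phi>_def Qm .
    qed
    also have "\<dots> = exp (real (k ^ DIM('d)) * (- (\<mu> * (1 / real k) ^ DIM('d) / 2)))"
      by (simp only: prod_constant cardJ exp_of_nat_mult)
    \<comment> \<open>The total volume of the cells is 1, so the exponent does not depend on
      \<open>k\<close>.\<close>
    also have "real (k ^ DIM('d)) * (- (\<mu> * (1 / real k) ^ DIM('d) / 2)) = - (\<mu> / 2)"
      using k by (simp add: power_one_over)
    finally have "(\<Prod>j\<in>J. \<phi> j t) \<le> exp (- (\<mu> / 2))" .
    moreover have "0 \<le> exp (l * b\<^sup>2 * c / 2 - l * \<tau>) * exp ((- l * b * sqrt c) * t)" by simp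
    ultimately show ?thesis by linarith
  next
    case False
    have "0 \<le> - l * (b * sqrt c * t - b\<^sup>2 * c / 2 + \<tau>)" using False l by (simp add: mult_nonneg_nonpos)
    hence "1 \<le> exp (- l * (b * sqrt c * t - b\<^sup>2 * c / 2 + \<tau>))" by simp
    also have "- l * (b * sqrt c * t - b\<^sup>2 * c / 2 + \<tau>) = (l * b\<^sup>2 * c / 2 - l * \<tau>) + (- l * b * sqrt c) * t"
      by (simp add: algebra_simps)
    finally have "1 \<le> exp (l * b\<^sup>2 * c / 2 - l * \<tau>) * exp ((- l * b * sqrt c) * t)" by (simp only: exp_add)
    moreover have "0 \<le> exp (- (\<mu> / 2))" by simp
    ultimately show ?thesis using prod01(2)[of t] by linarith
  qed
  have hb: "has_bochner_integral std_normal_measure (\<lambda>t. exp (- (\<mu> / 2)) + exp (l * b\<^sup>2 * c / 2 - l * \<tau>) * exp ((- l * b * sqrt c) * t))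
      (exp (- (\<mu> / 2)) + exp (l * b\<^sup>2 * c / 2 - l * \<tau>) * exp ((- l * b * sqrt c)\<^sup>2 / 2))"
  proof (intro has_bochner_integral_add has_bochner_integral_mult_right std_normal_exp)
    show "has_bochner_integral std_normal_measure (\<lambda>t. exp (- (\<mu> / 2))) (exp (- (\<mu> / 2)))"
      using Nm.prob_space by (simp add: has_bochner_integral_iff)
  qed
  have "(\<integral>\<omega>. exp (- (lam * (z * mass \<epsilon> b B \<omega>))) \<partial>M) \<le> (\<integral>\<omega>. exp (- (lam * (\<Sum>j\<in>J. nmass \<epsilon> b (Q j) \<omega>))) \<partial>M)"
    by (rule integral_mono_AE[OF i1 i2 le])
  also have "\<dots> \<le> (\<integral>t. (\<Prod>j\<in>J. \<phi> j t) \<partial>std_normal_measure)"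
    unfolding \<phi>_def Q_def
    by (rule continuum_kahane[OF e J _ _ c0 _ lam]) (use QB Qne cross in \<open>unfold Q_def, blast+\<close>)
  also have "\<dots> \<le> (\<integral>t. exp (- (\<mu> / 2)) + exp (l * b\<^sup>2 * c / 2 - l * \<tau>) * exp ((- l * b * sqrt c) * t) \<partial>std_normal_measure)"
  proof (rule integral_mono')
    show "integrable std_normal_measure (\<lambda>t. exp (- (\<mu> / 2)) + exp (l * b\<^sup>2 * c / 2 - l * \<tau>) * exp ((- l * b * sqrt c) * t))"
      using hb by (simp only: has_bochner_integral_iff)
  qed (use prod_le prod01(1) in \<open>auto intro: add_nonneg_nonneg\<close>)
  also have "\<dots> = exp (- (\<mu> / 2)) + exp (l * b\<^sup>2 * c / 2 - l * \<tau>) * exp ((- l * b * sqrt c)\<^sup>2 / 2)"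
    using hb by (simp only: has_bochner_integral_iff)
  also have "exp (l * b\<^sup>2 * c / 2 - l * \<tau>) * exp ((- l * b * sqrt c)\<^sup>2 / 2) = exp ((l\<^sup>2 + l) * (b\<^sup>2 * c) / 2 - l * \<tau>)"
    unfolding exp_add[symmetric] using c0 by (simp add: power_mult_distrib algebra_simps add_divide_distrib)
  finally show ?thesis unfolding lam_def z_def c_def by (simp only: mult.assoc)
qed

text \<open>The exponent is not sharp, but the bound is of polynomial order in
  \<open>1 / \<epsilon>\<close>; that is enough where an arbitrarily high power of
  \<open>\<epsilon>\<close> can be gained elsewhere.\<close>

lemma mass_neg_moment_crude:
  assumes e: "\<epsilon> \<in> {0<..1}" and p: "p > 0"
  shows "integrable M (\<lambda>\<omega>. mass \<epsilon> b B \<omega> powr (- p))"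
    and "(\<integral>\<omega>. mass \<epsilon> b B \<omega> powr (- p) \<partial>M) \<le> measure lborel B powr (- p) * exp (p\<^sup>2 * b\<^sup>2 * (- ln \<epsilon> + C) / 2)"
proof -
  have nn: "AE \<omega> in M. 0 \<le> mass \<epsilon> b B \<omega> powr (- p)" by simp
  note sw = integrable_sandwich[OF integrable_mult_right[OF mass_integral(1)[OF e B_facts(1) order_refl]]
      mass_powr_measurable[OF e B_facts(1) order_refl] nn mass_neg_powr_AE[OF e B_facts(1) order_refl B_facts(2) p, of b]]
  show "integrable M (\<lambda>\<omega>. mass \<epsilon> b B \<omega> powr (- p))" by (rule sw(1))
  have "(\<integral>\<omega>. mass \<epsilon> b B \<omega> powr (- p) \<partial>M) \<le> measure lborel B powr (- p - 1) * (\<integral>\<omega>. mass \<epsilon> (- p * b) B \<omega> \<partial>M)"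
    using sw(2) by simp
  also have "\<dots> \<le> measure lborel B powr (- p - 1) * (exp ((- p * b)\<^sup>2 * (- ln \<epsilon> + C) / 2) * measure lborel B)"
    by (rule mult_left_mono[OF mass_integral(2)[OF e B_facts(1) order_refl]]) simp
  also have "\<dots> = (measure lborel B powr (- p - 1) * measure lborel B powr 1) * exp (p\<^sup>2 * b\<^sup>2 * (- ln \<epsilon> + C) / 2)"
    using B_facts(2) by (simp add: power_mult_distrib)
  also have "measure lborel B powr (- p - 1) * measure lborel B powr 1 = measure lborel B powr (- p)"
    unfolding powr_add[symmetric] by simp
  finally show "(\<integral>\<omega>. mass \<epsilon> b B \<omega> powr (- p) \<partial>M) \<le> measure lborel B powr (- p) * exp (p\<^sup>2 * b\<^sup>2 * (- ln \<epsilon> + C) / 2)" .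
qed

text \<open>A negative moment is controlled by the Laplace transform at \<open>lam\<close>, at the price of a crude
  moment of double order weighted by the free parameter \<open>\<eta>\<close>.\<close>

lemma neg_moment_step:
  assumes e: "\<epsilon> \<in> {0<..1}" and s: "s > 0" and lam: "lam > 0" and \<eta>: "\<eta> > 0" and z: "z > 0"
  shows "(\<integral>\<omega>. mass \<epsilon> b B \<omega> powr (- s) \<partial>M) \<le> z powr s * (lam powr s +
      (\<eta> * (z powr (- (2 * s)) * (measure lborel B powr (- (2 * s)) * exp ((2 * s)\<^sup>2 * b\<^sup>2 * (- ln \<epsilon> + C) / 2))) +
       exp 1 / \<eta> * (\<integral>\<omega>. exp (- (lam * (z * mass \<epsilon> b B \<omega>))) \<partial>M)) / 2)"
proof -
  have s2: "2 * s > 0" using s by simp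
  note c2 = mass_neg_moment_crude[OF e s2, of b] and c1 = mass_neg_moment_crude[OF e s, of b]
  note [measurable] = mass_measurable[OF e B_facts(1) order_refl, of b]
  have iL: "integrable M (\<lambda>\<omega>. exp (- (lam * (z * mass \<epsilon> b B \<omega>))))"
    by (rule nn_integral_bounded(2)) (use lam z mass_nonneg in \<open>simp_all add: less_imp_le\<close>)
  \<comment> \<open>For \<open>y \<ge> 1 / lam\<close> the first term suffices. For smaller
    \<open>y\<close>, the inequality \<open>2 * w \<le> \<eta> * w\<^sup>2 + 1 / \<eta>\<close> with
    \<open>w = y powr (- s)\<close> applies, and \<open>exp 1 * exp (- (lam * y)) \<ge> 1\<close>
    inserts the Laplace transform.\<close>
  have pw: "y powr (- s) \<le> lam powr s + (\<eta> * y powr (- (2 * s)) + exp 1 / \<eta> * exp (- (lam * y))) / 2" if y: "y > 0" for y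
  proof (cases "1 / lam \<le> y")
    case True
    have "y powr (- s) \<le> (1 / lam) powr (- s)" using True s lam by (intro powr_mono2') auto
    also have "\<dots> = lam powr s" using lam by (simp add: powr_minus powr_divide)
    finally have "y powr (- s) \<le> lam powr s" .
    moreover have "0 \<le> (\<eta> * y powr (- (2 * s)) + exp 1 / \<eta> * exp (- (lam * y))) / 2" using \<eta> by simp
    ultimately show ?thesis by linarith
  next
    case False
    hence "lam * y \<le> 1" using lam by (simp add: field_simps)
    hence e1: "1 \<le> exp 1 * exp (- (lam * y))" unfolding exp_add[symmetric] by simp
    define w where "w = y powr (- s)"
    have "0 \<le> (\<eta> * w - 1)\<^sup>2" by simp
    hence "2 * (\<eta> * w) \<le> \<eta>\<^sup>2 * w\<^sup>2 + 1" by (simp add: power2_eq_square algebra_simps)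
    hence "w \<le> (\<eta> * w\<^sup>2 + 1 / \<eta>) / 2" using \<eta> by (simp add: field_simps power2_eq_square)
    moreover have "w\<^sup>2 = y powr (- (2 * s))" unfolding w_def power2_eq_square powr_add[symmetric] by simp
    moreover have "1 / \<eta> \<le> exp 1 / \<eta> * exp (- (lam * y))" using e1 \<eta> by (simp add: field_simps)
    ultimately have "w \<le> (\<eta> * y powr (- (2 * s)) + 1 / \<eta>) / 2"
        "(\<eta> * y powr (- (2 * s)) + 1 / \<eta>) / 2 \<le> (\<eta> * y powr (- (2 * s)) + exp 1 / \<eta> * exp (- (lam * y))) / 2"
      by (simp only:, intro divide_right_mono add_left_mono) simp_all
    hence "w \<le> (\<eta> * y powr (- (2 * s)) + exp 1 / \<eta> * exp (- (lam * y))) / 2" by (rule order_trans)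
    moreover have "0 \<le> lam powr s" by simp
    ultimately show ?thesis unfolding w_def by linarith
  qed
  define H where "H \<omega> = z powr s * (lam powr s + (\<eta> * (z powr (- (2 * s)) * mass \<epsilon> b B \<omega> powr (- (2 * s))) +
      exp 1 / \<eta> * exp (- (lam * (z * mass \<epsilon> b B \<omega>)))) / 2)" for \<omega>
  have le: "AE \<omega> in M. mass \<epsilon> b B \<omega> powr (- s) \<le> H \<omega>"
    using mass_pos_AE[OF e B_facts(1) order_refl B_facts(3), of b]
  proof eventually_elim
    case (elim \<omega>)
    have "mass \<epsilon> b B \<omega> powr (- s) = z powr s * (z * mass \<epsilon> b B \<omega>) powr (- s)"
      using z elim by (simp add: powr_mult powr_minus)
    also have "\<dots> \<le> z powr s * (lam powr s + (\<eta> * (z * mass \<epsilon> b B \<omega>) powr (- (2 * s)) + exp 1 / \<eta> * exp (- (lam * (z * mass \<epsilon> b B \<omega>)))) / 2)"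
      using z elim by (intro mult_left_mono pw mult_pos_pos) auto
    also have "(z * mass \<epsilon> b B \<omega>) powr (- (2 * s)) = z powr (- (2 * s)) * mass \<epsilon> b B \<omega> powr (- (2 * s))"
      using z elim by (simp add: powr_mult)
    finally show ?case unfolding H_def .
  qed
  define I2 IL where "I2 = (\<integral>\<omega>. mass \<epsilon> b B \<omega> powr (- (2 * s)) \<partial>M)" and "IL = (\<integral>\<omega>. exp (- (lam * (z * mass \<epsilon> b B \<omega>))) \<partial>M)"
  have hb: "has_bochner_integral M H (z powr s * (lam powr s + (\<eta> * (z powr (- (2 * s)) * I2) + exp 1 / \<eta> * IL) / 2))"
    unfolding H_def
  proof (intro has_bochner_integral_mult_right has_bochner_integral_add has_bochner_integral_divide_zero)
    show "has_bochner_integral M (\<lambda>\<omega>. lam powr s) (lam powr s)" by (simp add: has_bochner_integral_iff prob_space)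
    show "has_bochner_integral M (\<lambda>\<omega>. mass \<epsilon> b B \<omega> powr (- (2 * s))) I2"
      unfolding I2_def using c2(1) by (simp only: has_bochner_integral_iff simp_thms)
    show "has_bochner_integral M (\<lambda>\<omega>. exp (- (lam * (z * mass \<epsilon> b B \<omega>)))) IL"
      unfolding IL_def using iL by (simp only: has_bochner_integral_iff simp_thms)
  qed
  have "(\<integral>\<omega>. mass \<epsilon> b B \<omega> powr (- s) \<partial>M) \<le> (\<integral>\<omega>. H \<omega> \<partial>M)"
    by (rule integral_mono_AE[OF c1(1) _ le]) (use hb in \<open>simp only: has_bochner_integral_iff\<close>)
  also have "\<dots> = z powr s * (lam powr s + (\<eta> * (z powr (- (2 * s)) * I2) + exp 1 / \<eta> * IL) / 2)"
    using hb by (simp only: has_bochner_integral_iff)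
  also have "\<dots> \<le> z powr s * (lam powr s +
      (\<eta> * (z powr (- (2 * s)) * (measure lborel B powr (- (2 * s)) * exp ((2 * s)\<^sup>2 * b\<^sup>2 * (- ln \<epsilon> + C) / 2))) + exp 1 / \<eta> * IL) / 2)"
    using c2(2) \<eta> unfolding I2_def by (intro mult_left_mono add_left_mono divide_right_mono add_right_mono) auto
  finally show ?thesis unfolding IL_def .
qed

end

section \<open>Growth exponents\<close>

text \<open>\<open>ub h \<phi>\<close> says that \<open>limsup h \<epsilon> / ln (1 / \<epsilon>) \<le> \<phi>\<close> as \<open>\<epsilon>\<close> decreases to 0.\<close>

definition ub :: "(real \<Rightarrow> real) \<Rightarrow> real \<Rightarrow> bool" where
  "ub h \<phi> \<longleftrightarrow> (\<forall>\<delta>>0. \<forall>\<^sub>F \<epsilon> in at_right 0. h \<epsilon> \<le> (\<phi> + \<delta>) * (- ln \<epsilon>))"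

lemma filterlim_minus_ln: "filterlim (\<lambda>\<epsilon>::real. - ln \<epsilon>) at_top (at_right 0)"
  using ln_at_0 by (simp add: filterlim_uminus_at_top)

lemma eventually_minus_ln: "\<forall>\<^sub>F T in at_top. P T \<Longrightarrow> \<forall>\<^sub>F \<epsilon>::real in at_right 0. P (- ln \<epsilon>)"
  by (rule eventually_compose_filterlim[OF _ filterlim_minus_ln])

lemma eventually_unit: "\<forall>\<^sub>F \<epsilon>::real in at_right 0. \<epsilon> \<in> {0<..1}"
proof -
  have "\<forall>\<^sub>F \<epsilon>::real in at_right 0. \<epsilon> \<in> {0<..<1}" by (rule eventually_at_right_real) simp
  thus ?thesis by eventually_elim simp
qed

lemma ubI:
  assumes "\<And>\<delta>. \<delta> > 0 \<Longrightarrow> \<exists>c. \<forall>\<^sub>F \<epsilon> in at_right 0. h \<epsilon> \<le> (\<phi> + \<delta>) * (- ln \<epsilon>) + c"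
  shows "ub h \<phi>"
  unfolding ub_def
proof (intro allI impI)
  fix \<delta> :: real assume \<delta>: "\<delta> > 0"
  then obtain c where c: "\<forall>\<^sub>F \<epsilon> in at_right 0. h \<epsilon> \<le> (\<phi> + \<delta> / 2) * (- ln \<epsilon>) + c"
    using assms[of "\<delta> / 2"] by auto
  have "\<forall>\<^sub>F T in at_top. T \<ge> c / (\<delta> / 2)" by (rule eventually_ge_at_top)
  from eventually_minus_ln[OF this] c
  show "\<forall>\<^sub>F \<epsilon> in at_right 0. h \<epsilon> \<le> (\<phi> + \<delta>) * (- ln \<epsilon>)"
  proof eventually_elim
    case (elim \<epsilon>)
    define T where "T = - ln \<epsilon>"
    have "c \<le> \<delta> / 2 * T" using elim(1) \<delta> by (simp add: T_def field_simps)
    moreover have "h \<epsilon> \<le> (\<phi> + \<delta> / 2) * T + c" using elim(2) by (simp add: T_def)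
    ultimately have "h \<epsilon> \<le> (\<phi> + \<delta>) * T" by (simp add: algebra_simps)
    thus ?case by (simp add: T_def)
  qed
qed

lemma ub_const:
  assumes "\<forall>\<^sub>F \<epsilon> in at_right 0. h \<epsilon> \<le> \<phi> * (- ln \<epsilon>) + c"
  shows "ub h \<phi>"
proof (rule ubI)
  fix \<delta> :: real assume \<delta>: "\<delta> > 0"
  have "\<forall>\<^sub>F \<epsilon> in at_right 0. h \<epsilon> \<le> (\<phi> + \<delta>) * (- ln \<epsilon>) + c"
    using assms eventually_minus_ln[OF eventually_ge_at_top[of 0]]
  proof eventually_elim
    case (elim \<epsilon>)
    have "0 \<le> \<delta> * (- ln \<epsilon>)" using elim(2) \<delta> by (intro mult_nonneg_nonneg) auto
    thus ?case using elim(1) by (simp add: algebra_simps)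
  qed
  thus "\<exists>c. \<forall>\<^sub>F \<epsilon> in at_right 0. h \<epsilon> \<le> (\<phi> + \<delta>) * (- ln \<epsilon>) + c" by blast
qed

lemma ub_mono:
  assumes "ub h \<phi>" "\<forall>\<^sub>F \<epsilon> in at_right 0. h' \<epsilon> \<le> h \<epsilon>"
  shows "ub h' \<phi>"
  unfolding ub_def
proof (intro allI impI)
  fix \<delta> :: real assume "\<delta> > 0"
  hence "\<forall>\<^sub>F \<epsilon> in at_right 0. h \<epsilon> \<le> (\<phi> + \<delta>) * (- ln \<epsilon>)" using assms(1) by (simp add: ub_def)
  thus "\<forall>\<^sub>F \<epsilon> in at_right 0. h' \<epsilon> \<le> (\<phi> + \<delta>) * (- ln \<epsilon>)" using assms(2) by eventually_elim simp
qed

lemma ub_add: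
  assumes "ub f \<phi>" "ub g \<psi>"
  shows "ub (\<lambda>\<epsilon>. f \<epsilon> + g \<epsilon>) (\<phi> + \<psi>)"
  unfolding ub_def
proof (intro allI impI)
  fix \<delta> :: real assume "\<delta> > 0"
  hence "\<forall>\<^sub>F \<epsilon> in at_right 0. f \<epsilon> \<le> (\<phi> + \<delta> / 2) * (- ln \<epsilon>)" "\<forall>\<^sub>F \<epsilon> in at_right 0. g \<epsilon> \<le> (\<psi> + \<delta> / 2) * (- ln \<epsilon>)"
    using assms by (simp_all add: ub_def)
  thus "\<forall>\<^sub>F \<epsilon> in at_right 0. f \<epsilon> + g \<epsilon> \<le> (\<phi> + \<psi> + \<delta>) * (- ln \<epsilon>)"
    by eventually_elim (simp add: algebra_simps)
qed

lemma ub_cmult: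
  assumes "ub f \<phi>" "0 \<le> c"
  shows "ub (\<lambda>\<epsilon>. c * f \<epsilon>) (c * \<phi>)"
proof (cases "c = 0")
  case False
  hence c: "c > 0" using assms by simp
  show ?thesis unfolding ub_def
  proof (intro allI impI)
    fix \<delta> :: real assume "\<delta> > 0"
    hence "\<forall>\<^sub>F \<epsilon> in at_right 0. f \<epsilon> \<le> (\<phi> + \<delta> / c) * (- ln \<epsilon>)" using assms(1) c by (simp add: ub_def)
    thus "\<forall>\<^sub>F \<epsilon> in at_right 0. c * f \<epsilon> \<le> (c * \<phi> + \<delta>) * (- ln \<epsilon>)"
    proof eventually_elim
      case (elim \<epsilon>)
      have "c * f \<epsilon> \<le> c * ((\<phi> + \<delta> / c) * (- ln \<epsilon>))" using elim c by (intro mult_left_mono) auto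
      also have "\<dots> = (c * \<phi> + \<delta>) * (- ln \<epsilon>)" using c by (simp add: field_simps)
      finally show ?case .
    qed
  qed
next
  case True
  thus ?thesis using ub_const[of "\<lambda>_. 0" 0 0] by simp
qed

lemma ub_le:
  assumes "ub h \<phi>" "\<phi> \<le> \<psi>"
  shows "ub h \<psi>"
  unfolding ub_def
proof (intro allI impI)
  fix \<delta> :: real assume "\<delta> > 0"
  hence "\<forall>\<^sub>F \<epsilon> in at_right 0. h \<epsilon> \<le> (\<phi> + \<delta>) * (- ln \<epsilon>)" using assms(1) by (simp add: ub_def)
  thus "\<forall>\<^sub>F \<epsilon> in at_right 0. h \<epsilon> \<le> (\<psi> + \<delta>) * (- ln \<epsilon>)"
    using eventually_minus_ln[OF eventually_ge_at_top[of 0]]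
  proof eventually_elim
    case (elim \<epsilon>)
    have "(\<phi> + \<delta>) * (- ln \<epsilon>) \<le> (\<psi> + \<delta>) * (- ln \<epsilon>)" using elim(2) assms(2) by (intro mult_right_mono) auto
    thus ?case using elim(1) by linarith
  qed
qed

lemma ub_limit:
  assumes "\<And>\<delta>. \<delta> > 0 \<Longrightarrow> ub h (\<phi> + \<delta>)"
  shows "ub h \<phi>"
  unfolding ub_def
proof (intro allI impI)
  fix \<delta> :: real assume "\<delta> > 0"
  hence p: "0 < \<delta> / 2" by simp
  have "\<forall>\<delta>'>0. \<forall>\<^sub>F \<epsilon> in at_right 0. h \<epsilon> \<le> (\<phi> + \<delta> / 2 + \<delta>') * (- ln \<epsilon>)"
    using assms[OF p] unfolding ub_def .
  from mp[OF spec[OF this] p] show "\<forall>\<^sub>F \<epsilon> in at_right 0. h \<epsilon> \<le> (\<phi> + \<delta>) * (- ln \<epsilon>)"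
    by (simp only: add.assoc field_sum_of_halves)
qed

text \<open>The sign of the limit flips because \<open>ln \<epsilon>\<close> is negative near
  0.\<close>

lemma ub_tendsto:
  assumes "ub h \<phi>" "ub (\<lambda>\<epsilon>. - h \<epsilon>) (- \<phi>)"
  shows "((\<lambda>\<epsilon>. h \<epsilon> / ln \<epsilon>) \<longlongrightarrow> - \<phi>) (at_right 0)"
proof (rule tendstoI)
  fix \<delta> :: real assume \<delta>: "\<delta> > 0"
  hence "\<forall>\<^sub>F \<epsilon> in at_right 0. h \<epsilon> \<le> (\<phi> + \<delta> / 2) * (- ln \<epsilon>)" "\<forall>\<^sub>F \<epsilon> in at_right 0. - h \<epsilon> \<le> (- \<phi> + \<delta> / 2) * (- ln \<epsilon>)"
    using assms by (simp_all add: ub_def)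
  thus "\<forall>\<^sub>F \<epsilon> in at_right 0. dist (h \<epsilon> / ln \<epsilon>) (- \<phi>) < \<delta>"
    using eventually_minus_ln[OF eventually_gt_at_top[of 0]]
  proof eventually_elim
    case (elim \<epsilon>)
    define T where "T = - ln \<epsilon>"
    have T: "T > 0" "ln \<epsilon> = - T" using elim by (auto simp: T_def)
    have "h \<epsilon> / T \<le> \<phi> + \<delta> / 2" using elim(1) T by (simp add: pos_divide_le_eq)
    moreover have "(\<phi> - \<delta> / 2) * T \<le> h \<epsilon>" using elim(2) T by (simp add: algebra_simps)
    hence "\<phi> - \<delta> / 2 \<le> h \<epsilon> / T" using T by (simp add: pos_le_divide_eq)
    ultimately have "\<bar>h \<epsilon> / T - \<phi>\<bar> \<le> \<delta> / 2" by linarith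
    moreover have "dist (h \<epsilon> / ln \<epsilon>) (- \<phi>) = \<bar>h \<epsilon> / T - \<phi>\<bar>" by (simp add: T(2) dist_real_def abs_minus_commute)
    ultimately show ?case using \<delta> by linarith
  qed
qed

context log_correlated_fields
begin

lemma exists_shell_exponent:
  assumes "q * b\<^sup>2 < real DIM('d) + b\<^sup>2 / 2"
  shows "\<exists>s. 0 < s \<and> s < 1 \<and> 0 < shell_exponent b q s"
proof -
  define w where "w = real DIM('d) + b\<^sup>2 / 2 - q * b\<^sup>2"
  have w: "w > 0" using assms by (simp add: w_def)
  \<comment> \<open>Dividing by \<open>b\<^sup>2 + 1\<close> rather than \<open>b\<^sup>2\<close>
    gives the strict inequality \<open>s * b\<^sup>2 < w\<close> and covers
    \<open>b = 0\<close>.\<close>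
  define s where "s = min (1 / 2) (w / (b\<^sup>2 + 1))"
  have b: "0 < b\<^sup>2 + 1" by (intro add_nonneg_pos) auto
  have s: "0 < s" "s < 1" using w b by (auto simp: s_def)
  have "s * (b\<^sup>2 + 1) \<le> w" using b by (simp add: s_def min_mult_distrib_right)
  hence "s * b\<^sup>2 < w" using s by (simp add: algebra_simps)
  hence "s * b\<^sup>2 / 2 < w" using w by simp
  hence "0 < shell_exponent b q s" unfolding shell_exponent_def using s
    by (intro mult_pos_pos) (auto simp: w_def)
  thus ?thesis using s by blast
qed

text \<open>With \<open>T = - ln \<epsilon>\<close>, the factor \<open>z powr s\<close> in
  \<open>neg_moment_step\<close> supplies the exponent \<open>- s * b\<^sup>2 / 2\<close>. The
  parameters are tuned so that \<open>lam powr s\<close> costs at most order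
  \<open>exp (\<delta> * T)\<close> while the weighted crude moment and the weighted Laplace
  transform stay bounded.\<close>

theorem ub_neg_moment:
  assumes b: "b\<^sup>2 < 2 * real DIM('d)" and s: "s > 0"
  shows "ub (\<lambda>\<epsilon>. ln (\<integral>\<omega>. mass \<epsilon> b B \<omega> powr (- s) \<partial>M)) (- (s * b\<^sup>2 / 2))"
proof (rule ubI)
  fix \<delta> :: real assume \<delta>: "\<delta> > 0"
  define \<gamma> where "\<gamma> = b\<^sup>2"
  have \<gamma>: "\<gamma> \<ge> 0" by (simp add: \<gamma>_def)
  define d where "d = real DIM('d)"
  have d: "d \<ge> 1" using DIM_positive[where 'a = 'd] unfolding d_def by (simp add: Suc_leI)
  obtain h where h: "0 < h" "h < 1" and A0: "0 < shell_exponent b 1 h"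
    using exists_shell_exponent[of 1 b] b by auto
  define A where "A = shell_exponent b 1 h"
  have A: "A > 0" using A0 by (simp add: A_def)
  \<comment> \<open>The exponential rate in \<open>T\<close> of the crude moment of order
    \<open>2 * s\<close> after normalisation: \<open>s * \<gamma>\<close> comes from
    \<open>z powr (- (2 * s))\<close>, and \<open>2 * s\<^sup>2 * \<gamma>\<close> from the moment
    itself.\<close>
  define m where "m = s * \<gamma> + 2 * s\<^sup>2 * \<gamma>"
  have m: "m \<ge> 0" using s \<gamma> by (auto simp: m_def)
  \<comment> \<open>The allowance \<open>\<tau> = \<beta> * T\<close> for the common variable uses
    up half of the permitted loss: \<open>s * \<beta> = \<delta> / 2\<close>.\<close>
  define \<beta> where "\<beta> = \<delta> / (2 * s)"
  have \<beta>: "\<beta> > 0" using \<delta> s by (simp add: \<beta>_def)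
  \<comment> \<open>The Chernoff gain \<open>exp (- l * \<beta> * T)\<close> beats the weight
    \<open>exp (m * T)\<close> with a factor \<open>exp (- T)\<close> to spare.\<close>
  define l where "l = (m + 1) / \<beta>"
  have l: "l \<ge> 0" "l * \<beta> = m + 1" using m \<beta> by (simp_all add: l_def)
  define ll where "ll = (l\<^sup>2 + l) * \<gamma> / 2"
  have ll: "ll \<ge> 0" using l \<gamma> by (simp add: ll_def)
  \<comment> \<open>The number of cells per direction is about \<open>exp (\<kappa> * T)\<close>.
    The bound \<open>1 / 2\<close> keeps the cell scale above \<open>\<epsilon>\<close>, the second
    makes the common variable cost at most order \<open>exp T\<close>, and the third keeps
    \<open>s * \<rho> \<le> \<delta> / 2\<close>.\<close>
  define \<kappa> where "\<kappa> = min (1 / 2) (min (1 / (ll + 1)) (\<delta> * h / (s * A)))"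
  have \<kappa>: "0 < \<kappa>" using ll \<delta> h s A by (auto simp: \<kappa>_def)
  have \<kappa>_half: "\<kappa> \<le> 1 / 2" unfolding \<kappa>_def by (rule min.cobounded1)
  have \<kappa>1: "ll * \<kappa> \<le> 1"
  proof -
    have "ll * \<kappa> \<le> ll * (1 / (ll + 1))" using ll by (intro mult_left_mono) (auto simp: \<kappa>_def)
    also have "\<dots> \<le> 1" using ll by simp
    finally show ?thesis .
  qed
  \<comment> \<open>Small cells gain \<open>exp (- \<kappa> * A * T)\<close> in the moment of order
    \<open>1 + h\<close>. Half of it pays for the probe average through \<open>nA\<close>; the other
    half allows \<open>\<mu> powr h\<close> to grow like
    \<open>exp (\<kappa> * A / 2 * T)\<close>.\<close>
  define \<rho> where "\<rho> = \<kappa> * A / (2 * h)"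
  have \<rho>: "\<rho> > 0" using \<kappa> A h by (simp add: \<rho>_def)
  have \<rho>s: "s * \<rho> \<le> \<delta> / 2"
  proof -
    have "\<kappa> \<le> \<delta> * h / (s * A)" by (simp add: \<kappa>_def)
    hence "\<kappa> * (s * A) \<le> \<delta> * h" using s A by (simp add: pos_le_divide_eq)
    thus ?thesis using h by (simp add: \<rho>_def field_simps)
  qed
  obtain n0 :: nat where n0: "\<gamma> * (h * (1 - h)) / (\<kappa> * A) < real n0" using reals_Archimedean2 by blast
  define n where "n = Suc n0"
  have n: "n \<ge> 1" by (simp add: n_def)
  have nA: "\<gamma> / 2 * (h * (1 - h) / real n) \<le> \<kappa> * A / 2"
  proof -
    have "\<gamma> * (h * (1 - h)) / (\<kappa> * A) \<le> real n" using n0 by (simp add: n_def)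
    hence "\<gamma> * (h * (1 - h)) \<le> real n * (\<kappa> * A)" using \<kappa> A by (simp add: pos_divide_le_eq)
    thus ?thesis using n by (simp add: field_simps)
  qed
  define mc where "mc = moment_const b h n"
  have "2 powr (- A) < 2 powr 0" using A by (intro powr_less_mono) auto
  hence mc: "mc > 0" by (simp add: mc_def moment_const_def A_def)
  define m1 where "m1 = 2 * mc * d powr A"
  have m1: "m1 > 0" using mc d by (simp add: m1_def)
  \<comment> \<open>Normalised so that the smallness condition of \<open>laplace_bound\<close> holds
    with the constant \<open>1 / 2\<close>.\<close>
  define m0 where "m0 = m1 powr (- 1 / h)"
  have m0: "m0 > 0" "m0 powr h = 1 / m1"
  proof -
    show "m0 > 0" using m1 by (simp add: m0_def)
    have "m0 powr h = m1 powr (- 1 / h * h)" unfolding m0_def by (rule powr_powr)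
    also have "- 1 / h * h = - 1" using h by simp
    finally show "m0 powr h = 1 / m1" using m1 by (simp add: powr_minus_divide)
  qed
  define v where "v = measure lborel B"
  have v: "v > 0" using B_facts by (simp add: v_def)
  define C3 where "C3 = v powr (- (2 * s)) * exp (2 * s\<^sup>2 * \<gamma> * C - s * \<gamma> * C)"
  define C4 where "C4 = ll * (ln 2 + C)"
  define C6 where "C6 = m0 powr s + (C3 + exp 1 * (1 + exp C4)) / 2"
  have C6: "C6 > 0" unfolding C6_def using m0 v by (intro add_pos_nonneg) (auto simp: C3_def)
  \<comment> \<open>The three conditions on large \<open>T\<close> ensure respectively that the cell
    scale \<open>d / k\<close> is at least \<open>\<epsilon>\<close>, that it is at most 1, and that
    \<open>exp (m * T - \<mu> / 2) \<le> 1\<close>.\<close>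
  have ev1: "\<forall>\<^sub>F T::real in at_top. exp (T / 2) \<ge> 2" by real_asymp
  have ev2: "\<forall>\<^sub>F T::real in at_top. exp (\<kappa> * T) \<ge> d"
  proof -
    have "filterlim (\<lambda>T::real. exp (\<kappa> * T)) at_top at_top" using \<kappa> by real_asymp
    thus ?thesis unfolding filterlim_at_top by blast
  qed
  have ev3: "\<forall>\<^sub>F T::real in at_top. m * T \<le> m0 * exp (\<rho> * T) / 2"
  proof -
    have "filterlim (\<lambda>T::real. m0 * exp (\<rho> * T) / 2 - m * T) at_top at_top" using m0(1) \<rho> by real_asymp
    hence "\<forall>\<^sub>F T::real in at_top. 0 \<le> m0 * exp (\<rho> * T) / 2 - m * T" unfolding filterlim_at_top by blast
    thus ?thesis by eventually_elim simp
  qed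
  have "\<forall>\<^sub>F \<epsilon> in at_right 0. ln (\<integral>\<omega>. mass \<epsilon> b B \<omega> powr (- s) \<partial>M) \<le>
      (- (s * b\<^sup>2 / 2) + \<delta>) * (- ln \<epsilon>) + (s * \<gamma> * C / 2 + ln C6)"
    using eventually_unit eventually_minus_ln[OF ev1] eventually_minus_ln[OF ev2] eventually_minus_ln[OF ev3]
  proof eventually_elim
    case (elim \<epsilon>)
    note e = elim(1)
    define T where "T = - ln \<epsilon>"
    have T: "T \<ge> 0" using e by (auto simp: T_def ln_le_zero_iff)
    have eT: "\<epsilon> = exp (- T)" using e by (simp add: T_def)
    note E1 = elim(2)[folded T_def] and E2 = elim(3)[folded T_def] and E3 = elim(4)[folded T_def]
    define k where "k = nat \<lceil>exp (\<kappa> * T)\<rceil>"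
    have k_ge: "exp (\<kappa> * T) \<le> real k" unfolding k_def by linarith
    have ex1: "1 \<le> exp (\<kappa> * T)" using \<kappa> T by simp
    have k_le: "real k \<le> 2 * exp (\<kappa> * T)"
    proof -
      have "real k \<le> exp (\<kappa> * T) + 1" unfolding k_def using ex1 by linarith
      thus ?thesis using ex1 by linarith
    qed
    have k1: "k \<ge> 1" using k_ge ex1 by linarith
    have kp: "real k > 0" using k1 by simp
    define R where "R = d / real k"
    have R1: "\<epsilon> \<le> R"
    proof -
      have "exp (- T) * real k \<le> exp (- T) * (2 * exp (\<kappa> * T))" using k_le by (intro mult_left_mono) auto
      also have "\<dots> \<le> exp (- T) * (exp (T / 2) * exp (T / 2))"
        using E1 T mult_right_mono[OF \<kappa>_half T] by (intro mult_left_mono mult_mono) auto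
      also have "\<dots> = 1" unfolding exp_add[symmetric] by simp
      finally have "exp (- T) * real k \<le> d" using d by linarith
      thus ?thesis unfolding R_def eT using kp by (simp add: pos_le_divide_eq)
    qed
    have R2: "R \<le> 1" unfolding R_def using E2 k_ge kp by (simp add: pos_divide_le_eq)
    have RA: "R powr A \<le> d powr A * exp (- (\<kappa> * A * T))"
    proof -
      have "R \<le> d * exp (- (\<kappa> * T))"
        unfolding R_def exp_minus using k_ge d by (simp add: divide_inverse le_imp_inverse_le mult_left_mono)
      hence "R powr A \<le> (d * exp (- (\<kappa> * T))) powr A" using A d kp by (intro powr_mono2) (auto simp: R_def)
      also have "\<dots> = d powr A * exp (- (\<kappa> * T) * A)" using d by (simp add: powr_mult exp_powr_real)
      finally show ?thesis by (simp add: mult_ac)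
    qed
    define \<mu> where "\<mu> = m0 * exp (\<rho> * T)"
    have \<mu>: "\<mu> > 0" using m0 by (simp add: \<mu>_def)
    have small: "\<mu> powr h * (mc * exp (\<gamma> / 2 * (h * (1 - h) / real n) * T) * R powr A) \<le> 1 / 2"
    proof -
      have "exp (\<gamma> / 2 * (h * (1 - h) / real n) * T) \<le> exp (\<kappa> * A / 2 * T)"
        using mult_right_mono[OF nA T] by simp
      hence mcR: "mc * exp (\<gamma> / 2 * (h * (1 - h) / real n) * T) * R powr A \<le> mc * exp (\<kappa> * A / 2 * T) * (d powr A * exp (- (\<kappa> * A * T)))"
        using RA mc by (intro mult_mono mult_left_mono) auto
      define L where "L = \<mu> powr h * (mc * exp (\<gamma> / 2 * (h * (1 - h) / real n) * T) * R powr A)"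
      have "L \<le> \<mu> powr h * (mc * exp (\<kappa> * A / 2 * T) * (d powr A * exp (- (\<kappa> * A * T))))"
        unfolding L_def by (rule mult_left_mono[OF mcR]) simp
      also have "\<mu> powr h = exp (\<kappa> * A / 2 * T) / m1"
      proof -
        have "\<mu> powr h = m0 powr h * exp (\<rho> * T * h)" using m0(1) by (simp add: \<mu>_def powr_mult exp_powr_real)
        also have "\<rho> * T * h = \<kappa> * A / 2 * T" using h by (simp add: \<rho>_def)
        finally show ?thesis using m0(2) by simp
      qed
      also have "exp (\<kappa> * A / 2 * T) / m1 * (mc * exp (\<kappa> * A / 2 * T) * (d powr A * exp (- (\<kappa> * A * T)))) =
          (mc * d powr A / m1) * (exp (\<kappa> * A / 2 * T) * exp (\<kappa> * A / 2 * T) * exp (- (\<kappa> * A * T)))" by simp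
      also have "exp (\<kappa> * A / 2 * T) * exp (\<kappa> * A / 2 * T) * exp (- (\<kappa> * A * T)) = 1"
        unfolding exp_add[symmetric] by simp
      also have "mc * d powr A / m1 * 1 = 1 / 2" using mc d by (simp add: m1_def)
      finally show ?thesis unfolding L_def .
    qed
    define z where "z = exp (- (b\<^sup>2 * (T - C) / 2))"
    have z: "z > 0" by (simp add: z_def)
    define lam where "lam = \<mu> * exp (\<beta> * T)"
    have lam: "lam > 0" using \<mu> by (simp add: lam_def)
    define IL where "IL = (\<integral>\<omega>. exp (- (lam * (z * mass \<epsilon> b B \<omega>))) \<partial>M)"
    have IL: "IL \<le> exp (- (\<mu> / 2)) + exp ((l\<^sup>2 + l) * (b\<^sup>2 * (ln (real k) + C)) / 2 - l * (\<beta> * T))"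
      using laplace_bound[OF e n h A0 k1 R1[unfolded R_def d_def] R2[unfolded R_def d_def] less_imp_le[OF \<mu>] l(1)
          small[unfolded mc_def \<gamma>_def R_def d_def T_def A_def], of "\<beta> * T"]
      unfolding IL_def lam_def z_def T_def .
    have "exp (m * T) * IL \<le> 1 + exp C4"
    proof -
      have "exp (m * T) * IL \<le> exp (m * T) * (exp (- (\<mu> / 2)) + exp ((l\<^sup>2 + l) * (b\<^sup>2 * (ln (real k) + C)) / 2 - l * (\<beta> * T)))"
        by (rule mult_left_mono[OF IL]) simp
      also have "\<dots> = exp (m * T - \<mu> / 2) + exp (m * T + ((l\<^sup>2 + l) * (b\<^sup>2 * (ln (real k) + C)) / 2 - l * (\<beta> * T)))"
        unfolding distrib_left exp_add[symmetric] by simp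
      also have "\<dots> \<le> 1 + exp C4"
      proof (rule add_mono)
        show "exp (m * T - \<mu> / 2) \<le> 1" using E3 by (simp add: \<mu>_def)
        have "ln (real k) \<le> ln (2 * exp (\<kappa> * T))" using k_le kp by (subst ln_le_cancel_iff) auto
        also have "\<dots> = ln 2 + \<kappa> * T" by (simp add: ln_mult)
        finally have "ll * (ln (real k) + C) \<le> ll * (ln 2 + \<kappa> * T + C)" using ll by (intro mult_left_mono) auto
        also have "\<dots> = C4 + ll * \<kappa> * T" by (simp add: C4_def algebra_simps)
        also have "ll * \<kappa> * T \<le> 1 * T" by (rule mult_right_mono[OF \<kappa>1 T])
        finally have "ll * (ln (real k) + C) \<le> C4 + T" by simp
        moreover have "(l\<^sup>2 + l) * (b\<^sup>2 * (ln (real k) + C)) / 2 = ll * (ln (real k) + C)" by (simp add: ll_def \<gamma>_def)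
        moreover have "l * (\<beta> * T) = (m + 1) * T" using l(2) by (simp add: mult.assoc[symmetric])
        ultimately show "exp (m * T + ((l\<^sup>2 + l) * (b\<^sup>2 * (ln (real k) + C)) / 2 - l * (\<beta> * T))) \<le> exp C4"
          by (simp add: algebra_simps)
      qed
      finally show ?thesis .
    qed
    \<comment> \<open>Exactly cancels the growth of the normalised crude moment, leaving the
      constant \<open>C3\<close>.\<close>
    define \<eta> where "\<eta> = exp (- (m * T))"
    have \<eta>: "\<eta> > 0" by (simp add: \<eta>_def)
    have t2: "exp 1 / \<eta> * IL \<le> exp 1 * (1 + exp C4)"
      using mult_left_mono[OF \<open>exp (m * T) * IL \<le> 1 + exp C4\<close>, of "exp 1"]
      by (simp add: \<eta>_def exp_minus divide_inverse mult_ac)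
    have t1: "\<eta> * (z powr (- (2 * s)) * (v powr (- (2 * s)) * exp ((2 * s)\<^sup>2 * b\<^sup>2 * (T + C) / 2))) = C3"
    proof -
      have eq: "\<eta> * z powr (- (2 * s)) * exp ((2 * s)\<^sup>2 * b\<^sup>2 * (T + C) / 2) = exp (2 * s\<^sup>2 * \<gamma> * C - s * \<gamma> * C)"
        unfolding \<eta>_def z_def exp_powr_real exp_add[symmetric] m_def \<gamma>_def
        by (rule arg_cong[where f = exp]) (simp add: power2_eq_square field_simps)
      have "\<eta> * (z powr (- (2 * s)) * (v powr (- (2 * s)) * exp ((2 * s)\<^sup>2 * b\<^sup>2 * (T + C) / 2))) =
          v powr (- (2 * s)) * (\<eta> * z powr (- (2 * s)) * exp ((2 * s)\<^sup>2 * b\<^sup>2 * (T + C) / 2))" by (simp only: mult_ac)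
      thus ?thesis unfolding eq C3_def .
    qed
    have t0: "lam powr s \<le> m0 powr s * exp (\<delta> * T)"
    proof -
      have "lam powr s = m0 powr s * exp ((\<rho> + \<beta>) * T * s)"
        unfolding lam_def \<mu>_def using m0(1) by (simp add: powr_mult exp_powr_real exp_add[symmetric] distrib_right mult.assoc)
      also have "(\<rho> + \<beta>) * T * s \<le> \<delta> * T"
      proof -
        have "s * \<beta> = \<delta> / 2" using s by (simp add: \<beta>_def)
        hence "(s * \<rho> + s * \<beta>) * T \<le> \<delta> * T" using \<rho>s T by (intro mult_right_mono) auto
        thus ?thesis by (simp add: algebra_simps)
      qed
      finally show ?thesis by (simp add: mult_left_mono)
    qed
    have "(\<integral>\<omega>. mass \<epsilon> b B \<omega> powr (- s) \<partial>M) \<le> z powr s * (lam powr s + (C3 + exp 1 / \<eta> * IL) / 2)"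
      using neg_moment_step[OF e s lam \<eta> z, of b] unfolding IL_def[symmetric] v_def[symmetric] T_def[symmetric] t1 .
    also have "\<dots> \<le> z powr s * (m0 powr s * exp (\<delta> * T) + (C3 + exp 1 * (1 + exp C4)) / 2 * exp (\<delta> * T))"
    proof (intro mult_left_mono add_mono t0)
      have "(C3 + exp 1 / \<eta> * IL) / 2 \<le> (C3 + exp 1 * (1 + exp C4)) / 2"
        by (intro divide_right_mono add_left_mono t2) simp
      also have "\<dots> = (C3 + exp 1 * (1 + exp C4)) / 2 * 1" by simp
      also have "\<dots> \<le> (C3 + exp 1 * (1 + exp C4)) / 2 * exp (\<delta> * T)"
        using \<delta> T by (intro mult_left_mono) (auto simp: C3_def)
      finally show "(C3 + exp 1 / \<eta> * IL) / 2 \<le> (C3 + exp 1 * (1 + exp C4)) / 2 * exp (\<delta> * T)" .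
    qed simp
    also have "\<dots> = C6 * exp (- (b\<^sup>2 * (T - C) / 2) * s + \<delta> * T)"
      unfolding C6_def z_def exp_powr_real exp_add by (simp add: algebra_simps)
    finally have fin: "(\<integral>\<omega>. mass \<epsilon> b B \<omega> powr (- s) \<partial>M) \<le> C6 * exp (- (b\<^sup>2 * (T - C) / 2) * s + \<delta> * T)" .
    have pos: "0 < (\<integral>\<omega>. mass \<epsilon> b B \<omega> powr (- s) \<partial>M)"
    proof (rule expectation_pos[OF mass_neg_moment_crude(1)[OF e s]])
      show "AE \<omega> in M. 0 < mass \<epsilon> b B \<omega> powr (- s)"
        using mass_pos_AE[OF e B_facts(1) order_refl B_facts(3), of b] by eventually_elim simp
    qed
    have "ln (\<integral>\<omega>. mass \<epsilon> b B \<omega> powr (- s) \<partial>M) \<le> ln (C6 * exp (- (b\<^sup>2 * (T - C) / 2) * s + \<delta> * T))"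
      using fin pos by (subst ln_le_cancel_iff) (auto intro: less_le_trans)
    also have "\<dots> = ln C6 + (- (b\<^sup>2 * (T - C) / 2) * s + \<delta> * T)" using C6 by (simp add: ln_mult)
    also have "\<dots> = (- (s * b\<^sup>2 / 2) + \<delta>) * T + (s * \<gamma> * C / 2 + ln C6)"
      by (simp add: \<gamma>_def field_simps)
    finally show ?case by (simp add: T_def)
  qed
  thus "\<exists>c. \<forall>\<^sub>F \<epsilon> in at_right 0. ln (\<integral>\<omega>. mass \<epsilon> b B \<omega> powr (- s) \<partial>M) \<le> (- (s * b\<^sup>2 / 2) + \<delta>) * (- ln \<epsilon>) + c"
    by blast
qed

end

section \<open>Convexity in the exponent\<close>

lemma ub_real_limit:
  assumes "\<forall>\<^sub>F t in F. ub h (f t)" "(f \<longlongrightarrow> \<phi>) F" "F \<noteq> bot"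
  shows "ub h \<phi>"
proof (rule ub_limit)
  fix \<delta> :: real assume "\<delta> > 0"
  hence "\<forall>\<^sub>F t in F. f t < \<phi> + \<delta>" using assms(2) by (intro order_tendstoD(2)) auto
  with assms(1) have "\<forall>\<^sub>F t in F. ub h (f t) \<and> f t < \<phi> + \<delta>" by (rule eventually_conj)
  from eventually_happens'[OF assms(3) this] obtain t where "ub h (f t)" "f t < \<phi> + \<delta>" by (elim exE conjE)
  thus "ub h (\<phi> + \<delta>)" by (rule ub_le[OF _ less_imp_le])
qed

text \<open>Convexity solved for the far endpoint: an upper bound at the near endpoint and a lower
  bound at an interior point force a lower bound beyond. It serves both in \<open>q\<close> for
  \<open>lnA\<close> and in \<open>b\<close> for \<open>ElnZ\<close>.\<close>

lemma ub_extrapolate: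
  assumes \<theta>: "0 < \<theta>" "\<theta> < 1"
    and le: "\<forall>\<^sub>F \<epsilon> in at_right 0. h1 \<epsilon> \<le> (1 - \<theta>) * h0 \<epsilon> + \<theta> * h \<epsilon>"
    and lb1: "ub (\<lambda>\<epsilon>. - h1 \<epsilon>) (- f1)" and ub0: "ub h0 f0"
  shows "ub (\<lambda>\<epsilon>. - h \<epsilon>) (- f0 - (f1 - f0) / \<theta>)"
proof -
  have "ub (\<lambda>\<epsilon>. 1 / \<theta> * (- h1 \<epsilon>) + (1 - \<theta>) / \<theta> * h0 \<epsilon>) (1 / \<theta> * (- f1) + (1 - \<theta>) / \<theta> * f0)"
    using \<theta> by (intro ub_add ub_cmult lb1 ub0) auto
  hence "ub (\<lambda>\<epsilon>. - h \<epsilon>) (1 / \<theta> * (- f1) + (1 - \<theta>) / \<theta> * f0)"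
  proof (rule ub_mono)
    show "\<forall>\<^sub>F \<epsilon> in at_right 0. - h \<epsilon> \<le> 1 / \<theta> * (- h1 \<epsilon>) + (1 - \<theta>) / \<theta> * h0 \<epsilon>"
      using le
    proof eventually_elim
      case (elim \<epsilon>)
      hence "1 / \<theta> * h1 \<epsilon> \<le> 1 / \<theta> * ((1 - \<theta>) * h0 \<epsilon> + \<theta> * h \<epsilon>)"
        using \<theta>(1) by (intro mult_left_mono) auto
      also have "\<dots> = (1 - \<theta>) / \<theta> * h0 \<epsilon> + h \<epsilon>" using \<theta>(1) by (simp add: distrib_left)
      finally show ?case by simp
    qed
  qed
  moreover have "1 / \<theta> * (- f1) + (1 - \<theta>) / \<theta> * f0 = - f0 - (f1 - f0) / \<theta>"
    using \<theta>(1) by (simp add: field_simps)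
  ultimately show ?thesis by simp
qed

context log_correlated_fields
begin

section \<open>Exponent bounds for the moment ratio\<close>

definition lnA :: "real \<Rightarrow> real \<Rightarrow> real \<Rightarrow> real" where
  "lnA b q \<epsilon> = ln (\<integral>\<omega>. ratio \<epsilon> b q \<omega> \<partial>M)"

lemma unit_ub_const:
  assumes "\<And>\<epsilon>. \<epsilon> \<in> {0<..1} \<Longrightarrow> h \<epsilon> \<le> \<phi> * (- ln \<epsilon>) + c"
  shows "ub h \<phi>"
  by (rule ub_const, rule eventually_mono[OF eventually_unit]) (rule assms)

lemma mass_moment_pos:
  assumes "\<epsilon> \<in> {0<..1}"
  shows "0 < (\<integral>\<omega>. mass \<epsilon> c B \<omega> \<partial>M)"
  by (rule expectation_pos[OF mass_integral(1)[OF assms B_facts(1) order_refl] mass_pos_AE[OF assms B_facts(1) order_refl B_facts(3)]])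

lemma ln_mass_moment_le:
  assumes e: "\<epsilon> \<in> {0<..1}"
  shows "ln (\<integral>\<omega>. mass \<epsilon> c B \<omega> \<partial>M) \<le> c\<^sup>2 / 2 * (- ln \<epsilon>) + (c\<^sup>2 * C / 2 + ln (measure lborel B))"
    and "ln (\<integral>\<omega>. mass \<epsilon> c B \<omega> \<partial>M) \<ge> c\<^sup>2 / 2 * (- ln \<epsilon>) - c\<^sup>2 * C / 2 + ln (measure lborel B)"
proof -
  define v where "v = measure lborel B"
  have v: "v > 0" unfolding v_def by (rule B_facts(2))
  note m = mass_integral(2,3)[OF e B_facts(1) order_refl, of c, folded v_def]
  have lnv: "ln (exp x * v) = x + ln v" for x using v by (simp add: ln_mult)
  have "ln (\<integral>\<omega>. mass \<epsilon> c B \<omega> \<partial>M) \<le> ln (exp (c\<^sup>2 * (- ln \<epsilon> + C) / 2) * v)"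
    using m(1) mass_moment_pos[OF e, of c] by (rule ln_mono)
  thus "ln (\<integral>\<omega>. mass \<epsilon> c B \<omega> \<partial>M) \<le> c\<^sup>2 / 2 * (- ln \<epsilon>) + (c\<^sup>2 * C / 2 + ln (measure lborel B))"
    unfolding lnv v_def[symmetric] by (simp add: field_simps)
  have "ln (exp (c\<^sup>2 * (- ln \<epsilon> - C) / 2) * v) \<le> ln (\<integral>\<omega>. mass \<epsilon> c B \<omega> \<partial>M)"
    using m(2) by (rule ln_mono) (use v in simp)
  thus "ln (\<integral>\<omega>. mass \<epsilon> c B \<omega> \<partial>M) \<ge> c\<^sup>2 / 2 * (- ln \<epsilon>) - c\<^sup>2 * C / 2 + ln (measure lborel B)"
    unfolding lnv v_def[symmetric] by (simp add: field_simps)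
qed

lemma mass_powr_moment:
  assumes e: "\<epsilon> \<in> {0<..1}" and a: "a > 1"
  shows "integrable M (\<lambda>\<omega>. mass \<epsilon> c B \<omega> powr a)"
    and "ln (\<integral>\<omega>. mass \<epsilon> c B \<omega> powr a \<partial>M) \<le> (a * c)\<^sup>2 / 2 * (- ln \<epsilon>) + ((a * c)\<^sup>2 * C / 2 + a * ln (measure lborel B))"
proof -
  define v where "v = measure lborel B"
  have v: "v > 0" using B_facts(2) by (simp add: v_def)
  have nn: "AE \<omega> in M. 0 \<le> mass \<epsilon> c B \<omega> powr a" by simp
  note sw = integrable_sandwich[OF integrable_mult_right[OF mass_integral(1)[OF e B_facts(1) order_refl]]
      mass_powr_measurable[OF e B_facts(1) order_refl] nn mass_powr_AE[OF e B_facts(1) order_refl B_facts(2) a, of c]]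
  show i: "integrable M (\<lambda>\<omega>. mass \<epsilon> c B \<omega> powr a)" by (rule sw(1))
  have pos: "0 < (\<integral>\<omega>. mass \<epsilon> c B \<omega> powr a \<partial>M)"
  proof (rule expectation_pos[OF i])
    show "AE \<omega> in M. 0 < mass \<epsilon> c B \<omega> powr a"
      using mass_pos_AE[OF e B_facts(1) order_refl B_facts(3), of c] by eventually_elim simp
  qed
  have "(\<integral>\<omega>. mass \<epsilon> c B \<omega> powr a \<partial>M) \<le> v powr (a - 1) * (\<integral>\<omega>. mass \<epsilon> (a * c) B \<omega> \<partial>M)"
    using sw(2) by (simp add: v_def)
  hence "ln (\<integral>\<omega>. mass \<epsilon> c B \<omega> powr a \<partial>M) \<le> ln (v powr (a - 1) * (\<integral>\<omega>. mass \<epsilon> (a * c) B \<omega> \<partial>M))"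
    using pos v mass_moment_pos[OF e, of "a * c"] by (subst ln_le_cancel_iff) auto
  also have "\<dots> = (a - 1) * ln v + ln (\<integral>\<omega>. mass \<epsilon> (a * c) B \<omega> \<partial>M)"
    using v mass_moment_pos[OF e, of "a * c"] by (subst ln_mult) (auto simp: ln_powr)
  also have "\<dots> \<le> (a - 1) * ln v + ((a * c)\<^sup>2 / 2 * (- ln \<epsilon>) + ((a * c)\<^sup>2 * C / 2 + ln v))"
    using ln_mass_moment_le(1)[OF e, of "a * c"] unfolding v_def by (rule add_left_mono)
  also have "\<dots> = (a * c)\<^sup>2 / 2 * (- ln \<epsilon>) + ((a * c)\<^sup>2 * C / 2 + a * ln v)" by (simp add: algebra_simps)
  finally show "ln (\<integral>\<omega>. mass \<epsilon> c B \<omega> powr a \<partial>M) \<le> (a * c)\<^sup>2 / 2 * (- ln \<epsilon>) + ((a * c)\<^sup>2 * C / 2 + a * ln (measure lborel B))"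
    unfolding v_def .
qed

text \<open>Hoelder's inequality with exponent \<open>a\<close> slightly above 1 on the mass with
  parameter \<open>q * b\<close> needs a negative moment of very large order
  \<open>p = q / (1 - \<theta>)\<close>. This loses nothing, since \<open>ub_neg_moment\<close> is
  linear in the order; then \<open>a\<close> tends to 1.\<close>

lemma ub_subcritical:
  assumes b: "b\<^sup>2 < 2 * real DIM('d)" and q: "q > 0"
  shows "ub (lnA b q) (b\<^sup>2 * (q\<^sup>2 - q) / 2)"
proof (rule ub_real_limit[where F = "at_right 1" and f = "\<lambda>a. a * q\<^sup>2 * b\<^sup>2 / 2 - q * b\<^sup>2 / 2"])
  have "((\<lambda>a. a * q\<^sup>2 * b\<^sup>2 / 2 - q * b\<^sup>2 / 2) \<longlongrightarrow> 1 * q\<^sup>2 * b\<^sup>2 / 2 - q * b\<^sup>2 / 2) (at_right 1)"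
    by (intro tendsto_intros) simp_all
  thus "((\<lambda>a. a * q\<^sup>2 * b\<^sup>2 / 2 - q * b\<^sup>2 / 2) \<longlongrightarrow> b\<^sup>2 * (q\<^sup>2 - q) / 2) (at_right 1)"
    by (simp add: algebra_simps diff_divide_distrib)
  show "\<forall>\<^sub>F a in at_right 1. ub (lnA b q) (a * q\<^sup>2 * b\<^sup>2 / 2 - q * b\<^sup>2 / 2)"
    using eventually_at_right_less[of "1::real"]
  proof eventually_elim
    case (elim a)
    hence a: "a > 1" .
    define \<theta> where "\<theta> = 1 / a"
    have \<theta>: "0 < \<theta>" "\<theta> < 1" using a by (auto simp: \<theta>_def)
    define p where "p = q / (1 - \<theta>)"
    have p: "p > 0" using q \<theta> by (simp add: p_def)
    define N where "N \<epsilon> = ln (\<integral>\<omega>. mass \<epsilon> b B \<omega> powr (- p) \<partial>M)" for \<epsilon>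
    define G where "G \<epsilon> = ln (\<integral>\<omega>. mass \<epsilon> (q * b) B \<omega> powr a \<partial>M)" for \<epsilon>
    have le: "lnA b q \<epsilon> \<le> (1 - \<theta>) * N \<epsilon> + \<theta> * G \<epsilon>" if e: "\<epsilon> \<in> {0<..1}" for \<epsilon>
    proof -
      note i0 = mass_neg_moment_crude(1)[OF e p, of b] and i2 = mass_powr_moment(1)[OF e a, of "q * b"]
      have posAE: "AE \<omega> in M. 0 < mass \<epsilon> c B \<omega>" for c by (rule mass_pos_AE[OF e B_facts(1) order_refl B_facts(3)])
      have P0: "0 < (\<integral>\<omega>. mass \<epsilon> b B \<omega> powr (- p) \<partial>M)"
        by (rule expectation_pos[OF i0]) (use posAE[of b] in \<open>eventually_elim, simp\<close>)
      have P2: "0 < (\<integral>\<omega>. mass \<epsilon> (q * b) B \<omega> powr a \<partial>M)"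
        by (rule expectation_pos[OF i2]) (use posAE[of "q * b"] in \<open>eventually_elim, simp\<close>)
      have nn: "AE \<omega> in M. 0 \<le> mass \<epsilon> b B \<omega> powr (- p)" "AE \<omega> in M. 0 \<le> mass \<epsilon> (q * b) B \<omega> powr a" by simp_all
      have eq: "(mass \<epsilon> b B \<omega> powr (- p)) powr (1 - \<theta>) * (mass \<epsilon> (q * b) B \<omega> powr a) powr \<theta> = ratio \<epsilon> b q \<omega>" for \<omega>
      proof -
        have "- p * (1 - \<theta>) = - q" "a * \<theta> = 1" using \<theta> a by (simp_all add: p_def \<theta>_def)
        thus ?thesis unfolding ratio_def powr_powr using mass_nonneg by simp
      qed
      have "(\<integral>\<omega>. ratio \<epsilon> b q \<omega> \<partial>M) \<le> (\<integral>\<omega>. mass \<epsilon> b B \<omega> powr (- p) \<partial>M) powr (1 - \<theta>) * (\<integral>\<omega>. mass \<epsilon> (q * b) B \<omega> powr a \<partial>M) powr \<theta>"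
        using powr_holder_integral(2)[OF i0 i2 nn \<theta>] unfolding eq .
      hence "lnA b q \<epsilon> \<le> ln ((\<integral>\<omega>. mass \<epsilon> b B \<omega> powr (- p) \<partial>M) powr (1 - \<theta>) * (\<integral>\<omega>. mass \<epsilon> (q * b) B \<omega> powr a \<partial>M) powr \<theta>)"
        unfolding lnA_def using ratio_expectation_pos[OF q e, of b] P0 P2 by (subst ln_le_cancel_iff) auto
      also have "\<dots> = (1 - \<theta>) * N \<epsilon> + \<theta> * G \<epsilon>" unfolding N_def G_def using P0 P2 by (simp add: ln_mult ln_powr)
      finally show ?thesis .
    qed
    have "ub N (- (p * b\<^sup>2 / 2))" unfolding N_def by (rule ub_neg_moment[OF b p])
    moreover have "ub G ((a * (q * b))\<^sup>2 / 2)" unfolding G_def by (rule unit_ub_const) (rule mass_powr_moment(2)[OF _ a])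
    ultimately have "ub (\<lambda>\<epsilon>. (1 - \<theta>) * N \<epsilon> + \<theta> * G \<epsilon>) ((1 - \<theta>) * (- (p * b\<^sup>2 / 2)) + \<theta> * ((a * (q * b))\<^sup>2 / 2))"
      using \<theta> by (intro ub_add ub_cmult) auto
    hence "ub (lnA b q) ((1 - \<theta>) * (- (p * b\<^sup>2 / 2)) + \<theta> * ((a * (q * b))\<^sup>2 / 2))"
      by (rule ub_mono) (rule eventually_mono[OF eventually_unit le])
    moreover have "(1 - \<theta>) * (- (p * b\<^sup>2 / 2)) + \<theta> * ((a * (q * b))\<^sup>2 / 2) = a * q\<^sup>2 * b\<^sup>2 / 2 - q * b\<^sup>2 / 2"
    proof -
      have "(1 - \<theta>) * p = q" using \<theta> by (simp add: p_def)
      hence "(1 - \<theta>) * (- (p * b\<^sup>2 / 2)) = - (q * b\<^sup>2 / 2)" by (simp add: mult.assoc[symmetric])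
      moreover have "\<theta> * ((a * (q * b))\<^sup>2 / 2) = a * q\<^sup>2 * b\<^sup>2 / 2" using a by (simp add: \<theta>_def power2_eq_square)
      ultimately show ?thesis by simp
    qed
    ultimately show ?case by simp
  qed
qed simp

text \<open>The first moment of the mass with parameter \<open>q * b\<close> is interpolated between
  the ratio and the moment of \<open>tilted_moment\<close>. The resulting exponents combine exactly
  for each admissible \<open>s\<close>, so one fixed \<open>s\<close> is enough.\<close>

lemma lb_subcritical:
  assumes q: "q > 0" and qb: "q * b\<^sup>2 < real DIM('d) + b\<^sup>2 / 2"
  shows "ub (\<lambda>\<epsilon>. - lnA b q \<epsilon>) (- (b\<^sup>2 * (q\<^sup>2 - q) / 2))"
proof -
  obtain s where s: "0 < s" "s < 1" and A: "0 < shell_exponent b q s" using exists_shell_exponent[OF qb] by blast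
  define G where "G \<epsilon> = (\<integral>\<omega>. mass \<epsilon> b B \<omega> powr s * mass \<epsilon> (q * b) B \<omega> \<partial>M)" for \<epsilon>
  have posAE: "AE \<omega> in M. 0 < mass \<epsilon> c B \<omega>" if "\<epsilon> \<in> {0<..1}" for \<epsilon> c by (rule mass_pos_AE[OF that B_facts(1) order_refl B_facts(3)])
  have Gi: "integrable M (\<lambda>\<omega>. mass \<epsilon> b B \<omega> powr s * mass \<epsilon> (q * b) B \<omega>)" if "\<epsilon> \<in> {0<..1}" for \<epsilon>
    using bspec[OF _ that] tilted_moment[OF order_refl less_imp_le[OF q] s A] by blast
  have Gpos: "0 < G \<epsilon>" if e: "\<epsilon> \<in> {0<..1}" for \<epsilon>
    unfolding G_def
    by (rule expectation_pos[OF Gi[OF e]]) (use posAE[OF e, of b] posAE[OF e, of "q * b"] in \<open>eventually_elim, simp\<close>)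
  have ubG: "ub (\<lambda>\<epsilon>. ln (G \<epsilon>)) (b\<^sup>2 / 2 * (q\<^sup>2 + s))"
  proof (rule ub_real_limit[where F = sequentially and f = "\<lambda>n. b\<^sup>2 / 2 * (q\<^sup>2 + s + s * (1 - s) / real n)"])
    show "\<forall>\<^sub>F n in sequentially. ub (\<lambda>\<epsilon>. ln (G \<epsilon>)) (b\<^sup>2 / 2 * (q\<^sup>2 + s + s * (1 - s) / real n))"
      using eventually_ge_at_top[of 1]
    proof eventually_elim
      case (elim n)
      obtain A' where A': "A' > 0" and bound: "\<And>\<epsilon>. \<epsilon> \<in> {0<..1} \<Longrightarrow>
          G \<epsilon> \<le> A' * exp (b\<^sup>2 / 2 * (q\<^sup>2 + s + s * (1 - s) / real n) * (- ln \<epsilon>))"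
        using tilted_moment[OF elim less_imp_le[OF q] s A] unfolding G_def by blast
      show ?case
      proof (rule unit_ub_const)
        fix \<epsilon> :: real assume e: "\<epsilon> \<in> {0<..1}"
        have "ln (G \<epsilon>) \<le> ln (A' * exp (b\<^sup>2 / 2 * (q\<^sup>2 + s + s * (1 - s) / real n) * (- ln \<epsilon>)))"
          using bound[OF e] Gpos[OF e] A' by (subst ln_le_cancel_iff) auto
        also have "\<dots> = b\<^sup>2 / 2 * (q\<^sup>2 + s + s * (1 - s) / real n) * (- ln \<epsilon>) + ln A'" using A' by (subst ln_mult) auto
        finally show "ln (G \<epsilon>) \<le> b\<^sup>2 / 2 * (q\<^sup>2 + s + s * (1 - s) / real n) * (- ln \<epsilon>) + ln A'" .
      qed
    qed
    have "(\<lambda>n. b\<^sup>2 / 2 * (q\<^sup>2 + s + s * (1 - s) / real n)) \<longlonglongrightarrow> b\<^sup>2 / 2 * (q\<^sup>2 + s + 0)"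
      by (intro tendsto_intros lim_const_over_n)
    thus "(\<lambda>n. b\<^sup>2 / 2 * (q\<^sup>2 + s + s * (1 - s) / real n)) \<longlonglongrightarrow> b\<^sup>2 / 2 * (q\<^sup>2 + s)" by simp
  qed simp
  \<comment> \<open>The weight at which the powers \<open>- q\<close> and \<open>s\<close> of the
    mass with parameter \<open>b\<close> cancel.\<close>
  define \<theta> where "\<theta> = q / (q + s)"
  have \<theta>: "0 < \<theta>" "\<theta> < 1" "1 - \<theta> = s / (q + s)" using q s by (auto simp: \<theta>_def field_simps)
  define Z where "Z \<epsilon> = ln (\<integral>\<omega>. mass \<epsilon> (q * b) B \<omega> \<partial>M)" for \<epsilon>
  have le: "- lnA b q \<epsilon> \<le> q / s * ln (G \<epsilon>) + (q + s) / s * (- Z \<epsilon>)" if e: "\<epsilon> \<in> {0<..1}" for \<epsilon>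
  proof -
    note i0 = ratio_integrable[OF q e, of b]
    have nn: "AE \<omega> in M. 0 \<le> ratio \<epsilon> b q \<omega>" "AE \<omega> in M. 0 \<le> mass \<epsilon> b B \<omega> powr s * mass \<epsilon> (q * b) B \<omega>"
      using mass_nonneg by (simp_all add: ratio_def)
    note H = powr_holder_integral[OF i0 Gi[OF e] nn \<theta>(1,2)]
    have AEeq: "AE \<omega> in M. ratio \<epsilon> b q \<omega> powr (1 - \<theta>) * (mass \<epsilon> b B \<omega> powr s * mass \<epsilon> (q * b) B \<omega>) powr \<theta> = mass \<epsilon> (q * b) B \<omega>"
      using posAE[OF e, of b]
    proof eventually_elim
      case (elim \<omega>)
      have "ratio \<epsilon> b q \<omega> powr (1 - \<theta>) * (mass \<epsilon> b B \<omega> powr s * mass \<epsilon> (q * b) B \<omega>) powr \<theta> =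
          mass \<epsilon> b B \<omega> powr (- q * (1 - \<theta>) + s * \<theta>) * mass \<epsilon> (q * b) B \<omega> powr ((1 - \<theta>) + \<theta>)"
        unfolding ratio_def powr_mult powr_powr powr_add by (simp only: mult_ac)
      also have "- q * (1 - \<theta>) + s * \<theta> = 0" unfolding \<theta>(3) by (simp add: \<theta>_def)
      finally show ?case using elim mass_nonneg by simp
    qed
    have "(\<integral>\<omega>. mass \<epsilon> (q * b) B \<omega> \<partial>M) = (\<integral>\<omega>. ratio \<epsilon> b q \<omega> powr (1 - \<theta>) * (mass \<epsilon> b B \<omega> powr s * mass \<epsilon> (q * b) B \<omega>) powr \<theta> \<partial>M)"
      by (rule integral_cong_AE[OF mass_measurable[OF e B_facts(1) order_refl] borel_measurable_integrable[OF H(1)]])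
         (use AEeq in \<open>eventually_elim, simp\<close>)
    also have "\<dots> \<le> (\<integral>\<omega>. ratio \<epsilon> b q \<omega> \<partial>M) powr (1 - \<theta>) * G \<epsilon> powr \<theta>" using H(2) unfolding G_def .
    finally have "Z \<epsilon> \<le> ln ((\<integral>\<omega>. ratio \<epsilon> b q \<omega> \<partial>M) powr (1 - \<theta>) * G \<epsilon> powr \<theta>)"
      unfolding Z_def using mass_moment_pos[OF e, of "q * b"] ratio_expectation_pos[OF q e, of b] Gpos[OF e]
      by (subst ln_le_cancel_iff) auto
    also have "\<dots> = (1 - \<theta>) * lnA b q \<epsilon> + \<theta> * ln (G \<epsilon>)"
      unfolding lnA_def using ratio_expectation_pos[OF q e, of b] Gpos[OF e] by (simp add: ln_mult ln_powr)
    also have "\<dots> = (s * lnA b q \<epsilon> + q * ln (G \<epsilon>)) / (q + s)"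
      unfolding \<theta>(3) by (simp add: \<theta>_def add_divide_distrib)
    finally have "Z \<epsilon> * (q + s) \<le> s * lnA b q \<epsilon> + q * ln (G \<epsilon>)" using q s by (simp add: pos_le_divide_eq)
    thus ?thesis using s by (simp add: field_simps)
  qed
  have "ub (\<lambda>\<epsilon>. - Z \<epsilon>) (- ((q * b)\<^sup>2 / 2))"
  proof (rule unit_ub_const)
    fix \<epsilon> :: real assume "\<epsilon> \<in> {0<..1}"
    from ln_mass_moment_le(2)[OF this, of "q * b"]
    show "- Z \<epsilon> \<le> - ((q * b)\<^sup>2 / 2) * (- ln \<epsilon>) + ((q * b)\<^sup>2 * C / 2 - ln (measure lborel B))" unfolding Z_def by linarith
  qed
  with ubG have "ub (\<lambda>\<epsilon>. q / s * ln (G \<epsilon>) + (q + s) / s * (- Z \<epsilon>)) (q / s * (b\<^sup>2 / 2 * (q\<^sup>2 + s)) + (q + s) / s * (- ((q * b)\<^sup>2 / 2)))"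
    using q s by (intro ub_add ub_cmult) auto
  hence "ub (\<lambda>\<epsilon>. - lnA b q \<epsilon>) (q / s * (b\<^sup>2 / 2 * (q\<^sup>2 + s)) + (q + s) / s * (- ((q * b)\<^sup>2 / 2)))"
    by (rule ub_mono) (rule eventually_mono[OF eventually_unit le])
  moreover have "q / s * (b\<^sup>2 / 2 * (q\<^sup>2 + s)) + (q + s) / s * (- ((q * b)\<^sup>2 / 2)) = - (b\<^sup>2 * (q\<^sup>2 - q) / 2)"
    using s by (simp add: field_simps power2_eq_square)
  ultimately show ?thesis by simp
qed

lemma ub_ratio_trivial:
  assumes "p > 0"
  shows "ub (lnA b p) (real DIM('d) * p)"
proof -
  obtain A where A: "A > 0" and bound: "\<And>\<epsilon>. \<epsilon> \<in> {0<..1} \<Longrightarrow> (\<integral>\<omega>. ratio \<epsilon> b p \<omega> \<partial>M) \<le> A * exp (real DIM('d) * p * (- ln \<epsilon>))"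
    using ratio_moment[OF assms, of b] by blast
  show ?thesis
  proof (rule unit_ub_const)
    fix \<epsilon> :: real assume e: "\<epsilon> \<in> {0<..1}"
    have "lnA b p \<epsilon> \<le> ln (A * exp (real DIM('d) * p * (- ln \<epsilon>)))"
      unfolding lnA_def using bound[OF e] ratio_expectation_pos[OF assms e, of b] A by (subst ln_le_cancel_iff) auto
    also have "\<dots> = real DIM('d) * p * (- ln \<epsilon>) + ln A" using A by (subst ln_mult) auto
    finally show "lnA b p \<epsilon> \<le> real DIM('d) * p * (- ln \<epsilon>) + ln A" .
  qed
qed

text \<open>A convex function of \<open>q\<close> that is at most \<open>d * q\<close> has slope at most \<open>d\<close> everywhere.\<close>

lemma ub_interpolate:
  assumes q0: "0 < q0" "q0 \<le> q" and ub0: "ub (lnA b q0) \<phi>"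
  shows "ub (lnA b q) (\<phi> + real DIM('d) * (q - q0))"
proof (cases "q = q0")
  case False
  hence q: "q0 < q" using q0 by simp
  define d where "d = real DIM('d)"
  show ?thesis
  \<comment> \<open>Interpolation between \<open>q0\<close> and a far point \<open>p\<close>; as
    \<open>p\<close> grows, the trivial bound \<open>d * p\<close> leaves only the slope
    \<open>d\<close>.\<close>
  proof (rule ub_real_limit[where F = at_top and f = "\<lambda>p. (1 - (q - q0) / (p - q0)) * \<phi> + (q - q0) / (p - q0) * (d * p)"])
    show "\<forall>\<^sub>F p in at_top. ub (lnA b q) ((1 - (q - q0) / (p - q0)) * \<phi> + (q - q0) / (p - q0) * (d * p))"
      using eventually_gt_at_top[of q]
    proof eventually_elim
      case (elim p)
      define \<theta> where "\<theta> = (q - q0) / (p - q0)"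
      have \<theta>: "0 < \<theta>" "\<theta> < 1" using elim q by (auto simp: \<theta>_def)
      have qeq: "q = (1 - \<theta>) * q0 + \<theta> * p"
      proof -
        have "\<theta> * (p - q0) = q - q0" using elim q by (simp add: \<theta>_def)
        thus ?thesis by (simp add: algebra_simps)
      qed
      have p: "p > 0" using elim q q0 by linarith
      have "ub (\<lambda>\<epsilon>. (1 - \<theta>) * lnA b q0 \<epsilon> + \<theta> * lnA b p \<epsilon>) ((1 - \<theta>) * \<phi> + \<theta> * (d * p))"
        unfolding d_def using \<theta> by (intro ub_add ub_cmult ub0 ub_ratio_trivial p) auto
      thus ?case unfolding \<theta>_def[symmetric]
        by (rule ub_mono) (rule eventually_mono[OF eventually_unit], unfold lnA_def, rule ratio_logconvex[OF _ q0(1) p \<theta> qeq])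
    qed
    show "((\<lambda>p. (1 - (q - q0) / (p - q0)) * \<phi> + (q - q0) / (p - q0) * (d * p)) \<longlongrightarrow> \<phi> + real DIM('d) * (q - q0)) at_top"
    proof -
      have "((\<lambda>p. 1 / (p - q0)) \<longlongrightarrow> 0) at_top" "((\<lambda>p. p / (p - q0)) \<longlongrightarrow> 1) at_top" by real_asymp+
      hence "((\<lambda>p. (1 - (q - q0) * (1 / (p - q0))) * \<phi> + (q - q0) * d * (p / (p - q0))) \<longlongrightarrow>
          (1 - (q - q0) * 0) * \<phi> + (q - q0) * d * 1) at_top" by (intro tendsto_intros)
      thus ?thesis by (simp add: d_def mult_ac)
    qed
  qed simp
qed (use ub0 in simp)

lemma lb_extrapolate:
  assumes q: "0 < q0" "q0 < q1" "q1 < q"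
    and lb1: "ub (\<lambda>\<epsilon>. - lnA b q1 \<epsilon>) (- f1)" and ub0: "ub (lnA b q0) f0"
  shows "ub (\<lambda>\<epsilon>. - lnA b q \<epsilon>) (- f0 - (f1 - f0) * (q - q0) / (q1 - q0))"
proof -
  define \<theta> where "\<theta> = (q1 - q0) / (q - q0)"
  have \<theta>: "0 < \<theta>" "\<theta> < 1" using q by (auto simp: \<theta>_def)
  have qeq: "q1 = (1 - \<theta>) * q0 + \<theta> * q"
  proof -
    have "\<theta> * (q - q0) = q1 - q0" using q by (simp add: \<theta>_def)
    thus ?thesis by (simp add: algebra_simps)
  qed
  have qp: "0 < q" using q by linarith
  have "ub (\<lambda>\<epsilon>. - lnA b q \<epsilon>) (- f0 - (f1 - f0) / \<theta>)"
    by (rule ub_extrapolate[OF \<theta> eventually_mono[OF eventually_unit] lb1 ub0])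
       (unfold lnA_def, rule ratio_logconvex[OF _ q(1) qp \<theta> qeq])
  thus ?thesis by (simp add: \<theta>_def)
qed

end

section \<open>Expected logarithms and the supercritical regime\<close>

lemma (in prob_space) Jensen_ln:
  fixes V :: "'a \<Rightarrow> real"
  assumes V: "integrable M V" "AE \<omega> in M. 0 < V \<omega>" and ln: "integrable M (\<lambda>\<omega>. ln (V \<omega>))"
  shows "(\<integral>\<omega>. ln (V \<omega>) \<partial>M) \<le> ln (\<integral>\<omega>. V \<omega> \<partial>M)"
proof -
  define m where "m = (\<integral>\<omega>. V \<omega> \<partial>M)"
  have m: "m > 0" unfolding m_def by (rule expectation_pos[OF V])
  have i: "integrable M (\<lambda>\<omega>. V \<omega> / m)" using V(1) by (rule integrable_divide)
  have "(\<integral>\<omega>. ln (V \<omega>) \<partial>M) \<le> (\<integral>\<omega>. V \<omega> / m + (ln m - 1) \<partial>M)"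
  proof (rule integral_mono_AE[OF ln])
    show "integrable M (\<lambda>\<omega>. V \<omega> / m + (ln m - 1))" by (rule Bochner_Integration.integrable_add[OF i]) simp
    show "AE \<omega> in M. ln (V \<omega>) \<le> V \<omega> / m + (ln m - 1)"
      using V(2)
    proof eventually_elim
      case (elim \<omega>)
      have "ln (V \<omega> / m) \<le> V \<omega> / m - 1" using elim m by (intro ln_le_minus_one) simp
      thus ?case using elim m by (simp add: ln_div)
    qed
  qed
  also have "\<dots> = (\<integral>\<omega>. V \<omega> / m \<partial>M) + (\<integral>\<omega>. ln m - 1 \<partial>M)"
    by (rule Bochner_Integration.integral_add[OF i]) simp
  also have "(\<integral>\<omega>. V \<omega> / m \<partial>M) = 1" using m by (simp add: m_def)
  also have "(\<integral>\<omega>. ln m - 1 \<partial>M) = ln m - 1" by (simp add: prob_space)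
  finally show ?thesis by (simp add: m_def)
qed

context log_correlated_fields
begin

definition ElnZ :: "real \<Rightarrow> real \<Rightarrow> real" where
  "ElnZ c \<epsilon> = (\<integral>\<omega>. ln (mass \<epsilon> c B \<omega>) \<partial>M)"

lemma mass_B_pos: "\<epsilon> \<in> {0<..1} \<Longrightarrow> AE \<omega> in M. 0 < mass \<epsilon> c B \<omega>"
  by (rule mass_pos_AE[OF _ B_facts(1) order_refl B_facts(3)])

lemma ln_mass_integrable:
  assumes e: "\<epsilon> \<in> {0<..1}"
  shows "integrable M (\<lambda>\<omega>. ln (mass \<epsilon> c B \<omega>))"
proof (rule Bochner_Integration.integrable_bound)
  show "integrable M (\<lambda>\<omega>. mass \<epsilon> c B \<omega> + mass \<epsilon> c B \<omega> powr (- 1))"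
    by (rule Bochner_Integration.integrable_add[OF mass_integral(1)[OF e B_facts(1) order_refl] mass_neg_moment_crude(1)[OF e zero_less_one]])
  show "(\<lambda>\<omega>. ln (mass \<epsilon> c B \<omega>)) \<in> borel_measurable M"
    by (rule borel_measurable_ln[OF mass_measurable[OF e B_facts(1) order_refl]])
  show "AE \<omega> in M. norm (ln (mass \<epsilon> c B \<omega>)) \<le> norm (mass \<epsilon> c B \<omega> + mass \<epsilon> c B \<omega> powr (- 1))"
    using mass_B_pos[OF e, of c]
  proof eventually_elim
    case (elim \<omega>)
    define z where "z = mass \<epsilon> c B \<omega>"
    have z: "z > 0" using elim by (simp add: z_def)
    have "ln z \<le> z - 1" using z by (rule ln_le_minus_one)
    moreover have "ln (1 / z) \<le> 1 / z - 1" using z by (intro ln_le_minus_one) simp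
    moreover have "z powr (- 1) = 1 / z" "ln (1 / z) = - ln z" "1 / z > 0" using z by (simp_all add: powr_minus_divide ln_div)
    ultimately have "\<bar>ln z\<bar> \<le> \<bar>z + z powr (- 1)\<bar>" using z by linarith
    thus ?case by (simp add: z_def)
  qed
qed

lemma ub_ElnZ: "ub (ElnZ c) (c\<^sup>2 / 2)"
proof (rule unit_ub_const)
  fix \<epsilon> :: real assume e: "\<epsilon> \<in> {0<..1}"
  have "ElnZ c \<epsilon> \<le> ln (\<integral>\<omega>. mass \<epsilon> c B \<omega> \<partial>M)"
    unfolding ElnZ_def by (rule Jensen_ln[OF mass_integral(1)[OF e B_facts(1) order_refl] mass_B_pos[OF e] ln_mass_integrable[OF e]])
  also note ln_mass_moment_le(1)[OF e, of c]
  finally show "ElnZ c \<epsilon> \<le> c\<^sup>2 / 2 * (- ln \<epsilon>) + (c\<^sup>2 * C / 2 + ln (measure lborel B))" .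
qed

text \<open>Jensen's inequality for the reciprocal of the mass bounds minus the expected logarithm
  by the logarithm of a negative moment, whose exponent is sharp below the critical value.\<close>

lemma lb_ElnZ_subcritical:
  assumes c: "c\<^sup>2 < 2 * real DIM('d)"
  shows "ub (\<lambda>\<epsilon>. - ElnZ c \<epsilon>) (- (c\<^sup>2 / 2))"
proof (rule ub_mono)
  show "ub (\<lambda>\<epsilon>. ln (\<integral>\<omega>. mass \<epsilon> c B \<omega> powr (- 1) \<partial>M)) (- (c\<^sup>2 / 2))"
    using ub_neg_moment[OF c zero_less_one] by simp
  show "\<forall>\<^sub>F \<epsilon> in at_right 0. - ElnZ c \<epsilon> \<le> ln (\<integral>\<omega>. mass \<epsilon> c B \<omega> powr (- 1) \<partial>M)"
    using eventually_unit
  proof eventually_elim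
    case (elim \<epsilon>)
    have eq: "ln (mass \<epsilon> c B \<omega> powr (- 1)) = - 1 * ln (mass \<epsilon> c B \<omega>)" for \<omega> by (simp only: ln_powr)
    have pos: "AE \<omega> in M. 0 < mass \<epsilon> c B \<omega> powr (- 1)" using mass_B_pos[OF elim, of c] by eventually_elim simp
    have i: "integrable M (\<lambda>\<omega>. ln (mass \<epsilon> c B \<omega> powr (- 1)))"
      unfolding eq by (rule integrable_mult_right[OF ln_mass_integrable[OF elim]])
    show ?case using Jensen_ln[OF mass_neg_moment_crude(1)[OF elim zero_less_one] pos i]
      unfolding eq ElnZ_def by simp
  qed
qed

lemma ElnZ_le_lnA:
  assumes p: "p > 0" and e: "\<epsilon> \<in> {0<..1}"
  shows "ElnZ (p * b) \<epsilon> - p * ElnZ b \<epsilon> \<le> lnA b p \<epsilon>"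
proof -
  note i = ln_mass_integrable[OF e]
  have d: "integrable M (\<lambda>\<omega>. ln (mass \<epsilon> (p * b) B \<omega>) - p * ln (mass \<epsilon> b B \<omega>))"
    by (rule Bochner_Integration.integrable_diff[OF i integrable_mult_right[OF i]])
  have eq: "AE \<omega> in M. ln (mass \<epsilon> (p * b) B \<omega>) - p * ln (mass \<epsilon> b B \<omega>) = ln (ratio \<epsilon> b p \<omega>)"
    using mass_B_pos[OF e, of "p * b"] mass_B_pos[OF e, of b]
  proof eventually_elim
    case (elim \<omega>)
    have "mass \<epsilon> b B \<omega> powr (- p) > 0" using elim by simp
    with elim have "ln (ratio \<epsilon> b p \<omega>) = ln (mass \<epsilon> b B \<omega> powr (- p)) + ln (mass \<epsilon> (p * b) B \<omega>)"
      unfolding ratio_def by (intro ln_mult_pos)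
    thus ?case by (simp only: ln_powr)
  qed
  have m: "(\<lambda>\<omega>. ln (ratio \<epsilon> b p \<omega>)) \<in> borel_measurable M"
    by (rule borel_measurable_ln[OF borel_measurable_integrable[OF ratio_integrable[OF p e]]])
  have li: "integrable M (\<lambda>\<omega>. ln (ratio \<epsilon> b p \<omega>))" by (rule integrable_cong_AE_imp[OF d m eq])
  have "ElnZ (p * b) \<epsilon> - p * ElnZ b \<epsilon> = (\<integral>\<omega>. ln (mass \<epsilon> (p * b) B \<omega>) - p * ln (mass \<epsilon> b B \<omega>) \<partial>M)"
    unfolding ElnZ_def Bochner_Integration.integral_diff[OF i integrable_mult_right[OF i]] by simp
  also have "\<dots> = (\<integral>\<omega>. ln (ratio \<epsilon> b p \<omega>) \<partial>M)"
    by (rule integral_cong_AE[OF borel_measurable_integrable[OF d] m eq])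
  also have "\<dots> \<le> lnA b p \<epsilon>"
    unfolding lnA_def by (rule Jensen_ln[OF ratio_integrable[OF p e] ratio_pos_AE[OF e] li])
  finally show ?thesis .
qed

text \<open>The ratio with \<open>q = 1\<close> has expectation 1, and from there the exponent grows
  with slope at most \<open>d\<close>. The bound holds for every \<open>b\<close>.\<close>

lemma ub_supercritical:
  assumes "q \<ge> 1"
  shows "ub (lnA b q) (real DIM('d) * (q - 1))"
proof -
  have "ub (lnA b 1) 0" by (rule unit_ub_const[where c = 0]) (simp add: lnA_def ratio_one)
  from ub_interpolate[OF zero_less_one assms this] show ?thesis by simp
qed

text \<open>The inequality \<open>ElnZ_le_lnA\<close> is read as an upper bound for its first term:
  the ratio contributes at most \<open>d * (p - 1)\<close> and the critical expected logarithm at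
  most \<open>d * p\<close>. Their sum is the tangent at 1 of the quadratic exponent
  \<open>d * p\<^sup>2\<close>.\<close>

lemma ub_ElnZ_supercritical:
  assumes b0: "b0\<^sup>2 = 2 * real DIM('d)" and p: "p \<ge> 1"
  shows "ub (ElnZ (p * b0)) (real DIM('d) * (2 * p - 1))"
proof -
  have p0: "p > 0" using p by simp
  have "ub (\<lambda>\<epsilon>. lnA b0 p \<epsilon> + p * ElnZ b0 \<epsilon>) (real DIM('d) * (p - 1) + p * (b0\<^sup>2 / 2))"
    using p0 by (intro ub_add ub_cmult ub_supercritical ub_ElnZ p) simp
  hence "ub (ElnZ (p * b0)) (real DIM('d) * (p - 1) + p * (b0\<^sup>2 / 2))"
  proof (rule ub_mono)
    show "\<forall>\<^sub>F \<epsilon> in at_right 0. ElnZ (p * b0) \<epsilon> \<le> lnA b0 p \<epsilon> + p * ElnZ b0 \<epsilon>"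
      using eventually_unit
    proof eventually_elim
      case (elim \<epsilon>)
      show ?case using ElnZ_le_lnA[OF p0 elim, of b0] by linarith
    qed
  qed
  thus ?thesis unfolding b0 by (simp add: algebra_simps)
qed

text \<open>Convexity in the parameter, extrapolated from two subcritical points
  \<open>1 - 2 * t\<close> and \<open>1 - t\<close>, in units of \<open>b0\<close>. As
  \<open>t\<close> tends to 0 the secant slope \<open>d * (2 - 3 * t)\<close> tends to the tangent
  slope \<open>2 * d\<close>.\<close>

lemma lb_ElnZ_supercritical:
  assumes b0: "b0\<^sup>2 = 2 * real DIM('d)" and p: "p > 1"
  shows "ub (\<lambda>\<epsilon>. - ElnZ (p * b0) \<epsilon>) (- (real DIM('d) * (2 * p - 1)))"
proof -
  define d where "d = real DIM('d)"
  have d: "d > 0" by (simp add: d_def)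
  show ?thesis
  proof (rule ub_real_limit[where F = "at_right 0" and f = "\<lambda>t. - (d * (1 - 2 * t)\<^sup>2) - d * (2 - 3 * t) * (p - (1 - 2 * t))"])
    have "((\<lambda>t. - (d * (1 - 2 * t)\<^sup>2) - d * (2 - 3 * t) * (p - (1 - 2 * t))) \<longlongrightarrow>
        - (d * (1 - 2 * 0)\<^sup>2) - d * (2 - 3 * 0) * (p - (1 - 2 * 0))) (at_right 0)"
      by (intro tendsto_intros)
    thus "((\<lambda>t. - (d * (1 - 2 * t)\<^sup>2) - d * (2 - 3 * t) * (p - (1 - 2 * t))) \<longlongrightarrow> - (real DIM('d) * (2 * p - 1))) (at_right 0)"
      unfolding d_def[symmetric] by (simp add: algebra_simps)
    have "\<forall>\<^sub>F t in at_right 0. t \<in> {0<..<1/2 :: real}" by (rule eventually_at_right_real) simp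
    thus "\<forall>\<^sub>F t in at_right 0. ub (\<lambda>\<epsilon>. - ElnZ (p * b0) \<epsilon>) (- (d * (1 - 2 * t)\<^sup>2) - d * (2 - 3 * t) * (p - (1 - 2 * t)))"
    proof eventually_elim
      case (elim t)
      define t0 where "t0 = 1 - 2 * t"
      define t1 where "t1 = 1 - t"
      have t: "0 < t" "0 < t0" "t0 < t1" "t1 < 1" "t1 - t0 = t" using elim by (auto simp: t0_def t1_def)
      define \<theta> where "\<theta> = t / (p - t0)"
      have pt: "p - t0 > 0" "t < p - t0" using p t by linarith+
      have \<theta>: "0 < \<theta>" "\<theta> < 1" using t pt by (auto simp: \<theta>_def)
      have "\<theta> * (p - t0) = t1 - t0" using pt t by (simp add: \<theta>_def)
      hence "(1 - \<theta>) * t0 + \<theta> * p = t1" by (simp add: algebra_simps)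
      hence "t1 * b0 = ((1 - \<theta>) * t0 + \<theta> * p) * b0" by simp
      hence beq: "(1 - \<theta>) * (t0 * b0) + \<theta> * (p * b0) = t1 * b0" by (simp only: distrib_right mult.assoc)
      have sq: "(t' * b0)\<^sup>2 / 2 = d * t'\<^sup>2" for t' by (simp add: power_mult_distrib b0 d_def)
      have le: "ElnZ (t1 * b0) \<epsilon> \<le> (1 - \<theta>) * ElnZ (t0 * b0) \<epsilon> + \<theta> * ElnZ (p * b0) \<epsilon>" if e: "\<epsilon> \<in> {0<..1}" for \<epsilon>
      proof -
        note i = ln_mass_integrable[OF e]
        note r = integrable_mult_right[OF i, of "1 - \<theta>" "t0 * b0"] integrable_mult_right[OF i, of \<theta> "p * b0"]
        have "ElnZ (t1 * b0) \<epsilon> \<le> (\<integral>\<omega>. (1 - \<theta>) * ln (mass \<epsilon> (t0 * b0) B \<omega>) + \<theta> * ln (mass \<epsilon> (p * b0) B \<omega>) \<partial>M)"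
          unfolding ElnZ_def
        proof (rule integral_mono_AE[OF i Bochner_Integration.integrable_add[OF r]])
          show "AE \<omega> in M. ln (mass \<epsilon> (t1 * b0) B \<omega>) \<le> (1 - \<theta>) * ln (mass \<epsilon> (t0 * b0) B \<omega>) + \<theta> * ln (mass \<epsilon> (p * b0) B \<omega>)"
            using mass_logconvex_AE[OF e B_facts(1) order_refl \<theta>, of "t0 * b0" "p * b0"]
              mass_B_pos[OF e, of "t0 * b0"] mass_B_pos[OF e, of "t1 * b0"] mass_B_pos[OF e, of "p * b0"]
          proof eventually_elim
            case (elim \<omega>)
            have "ln (mass \<epsilon> (t1 * b0) B \<omega>) \<le> ln (mass \<epsilon> (t0 * b0) B \<omega> powr (1 - \<theta>) * mass \<epsilon> (p * b0) B \<omega> powr \<theta>)"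
              using elim(1,3) unfolding beq by (rule ln_mono)
            also have "\<dots> = ln (mass \<epsilon> (t0 * b0) B \<omega> powr (1 - \<theta>)) + ln (mass \<epsilon> (p * b0) B \<omega> powr \<theta>)"
              using elim(2,4) by (intro ln_mult_pos) simp_all
            finally show ?case by (simp only: ln_powr)
          qed
        qed
        also have "\<dots> = (1 - \<theta>) * ElnZ (t0 * b0) \<epsilon> + \<theta> * ElnZ (p * b0) \<epsilon>"
          unfolding Bochner_Integration.integral_add[OF r] ElnZ_def by simp
        finally show ?thesis .
      qed
      have "t1\<^sup>2 < 1" using t by (simp add: power_less_one_iff)
      hence "d * t1\<^sup>2 < d" using d by simp
      hence "(t1 * b0)\<^sup>2 < 2 * real DIM('d)" using sq[of t1] unfolding d_def by linarith
      from lb_ElnZ_subcritical[OF this] have lb1: "ub (\<lambda>\<epsilon>. - ElnZ (t1 * b0) \<epsilon>) (- (d * t1\<^sup>2))" unfolding sq .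
      have ub0: "ub (ElnZ (t0 * b0)) (d * t0\<^sup>2)" using ub_ElnZ[of "t0 * b0"] unfolding sq .
      have "ub (\<lambda>\<epsilon>. - ElnZ (p * b0) \<epsilon>) (- (d * t0\<^sup>2) - (d * t1\<^sup>2 - d * t0\<^sup>2) / \<theta>)"
        by (rule ub_extrapolate[OF \<theta> eventually_mono[OF eventually_unit] lb1 ub0]) (rule le)
      moreover have "(d * t1\<^sup>2 - d * t0\<^sup>2) / \<theta> = d * (2 - 3 * t) * (p - t0)"
      proof -
        have "d * t1\<^sup>2 - d * t0\<^sup>2 = d * (2 - 3 * t) * t" unfolding t0_def t1_def by (simp add: algebra_simps power2_eq_square)
        thus ?thesis using t(1) pt by (simp add: \<theta>_def)
      qed
      ultimately show ?case unfolding t0_def[symmetric] by simp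
    qed
  qed simp
qed

text \<open>Beyond the critical value the expected logarithm is linear in the multiple
  \<open>p\<close>, so in \<open>d * (2 * q * p - 1) - q * d * (2 * p - 1) = d * (q - 1)\<close> the
  dependence on \<open>p\<close>, and hence on \<open>b\<close>, disappears.\<close>

lemma lb_supercritical:
  assumes b: "b\<^sup>2 \<ge> 2 * real DIM('d)" and q: "q > 1"
  shows "ub (\<lambda>\<epsilon>. - lnA b q \<epsilon>) (- (real DIM('d) * (q - 1)))"
proof -
  define s where "s = sqrt (2 * real DIM('d))"
  have s: "s > 0" "s\<^sup>2 = 2 * real DIM('d)" by (simp_all add: s_def)
  \<comment> \<open>Writes \<open>b = p * b0\<close> with \<open>p \<ge> 1\<close> and
    \<open>b0\<close> the critical value of the same sign as \<open>b\<close>.\<close>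
  define p where "p = \<bar>b\<bar> / s"
  define b0 where "b0 = sgn b * s"
  have "s\<^sup>2 \<le> \<bar>b\<bar>\<^sup>2" using b s by simp
  hence "s \<le> \<bar>b\<bar>" by (rule power2_le_imp_le) simp
  hence p: "p \<ge> 1" using s by (simp add: p_def)
  have "b \<noteq> 0" using \<open>s \<le> \<bar>b\<bar>\<close> s(1) by auto
  hence b0: "b0\<^sup>2 = 2 * real DIM('d)" using s(2) by (simp add: b0_def power_mult_distrib sgn_if)
  have bp: "p * b0 = b" using s(1) by (simp add: p_def b0_def abs_mult_sgn)
  have qp: "q * p > 1"
  proof -
    have "1 * 1 < q * p" using q p by (intro mult_less_le_imp_less) auto
    thus ?thesis by simp
  qed
  have "ub (\<lambda>\<epsilon>. - ElnZ (q * p * b0) \<epsilon> + q * ElnZ (p * b0) \<epsilon>)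
      (- (real DIM('d) * (2 * (q * p) - 1)) + q * (real DIM('d) * (2 * p - 1)))"
    using q by (intro ub_add ub_cmult lb_ElnZ_supercritical ub_ElnZ_supercritical b0 p qp) simp
  hence "ub (\<lambda>\<epsilon>. - lnA b q \<epsilon>) (- (real DIM('d) * (2 * (q * p) - 1)) + q * (real DIM('d) * (2 * p - 1)))"
  proof (rule ub_mono)
    show "\<forall>\<^sub>F \<epsilon> in at_right 0. - lnA b q \<epsilon> \<le> - ElnZ (q * p * b0) \<epsilon> + q * ElnZ (p * b0) \<epsilon>"
      using eventually_unit
    proof eventually_elim
      case (elim \<epsilon>)
      have q0: "q > 0" using q by simp
      show ?case using ElnZ_le_lnA[OF q0 elim, of b] unfolding mult.assoc bp by linarith
    qed
  qed
  thus ?thesis by (simp add: algebra_simps)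
qed

text \<open>The exponent follows the tangent of \<open>f\<close> at \<open>r + 1 / 2\<close>, the
  point where its slope is \<open>d\<close>. The upper bound starts at this point; the lower bound
  is known only strictly to the left of it, hence the extrapolation through
  \<open>r + 1 / 2 - 2 * t\<close> and \<open>r + 1 / 2 - t\<close>.\<close>

lemma intermediate:
  assumes q: "q > 1" and b: "2 * real DIM('d) / (2 * q - 1) \<le> b\<^sup>2" "b\<^sup>2 < 2 * real DIM('d)"
  defines "\<phi> \<equiv> real DIM('d) * (q - 1) - (2 * real DIM('d) - b\<^sup>2)\<^sup>2 / (8 * b\<^sup>2)"
  shows "ub (lnA b q) \<phi>" and "ub (\<lambda>\<epsilon>. - lnA b q \<epsilon>) (- \<phi>)"
proof -
  define d where "d = real DIM('d)"
  have d: "d > 0" by (simp add: d_def)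
  define f where "f x = b\<^sup>2 * (x\<^sup>2 - x) / 2" for x
  have b0: "b\<^sup>2 > 0" using b(1) q d unfolding d_def[symmetric] by (smt (verit) divide_pos_pos)
  \<comment> \<open>With this ratio \<open>f\<close> has derivative \<open>b\<^sup>2 * r = d\<close>
    at \<open>r + 1 / 2\<close>, and the two case bounds become \<open>r > 1 / 2\<close> and
    \<open>r + 1 / 2 \<le> q\<close>.\<close>
  define r where "r = d / b\<^sup>2"
  have dr: "d = r * b\<^sup>2" using b0 by (simp add: r_def)
  have r: "r > 1 / 2" using b(2) b0 unfolding d_def[symmetric] by (simp add: r_def field_simps)
  have rq: "r + 1 / 2 \<le> q" using b(1) b0 q unfolding d_def[symmetric] by (simp add: r_def field_simps)
  have \<phi>: "\<phi> = f (r + 1 / 2) + d * (q - (r + 1 / 2))"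
  proof -
    have "2 * d - b\<^sup>2 = b\<^sup>2 * (2 * r - 1)" unfolding dr by (simp add: algebra_simps)
    hence "(2 * d - b\<^sup>2)\<^sup>2 = b\<^sup>2 * (b\<^sup>2 * (2 * r - 1)\<^sup>2)" by (simp add: power2_eq_square mult_ac)
    hence eq: "(2 * d - b\<^sup>2)\<^sup>2 / (8 * b\<^sup>2) = b\<^sup>2 * (2 * r - 1)\<^sup>2 / 8"
      using b0 by (metis mult.commute nonzero_mult_divide_mult_cancel_left less_irrefl)
    show ?thesis unfolding \<phi>_def d_def[symmetric] eq f_def unfolding dr
      by (simp add: field_simps power2_eq_square)
  qed
  have qs: "r + 1 / 2 > 0" using r by simp
  have "ub (lnA b (r + 1 / 2)) (f (r + 1 / 2))" unfolding f_def by (rule ub_subcritical[OF b(2) qs])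
  from ub_interpolate[OF qs rq this] show "ub (lnA b q) \<phi>" unfolding \<phi> d_def .
  show "ub (\<lambda>\<epsilon>. - lnA b q \<epsilon>) (- \<phi>)"
  proof (rule ub_real_limit[where F = "at_right 0" and
        f = "\<lambda>t. - f (r + 1 / 2 - 2 * t) - b\<^sup>2 / 2 * (2 * r - 3 * t) * (q - (r + 1 / 2 - 2 * t))"])
    have "((\<lambda>t. - f (r + 1 / 2 - 2 * t) - b\<^sup>2 / 2 * (2 * r - 3 * t) * (q - (r + 1 / 2 - 2 * t))) \<longlongrightarrow>
        - f (r + 1 / 2 - 2 * 0) - b\<^sup>2 / 2 * (2 * r - 3 * 0) * (q - (r + 1 / 2 - 2 * 0))) (at_right 0)"
      unfolding f_def by (intro tendsto_intros) simp_all
    thus "((\<lambda>t. - f (r + 1 / 2 - 2 * t) - b\<^sup>2 / 2 * (2 * r - 3 * t) * (q - (r + 1 / 2 - 2 * t))) \<longlongrightarrow> - \<phi>) (at_right 0)"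
      unfolding \<phi> unfolding dr by (simp add: mult_ac)
    have "\<forall>\<^sub>F t in at_right 0. t \<in> {0<..<1/4 :: real}" by (rule eventually_at_right_real) simp
    thus "\<forall>\<^sub>F t in at_right 0. ub (\<lambda>\<epsilon>. - lnA b q \<epsilon>) (- f (r + 1 / 2 - 2 * t) - b\<^sup>2 / 2 * (2 * r - 3 * t) * (q - (r + 1 / 2 - 2 * t)))"
    proof eventually_elim
      case (elim t)
      define q0 where "q0 = r + 1 / 2 - 2 * t"
      define q1 where "q1 = r + 1 / 2 - t"
      have t: "0 < t" "0 < q0" "q0 < q1" "q1 < q" "q1 - q0 = t" "0 < q1"
        using elim r rq by (auto simp: q0_def q1_def)
      have "t * b\<^sup>2 > 0" using t(1) b0 by simp
      hence "q1 * b\<^sup>2 < real DIM('d) + b\<^sup>2 / 2" unfolding d_def[symmetric] dr q1_def by (simp add: algebra_simps)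
      from lb_subcritical[OF t(6) this] have lb1: "ub (\<lambda>\<epsilon>. - lnA b q1 \<epsilon>) (- f q1)" unfolding f_def .
      have ub0: "ub (lnA b q0) (f q0)" unfolding f_def by (rule ub_subcritical[OF b(2) t(2)])
      have "(f q1 - f q0) * (q - q0) / (q1 - q0) = b\<^sup>2 / 2 * (2 * r - 3 * t) * (q - q0)"
      proof -
        have "f q1 - f q0 = b\<^sup>2 / 2 * (2 * r - 3 * t) * t"
          unfolding f_def q0_def q1_def by (simp add: field_simps power2_eq_square)
        hence "(f q1 - f q0) * (q - q0) / t = b\<^sup>2 / 2 * (2 * r - 3 * t) * t * (q - q0) / t" by (simp only:)
        thus ?thesis unfolding t(5) using t(1) by simp
      qed
      with lb_extrapolate[OF t(2-4) lb1 ub0] show ?case unfolding q0_def[symmetric] by simp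
    qed
  qed simp
qed

lemma lnA_limit:
  assumes q: "q > 1"
  shows "((\<lambda>\<epsilon>. lnA b q \<epsilon> / ln \<epsilon>) \<longlongrightarrow> eta_tilde DIM('d) q b) (at_right 0)"
proof -
  have q0: "q > 0" using q by simp
  consider "b\<^sup>2 < 2 * real DIM('d) / (2 * q - 1)"
    | "2 * real DIM('d) / (2 * q - 1) \<le> b\<^sup>2" "b\<^sup>2 < 2 * real DIM('d)"
    | "\<not> b\<^sup>2 < 2 * real DIM('d) / (2 * q - 1)" "2 * real DIM('d) \<le> b\<^sup>2"
  proof -
    have "2 * real DIM('d) / (2 * q - 1) \<le> 2 * real DIM('d) / 1" using q by (intro divide_left_mono) auto
    thus thesis using that by linarith
  qed
  thus ?thesis
  proof cases
    case 1
    hence *: "b\<^sup>2 * (2 * q - 1) < 2 * real DIM('d)" using q by (simp add: pos_less_divide_eq)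
    have "b\<^sup>2 * 1 \<le> b\<^sup>2 * (2 * q - 1)" using q by (intro mult_left_mono) auto
    hence b: "b\<^sup>2 < 2 * real DIM('d)" using * by linarith
    have qb: "q * b\<^sup>2 < real DIM('d) + b\<^sup>2 / 2" using * by (simp add: algebra_simps)
    from ub_tendsto[OF ub_subcritical[OF b q0] lb_subcritical[OF q0 qb]] 1
    moreover have "- (b\<^sup>2 * (q\<^sup>2 - q) / 2) = - (b\<^sup>2 * q\<^sup>2) / 2 + b\<^sup>2 * q / 2" by (simp add: field_simps)
    ultimately show ?thesis by (simp add: eta_tilde_def)
  next
    case 2
    from ub_tendsto[OF intermediate[OF q 2]] 2
    show ?thesis by (simp add: eta_tilde_def)
  next
    case 3
    from ub_tendsto[OF ub_supercritical[OF less_imp_le[OF q]] lb_supercritical[OF 3(2) q]] 3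
    show ?thesis by (simp add: eta_tilde_def)
  qed
qed

end

theorem theorem1p1:
  fixes M :: "'w measure"
    and D :: "'d::euclidean_space set"
    and X :: "real \<Rightarrow> 'd \<Rightarrow> 'w \<Rightarrow> real"
    and g :: "real \<Rightarrow> 'd \<Rightarrow> 'd \<Rightarrow> real"
    and C\<^sub>g q \<beta> :: real
  assumes "prob_space M"
    and "open D" and "connected D"
    and "cbox (- 2 *\<^sub>R One) (2 *\<^sub>R One) \<subseteq> D"
    and "\<And>\<epsilon>. \<epsilon> \<in> {0<..1} \<Longrightarrow> centred_gaussian_field M D (X \<epsilon>)"
    and "\<And>\<epsilon>. \<epsilon> \<in> {0<..1} \<Longrightarrow>
           (\<lambda>p. X \<epsilon> (snd p) (fst p)) \<in> borel_measurable (M \<Otimes>\<^sub>M restrict_space lborel D)"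
    and "\<And>\<epsilon> x y. \<epsilon> \<in> {0<..1} \<Longrightarrow> x \<in> D \<Longrightarrow> y \<in> D \<Longrightarrow>
           (\<integral>\<omega>. X \<epsilon> x \<omega> * X \<epsilon> y \<omega> \<partial>M) = - ln (norm (x - y) + \<epsilon>) + g \<epsilon> x y"
    and "\<And>\<epsilon>. \<epsilon> \<in> {0<..1} \<Longrightarrow> continuous_on (D \<times> D) (\<lambda>(x, y). g \<epsilon> x y)"
    and "C\<^sub>g > 0"
    and "\<And>\<epsilon> x y. \<epsilon> \<in> {0<..1} \<Longrightarrow> x \<in> D \<Longrightarrow> y \<in> D \<Longrightarrow> \<bar>g \<epsilon> x y\<bar> \<le> C\<^sub>g"
    and "q > 1"
  shows "(\<forall>\<^sub>F \<epsilon> in at_right 0.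
            integrable M (\<lambda>\<omega>. Zpart (X \<epsilon>) (q * \<beta>) \<omega> / Zpart (X \<epsilon>) \<beta> \<omega> powr q))
       \<and> ((\<lambda>\<epsilon>. ln (\<integral>\<omega>. Zpart (X \<epsilon>) (q * \<beta>) \<omega> / Zpart (X \<epsilon>) \<beta> \<omega> powr q \<partial>M) / ln \<epsilon>)
            \<longlongrightarrow> eta_tilde DIM('d) q \<beta>) (at_right 0)"
proof -
  interpret prob_space M by fact
  interpret log_correlated_fields M D X g C\<^sub>g
    by unfold_locales (fact assms)+
  have ratio_eq: "Zpart (X \<epsilon>) (q * \<beta>) \<omega> / Zpart (X \<epsilon>) \<beta> \<omega> powr q = ratio \<epsilon> \<beta> q \<omega>" for \<epsilon> \<omega>
    by (simp add: Zpart_def ratio_def mass_def powr_minus_divide)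
  have q0: "q > 0" using \<open>q > 1\<close> by simp
  show ?thesis unfolding ratio_eq lnA_def[symmetric]
    using eventually_mono[OF eventually_unit ratio_integrable[OF q0]] lnA_limit[OF \<open>q > 1\<close>] by (rule conjI)
qed

end
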